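(* Let $b$ satisfy (b1)–(b4) and let $u\in BV(\Omega)\cap L^\infty(\Omega)$. Then for every Borel $\lambda\colon\Omega\to[0,1]$ and every Borel set $E\subset\Omega$, $$|(b(\cdot,u),Du)_\lambda|(E)\le\|b\|_\infty|Du|(E),\qquad |[b(\cdot,u),Du]_\lambda|(E)\le\|b\|_\infty|Du|(E).$$
   Context: $\Omega\subseteq\mathbb R^N$ ($N\ge2$) open; $\mathcal{DM}^\infty(\Omega)$ = fields $A\in L^\infty(\Omega;\mathbb R^N)$ with distributional divergence a finite Radon measure. Assumptions on $b\colon\Omega\times\mathbb R\to\mathbb R^N$: (b1) $b$ Borel and bounded; (b2) for a.e. $x$, $t\mapsto b(x,t)$ continuous; (b3) $b_t:=b(\cdot,t)\in\mathcal{DM}^\infty(\Omega)$ for every $t$; (b4) $\sigma:=\bigvee_{t\in\mathbb R}|\operatorname{div}_xb_t|$ (least upper bound of measures: $\sigma(E)=\sup\sum_{t\in T}|\operatorname{div}_xb_t|(E_t)$ over countable $T$ and Borel partitions $(E_t)$ of $E$) is a finite Radon measure. $f(\cdot,t)=d\operatorname{div}_xb_t/d\sigma$, $B(x,t)=\int_0^tb(x,s)ds$, $F(x,t)=\int_0^tf(x,s)ds$; $x\mapsto B(x,u(x))\in\mathcal{DM}^\infty(\Omega)$ for $u\in BV\cap L^\infty$. $u^\pm$ are approximate upper/lower limits (equal to the approximate limit $\tilde u$ off $S_u$, defined $\mathcal H^{N-1}$-a.e. hence $\sigma$-a.e.), $u^\lambda:=(1-\lambda)u^-+\lambda u^+$.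 Pairings: $(b(\cdot,u),Du)_\lambda:=-F(x,u^\lambda)\sigma+\operatorname{div}(B(x,u(x)))$ and $[b(\cdot,u),Du]_\lambda:=-((1-\lambda)F(x,u^-)+\lambda F(x,u^+))\sigma+\operatorname{div}(B(x,u(x)))$. *)

theory Defs
  imports "HOL-Analysis.Analysis"
begin

definition borel_sub :: "'a::topological_space set \<Rightarrow> 'a set \<Rightarrow> bool" where
  "borel_sub \<Omega> E \<longleftrightarrow> E \<in> sets borel \<and> E \<subseteq> \<Omega>"

text \<open>A finite (signed, or vector valued) Borel measure on \<Omega>, given as a countably
  additive set function on the Borel subsets of \<Omega> (values elsewhere irrelevant).
  On an open subset of R^N finite Borel measures are Radon measures.\<close>
definition vmeasure_on :: "'a::euclidean_space set \<Rightarrow> ('a set \<Rightarrow> 'b::real_normed_vector) \<Rightarrow> bool" where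
  "vmeasure_on \<Omega> \<mu> \<longleftrightarrow>
     (\<forall>A::nat \<Rightarrow> 'a set. (\<forall>n. borel_sub \<Omega> (A n)) \<and> disjoint_family A \<longrightarrow>
        (\<lambda>n. \<mu> (A n)) sums \<mu> (\<Union>n. A n))"

definition total_variation :: "'a::euclidean_space set \<Rightarrow> ('a set \<Rightarrow> 'b::real_normed_vector) \<Rightarrow> 'a set \<Rightarrow> ennreal" where
  "total_variation \<Omega> \<mu> E =
     (SUP A \<in> {A::nat \<Rightarrow> 'a set. (\<forall>n. borel_sub \<Omega> (A n)) \<and> disjoint_family A \<and> (\<Union>n. A n) = E}.
        (\<Sum>n. ennreal (norm (\<mu> (A n)))))"

definition pos_meas :: "'a::euclidean_space set \<Rightarrow> ('a set \<Rightarrow> real) \<Rightarrow> 'a measure" where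
  "pos_meas \<Omega> \<mu> = measure_of \<Omega> {E. borel_sub \<Omega> E}
     (\<lambda>E. SUP F \<in> {F. borel_sub \<Omega> F \<and> F \<subseteq> E}. ennreal (\<mu> F))"

definition sm_integral :: "'a::euclidean_space set \<Rightarrow> ('a set \<Rightarrow> real) \<Rightarrow> ('a \<Rightarrow> real) \<Rightarrow> real" where
  "sm_integral \<Omega> \<mu> \<phi> =
     integral\<^sup>L (pos_meas \<Omega> \<mu>) \<phi> - integral\<^sup>L (pos_meas \<Omega> (\<lambda>E. - \<mu> E)) \<phi>"

fun pderivs :: "'a::euclidean_space list \<Rightarrow> ('a \<Rightarrow> real) \<Rightarrow> 'a \<Rightarrow> real" where
  "pderivs [] \<phi> = \<phi>"
| "pderivs (v # vs) \<phi> = (\<lambda>x. frechet_derivative (pderivs vs \<phi>) (at x) v)"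

definition test_function :: "'a::euclidean_space set \<Rightarrow> ('a \<Rightarrow> real) \<Rightarrow> bool" where
  "test_function \<Omega> \<phi> \<longleftrightarrow>
     (\<forall>vs. set vs \<subseteq> Basis \<longrightarrow> pderivs vs \<phi> differentiable_on UNIV) \<and>
     compact (closure {x. \<phi> x \<noteq> 0}) \<and> closure {x. \<phi> x \<noteq> 0} \<subseteq> \<Omega>"

definition grad :: "('a::euclidean_space \<Rightarrow> real) \<Rightarrow> 'a \<Rightarrow> 'a" where
  "grad \<phi> x = (\<Sum>i\<in>Basis. frechet_derivative \<phi> (at x) i *\<^sub>R i)"

definition is_div :: "'a::euclidean_space set \<Rightarrow> ('a \<Rightarrow> 'a) \<Rightarrow> ('a set \<Rightarrow> real) \<Rightarrow> bool" where
  "is_div \<Omega> A \<mu> \<longleftrightarrow>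
     set_borel_measurable lebesgue \<Omega> A \<and>
     (\<exists>M. AE x in lebesgue. x \<in> \<Omega> \<longrightarrow> norm (A x) \<le> M) \<and>
     vmeasure_on \<Omega> \<mu> \<and>
     (\<forall>\<phi>. test_function \<Omega> \<phi> \<longrightarrow>
        (LINT x:\<Omega>|lebesgue. A x \<bullet> grad \<phi> x) = - sm_integral \<Omega> \<mu> \<phi>)"

definition is_BV :: "'a::euclidean_space set \<Rightarrow> ('a \<Rightarrow> real) \<Rightarrow> ('a set \<Rightarrow> 'a) \<Rightarrow> bool" where
  "is_BV \<Omega> u Du \<longleftrightarrow>
     set_integrable lebesgue \<Omega> u \<and> vmeasure_on \<Omega> Du \<and>
     (\<forall>\<phi>. test_function \<Omega> \<phi> \<longrightarrow> (\<forall>i\<in>Basis.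
        (LINT x:\<Omega>|lebesgue. u x * frechet_derivative \<phi> (at x) i) = - sm_integral \<Omega> (\<lambda>E. Du E \<bullet> i) \<phi>))"

definition lub_tv :: "'a::euclidean_space set \<Rightarrow> (real \<Rightarrow> 'a set \<Rightarrow> real) \<Rightarrow> 'a set \<Rightarrow> ennreal" where
  "lub_tv \<Omega> \<mu> E =
     (SUP (t, A) \<in> {(t::nat \<Rightarrow> real, A::nat \<Rightarrow> 'a set). (\<forall>n. borel_sub \<Omega> (A n)) \<and>
                          disjoint_family A \<and> (\<Union>n. A n) = E}.
        (\<Sum>n. total_variation \<Omega> (\<mu> (t n)) (A n)))"

definition lub_meas :: "'a::euclidean_space set \<Rightarrow> (real \<Rightarrow> 'a set \<Rightarrow> real) \<Rightarrow> 'a measure" where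
  "lub_meas \<Omega> \<mu> = measure_of \<Omega> {E. borel_sub \<Omega> E} (lub_tv \<Omega> \<mu>)"

definition ap_upper :: "'a::euclidean_space set \<Rightarrow> ('a \<Rightarrow> real) \<Rightarrow> 'a \<Rightarrow> real" where
  "ap_upper \<Omega> u x = Inf {t. ((\<lambda>r. measure lebesgue ({y\<in>\<Omega>. t < u y} \<inter> ball x r)
                                     / measure lebesgue (ball x r)) \<longlongrightarrow> 0) (at_right 0)}"

definition ap_lower :: "'a::euclidean_space set \<Rightarrow> ('a \<Rightarrow> real) \<Rightarrow> 'a \<Rightarrow> real" where
  "ap_lower \<Omega> u x = Sup {t. ((\<lambda>r. measure lebesgue ({y\<in>\<Omega>. u y < t} \<inter> ball x r)
                                     / measure lebesgue (ball x r)) \<longlongrightarrow> 0) (at_right 0)}"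

definition linf_norm :: "'a::euclidean_space set \<Rightarrow> ('a \<Rightarrow> real \<Rightarrow> 'a) \<Rightarrow> real" where
  "linf_norm \<Omega> b = Inf {M. AE p in lebesgue. p \<in> \<Omega> \<times> UNIV \<longrightarrow> norm (b (fst p) (snd p)) \<le> M}"

end

theory Submission
imports Defs "HOL-Analysis.Analysis" "HOL-Analysis.Regularity" "HOL-Computational_Algebra.Polynomial"
begin

text \<open>Let \<open>S\<close> be the subgraph of \<open>u\<close>, cut off to a bounded set of finite perimeter in \<open>\<Omega> \<times> \<real>\<close>.
  The field \<open>(b(x, t), 0)\<close> has divergence \<open>f \<sigma> \<otimes> dt\<close>. Testing it with \<open>\<psi>\<^sub>k(1\<^sub>S * \<rho>\<^sub>r)\<close>, where
  \<open>\<psi>\<^sub>k\<close> increases from 0 to 1 on \<open>[1 - 1/k, 1]\<close>, and letting first \<open>r \<rightarrow> 0\<close> and then \<open>k \<rightarrow> \<infinity>\<close> selects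
  the points of density one of \<open>S\<close>: by a covering argument based on the relative isoperimetric
  inequality, the remaining points do not contribute, a divergence of a bounded field being absolutely
  continuous with respect to codimension-one content. On the other side, the total gradient mass of the
  mollified sets converges to the perimeter without loss, so the flux is at most \<open>\<parallel>b\<parallel>\<close> times the
  horizontal part of the perimeter measure, which is \<open>|Du|\<close>. Using \<open>\<psi>\<^sub>k\<close> above and \<open>1 - \<psi>\<^sub>k(1 - \<cdot>)\<close> below
  level \<open>c\<close> gives the estimate with \<open>u\<^sup>-\<close>, \<open>u\<^sup>+\<close> replaced by \<open>c\<close> clamped between them. For a Borel value
  between \<open>u\<^sup>-\<close> and \<open>u\<^sup>+\<close>, such as \<open>u\<^sup>\<lambda>\<close>, the set is partitioned into strips on which \<open>c\<close> is frozen. For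
  the second pairing, the estimates for \<open>u\<^sup>-\<close> and \<open>u\<^sup>+\<close> are combined convexly.\<close>

text \<open>The obstacle is that \<open>f \<sigma> \<otimes> dt\<close> may charge Lebesgue null
  sets, so the mollified indicators must converge almost everywhere for that measure. The dangerous
  points are those where the mollification at scale r is close to one although the complement has
  positive upper density. Going down in scale, such a point has a radius at which the set and its
  complement both fill a fair share of the ball. By the isoperimetric inequality that ball contains
  perimeter which is visible at fine scales but hardly at a scale comparable to r. Since gradient
  masses converge without loss, little perimeter can hide in this way, and the balls have small
  content. The order of limits is forced: k says how close to one the mollification must be, and
  only then may r tend to 0. The sharp constant has a second source: the lifted field has no
  vertical component. Only horizontal gradients on slices of fixed t have to be controlled, and the
  profile applied to the mollification may jump in t at the level c.\<close>

abbreviation lint (binder "LI " [60] 60) where "lint f \<equiv> integral\<^sup>L lborel f"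
abbreviation nint (binder "NI " [60] 60) where "nint f \<equiv> integral\<^sup>N lborel f"
abbreviation (input) "un g p \<equiv> g (fst p) (snd p)"
abbreviation "ind \<equiv> indicator"
abbreviation "integ \<equiv> integrable lborel"
abbreviation "Borel \<equiv> borel_measurable borel"
abbreviation "vol \<equiv> measure lborel"
lemmas B_integrable_bound = Bochner_Integration.integrable_bound
lemmas B_integrable_diff = Bochner_Integration.integrable_diff
lemmas B_integral_diff = Bochner_Integration.integral_diff
lemmas B_integral_cong = Bochner_Integration.integral_cong
lemmas B_integral_add = Bochner_Integration.integral_add
lemmas B_integrable_add = Bochner_Integration.integrable_add
lemmas B_integral_norm_bound_integral = Bochner_Integration.integral_norm_bound_integral
lemmas B_integral_sum = Bochner_Integration.integral_sum
lemmas B_integrable_sum = Bochner_Integration.integrable_sum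
lemmas B_integral_nonneg = Bochner_Integration.integral_nonneg

section \<open>Mollification\<close>

text \<open>The gradient is an explicit argument, so it can be integrated, projected and bounded
  without appeal to a chosen derivative. All estimates are made for this class;
  \<open>test_function_extension\<close> later carries integral identities over from smooth test
  functions.\<close>

definition C1 :: "('b::euclidean_space => real) => ('b => 'b) => bool" where
 "C1 f g \<longleftrightarrow> (ALL x. (f has_derivative (%h. g x \<bullet> h)) (at x)) & continuous_on UNIV g"

lemma C1_derivative: "C1 f g ==> (f has_derivative (%h. g x \<bullet> h)) (at x within S)"
 by (auto simp: C1_def intro: has_derivative_at_withinI)

lemma C1_continuous_grad: "C1 f g ==> continuous_on S g" by (auto simp: C1_def intro: continuous_on_subset)

lemma C1_continuous: "C1 f g ==> continuous_on S f" by (meson C1_derivative has_derivative_continuous_on)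

lemma C1_measurable [measurable_dest]: "C1 f g ==> f \<in> Borel"
 by (rule borel_measurable_continuous_onI) (rule C1_continuous)

lemma C1_measurable_grad [measurable_dest]: "C1 f g ==> g \<in> Borel"
 by (rule borel_measurable_continuous_onI) (rule C1_continuous_grad)

lemma C1_const: "C1 (%x. c) (%x. 0)" by (auto simp: C1_def intro!: derivative_eq_intros)

lemma C1_add: "C1 f f' ==> C1 g g' ==> C1 (%x. f x+g x) (%x. f' x+g' x)"
 unfolding C1_def by (auto intro!: derivative_eq_intros continuous_intros simp: inner_add_left)

lemma C1_diff: "C1 f f' ==> C1 g g' ==> C1 (%x. f x - g x) (%x. f' x - g' x)"
 unfolding C1_def by (auto intro!: derivative_eq_intros continuous_intros simp: inner_diff_left)

lemma C1_mult: assumes "C1 f f'" "C1 g g'" shows "C1 (%x. f x*g x) (%x. f x *\<^sub>R g' x+g x *\<^sub>R f' x)"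
 using assms C1_continuous[OF assms(1)] C1_continuous[OF assms(2)] unfolding C1_def
 by (auto intro!: derivative_eq_intros continuous_intros simp: inner_add_left algebra_simps)

lemma C1_compose: assumes "C1 f f'" "!!t. (h has_real_derivative h' t) (at t)" "continuous_on UNIV h'"
 shows "C1 (%x. h (f x)) (%x. h' (f x) *\<^sub>R f' x)" unfolding C1_def
proof safe
 fix x
 have "(h \<circ> f has_derivative (%k. h' (f x)*k) \<circ> (%k. f' x \<bullet> k)) (at x)"
  using assms(1,2) by (intro diff_chain_at) (auto simp: C1_def has_field_derivative_def)
 thus "((%x. h (f x)) has_derivative (%k. h' (f x) *\<^sub>R f' x \<bullet> k)) (at x)" by (simp add: o_def)
next
 have "continuous_on UNIV (%x. h' (f x))"
  using continuous_on_compose[OF C1_continuous[OF assms(1)], of UNIV h'] assms(3)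
  by (auto simp: o_def intro: continuous_on_subset)
 thus "continuous_on UNIV (%x. h' (f x) *\<^sub>R f' x)" by (intro continuous_intros C1_continuous_grad[OF assms(1)])
qed

lemma C1_inner_self: "C1 (%x. x \<bullet> x) (%x. 2 *\<^sub>R x)"
 by (auto simp: C1_def inner_commute intro!: derivative_eq_intros continuous_intros)

lemma C1_reflect: assumes "C1 f g" shows "C1 (%y. f (x - y)) (%y. - g (x - y))" unfolding C1_def
proof safe
 fix y
 have "(f \<circ> (%y. x - y) has_derivative (%h. g (x - y) \<bullet> h) \<circ> (%h. - h)) (at y)"
  using assms by (intro diff_chain_at) (auto simp: C1_def intro!: derivative_eq_intros)
 thus "((%y. f (x - y)) has_derivative (%h. - g (x - y) \<bullet> h)) (at y)" by (simp add: o_def)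
next
 show "continuous_on UNIV (%y. - g (x - y))"
  by (intro continuous_intros continuous_on_compose2[OF C1_continuous_grad[OF assms, of UNIV]]) auto
qed

lemma C1_shift: assumes "C1 f g" shows "C1 (%y. f (y - x)) (%y. g (y - x))" unfolding C1_def
proof safe
 fix y
 have "(f \<circ> (%y. y - x) has_derivative (%h. g (y - x) \<bullet> h) \<circ> (%h. h)) (at y)"
  using assms by (intro diff_chain_at) (auto simp: C1_def intro!: derivative_eq_intros)
 thus "((%y. f (y - x)) has_derivative (%h. g (y - x) \<bullet> h)) (at y)" by (simp add: o_def)
next
 show "continuous_on UNIV (%y. g (y - x))"
  by (intro continuous_intros continuous_on_compose2[OF C1_continuous_grad[OF assms, of UNIV]]) auto
qed

lemma C1_grad_unique:
 assumes "(f has_derivative (%h. a \<bullet> h)) (at x)" "(f has_derivative (%h. b \<bullet> h)) (at x)"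
 shows "a = (b::'b::euclidean_space)"
proof -
 have "(%h. a \<bullet> h) = (%h. b \<bullet> h)" using has_derivative_unique[OF assms] .
 thus ?thesis by (metis inner_commute vector_eq_ldot)
qed

lemma C1_zero_outside: assumes "C1 f g" "closed K" "!!x. x \<notin> K ==> f x = 0" "x \<notin> K" shows "g x = 0"
proof -
 have "((%x. 0) has_derivative (%h. 0 \<bullet> h)) (at x)" by simp
 hence "(f has_derivative (%h. 0 \<bullet> h)) (at x)"
  by (rule has_derivative_transform_within_open[OF _ open_Compl[OF assms(2)]]) (use assms in auto)
 thus ?thesis using C1_grad_unique C1_derivative[OF assms(1)] by blast
qed

lemma C1_frechet: "C1 f g ==> frechet_derivative f (at x) = (%h. g x \<bullet> h)"
 using C1_derivative[of f g x UNIV] frechet_derivative_at by fastforce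

lemma C1_grad: "C1 f g ==> grad f x = g x" by (simp add: grad_def C1_frechet euclidean_representation)

lemma integrable_compact_support:
 fixes f :: "'b::euclidean_space => 'c::{banach,second_countable_topology}"
 assumes "continuous_on UNIV f" "compact K" "!!x. x \<notin> K ==> f x = 0" shows "integ f"
proof -
 have "integ (%x. ind K x *\<^sub>R f x)"
  by (rule borel_integrable_compact) (use assms in "auto intro: continuous_on_subset")
 also have "(%x. ind K x *\<^sub>R f x) = f" using assms(3) by (auto simp: fun_eq_iff indicator_def)
 finally show ?thesis .
qed

lemma bounded_compact_support:
 fixes f :: "'b::euclidean_space => 'c::real_normed_vector"
 assumes "continuous_on UNIV f" "compact K" "!!x. x \<notin> K ==> f x = 0"
 obtains B where "B > 0" "!!x. norm (f x) <= B"
proof -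
 have "bounded (f ` K)"
  using assms by (meson compact_continuous_image compact_imp_bounded continuous_on_subset subset_UNIV)
 then obtain B where B: "B > 0" "!!x. x \<in> K ==> norm (f x) <= B" unfolding bounded_pos by auto
 show ?thesis by (rule that[OF B(1)]) (metis B assms(3) less_imp_le norm_zero)
qed

lemma C1_mean_value: assumes "C1 f g" "!!x. norm (g x) <= B" shows "\<bar>f x - f y\<bar> <= B*norm (x - y)"
proof -
 have "onorm (%h. g z \<bullet> h) <= B" for z
  by (rule onorm_le) (metis Cauchy_Schwarz_ineq2 assms(2) mult.commute mult_left_mono norm_ge_zero order_trans real_norm_def)
 hence "norm (f x - f y) <= B*norm (x - y)"
  by (intro differentiable_bound[where S=UNIV and f'="%z h. g z \<bullet> h"]) (use assms(1) in "auto simp: C1_def")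
 thus ?thesis by simp
qed

lemma lborel_distr_translate: "distr lborel borel (%x. x+a) = (lborel :: 'b::euclidean_space measure)"
proof -
 have "(%x. x+a) = (+) a" by (rule ext) (rule add.commute)
 thus ?thesis by (simp only: lborel_distr_plus)
qed

lemma lborel_integral_translate:
 fixes f :: "'b::euclidean_space => 'c::{banach,second_countable_topology}" assumes [measurable]: "f \<in> Borel"
 shows "integral\<^sup>L lborel (%x. f (x+a)) = integral\<^sup>L lborel f"
proof -
 have "integral\<^sup>L (distr lborel borel (%x. x+a)) f = integral\<^sup>L lborel (%x. f (x+a))"
  by (rule integral_distr) measurable
 thus ?thesis by (simp only: lborel_distr_translate)
qed

lemma lborel_integrable_translate:
 fixes f :: "'b::euclidean_space => 'c::{banach,second_countable_topology}" assumes "integ f"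
 shows "integ (%x. f (x+a))"
proof -
 have [measurable]: "f \<in> Borel" using assms by auto
 have "integrable (distr lborel borel (%x. x+a)) f = integ (%x. f (x+a))" by (rule integrable_distr_eq) measurable
 thus ?thesis using assms by (simp only: lborel_distr_translate)
qed

text \<open>Every difference quotient has integral zero by translation invariance, and the quotients
  converge to the partial derivative under a common integrable bound.\<close>

lemma C1_integral_grad_zero:
 fixes f :: "'b::euclidean_space => real" assumes f: "C1 f g" and K: "compact K" "!!x. x \<notin> K ==> f x = 0"
 shows "integral\<^sup>L lborel g = 0"
proof -
 have g0: "x \<notin> K ==> g x = 0" for x using C1_zero_outside[OF f compact_imp_closed[OF K(1)] K(2)] by blast
 have gi: "integ g" by (rule integrable_compact_support[OF C1_continuous_grad[OF f] K(1) g0])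
 have fi: "integ f" by (rule integrable_compact_support[OF C1_continuous[OF f] K(1) K(2)])
 obtain B where B: "B > 0" "!!x. norm (g x) <= B"
  using bounded_compact_support[OF C1_continuous_grad[OF f] K(1) g0] by blast
 have "integral\<^sup>L lborel g \<bullet> i = 0" if i: "i \<in> Basis" for i
 proof -
  define h where "h n = inverse (real (Suc n))" for n
  have h0: "h n > 0" and h1: "h n <= 1" for n by (auto simp: h_def divide_simps)
  have hl: "h \<longlonglongrightarrow> 0" unfolding h_def by (rule LIMSEQ_inverse_real_of_nat)
  define s where "s n x = (f (x+h n *\<^sub>R i) - f x)/h n" for n x
  \<comment> \<open>The steps \<open>h n\<close> are at most 1, so K enlarged by the closed unit
    ball contains the supports of all quotients at once.\<close>
  define K' where "K' = (\<Union>x\<in>K. \<Union>y\<in>cball 0 1. {x+y})"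
  have K': "compact K'" unfolding K'_def by (rule compact_sums'[OF K(1) compact_cball])
  have s0: "s n x = 0" if "x \<notin> K'" for n x
  proof -
   have "x \<notin> K"
   proof
    assume "x \<in> K"
    hence "x+0 \<in> K'" unfolding K'_def by (intro UN_I[of x] UN_I[of 0]) auto
    with that show False by simp
   qed
   moreover have "x+h n *\<^sub>R i \<notin> K"
   proof
    assume a: "x+h n *\<^sub>R i \<in> K"
    have "x = (x+h n *\<^sub>R i)+(- (h n *\<^sub>R i))" by simp
    moreover have "- (h n *\<^sub>R i) \<in> cball 0 1" using h0[of n] h1[of n] i by (simp add: )
    ultimately have "x \<in> K'" unfolding K'_def using a by blast
    with that show False by simp
   qed
   ultimately show ?thesis using K(2) by (simp add: s_def)
  qed
  have sb: "norm (s n x) <= B*ind K' x" for n x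
  proof (cases "x \<in> K'")
   case True
   have "\<bar>f (x+h n *\<^sub>R i) - f x\<bar> <= B*h n"
    using C1_mean_value[OF f B(2), of "x+h n *\<^sub>R i" x] i h0[of n] by simp
   thus ?thesis using True h0[of n] by (simp add: s_def divide_simps)
  qed (simp add: s0)
  have "(%n. integral\<^sup>L lborel (s n)) \<longlonglongrightarrow> (\<integral>x. g x \<bullet> i \<partial>lborel)"
  proof (rule integral_dominated_convergence[where w="%x. B*ind K' x"])
   show "(%x. g x \<bullet> i) \<in> borel_measurable lborel" using gi by measurable
   show "s n \<in> borel_measurable lborel" for n unfolding s_def using C1_measurable[OF f] by measurable
   show "integ (%x. B*ind K' x :: real)" using K' emeasure_bounded_finite[OF compact_imp_bounded[OF K']]
    by (intro integrable_mult_right) (auto simp: integrable_indicator_iff borel_compact)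
   show "AE x in lborel. norm (s n x) <= B*ind K' x" for n using sb by simp
   show "AE x in lborel. (%n. s n x) \<longlonglongrightarrow> g x \<bullet> i"
   proof (rule AE_I2)
    fix x
    have "((%t. x+t *\<^sub>R i) has_derivative (%t. t *\<^sub>R i)) (at 0)" by (auto intro!: derivative_eq_intros)
    from diff_chain_at[OF this, of f "%h. g x \<bullet> h"] C1_derivative[OF f, of x UNIV]
    have "((%t. f (x+t *\<^sub>R i)) has_derivative (%t. g x \<bullet> (t *\<^sub>R i))) (at 0)" by (simp add: o_def)
    hence "((%t. f (x+t *\<^sub>R i)) has_real_derivative (g x \<bullet> i)) (at 0)"
     by (simp add: has_field_derivative_def mult_commute_abs)
    hence "((%t. (f (x+t *\<^sub>R i) - f x)/t) \<longlongrightarrow> g x \<bullet> i) (at 0)"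
     by (simp add: has_field_derivative_iff)
    moreover have "filterlim h (at 0) sequentially"
     using hl h0 by (auto simp: filterlim_at intro!: always_eventually) (metis less_irrefl)
    ultimately show "(%n. s n x) \<longlonglongrightarrow> g x \<bullet> i"
     unfolding s_def by (rule filterlim_compose)
   qed
  qed
  moreover have "integral\<^sup>L lborel (s n) = 0" for n
  proof -
   have "integral\<^sup>L lborel (%x. f (x+h n *\<^sub>R i)) = integral\<^sup>L lborel f"
    by (rule lborel_integral_translate[OF C1_measurable[OF f]])
   moreover have "integ (%x. f (x+h n *\<^sub>R i))" by (rule lborel_integrable_translate[OF fi])
   ultimately show ?thesis unfolding s_def using fi by simp
  qed
  ultimately have "(\<integral>x. g x \<bullet> i \<partial>lborel) = 0" by (simp add: LIMSEQ_const_iff)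
  thus ?thesis using gi by simp
 qed
 thus ?thesis by (simp add: euclidean_eqI[of _ "0::'b"])
qed

section \<open>An explicit C^1 kernel and transition function\<close>

definition psq :: "real => real" where "psq t = (max 0 t)\<^sup>2"

lemma psq_derivative: "(psq has_real_derivative 2*max 0 t) (at t)"
proof (cases t "0::real" rule: linorder_cases)
 case less
 have "((%t. 0) has_real_derivative 2*max 0 t) (at t)" using less by simp
 thus ?thesis by (rule DERIV_cong_ev[THEN iffD2, rotated -1, OF _ refl _ refl])
    (use less in \<open>auto simp: psq_def eventually_nhds intro!: exI[of _ "{..<0}"]\<close>)
next
 case greater
 have "((%t. t\<^sup>2) has_real_derivative 2*max 0 t) (at t)" using greater by (auto intro!: derivative_eq_intros)
 thus ?thesis by (rule DERIV_cong_ev[THEN iffD2, rotated -1, OF _ refl _ refl])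
    (use greater in \<open>auto simp: psq_def eventually_nhds intro!: exI[of _ "{0<..}"]\<close>)
next
 case equal
 have "((%h. max 0 h) \<longlongrightarrow> max 0 (0::real)) (at 0)" by (intro tendsto_intros)
 hence "((%h. max 0 h) \<longlongrightarrow> (0::real)) (at 0)" by simp
 hence "((%h. (psq (0+h) - psq 0)/h) \<longlongrightarrow> 0) (at 0)" by (rule Lim_transform_eventually)
    (auto simp: psq_def eventually_at_filter max_def power2_eq_square intro!: always_eventually)
 thus ?thesis using equal by (simp add: DERIV_def)
qed

lemma psq_simps [simp]: "psq t >= 0" "t <= 0 ==> psq t = 0" "t >= 0 ==> psq t = t\<^sup>2" by (auto simp: psq_def)

lemma psq_mono: "s <= t ==> psq s <= psq t" by (auto simp: psq_def intro!: power_mono)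

text \<open>On [0,1] this is 1 - (1 - t^2)^2, whose derivative 4t(1 - t^2) vanishes at both ends;
  this is why the two truncations glue to a C^1 transition from 0 to 1.\<close>

definition step :: "real => real" where "step t = 1 - psq (1 - psq t)"
definition dstep :: "real => real" where "dstep t = 2*max 0 (1 - psq t)*(2*max 0 t)"

lemma step_derivative: "(step has_real_derivative dstep t) (at t)"
proof -
 have "((%t. 1 - psq (1 - psq t)) has_real_derivative 0 - 2*max 0 (1 - psq t)*(0 - 2*max 0 t)) (at t)"
  by (intro derivative_intros DERIV_chain'[where g=psq, OF _ psq_derivative] psq_derivative)
 thus ?thesis unfolding step_def[abs_def] dstep_def by simp
qed

lemma continuous_dstep: "continuous_on S dstep" unfolding dstep_def psq_def by (intro continuous_intros)

lemma step_bounds: "0 <= step t" "step t <= 1"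
proof -
 have "psq (1 - psq t) <= psq 1" by (rule psq_mono) simp
 thus "0 <= step t" by (simp add: step_def)
qed (simp add: step_def)

lemma step_0: "t <= 0 ==> step t = 0" by (simp add: step_def)

lemma step_1: "t >= 1 ==> step t = 1"
proof -
 assume "t >= 1"
 hence "psq t >= 1" by simp
 thus ?thesis by (simp add: step_def)
qed

lemma dstep_nonneg: "0 <= dstep t" by (simp add: dstep_def)

lemma dstep_le: "dstep t <= 4"
proof (cases "0 <= t & t <= 1")
 case True
 hence "max 0 (1 - psq t) <= 1" "max 0 t <= 1" "max 0 (1 - psq t) >= 0" "max 0 t >= 0" by auto
 hence "max 0 (1 - psq t)*max 0 t <= 1*1" by (intro mult_mono) auto
 thus ?thesis by (simp add: dstep_def)
next
 case False
 then consider "t < 0" | "t > 1" by linarith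
 thus ?thesis
 proof cases
  case 2
  hence "psq t >= 1" by simp
  thus ?thesis by (simp add: dstep_def)
 qed (simp add: dstep_def)
qed

text \<open>The normalised kernel is only C^1, which is enough for gradient masses. A smooth kernel
  is built separately, where \<open>test_function\<close> demands one.\<close>

definition mol :: "real => 'b::euclidean_space => real" where
 "mol r x = psq (1 - (x \<bullet> x)/r\<^sup>2)/(LI y::'b. psq (1 - (y \<bullet> y)/r\<^sup>2))"

definition dmol :: "real => 'b::euclidean_space => 'b" where
 "dmol r x = (2*max 0 (1 - (x \<bullet> x)/r\<^sup>2)*(- 2/r\<^sup>2)
  /(LI y::'b. psq (1 - (y \<bullet> y)/r\<^sup>2))) *\<^sub>R x"

lemma C1_mol: "C1 (mol r :: 'b::euclidean_space => real) (dmol r)"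
proof -
 let ?Z = "LI y::'b. psq (1 - (y \<bullet> y)/r\<^sup>2)"
 have "C1 (%x::'b. 1+(- 1/r\<^sup>2)*(x \<bullet> x)) (%x. 0+((- 1/r\<^sup>2) *\<^sub>R (2 *\<^sub>R x)+(x \<bullet> x) *\<^sub>R 0))"
  by (intro C1_add C1_mult C1_const C1_inner_self)
 hence "C1 (%x::'b. psq (1+(- 1/r\<^sup>2)*(x \<bullet> x))*(1/?Z))
   (%x. psq (1+(- 1/r\<^sup>2)*(x \<bullet> x)) *\<^sub>R 0 +
     (1/?Z) *\<^sub>R ((2*max 0 (1+(- 1/r\<^sup>2)*(x \<bullet> x))) *\<^sub>R (0+((- 1/r\<^sup>2) *\<^sub>R (2 *\<^sub>R x)+(x \<bullet> x) *\<^sub>R 0))))"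
  by (intro C1_mult C1_const C1_compose[OF _ psq_derivative] continuous_intros)
 moreover have "(%x::'b. psq (1+(- 1/r\<^sup>2)*(x \<bullet> x))*(1/?Z)) = mol r" by (simp add: mol_def fun_eq_iff)
 moreover have "(%x::'b. psq (1+(- 1/r\<^sup>2)*(x \<bullet> x)) *\<^sub>R 0 +
     (1/?Z) *\<^sub>R ((2*max 0 (1+(- 1/r\<^sup>2)*(x \<bullet> x))) *\<^sub>R (0+((- 1/r\<^sup>2) *\<^sub>R (2 *\<^sub>R x)+(x \<bullet> x) *\<^sub>R 0))))
   = dmol r" by (simp add: dmol_def fun_eq_iff)
 ultimately show ?thesis by simp
qed

lemma mol_eq_0: "r > 0 ==> norm x >= r ==> mol r x = 0"
proof -
 assume "r > 0" "norm x >= r"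
 hence "x \<bullet> x >= r\<^sup>2" by (metis dot_square_norm less_imp_le power_mono)
 hence "1 - (x \<bullet> x)/r\<^sup>2 <= 0" using \<open>r > 0\<close> by (simp add: field_simps)
 thus ?thesis by (simp add: mol_def)
qed

lemma mol_support: "r > 0 ==> x \<notin> cball 0 r ==> mol r x = 0" by (simp add: mol_eq_0)

lemma dmol_support: "r > 0 ==> x \<notin> cball 0 r ==> dmol r x = 0"
 using C1_zero_outside[OF C1_mol closed_cball mol_support] by blast

lemma mol_minus: "mol r (- x) = mol r x" by (simp add: mol_def)

lemma mol_nonneg: "mol r x >= 0" by (auto simp: mol_def intro!: divide_nonneg_nonneg integral_nonneg)

lemma mol_mass_scale: assumes "r > 0" shows "(LI y::'b::euclidean_space. psq (1 - (y \<bullet> y)/r\<^sup>2))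
   = r ^ DIM('b)*(LI y::'b. psq (1 - (y \<bullet> y)))"
proof -
 have [measurable]: "psq \<in> Borel" unfolding psq_def by measurable
 have "(LI y::'b. psq (1 - (y \<bullet> y)/r\<^sup>2)) =
  (LINT y::'b|density (distr lborel borel (%x. 0+r *\<^sub>R x)) (%_. \<bar>r\<bar> ^ DIM('b)). psq (1 - (y \<bullet> y)/r\<^sup>2))"
  using lborel_affine[of r "0::'b"] assms by simp
 also have "... = (LI y::'b. r ^ DIM('b)*psq (1 - (y \<bullet> y)))"
  using assms by (simp add: integral_density integral_distr power2_eq_square)
 finally show ?thesis by simp
qed

text \<open>A vanishing integral would make the nonempty open set on which f is nonzero
  negligible.\<close>

lemma integral_pos_continuous:
 fixes f :: "'b::euclidean_space => real"
 assumes f: "continuous_on UNIV f" "integ f" "!!x. f x >= 0" "f z ~= 0" shows "(LI x. f x) > 0"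
proof -
 have "(LI x. f x) ~= 0"
 proof
  assume "(LI x. f x) = 0"
  hence "AE x in lborel. f x = 0" using integral_nonneg_eq_0_iff_AE[OF f(2)] f(3) by auto
  hence "AE x in lebesgue. x \<notin> {x. f x ~= 0}" by (simp add: AE_completion_iff)
  moreover have op: "open {x. f x ~= 0}" using f(1) by (intro open_Collect_neq) auto
  ultimately have "negligible {x. f x ~= 0}" by (auto simp: negligible_iff_null_sets AE_iff_null_sets)
  thus False using open_not_negligible[OF op] f(4) by auto
 qed
 thus ?thesis using B_integral_nonneg[of lborel f] f(3) by fastforce
qed

lemma mol_mass_pos: "(LI y::'b::euclidean_space. psq (1 - (y \<bullet> y))) > 0"
proof (rule integral_pos_continuous[where z=0])
 show c: "continuous_on UNIV (%y::'b. psq (1 - y \<bullet> y))" unfolding psq_def by (intro continuous_intros)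
 show "integ (%y::'b. psq (1 - (y \<bullet> y)))"
 proof (rule integrable_compact_support[OF c compact_cball[of 0 1]])
  show "y \<notin> cball 0 1 ==> psq (1 - y \<bullet> y) = 0" for y :: 'b
   using mol_support[of 1 y] by (auto simp: dot_square_norm psq_def not_le intro!: max_absorb1)
 qed
qed auto

lemma mol_integrable: "r > 0 ==> integ (mol r)"
 by (rule integrable_compact_support[where K="cball 0 r", OF C1_continuous[OF C1_mol]]) (auto simp: mol_eq_0)

lemma dmol_integrable: "r > 0 ==> integ (dmol r)"
 by (rule integrable_compact_support[where K="cball 0 r", OF C1_continuous_grad[OF C1_mol]]) (auto simp: dmol_support)

lemma mol_integral: "r > 0 ==> (LI x::'b::euclidean_space. mol r x) = 1"
proof -
 assume "r > 0"
 hence "(LI y::'b. psq (1 - (y \<bullet> y)/r\<^sup>2)) > 0"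
  using mol_mass_pos[where 'b='b] by (simp add: mol_mass_scale)
 thus ?thesis by (simp add: mol_def)
qed

text \<open>The normalisation scales like r^n, so this constant and the one of
  \<open>mol_lower\<close> do not depend on r. Together they make \<open>1 - mi E r\<close>
  comparable to the mass of the complement in balls.\<close>

lemma mol_upper:
 obtains c where "c > 0" "!!r x. r > 0 ==> mol r (x::'b::euclidean_space) <= c/r ^ DIM('b)"
proof
 let ?Z = "LI y::'b. psq (1 - (y \<bullet> y))"
 show "1/?Z > 0" using mol_mass_pos by auto
 fix r :: real and x :: 'b assume r: "r > 0"
 have "psq (1 - (x \<bullet> x)/r\<^sup>2) <= psq 1" by (rule psq_mono) simp
 thus "mol r x <= 1/?Z/r ^ DIM('b)"
  using r mol_mass_pos[where 'b='b] unfolding mol_def mol_mass_scale[OF r] by (simp add: field_simps)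
qed

lemma mol_lower:
 obtains c where "c > 0" "!!r x. r > 0 ==> norm x <= r/2 ==> mol r (x::'b::euclidean_space) >= c/r ^ DIM('b)"
proof
 let ?Z = "LI y::'b. psq (1 - (y \<bullet> y))"
 show "1/4/?Z > 0" using mol_mass_pos by auto
 fix r :: real and x :: 'b assume r: "r > 0" "norm x <= r/2"
 hence "(norm x)\<^sup>2 <= (r/2)\<^sup>2" by (intro power_mono) auto
 hence le: "(x \<bullet> x)/r\<^sup>2 <= 1/4" using r by (simp add: dot_square_norm power_divide field_simps)
 have "psq (1/2) <= psq (1 - (x \<bullet> x)/r\<^sup>2)" by (rule psq_mono) (use le in linarith)
 thus "1/4/?Z/r ^ DIM('b) <= mol r x" using r mol_mass_pos[where 'b='b] unfolding mol_def mol_mass_scale[OF r(1)]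
  by (simp add: field_simps power_divide)
qed

section \<open>Convolution with a compactly supported C^1 kernel\<close>

definition cv :: "('b::euclidean_space => real) => ('b => 'c::{banach,second_countable_topology}) => 'b => 'c" where
 "cv f G x = (LI y. f y *\<^sub>R G (x - y))"

lemma cv_measurable [measurable]: assumes [measurable]: "f \<in> Borel" "G \<in> Borel" shows "cv f G \<in> Borel"
 unfolding cv_def by measurable

lemma cv_integrable_point:
 fixes G :: "'b::euclidean_space => 'c::{banach,second_countable_topology}"
 assumes f: "integ f" and G: "G \<in> Borel" "!!x. norm (G x) <= B" shows "integ (%y. f y *\<^sub>R G (x - y))"
proof (rule B_integrable_bound[of _ "%y. B*f y"])
 have [measurable]: "f \<in> Borel" using f by auto
 note [measurable] = G(1)
 show "(%y. f y *\<^sub>R G (x - y)) \<in> borel_measurable lborel" by measurable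
 have "\<bar>f y\<bar>*norm (G (x - y)) <= \<bar>B\<bar>*\<bar>f y\<bar>" for y
  using mult_left_mono[OF order_trans[OF G(2)[of "x-y"] abs_ge_self[of B]], of "\<bar>f y\<bar>"]
  by (simp add: mult.commute)
 thus "AE y in lborel. norm (f y *\<^sub>R G (x - y)) <= norm (B*f y)" by (auto simp: abs_mult)
qed (use f in simp)

lemma uniformly_continuous_compact_support:
 fixes f :: "'b::euclidean_space => 'c::euclidean_space"
 assumes "continuous_on UNIV f" "compact K" "!!x. x \<notin> K ==> f x = 0" shows "uniformly_continuous_on UNIV f"
 unfolding uniformly_continuous_on_def
proof (intro allI impI)
 fix e :: real assume e: "e > 0"
 define K' where "K' = (\<Union>x\<in>K. \<Union>y\<in>cball 0 1. {x+y})"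
 have K': "compact K'" unfolding K'_def by (rule compact_sums'[OF assms(2) compact_cball])
 have "uniformly_continuous_on K' f"
  using compact_uniformly_continuous[OF continuous_on_subset[OF assms(1)] K'] by auto
 then obtain d where d: "d > 0" "!!x y. x \<in> K' ==> y \<in> K' ==> dist y x < d ==> dist (f y) (f x) < e"
  using e unfolding uniformly_continuous_on_def by blast
 have *: "x \<in> K ==> dist x y <= 1 ==> y \<in> K'" for x y
  unfolding K'_def by (intro UN_I[of x] UN_I[of "y - x"]) (auto simp: dist_norm norm_minus_commute)
 show "EX d>0. ALL x:UNIV. ALL x':UNIV. dist x' x < d --> dist (f x') (f x) < e"
 proof (intro exI[of _ "min d 1"] conjI ballI impI)
  fix x x' :: 'b assume dd: "dist x' x < min d 1"
  show "dist (f x') (f x) < e"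
  proof (cases "x \<in> K \<or> x' \<in> K")
   case True
   hence "x \<in> K' & x' \<in> K'" using *[of x x'] *[of x' x] *[of x x] *[of x' x'] dd by (auto simp: dist_commute)
   thus ?thesis using d(2) dd by auto
  qed (use e assms(3) in auto)
 qed (use d in auto)
qed

lemma cv_continuous:
 fixes G :: "'b::euclidean_space => 'c::euclidean_space"
 assumes f: "integ f" and G: "continuous_on UNIV G" "compact K" "!!x. x \<notin> K ==> G x = 0"
 shows "continuous_on UNIV (cv f G)"
proof -
 obtain B where B: "!!x. norm (G x) <= B" using bounded_compact_support[OF G] by blast
 have Gm: "G \<in> Borel" using G(1) by (rule borel_measurable_continuous_onI)
 note ip = cv_integrable_point[OF f Gm B]
 have uc: "uniformly_continuous_on UNIV G" by (rule uniformly_continuous_compact_support[OF G])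
 define I where "I = (LI y. \<bar>f y\<bar>)"
 have I: "I >= 0" by (simp add: I_def)
 show ?thesis unfolding continuous_on_iff
 proof (intro ballI allI impI)
  fix x and e :: real assume e: "e > 0"
  \<comment> \<open>The summand 1 covers the case in which f has L^1 norm zero.\<close>
  hence "e/(I+1) > 0" using I by simp
  then obtain d where d: "d > 0" "!!x y. dist y x < d ==> dist (G y) (G x) < e/(I+1)"
   using uc unfolding uniformly_continuous_on_def by (metis UNIV_I)
  show "EX d>0. ALL x':UNIV. dist x' x < d --> dist (cv f G x') (cv f G x) < e"
  proof (intro exI[of _ d] conjI ballI impI)
   fix x' assume dd: "dist x' x < d"
   have "norm (cv f G x' - cv f G x) = norm (LI y. f y *\<^sub>R G (x' - y) - f y *\<^sub>R G (x - y))"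
    unfolding cv_def by (subst B_integral_diff) (use ip in auto)
   also have "... <= (LI y. e/(I+1)*\<bar>f y\<bar>)"
   proof (rule B_integral_norm_bound_integral)
    show "integ (%y. e/(I+1)*\<bar>f y\<bar>)" using f by simp
    show "norm (f y *\<^sub>R G (x' - y) - f y *\<^sub>R G (x - y)) <= e/(I+1)*\<bar>f y\<bar>" for y
    proof -
     have "norm (G (x' - y) - G (x - y)) <= e/(I+1)" using d(2)[of "x' - y" "x - y"] dd by (simp add: dist_norm)
     hence "\<bar>f y\<bar>*norm (G (x' - y) - G (x - y)) <= \<bar>f y\<bar>*(e/(I+1))" by (rule mult_left_mono) simp
     thus ?thesis by (simp add: scaleR_diff_right[symmetric] mult.commute)
    qed
   qed (use ip in auto)
   also have "... = e*(I/(I+1))" by (simp add: I_def)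
   also have "... < e" using e I by (simp add: field_simps)
   finally show "dist (cv f G x') (cv f G x) < e" by (simp add: dist_norm)
  qed (use d in auto)
 qed
qed

text \<open>The gradient of the compactly supported kernel is uniformly continuous, so the
  linearization error of the kernel is uniform in y and can be integrated against
  \<open>\<bar>f y\<bar>\<close>.\<close>

lemma C1_cv:
 fixes theta :: "'b::euclidean_space => real"
 assumes f: "integ f" and th: "C1 theta G" "compact K" "!!x. x \<notin> K ==> theta x = 0"
 shows "C1 (cv f theta) (cv f G)"
proof -
 have G0: "!!x. x \<notin> K ==> G x = 0" using C1_zero_outside[OF th(1) compact_imp_closed[OF th(2)] th(3)] by blast
 note Gc = C1_continuous_grad[OF th(1), of UNIV]
 obtain B where B: "!!x. norm (G x) <= B" using bounded_compact_support[OF Gc th(2) G0] by blast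
 obtain B' where B': "!!x. norm (theta x) <= B'"
  using bounded_compact_support[OF C1_continuous[OF th(1)] th(2,3)] by blast
 have Gm: "G \<in> Borel" using th(1) by measurable
 have thmeas: "theta \<in> Borel" using th(1) by measurable
 note ip = cv_integrable_point[OF f Gm B]
 note ip' = cv_integrable_point[OF f thmeas B']
 have uc: "uniformly_continuous_on UNIV G" by (rule uniformly_continuous_compact_support[OF Gc th(2) G0])
 define I where "I = (LI y. \<bar>f y\<bar>)"
 have I: "I >= 0" by (simp add: I_def)
 have "(cv f theta has_derivative (%h. cv f G x \<bullet> h)) (at x)" for x unfolding has_derivative_at_alt
 proof (intro conjI allI impI)
  show "bounded_linear (%h. cv f G x \<bullet> h)" by (rule bounded_linear_inner_right)
  fix e :: real assume e: "e > 0"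
  hence "e/(I+1) > 0" using I by simp
  then obtain d where d: "d > 0" "!!x y. dist y x < d ==> dist (G y) (G x) < e/(I+1)"
   using uc unfolding uniformly_continuous_on_def by (metis UNIV_I)
  show "EX d>0. ALL y. norm (y - x) < d -->
    norm (cv f theta y - cv f theta x - cv f G x \<bullet> (y - x)) <= e*norm (y - x)"
  proof (intro exI[of _ d] conjI allI impI)
   fix x' assume dd: "norm (x' - x) < d"
   have lin: "norm (theta (x' - y) - theta (x - y) - G (x - y) \<bullet> (x' - x)) <= norm (x' - x)*(e/(I+1))" for y
   proof -
    have "norm (theta (x' - y) - theta (x - y) - G (x - y) \<bullet> ((x' - y) - (x - y))) <= norm ((x' - y) - (x - y))*(e/(I+1))"
    proof (rule differentiable_bound_linearization[where S="closed_segment (x - y) (x' - y)" and f'="%z h. G z \<bullet> h"])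
     show "(x - y)+t *\<^sub>R ((x' - y) - (x - y)) \<in> closed_segment (x - y) (x' - y)" if "t \<in> {0..1}" for t
      using that unfolding closed_segment_def by (auto intro!: exI[of _ t] simp: algebra_simps)
     show "(theta has_derivative (%h. G z \<bullet> h)) (at z within closed_segment (x - y) (x' - y))" for z
      by (rule C1_derivative[OF th(1)])
     show "onorm ((%h. G z \<bullet> h) - (%h. G (x - y) \<bullet> h)) <= e/(I+1)" if "z \<in> closed_segment (x - y) (x' - y)" for z
      unfolding fun_diff_def
     proof (rule onorm_le)
      fix h :: 'b
      have "dist z (x - y) < d" using segment_bound(1)[OF that] dd by (simp add: dist_norm norm_minus_commute)
      hence "norm (G z - G (x - y)) <= e/(I+1)" using d(2) by (auto simp: dist_norm less_imp_le)
      hence "norm (G z - G (x - y))*norm h <= e/(I+1)*norm h" by (rule mult_right_mono) simp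
      thus "norm (G z \<bullet> h - G (x - y) \<bullet> h) <= e/(I+1)*norm h"
       using Cauchy_Schwarz_ineq2[of "G z - G (x - y)" h] by (simp add: inner_diff_left)
     qed
    qed auto
    thus ?thesis by simp
   qed
   have eq: "cv f theta x' - cv f theta x - cv f G x \<bullet> (x' - x) =
    (LI y. f y *\<^sub>R theta (x' - y) - f y *\<^sub>R theta (x - y) - (f y *\<^sub>R G (x - y)) \<bullet> (x' - x))"
    unfolding cv_def B_integral_diff[OF B_integrable_diff[OF ip' ip'] integrable_inner_left[OF ip]]
     B_integral_diff[OF ip' ip'] integral_inner_left[OF ip] ..
   have "norm (cv f theta x' - cv f theta x - cv f G x \<bullet> (x' - x)) <= (LI y. (norm (x' - x)*(e/(I+1)))*\<bar>f y\<bar>)"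
    unfolding eq
   proof (rule B_integral_norm_bound_integral)
    show "integ (%y. norm (x' - x)*(e/(I+1))*\<bar>f y\<bar>)" using f by simp
    show "integ (%y. f y *\<^sub>R theta (x' - y) - f y *\<^sub>R theta (x - y) - (f y *\<^sub>R G (x - y)) \<bullet> (x' - x))"
     using ip ip' by (intro B_integrable_diff integrable_inner_left) auto
    show "norm (f y *\<^sub>R theta (x' - y) - f y *\<^sub>R theta (x - y) - (f y *\<^sub>R G (x - y)) \<bullet> (x' - x))
      <= norm (x' - x)*(e/(I+1))*\<bar>f y\<bar>" for y using mult_left_mono[OF lin[of y], of "\<bar>f y\<bar>"]
     by (simp add: abs_mult[symmetric] algebra_simps)
   qed
   also have "... = norm (x' - x)*e*(I/(I+1))" by (simp add: I_def)
   also have "... <= norm (x' - x)*e*1" using e I by (intro mult_left_mono) (auto simp: field_simps)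
   finally show "norm (cv f theta x' - cv f theta x - cv f G x \<bullet> (x' - x)) <= e*norm (x' - x)"
    by (simp add: mult.commute)
  qed (use d in auto)
 qed
 thus ?thesis unfolding C1_def using cv_continuous[OF f Gc th(2) G0] by blast
qed

lemma cv_pair_integrable:
 fixes G :: "'b::euclidean_space => 'c::{banach,second_countable_topology}" assumes f: "integ f" and G: "integ G"
 shows "integrable (lborel \<Otimes>\<^sub>M lborel) (%(x,y). f y *\<^sub>R G (x - y))"
  and "integrable (lborel \<Otimes>\<^sub>M lborel) (%(x,y). f x *\<^sub>R G (y - x))"
proof -
 have [measurable]: "f \<in> Borel" "G \<in> Borel" using f G by auto
 have tr: "(NI  y. ennreal (norm (G (y - x)))) = (NI  y. ennreal (norm (G y)))" for x
 proof -
  have "(NI  y. ennreal (norm (G (y+(- x))))) = (\<integral>\<^sup>+ y. ennreal (norm (G y)) \<partial>distr lborel borel (%y. y+(- x)))"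
   by (rule nn_integral_distr[symmetric]) measurable
  thus ?thesis unfolding lborel_distr_translate by simp
 qed
 show i: "integrable (lborel \<Otimes>\<^sub>M lborel) (%(x,y). f x *\<^sub>R G (y - x))"
 proof (rule integrableI_bounded)
  show "(%(x,y). f x *\<^sub>R G (y - x)) \<in> borel_measurable (lborel \<Otimes>\<^sub>M lborel)" by measurable
  have "(\<integral>\<^sup>+ z. ennreal (norm (case z of (x,y) => f x *\<^sub>R G (y - x))) \<partial>(lborel \<Otimes>\<^sub>M lborel))
    = (NI  x. NI  y. ennreal \<bar>f x\<bar>*ennreal (norm (G (y - x))))"
   by (subst lborel.nn_integral_fst[symmetric]) (auto simp: ennreal_mult)
  also have "... = (NI  x. ennreal \<bar>f x\<bar>)*(NI  y. ennreal (norm (G y)))"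
   by (simp add: nn_integral_cmult tr nn_integral_multc)
  also have "... < \<infinity>" using f G by (simp add: integrable_iff_bounded ennreal_mult_less_top)
  finally show "(\<integral>\<^sup>+ z. ennreal (norm (case z of (x,y) => f x *\<^sub>R G (y - x))) \<partial>(lborel \<Otimes>\<^sub>M lborel)) < \<infinity>" .
 qed
 show "integrable (lborel \<Otimes>\<^sub>M lborel) (%(x,y). f y *\<^sub>R G (x - y))"
  using lborel_pair.integrable_product_swap[OF i] by (simp add: split_def)
qed

lemma lborel_distr_reflect: "distr lborel borel (%y. x - y) = (lborel :: 'b::euclidean_space measure)"
proof -
 have "density (distr lborel borel (%y. x+(-1) *\<^sub>R y)) (%_. ennreal (\<bar>-1\<bar> ^ DIM('b))) = (lborel :: 'b measure)"
  by (rule lborel_affine[symmetric]) simp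
 thus ?thesis by (simp add: density_1)
qed

lemma lborel_integral_reflect:
 fixes f :: "'b::euclidean_space => 'c::{banach,second_countable_topology}" assumes [measurable]: "f \<in> Borel"
 shows "(LI y. f (x - y)) = integral\<^sup>L lborel f"
proof -
 have "integral\<^sup>L (distr lborel borel (%y. x - y)) f = (LI y. f (x - y))" by (rule integral_distr) measurable
 thus ?thesis by (simp only: lborel_distr_reflect)
qed

lemma lborel_integrable_reflect:
 fixes f :: "'b::euclidean_space => 'c::{banach,second_countable_topology}" assumes "integ f"
 shows "integ (%y. f (x - y))"
proof -
 have [measurable]: "f \<in> Borel" using assms by auto
 have "integrable (distr lborel borel (%y. x - y)) f = integ (%y. f (x - y))" by (rule integrable_distr_eq) measurable
 thus ?thesis using assms by (simp only: lborel_distr_reflect)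
qed

lemma cv_integrable:
 fixes G :: "'b::euclidean_space => 'c::{banach,second_countable_topology}" assumes f: "integ f" and G: "integ G"
 shows "integ (cv f G)"
 using lborel_pair.integrable_fst'[OF cv_pair_integrable(1)[OF f G]] by (simp add: cv_def[abs_def])

lemma integral_cv:
 fixes G :: "'b::euclidean_space => real" assumes f: "integ f" and G: "integ G"
 shows "integral\<^sup>L lborel (cv f G) = integral\<^sup>L lborel f*integral\<^sup>L lborel G"
proof -
 have [measurable]: "G \<in> Borel" using G by auto
 have "integral\<^sup>L lborel (cv f G) = (LI y. LI x. f y *\<^sub>R G (x - y))"
  unfolding cv_def using lborel_pair.Fubini_integral[OF cv_pair_integrable(1)[OF f G]] by simp
 also have "... = (LI y. f y*integral\<^sup>L lborel G)" using lborel_integral_translate[of G "- y" for y] by simp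
 finally show ?thesis by simp
qed

lemma cv_norm_le:
 fixes G :: "'b::euclidean_space => 'c::{banach,second_countable_topology}"
 shows "norm (cv f G x) <= cv (%y. \<bar>f y\<bar>) (%y. norm (G y)) x"
 unfolding cv_def using integral_norm_bound[of lborel "%y. f y *\<^sub>R G (x - y)"] by simp

lemma cv_L1:
 fixes G :: "'b::euclidean_space => 'c::{banach,second_countable_topology}" assumes f: "integ f" and G: "integ G"
 shows "(LI x. norm (cv f G x)) <= (LI x. \<bar>f x\<bar>)*(LI x. norm (G x))"
proof -
 have "(LI x. norm (cv f G x)) <= integral\<^sup>L lborel (cv (%y. \<bar>f y\<bar>) (%y. norm (G y)))"
  by (intro integral_mono cv_norm_le integrable_norm cv_integrable integrable_abs f G)
 also have "... = (LI x. \<bar>f x\<bar>)*(LI x. norm (G x))"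
  by (intro integral_cv integrable_abs integrable_norm f G)
 finally show ?thesis .
qed

lemma cv_diff:
 fixes G :: "'b::euclidean_space => 'c::{banach,second_countable_topology}" assumes f: "integ f" and g: "integ g"
  and G: "G \<in> Borel" "!!x. norm (G x) <= B" shows "cv (%y. f y - g y) G x = cv f G x - cv g G x"
 unfolding cv_def scaleR_diff_left
 by (rule B_integral_diff) (rule cv_integrable_point[OF f G] cv_integrable_point[OF g G])+

text \<open>Integration by parts: the gradient of \<open>f y*theta (x - y)\<close> has integral
  zero, and reflecting the kernel produces the sign.\<close>

lemma cv_parts:
 fixes f theta :: "'b::euclidean_space => real"
 assumes f: "C1 f g" "compact K" "!!x. x \<notin> K ==> f x = 0" and th: "C1 theta G"
 shows "cv f G x = (LI y. theta (x - y) *\<^sub>R g y)"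
proof -
 have g0: "!!x. x \<notin> K ==> g x = 0" using C1_zero_outside[OF f(1) compact_imp_closed[OF f(2)] f(3)] by blast
 have c: "continuous_on UNIV (%y. theta (x - y))" "continuous_on UNIV (%y. G (x - y))"
  by (intro continuous_intros continuous_on_compose2[OF C1_continuous[OF th, of UNIV]]
    continuous_on_compose2[OF C1_continuous_grad[OF th, of UNIV]]; simp)+
 have "C1 (%y. f y*theta (x - y)) (%y. f y *\<^sub>R (- G (x - y))+theta (x - y) *\<^sub>R g y)"
  by (rule C1_mult[OF f(1) C1_reflect[OF th]])
 hence "(LI y. f y *\<^sub>R (- G (x - y))+theta (x - y) *\<^sub>R g y) = 0"
  by (rule C1_integral_grad_zero[OF _ f(2)]) (simp add: f(3))
 moreover have "integ (%y. f y *\<^sub>R G (x - y))"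
  by (rule integrable_compact_support[OF _ f(2)]) (auto simp: f(3) intro!: continuous_intros c C1_continuous[OF f(1)])
 moreover have "integ (%y. theta (x - y) *\<^sub>R g y)"
  by (rule integrable_compact_support[OF _ f(2)]) (auto simp: g0 intro!: continuous_intros c C1_continuous_grad[OF f(1)])
 ultimately show ?thesis unfolding cv_def by (simp add: algebra_simps)
qed

text \<open>After the integration by parts the kernel is nonnegative, so P and the norm pass under
  the integral. P is the identity for full gradients and \<open>fst\<close> for horizontal
  ones.\<close>

lemma cv_parts_norm_le:
 fixes f theta :: "'b::euclidean_space => real" and P :: "'b => 'c::euclidean_space"
 assumes f: "C1 f g" "compact K" "!!x. x \<notin> K ==> f x = 0" and th: "C1 theta G" "!!x. theta x >= 0"
  and P: "bounded_linear P" shows "norm (P (cv f G x)) <= cv (%y. norm (P (g y))) theta x"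
proof -
 have g0: "!!x. x \<notin> K ==> g x = 0" using C1_zero_outside[OF f(1) compact_imp_closed[OF f(2)] f(3)] by blast
 have c: "continuous_on UNIV (%y. theta (x - y))"
  by (intro continuous_intros continuous_on_compose2[OF C1_continuous[OF th(1), of UNIV]]; simp)
 have "integ (%y. theta (x - y) *\<^sub>R g y)"
  by (rule integrable_compact_support[OF _ f(2)]) (auto simp: g0 intro!: continuous_intros c C1_continuous_grad[OF f(1)])
 hence "P (cv f G x) = (LI y. P (theta (x - y) *\<^sub>R g y))"
  by (subst cv_parts[OF f th(1)]) (auto intro: Bochner_Integration.integral_bounded_linear[OF P, symmetric])
 also have "norm ... <= (LI y. norm (P (theta (x - y) *\<^sub>R g y)))" by (rule integral_norm_bound)
 also have "... = cv (%y. norm (P (g y))) theta x"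
  unfolding cv_def by (simp add: linear_simps(5)[OF P] th(2) mult.commute)
 finally show ?thesis .
qed

text \<open>Lower semicontinuity in quantitative form.\<close>
lemma gradient_mass_lsc:
 fixes f f' :: "'b::euclidean_space => real" and P :: "'b => 'c::euclidean_space"
 assumes f: "integ f" and f': "C1 f' g" "compact K" "!!x. x \<notin> K ==> f' x = 0"
  and P: "bounded_linear P" "!!x. norm (P x) <= norm x" and r: "r > 0" shows "(LI x. norm (P (cv f (dmol r) x))) <=
  (LI x. norm (P (g x)))+(LI x. norm (dmol r (x::'b)))*(LI x. \<bar>f x - f' x\<bar>)"
proof -
 have g0: "!!x. x \<notin> K ==> g x = 0" using C1_zero_outside[OF f'(1) compact_imp_closed[OF f'(2)] f'(3)] by blast
 have f'i: "integ f'" by (rule integrable_compact_support[OF C1_continuous[OF f'(1)] f'(2,3)])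
 have gi: "integ g" by (rule integrable_compact_support[OF C1_continuous_grad[OF f'(1)] f'(2) g0])
 have Pint: "integ (%x. P (k x))" if "integ k" for k :: "'b => 'b" by (rule integrable_bounded_linear[OF P(1) that])
 obtain B where B: "!!x. norm (dmol r (x::'b)) <= B"
  using bounded_compact_support[OF C1_continuous_grad[OF C1_mol] compact_cball dmol_support[OF r]] by blast
 have dm: "dmol r \<in> borel_measurable (borel :: 'b measure)" using C1_mol[of r] by measurable
 have di: "integ (dmol r :: 'b => 'b)" by (rule dmol_integrable[OF r])
 have "norm (P (cv f (dmol r) x)) <= cv (%y. norm (P (g y))) (mol r) x+norm (cv (%y. f y - f' y) (dmol r) x)" for x
 proof -
  \<comment> \<open>The function f is split into f' and the L^1 error f - f'. The derivative falls
    on f' in the first part and stays on the kernel in the second, which explains the factor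
    depending on r.\<close>
  have "P (cv f (dmol r) x) = P (cv f' (dmol r) x)+P (cv (%y. f y - f' y) (dmol r) x)"
   using cv_diff[OF f f'i dm B, of x] linear_simps(1)[OF P(1), symmetric] by simp
  hence "norm (P (cv f (dmol r) x)) <= norm (P (cv f' (dmol r) x))+norm (P (cv (%y. f y - f' y) (dmol r) x))"
   by (metis norm_triangle_ineq)
  thus ?thesis
   using cv_parts_norm_le[OF f' C1_mol mol_nonneg P(1), of r x] P(2)[of "cv (%y. f y - f' y) (dmol r) x"] by linarith
 qed
 hence "(LI x. norm (P (cv f (dmol r) x))) <=
   (LI x. cv (%y. norm (P (g y))) (mol r) x+norm (cv (%y. f y - f' y) (dmol r) x))"
  by (intro integral_mono B_integrable_add integrable_norm cv_integrable Pint
    B_integrable_diff f f'i di gi mol_integrable r)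
 also have "... = (LI x. norm (P (g x)))+(LI x. norm (cv (%y. f y - f' y) (dmol r) x))" by (subst B_integral_add)
    (auto intro!: integrable_norm cv_integrable Pint
    B_integrable_diff f f'i di gi mol_integrable r simp: integral_cv[OF integrable_norm[OF Pint[OF gi]] mol_integrable[OF r]] mol_integral[OF r])
 also have "(LI x. norm (cv (%y. f y - f' y) (dmol r) x)) <=
   (LI x. \<bar>f x - f' x\<bar>)*(LI x. norm (dmol r (x::'b)))" by (intro cv_L1 B_integrable_diff f f'i di)
 finally show ?thesis by (simp add: mult.commute)
qed

text \<open>The kernel is even, so convolution with it is self-adjoint.\<close>

lemma cv_sym:
 fixes h k theta :: "'b::euclidean_space => real"
 assumes h: "h \<in> Borel" "!!x. \<bar>h x\<bar> <= B" and k: "integ k"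
  and th: "integ theta" "!!x. theta (- x) = theta x" shows "(LI x. h x*cv k theta x) = (LI y. k y*cv h theta y)"
proof -
 note [measurable] = h(1)
 have [measurable]: "k \<in> Borel" "theta \<in> Borel" using k th by auto
 have i: "integrable (lborel \<Otimes>\<^sub>M lborel) (%(x,y). h x*(k y*theta (x - y)))"
 proof (rule B_integrable_bound[OF integrable_mult_right[OF cv_pair_integrable(1)[OF k th(1)], of B]])
  have "\<bar>h x\<bar>*\<bar>k y*theta (x - y)\<bar> <= \<bar>B\<bar>*\<bar>k y*theta (x - y)\<bar>" for x y
   by (rule mult_right_mono) (use h(2)[of x] in auto)
  thus "AE z in lborel \<Otimes>\<^sub>M lborel. norm (case z of (x, y) => h x*(k y*theta (x - y)))
    <= norm (B*(case z of (x, y) => k y *\<^sub>R theta (x - y)))" by (auto simp: abs_mult)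
 qed measurable
 have "(LI x. h x*cv k theta x) = (LI x. LI y. h x*(k y*theta (x - y)))" unfolding cv_def by simp
 also have "... = (LI y. LI x. h x*(k y*theta (x - y)))" using lborel_pair.Fubini_integral[OF i] by simp
 also have "... = (LI y. k y*cv h theta y)"
 proof (rule B_integral_cong[OF refl])
  fix y
  have "theta (x - y) = theta (y - x)" for x using th(2)[of "x - y"] by simp
  hence "(%x. h x*(k y*theta (x - y))) = (%x. k y*(h x *\<^sub>R theta (y - x)))" by (simp add: fun_eq_iff)
  thus "(LI x. h x*(k y*theta (x - y))) = k y*cv h theta y" unfolding cv_def by simp
 qed
 finally show ?thesis .
qed

section \<open>Convergence of mollifications in L^1\<close>

definition L1_approx :: "('b::euclidean_space => real) => bool" where
 "L1_approx f \<longleftrightarrow> ((%r. LI x. \<bar>cv f (mol r) x - f x\<bar>) \<longlongrightarrow> 0) (at_right 0)"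

lemma mol_bounded: assumes "r > 0"
 obtains B where "!!x. \<bar>mol r (x::'b::euclidean_space)\<bar> <= B"
 using bounded_compact_support[OF C1_continuous[OF C1_mol] compact_cball mol_support[OF assms]] by (metis real_norm_def)

lemma mol_measurable [measurable]: "mol r \<in> Borel" using C1_mol[of r] by measurable

lemma dmol_measurable [measurable]: "dmol r \<in> Borel" using C1_mol[of r] by measurable

text \<open>Mollification is a contraction of L^1, so the distance of f to g enters only twice, next
  to the error for g.\<close>

lemma L1_approx_closure:
 fixes f :: "'b::euclidean_space => real" assumes f: "integ f"
  and g: "!!e. e > 0 ==> EX g. integ g & L1_approx g & (LI x. \<bar>f x - g x\<bar>) < e" shows "L1_approx f"
 unfolding L1_approx_def
proof (rule tendstoI)
 fix e :: real assume e: "e > 0"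
 then obtain g where g: "integ g" "L1_approx g" "(LI x. \<bar>f x - g x\<bar>) < e/3" using g[of "e/3"] by auto
 have "\<forall>\<^sub>F r in at_right 0. dist (LI x. \<bar>cv g (mol r) x - g x\<bar>) 0 < e/3"
  using g(2) e unfolding L1_approx_def by (intro tendstoD) auto
 moreover have "\<forall>\<^sub>F r in at_right (0::real). r > 0" by (simp add: eventually_at_right_less)
 ultimately show "\<forall>\<^sub>F r in at_right 0. dist (LI x. \<bar>cv f (mol r) x - f x\<bar>) 0 < e"
 proof eventually_elim
  case (elim r)
  obtain B where B: "!!x. norm (mol r (x::'b)) <= B" using mol_bounded[OF elim(2)] by (metis real_norm_def)
  note [simp] = f g(1)
  have mi [simp]: "integ (mol r :: 'b => real)" by (rule mol_integrable[OF elim(2)])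
  have "(LI x. \<bar>cv f (mol r) x - f x\<bar>) <=
    (LI x. (\<bar>cv (%y. f y - g y) (mol r) x\<bar>+\<bar>cv g (mol r) x - g x\<bar>)+\<bar>f x - g x\<bar>)"
  proof (rule integral_mono)
   show "\<bar>cv f (mol r) x - f x\<bar> <= (\<bar>cv (%y. f y - g y) (mol r) x\<bar>+\<bar>cv g (mol r) x - g x\<bar>)+\<bar>f x - g x\<bar>" for x
    unfolding cv_diff[OF f g(1) mol_measurable B] by linarith
  qed (intro integrable_abs B_integrable_add B_integrable_diff cv_integrable f g(1) mi)+
  also have "... = (LI x. \<bar>cv (%y. f y - g y) (mol r) x\<bar>)+(LI x. \<bar>cv g (mol r) x - g x\<bar>)
   +(LI x. \<bar>f x - g x\<bar>)"
   by (subst B_integral_add, (intro integrable_abs B_integrable_add B_integrable_diff cv_integrable f g(1) mi)+)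
     (subst B_integral_add, (intro integrable_abs B_integrable_add B_integrable_diff cv_integrable f g(1) mi refl)+)
  also have "(LI x. \<bar>cv (%y. f y - g y) (mol r) x\<bar>) <= (LI x. \<bar>f x - g x\<bar>)"
   using cv_L1[of "%y. f y - g y" "mol r :: 'b => real"] mol_integral[OF elim(2), where 'b='b] by (simp add: mol_nonneg)
  finally have "(LI x. \<bar>cv f (mol r) x - f x\<bar>) < e" using elim(1) g(3) by simp
  thus ?case by simp
 qed
qed

text \<open>Uniform continuity makes the error at most e/V on K enlarged by the unit ball and zero
  elsewhere. Since V exceeds the volume of that set by 1, the total stays strictly below e.\<close>

lemma L1_approx_continuous:
 fixes g :: "'b::euclidean_space => real"
 assumes g: "continuous_on UNIV g" "compact K" "!!x. x \<notin> K ==> g x = 0" shows "L1_approx g"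
 unfolding L1_approx_def
proof (rule tendstoI)
 fix e :: real assume e: "e > 0"
 define K' where "K' = (\<Union>x\<in>K. \<Union>y\<in>cball 0 1. {x+y})"
 have K': "compact K'" unfolding K'_def by (rule compact_sums'[OF g(2) compact_cball])
 have Ki: "integ (ind K' :: 'b => real)" using K' emeasure_bounded_finite[OF compact_imp_bounded[OF K']]
  by (auto simp: integrable_indicator_iff borel_compact)
 have kk: "z \<in> K ==> norm w <= 1 ==> z+w \<in> K'" for z w unfolding K'_def by (intro UN_I[of z] UN_I[of w]) auto
 define V where "V = vol K'+1"
 have V: "V > 0" by (simp add: V_def add_nonneg_pos)
 have gi: "integ g" by (rule integrable_compact_support[OF g])
 have "uniformly_continuous_on UNIV g" by (rule uniformly_continuous_compact_support[OF g])
 moreover have "e/V > 0" using e V by simp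
 ultimately obtain d where d: "d > 0" "!!x y. dist y x < d ==> dist (g y) (g x) < e/V"
  unfolding uniformly_continuous_on_def by (metis UNIV_I)
 have "\<forall>\<^sub>F r in at_right 0. 0 < r & r < min d 1"
  unfolding eventually_at_right_field using d(1) by (auto intro!: exI[of _ "min d 1"])
 thus "\<forall>\<^sub>F r in at_right 0. dist (LI x. \<bar>cv g (mol r) x - g x\<bar>) 0 < e"
 proof eventually_elim
  case (elim r)
  hence r: "r > 0" by simp
  obtain B where B: "!!x. norm (mol r (x::'b)) <= B" using mol_bounded[OF r] by (metis real_norm_def)
  have mi: "integ (mol r :: 'b => real)" by (rule mol_integrable[OF r])
  have mr: "integ (%y. mol r (x - y))" for x :: 'b by (rule lborel_integrable_reflect[OF mi])
  have one: "(LI y. mol r (x - y)) = 1" for x :: 'b by (subst lborel_integral_reflect) (auto simp: mol_integral[OF r])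
  have pt: "\<bar>cv g (mol r) x - g x\<bar> <= e/V*ind K' x" for x
  proof -
   have eq: "cv g (mol r) x - g x = (LI y. (g y - g x)*mol r (x - y))"
    using cv_integrable_point[OF gi mol_measurable B, of x] one[of x] mr[of x] by (simp add: cv_def left_diff_distrib)
   have ii: "integ (%y. (g y - g x)*mol r (x - y))" using cv_integrable_point[OF gi mol_measurable B, of x] mr[of x]
    by (simp add: left_diff_distrib)
   show ?thesis
   proof (cases "x \<in> K'")
    case True
    have "norm (LI y. (g y - g x)*mol r (x - y)) <= (LI y. e/V*mol r (x - y))"
    proof (rule B_integral_norm_bound_integral[OF ii])
     show "norm ((g y - g x)*mol r (x - y)) <= e/V*mol r (x - y)" for y
     proof (cases "norm (x - y) < r")
      case True
      hence "\<bar>g y - g x\<bar> <= e/V" using d(2)[of y x] elim by (auto simp: dist_norm norm_minus_commute less_imp_le)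
      hence "\<bar>g y - g x\<bar>*mol r (x - y) <= e/V*mol r (x - y)" by (rule mult_right_mono[OF _ mol_nonneg])
      thus ?thesis by (simp add: abs_mult mol_nonneg)
     qed (simp add: mol_eq_0[OF r] not_less)
    qed (use mr in simp)
    thus ?thesis using True one eq by simp
   next
    case False
    have z: "(g y - g x)*mol r (x - y) = 0" for y
    proof (cases "norm (x - y) < r")
     case True
     have "y \<notin> K" "x \<notin> K" using False True elim kk[of x 0] kk[of y "x - y"] by auto
     thus ?thesis using g(3) by simp
    qed (simp add: mol_eq_0[OF r] not_less)
    show ?thesis unfolding eq z using False by simp
   qed
  qed
  have "(LI x. \<bar>cv g (mol r) x - g x\<bar>) <= (LI x. e/V*ind K' x)"
   using pt by (intro integral_mono) (auto intro!: cv_integrable gi mi Ki)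
  also have "... = e*((V - 1)/V)" using K' by (simp add: V_def)
  also have "... < e" using e V by (simp add: field_simps)
  finally show ?case by simp
 qed
qed

section \<open>Inner regularity and cut-off functions\<close>

lemma inner_compact_approx:
 fixes M :: "'b::euclidean_space measure"
 assumes M: "finite_measure M" "sets M = sets borel" and A: "A \<in> sets borel" and e: "e > 0"
 obtains K where "compact K" "K <= A" "measure M (A - K) < e"
proof -
 interpret finite_measure M by fact
 have eq: "emeasure M A = (SUP K \<in> {K. K <= A & compact K}. emeasure M K)"
  by (rule inner_regular[OF M(2) _ A]) (simp add: emeasure_eq_measure)
 have sup: "emeasure M A <= B" if "!!K. K <= A ==> compact K ==> emeasure M K <= B" for B
  unfolding eq by (rule SUP_least) (use that in blast)
 have "EX K. compact K & K <= A & measure M A < measure M K+e"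
 proof (rule ccontr)
  assume "\<not> ?thesis"
  hence "\<not> measure M A < measure M K+e" if "compact K" "K <= A" for K using that by blast
  hence le: "measure M K <= measure M A - e" if "compact K" "K <= A" for K
   using that by (simp add: not_less le_diff_eq)
  hence "emeasure M A <= ennreal (measure M A - e)"
   by (intro sup) (auto simp: emeasure_eq_measure intro!: ennreal_leI)
  thus False using le[of "{}"] e by (auto simp: emeasure_eq_measure)
 qed
 then obtain K where K: "K <= A" "compact K" "measure M A < measure M K+e" by blast
 note K(3)
 moreover have "measure M (A - K) = measure M A - measure M K"
  using K A M(2) by (intro finite_measure_Diff) (auto simp: borel_compact)
 ultimately show ?thesis using that K by auto
qed

text \<open>The indicator of the e/2-neighbourhood of K is mollified at scale e/4: points within e/4
  of K see only that neighbourhood, points farther away than e see none of it.\<close>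

lemma C1_cutoff:
 fixes K :: "'b::euclidean_space set" assumes K: "compact K" "open U" "K <= U"
 obtains ph g K' V where "C1 ph g" "!!x. 0 <= ph x" "!!x. ph x <= 1" "open V" "K <= V" "!!x. x \<in> V ==> ph x = 1"
  "compact K'" "K' <= U" "!!x. x \<notin> K' ==> ph x = 0"
proof (cases "K = {}")
 case True
 show ?thesis by (rule that[of "%x. 0" "%x. 0" "{}" "{}"]) (use True C1_const[of 0] in auto)
next
 case False
 obtain e where e: "e > 0" "{x. infdist x K <= e} <= U" using compact_in_open_separated[OF False K] by blast
 define A where "A = {x. infdist x K <= e/2}"
 have A: "compact A" unfolding A_def by (rule compact_infdist_le[OF False K(1)]) (use e in simp)
 have [measurable]: "A \<in> sets borel" using A by (rule borel_compact)
 have Ai: "integ (ind A :: 'b => real)"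
  using emeasure_bounded_finite[OF compact_imp_bounded[OF A]] by (auto simp: integrable_indicator_iff)
 have r: "e/4 > 0" using e by simp
 define ph where "ph = cv (ind A :: 'b => real) (mol (e/4))"
 have one: "(LI y. mol (e/4) (x - y)) = 1" for x :: 'b
  by (subst lborel_integral_reflect) (auto simp: mol_integral[OF r])
 have mi: "integ (%y. mol (e/4) (x - y))" for x :: 'b by (rule lborel_integrable_reflect[OF mol_integrable[OF r]])
 obtain B where B: "!!x. norm (mol (e/4) (x::'b)) <= B" using mol_bounded[OF r] by (metis real_norm_def)
 have near: "infdist y K <= infdist x K+e/4" if "norm (x - y) < e/4" for x y
  using infdist_triangle[of y K x] that by (simp add: dist_norm norm_minus_commute)
 show ?thesis
 proof (rule that[of ph "cv (ind A) (dmol (e/4))" "{x. infdist x K < e/4}" "{x. infdist x K <= e}"])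
  show "C1 ph (cv (ind A) (dmol (e/4)))"
   unfolding ph_def by (rule C1_cv[OF Ai C1_mol compact_cball mol_support[OF r]])
  show "0 <= ph x" for x unfolding ph_def cv_def by (auto simp: mol_nonneg)
  show "ph x <= 1" for x
  proof -
   have "ph x <= (LI y. mol (e/4) (x - y))" unfolding ph_def cv_def
    by (intro integral_mono cv_integrable_point[OF Ai mol_measurable B] mi) (auto simp: indicator_def mol_nonneg)
   thus ?thesis by (simp add: one)
  qed
  show "open {x. infdist x K < e/4}" by (intro open_Collect_less continuous_intros)
  show "K <= {x. infdist x K < e/4}" using r by auto
  show "ph x = 1" if "x \<in> {x. infdist x K < e/4}" for x
  proof -
   have "ind A y *\<^sub>R mol (e/4) (x - y) = mol (e/4) (x - y)" for y
   proof (cases "norm (x - y) < e/4")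
    case True
    hence "y \<in> A" using near[of x y] that by (auto simp: A_def)
    thus ?thesis by simp
   qed (simp add: mol_eq_0[OF r])
   thus ?thesis unfolding ph_def cv_def by (simp only: one)
  qed
  show "compact {x. infdist x K <= e}" by (rule compact_infdist_le[OF False K(1) e(1)])
  show "ph x = 0" if "x \<notin> {x. infdist x K <= e}" for x
  proof -
   have z: "ind A y *\<^sub>R mol (e/4) (x - y) = 0" for y
   proof (cases "norm (x - y) < e/4")
    case True
    hence "infdist x K <= infdist y K+e/4" using near[of y x] by (simp add: norm_minus_commute)
    hence "y \<notin> A" using that e by (auto simp: A_def)
    thus ?thesis by simp
   qed (simp add: mol_eq_0[OF r])
   show ?thesis unfolding ph_def cv_def z by simp
  qed
 qed (use e in auto)
qed

text \<open>The supports shrink into neighbourhoods of K of radius 1/(n+1), so the cut-offs converge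
  pointwise to the indicator. Dominated convergence can then replace test functions by compact
  sets.\<close>

lemma C1_cutoff_sequence:
 fixes K :: "'b::euclidean_space set" assumes K: "compact K" "open U" "K <= U"
 obtains ph g K' where "!!n::nat. C1 (ph n) (g n)" "!!n x. 0 <= ph n x" "!!n x. ph n x <= 1"
  "!!n x. x \<in> K ==> ph n x = 1"
  "!!n. compact (K' n)" "!!n. K' n <= U" "!!n x. x \<notin> K' n ==> ph n x = 0"
  "!!x. (%n. ph n x) \<longlonglongrightarrow> ind K x"
proof (cases "K = {}")
 case True
 show ?thesis by (rule that[of "%n x. 0" "%n x. 0" "%n. {}"]) (use True C1_const[of 0] in auto)
next
 case False
 define W where "W n = U \<inter> {x. infdist x K < 1/real (Suc n)}" for n
 have W: "open (W n)" "K <= W n" for n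
  using K unfolding W_def by (auto intro!: open_Int open_Collect_less continuous_intros)
 have "ALL n. EX ph g K'. C1 ph g & (ALL x. 0 <= ph x & ph x <= 1) & (ALL x:K. ph x = 1) & compact K' & K' <= W n & (ALL x. x \<notin> K' --> ph x = 0)"
 proof
  fix n
  obtain ph g K' V where *: "C1 ph g" "!!x. 0 <= ph x" "!!x. ph x <= 1" "open V" "K <= V" "!!x. x \<in> V ==> ph x = 1"
   "compact K'" "K' <= W n" "!!x. x \<notin> K' ==> ph x = 0" by (rule C1_cutoff[OF K(1) W[of n]]) blast
  show "EX ph g K'. C1 ph g & (ALL x. 0 <= ph x & ph x <= 1) & (ALL x:K. ph x = 1) & compact K' & K' <= W n & (ALL x. x \<notin> K' --> ph x = 0)"
   using*by (intro exI[of _ ph] exI[of _ g] exI[of _ K']) auto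
 qed
 then obtain ph g K' where P: "!!n. C1 (ph n) (g n)" "!!n x. 0 <= ph n x" "!!n x. ph n x <= 1" "!!n x. x \<in> K ==> ph n x = 1"
   "!!n. compact (K' n)" "!!n. K' n <= W n" "!!n x. x \<notin> K' n ==> ph n x = 0" by metis
 show ?thesis
 proof (rule that[OF P(1-5) _ P(7)])
  show "K' n <= U" for n using P(6) by (auto simp: W_def)
  show "(%n. ph n x) \<longlonglongrightarrow> ind K x" for x
  proof (cases "x \<in> K")
   case False
   hence "infdist x K > 0"
    using infdist_pos_not_in_closed[OF compact_imp_closed[OF K(1)]] \<open>K ~= {}\<close> by auto
   then obtain N where N: "1/real (Suc N) < infdist x K" using nat_approx_posE by blast
   have "ph n x = 0" if "n >= N" for n
   proof -
    have "1/real (Suc n) <= 1/real (Suc N)" using that by (simp add: frac_le)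
    hence "x \<notin> W n" using N by (auto simp: W_def)
    thus ?thesis using P(6,7) by blast
   qed
   thus ?thesis using False by (auto intro!: tendsto_eventually eventually_sequentiallyI[of N])
  qed (simp add: P)
 qed
qed

lemma L1_approx_compact:
 fixes K :: "'b::euclidean_space set" assumes K: "compact K" shows "L1_approx (ind K :: 'b => real)"
proof -
 obtain R where R: "K <= ball 0 R" using bounded_subset_ballD[OF compact_imp_bounded[OF K]] by blast
 obtain ph g K' where P: "!!n::nat. C1 (ph n) (g n)" "!!n x. 0 <= ph n x" "!!n x. ph n x <= 1"
  "!!n x. x \<in> K ==> ph n x = 1"
  "!!n. compact (K' n)" "!!n. K' n <= ball 0 R" "!!n x. x \<notin> K' n ==> ph n x = 0"
  "!!x. (%n. ph n x) \<longlonglongrightarrow> ind K x" using C1_cutoff_sequence[OF K open_ball R] by metis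
 have [measurable]: "K \<in> sets borel" using K by (rule borel_compact)
 have Ki: "integ (ind K :: 'b => real)"
  using emeasure_bounded_finite[OF compact_imp_bounded[OF K]] by (auto simp: integrable_indicator_iff)
 have [measurable]: "ph n \<in> Borel" for n using P(1)[of n] by measurable
 have "(%n. LI x. \<bar>ind K x - ph n x\<bar>) \<longlonglongrightarrow> (LI x::'b. 0)"
 proof (rule integral_dominated_convergence[where w="ind (ball 0 R)"])
  show "integ (ind (ball 0 R) :: 'b => real)"
   by (auto simp: integrable_indicator_iff emeasure_bounded_finite[simplified])
  show "AE x in lborel. norm \<bar>ind K x - ph n x\<bar> <= ind (ball 0 R) x" for n
  proof (rule AE_I2)
   fix x show "norm \<bar>ind K x - ph n x\<bar> <= ind (ball 0 R) x"
    using P(2,3)[of n x] P(4)[of x n] P(6)[of n] P(7)[of x n] R by (cases "x \<in> K' n") (auto simp: indicator_def)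
  qed
  show "AE x in lborel. (%n. \<bar>ind K x - ph n x\<bar>) \<longlonglongrightarrow> 0"
  proof (rule AE_I2)
   fix x show "(%n. \<bar>ind K x - ph n x\<bar>) \<longlonglongrightarrow> 0"
    using tendsto_rabs[OF tendsto_diff[OF tendsto_const[of "ind K x"] P(8)[of x]]] by simp
  qed
 qed measurable
 hence lim: "(%n. LI x. \<bar>ind K x - ph n x\<bar>) \<longlonglongrightarrow> 0" by simp
 show ?thesis
 proof (rule L1_approx_closure[OF Ki])
  fix e :: real assume "e > 0"
  hence "\<forall>\<^sub>F n in sequentially. (LI x. \<bar>ind K x - ph n x\<bar>) < e"
   using order_tendstoD(2)[OF lim] by blast
  then obtain n where "(LI x. \<bar>ind K x - ph n x\<bar>) < e"
   using eventually_happens'[OF sequentially_bot] by blast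
  thus "EX g. integ g & L1_approx g & (LI x. \<bar>ind K x - g x\<bar>) < e"
   by (intro exI[of _ "ph n"] conjI integrable_compact_support[OF C1_continuous[OF P(1)] P(5,7)]
     L1_approx_continuous[OF C1_continuous[OF P(1)] P(5,7)])
 qed
qed

lemma L1_approx_add:
 fixes f g :: "'b::euclidean_space => real" assumes f: "integ f" "L1_approx f" and g: "integ g" "L1_approx g"
 shows "L1_approx (%x. f x+g x)" unfolding L1_approx_def
proof (rule tendsto_sandwich[where f="%_. 0"])
 have lim: "((%r. (LI x. \<bar>cv f (mol r) x - f x\<bar>)+(LI x. \<bar>cv g (mol r) x - g x\<bar>)) \<longlongrightarrow> 0) (at_right 0)"
  using tendsto_add[OF f(2)[unfolded L1_approx_def] g(2)[unfolded L1_approx_def]] by simp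
 thus "((%r. (LI x. \<bar>cv f (mol r) x - f x\<bar>)+(LI x. \<bar>cv g (mol r) x - g x\<bar>)) \<longlongrightarrow> 0) (at_right 0)" .
 have "\<forall>\<^sub>F r in at_right (0::real). r > 0" by (simp add: eventually_at_right_less)
 thus "\<forall>\<^sub>F r in at_right 0. (LI x. \<bar>cv (%x. f x+g x) (mol r) x - (f x+g x)\<bar>) <=
   (LI x. \<bar>cv f (mol r) x - f x\<bar>)+(LI x. \<bar>cv g (mol r) x - g x\<bar>)"
 proof eventually_elim
  case (elim r)
  have mi: "integ (mol r :: 'b => real)" by (rule mol_integrable[OF elim])
  obtain B where B: "!!x. norm (mol r (x::'b)) <= B" using mol_bounded[OF elim] by (metis real_norm_def)
  have eq: "cv (%x. f x+g x) (mol r) x = cv f (mol r) x+cv g (mol r) x" for x unfolding cv_def scaleR_add_left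
   by (rule B_integral_add) (rule cv_integrable_point[OF f(1) mol_measurable B] cv_integrable_point[OF g(1) mol_measurable B])+
  have "(LI x. \<bar>cv (%x. f x+g x) (mol r) x - (f x+g x)\<bar>) <=
    (LI x. \<bar>cv f (mol r) x - f x\<bar>+\<bar>cv g (mol r) x - g x\<bar>)"
   by (intro integral_mono integrable_abs B_integrable_add B_integrable_diff cv_integrable f(1) g(1) mi)
     (simp add: eq)
  also have "... = (LI x. \<bar>cv f (mol r) x - f x\<bar>)+(LI x. \<bar>cv g (mol r) x - g x\<bar>)"
   by (intro B_integral_add integrable_abs B_integrable_diff cv_integrable f(1) g(1) mi)
  finally show ?case .
 qed
qed auto

lemma L1_approx_cmult: assumes "L1_approx f" shows "L1_approx (%x. f x*c)"
proof -
 have "cv (%x. f x*c) (mol r) x = cv f (mol r) x*c" for r x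
  unfolding cv_def by (simp add: mult.commute mult.left_commute mult.assoc flip: integral_mult_right_zero)
 hence "\<bar>cv (%x. f x*c) (mol r) x - f x*c\<bar> = \<bar>cv f (mol r) x - f x\<bar>*\<bar>c\<bar>" for r x
  by (simp add: abs_mult[symmetric] left_diff_distrib)
 thus ?thesis using tendsto_mult_right[OF assms[unfolded L1_approx_def], of "\<bar>c\<bar>"]
  unfolding L1_approx_def by simp
qed

text \<open>Compact sets exhaust Borel sets of finite measure from inside, simple functions follow
  by linearity, and the last case of the induction is dominated convergence.\<close>

lemma L1_approx_integrable:
 fixes f :: "'b::euclidean_space => real" assumes "integ f" shows "L1_approx f" using assms
proof (induct rule: integrable_induct)
 case (base A c)
 have [measurable]: "A \<in> sets borel" using base by simp
 have Ai: "integ (ind A :: 'b => real)" using base by (auto simp: integrable_indicator_iff)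
 have "L1_approx (ind A :: 'b => real)"
 proof (rule L1_approx_closure[OF Ai])
  fix e :: real assume e: "e > 0"
  define M where "M = density lborel (ind A :: 'b => ennreal)"
  have eM: "emeasure M X = emeasure lborel (A \<inter> X)" if "X \<in> sets borel" for X
   unfolding M_def using that by (subst emeasure_restricted) auto
  have "finite_measure M" by (rule finite_measureI) (use eM[of UNIV] base in "auto simp: M_def")
  moreover have "sets M = sets borel" by (simp add: M_def)
  ultimately obtain K where K: "compact K" "K <= A" "measure M (A - K) < e"
   using inner_compact_approx[of M A e] e by auto
  have [measurable]: "K \<in> sets borel" using K(1) by (rule borel_compact)
  have Ki: "integ (ind K :: 'b => real)"
   using emeasure_bounded_finite[OF compact_imp_bounded[OF K(1)]] by (auto simp: integrable_indicator_iff)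
  have "(%x. \<bar>ind A x - ind K x\<bar>) = (ind (A - K) :: 'b => real)"
   using K(2) by (auto simp: fun_eq_iff indicator_def)
  hence "(LI x. \<bar>ind A x - ind K x\<bar>) = vol (A - K)" by simp
  also have "... = measure M (A - K)" using eM[of "A - K"] by (simp add: measure_def Int_absorb1)
  finally show "EX g. integ g & L1_approx g & (LI x. \<bar>ind A x - g x\<bar>) < e"
   using K(3) Ki L1_approx_compact[OF K(1)] by (intro exI[of _ "ind K"]) simp
 qed
 from L1_approx_cmult[OF this, of c] show ?case by simp
next
 case (add f g)
 thus ?case by (intro L1_approx_add)
next
 case (lim f s)
 have "(%n. LI x. \<bar>f x - s n x\<bar>) \<longlonglongrightarrow> (LI x::'b. 0)"
 proof (rule integral_dominated_convergence[where w="%x. 3*\<bar>f x\<bar>"])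
  show "AE x in lborel. norm \<bar>f x - s n x\<bar> <= 3*\<bar>f x\<bar>" for n
  proof (rule AE_I2)
   fix x show "norm \<bar>f x - s n x\<bar> <= 3*\<bar>f x\<bar>" using lim(4)[of x n] by simp
  qed
  show "AE x in lborel. (%n. \<bar>f x - s n x\<bar>) \<longlonglongrightarrow> 0"
  proof (rule AE_I2)
   fix x show "(%n. \<bar>f x - s n x\<bar>) \<longlonglongrightarrow> 0"
    using tendsto_rabs[OF tendsto_diff[OF tendsto_const[of "f x"] lim(3)[of x]]] by simp
  qed
 qed (use lim in auto)
 hence l0: "(%n. LI x. \<bar>f x - s n x\<bar>) \<longlonglongrightarrow> 0" by simp
 show ?case
 proof (rule L1_approx_closure[OF lim(5)])
  fix e :: real assume "e > 0"
  hence "\<forall>\<^sub>F n in sequentially. (LI x. \<bar>f x - s n x\<bar>) < e"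
   using order_tendstoD(2)[OF l0] by blast
  then obtain n where "(LI x. \<bar>f x - s n x\<bar>) < e" using eventually_happens'[OF sequentially_bot] by blast
  thus "EX g. integ g & L1_approx g & (LI x. \<bar>f x - g x\<bar>) < e" using lim by blast
 qed
qed

section \<open>A relative isoperimetric inequality\<close>

text \<open>The substitution has Jacobian c^n, whose inverse is at most 2^n.\<close>

lemma nn_integral_affine_le:
 fixes k :: "'b::euclidean_space => ennreal" assumes [measurable]: "k \<in> Borel" and c: "c >= 1/2"
 shows "(NI x. k (a+c *\<^sub>R x)) <= ennreal (2 ^ DIM('b))*(NI x. k x)"
proof -
 have "(NI x. k x) = (\<integral>\<^sup>+x. k x \<partial>(density (distr lborel borel (%x. a+c *\<^sub>R x)) (%_. ennreal (\<bar>c\<bar> ^ DIM('b)))))"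
  using lborel_affine[of c a] c by simp
 also have "... = ennreal (\<bar>c\<bar> ^ DIM('b))*(NI x. k (a+c *\<^sub>R x))"
  by (simp add: nn_integral_density nn_integral_distr nn_integral_cmult)
 finally have eq: "(NI x. k x) = ennreal (\<bar>c\<bar> ^ DIM('b))*(NI x. k (a+c *\<^sub>R x))" .
 have "1 <= (2*c) ^ DIM('b)" using c by (intro one_le_power) auto
 hence "1 <= ennreal (2 ^ DIM('b)*\<bar>c\<bar> ^ DIM('b))" using c by (simp add: power_mult_distrib)
 hence "(NI x. k (a+c *\<^sub>R x)) <= ennreal (2 ^ DIM('b)*\<bar>c\<bar> ^ DIM('b))*(NI x. k (a+c *\<^sub>R x))"
  using mult_right_mono[of 1 "ennreal (2 ^ DIM('b)*\<bar>c\<bar> ^ DIM('b))" "NI x. k (a+c *\<^sub>R x)"] by simp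
 thus ?thesis unfolding eq by (simp add: ennreal_mult mult.assoc)
qed

lemma C1_segment_bound:
 fixes w :: "'b::euclidean_space => real" assumes "C1 w g"
 shows "ennreal \<bar>w x - w y\<bar> <= ennreal (norm (x - y))*(NI t. ind {0..1} t*ennreal (norm (g (y+t *\<^sub>R (x - y)))))"
proof -
 have cg: "continuous_on S (%t::real. g (y+t *\<^sub>R (x - y)))" for S
  by (intro continuous_on_compose2[OF C1_continuous_grad[OF assms, of UNIV]] continuous_intros) auto
 have d: "((%t. w (y+t *\<^sub>R (x - y))) has_vector_derivative g (y+t *\<^sub>R (x - y)) \<bullet> (x - y)) (at t within {0..1})" for t
 proof -
  have "((%t. y+t *\<^sub>R (x - y)) has_derivative (%h. h *\<^sub>R (x - y))) (at t)"
   by (auto intro!: derivative_eq_intros)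
  from diff_chain_at[OF this, of w "%h. g (y+t *\<^sub>R (x - y)) \<bullet> h"] C1_derivative[OF assms, of "y+t *\<^sub>R (x - y)" UNIV]
  have "((%t. w (y+t *\<^sub>R (x - y))) has_derivative (%h. g (y+t *\<^sub>R (x - y)) \<bullet> (h *\<^sub>R (x - y)))) (at t)"
   by (simp add: o_def)
  thus ?thesis by (auto simp: has_vector_derivative_def intro: has_derivative_at_withinI)
 qed
 have "(LI t. ind {0..1} t *\<^sub>R (g (y+t *\<^sub>R (x - y)) \<bullet> (x - y))) = w (y+1 *\<^sub>R (x - y)) - w (y+0 *\<^sub>R (x - y))"
  by (rule integral_FTC_Icc[OF _ d]) (auto intro!: continuous_intros cg)
 hence eq: "w x - w y = (LI t. ind {0..1} t *\<^sub>R (g (y+t *\<^sub>R (x - y)) \<bullet> (x - y)))" by simp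
 have [measurable]: "g \<in> Borel" using assms by measurable
 have i: "integ (%t. ind {0..1} t *\<^sub>R (g (y+t *\<^sub>R (x - y)) \<bullet> (x - y)))"
  by (rule borel_integrable_compact) (auto intro!: continuous_intros cg)
 have "ennreal \<bar>w x - w y\<bar> <= (NI t. ennreal (norm (ind {0..1} t *\<^sub>R (g (y+t *\<^sub>R (x - y)) \<bullet> (x - y)))))"
  using integral_norm_bound_ennreal[OF i] unfolding eq by simp
 also have "... <= (NI t. ennreal (norm (x - y))*(ind {0..1} t*ennreal (norm (g (y+t *\<^sub>R (x - y))))))"
 proof (rule nn_integral_mono)
  fix t :: real
  show "ennreal (norm (ind {0..1} t *\<^sub>R (g (y+t *\<^sub>R (x - y)) \<bullet> (x - y)))) <=
   ennreal (norm (x - y))*(ind {0..1} t*ennreal (norm (g (y+t *\<^sub>R (x - y)))))"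
   using Cauchy_Schwarz_ineq2[of "g (y+t *\<^sub>R (x - y))" "x - y"]
   by (auto simp: indicator_def ennreal_mult[symmetric] mult.commute intro!: ennreal_leI)
 qed
 also have "... = ennreal (norm (x - y))*(NI t. ind {0..1} t*ennreal (norm (g (y+t *\<^sub>R (x - y)))))"
  by (rule nn_integral_cmult) measurable
 finally show ?thesis .
qed

text \<open>The difference of w is integrated along the segment, which convexity keeps in the ball.
  The point of the segment at parameter t depends on x with factor t and on y with factor 1 - t. One
  of the two factors is at least 1/2, and a change of that variable costs only 2^n.\<close>

lemma poincare_ball_nn:
 fixes w :: "'b::euclidean_space => real" and z :: 'b assumes w: "C1 w g" and R: "R > 0"
 defines "B \<equiv> ball z R" shows "(NI x. NI y. ind B x*ind B y*ennreal \<bar>w x - w y\<bar>)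
  <= ennreal (2*R*2 ^ DIM('b))*emeasure lborel B*(NI x. ind B x*ennreal (norm (g x)))"
proof -
 have [measurable]: "g \<in> Borel" using w by measurable
 have [measurable]: "B \<in> sets borel" by (simp add: B_def)
 define k where "k x = ind B x*ennreal (norm (g x))" for x
 have [measurable]: "k \<in> Borel" unfolding k_def by measurable
 define J where "J = (NI x. k x)"
 define h where "h t x y = (ind {0..1} t*(ind B x*ind B y)*ennreal (norm (g (y+t *\<^sub>R (x - y)))) :: ennreal)"
  for t :: real and x y
 have hm [measurable]: "(%(t,x,y). h t x y) \<in> borel_measurable (borel \<Otimes>\<^sub>M borel \<Otimes>\<^sub>M borel)"
  unfolding h_def by measurable
 have hle: "h t x y <= ind {0..1} t*(ind B y*k (y+t *\<^sub>R (x - y)))"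
   "h t x y <= ind {0..1} t*(ind B x*k (y+t *\<^sub>R (x - y)))" for t x y
 proof -
  have "y+t *\<^sub>R (x - y) \<in> B" if "t \<in> {0..1}" "x \<in> B" "y \<in> B"
  proof -
   have "(1 - t) *\<^sub>R y+t *\<^sub>R x \<in> B"
    using convexD_alt[of B y x t] that by (simp add: B_def convex_ball)
   thus ?thesis by (simp add: algebra_simps)
  qed
  thus "h t x y <= ind {0..1} t*(ind B y*k (y+t *\<^sub>R (x - y)))"
   "h t x y <= ind {0..1} t*(ind B x*k (y+t *\<^sub>R (x - y)))" by (auto simp: h_def k_def indicator_def)
 qed
 have inner: "(NI x. NI y. h t x y) <= ind {0..1} t*(ennreal (2 ^ DIM('b))*emeasure lborel B*J)" for t
 proof (cases "t >= 1/2")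
  case True
  have "(NI x. NI y. h t x y) = (NI y. NI x. h t x y)" by (rule lborel_pair.Fubini'[symmetric]) measurable
  also have "... <= (NI y. ind {0..1} t*(ind B y*(ennreal (2 ^ DIM('b))*J)))"
  proof (rule nn_integral_mono)
   fix y
   have "(NI x. h t x y) <= (NI x. ind {0..1} t*(ind B y*k ((y - t *\<^sub>R y)+t *\<^sub>R x)))"
    using hle(1)[of t _ y] by (intro nn_integral_mono) (simp add: algebra_simps)
   also have "... = ind {0..1} t*(ind B y*(NI x. k ((y - t *\<^sub>R y)+t *\<^sub>R x)))"
    by (simp add: nn_integral_cmult)
   also have "... <= ind {0..1} t*(ind B y*(ennreal (2 ^ DIM('b))*J))"
    unfolding J_def by (intro mult_left_mono nn_integral_affine_le True) auto
   finally show "(NI x. h t x y) <= ind {0..1} t*(ind B y*(ennreal (2 ^ DIM('b))*J))" .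
  qed
  also have "... = ind {0..1} t*(ennreal (2 ^ DIM('b))*emeasure lborel B*J)"
   by (simp add: nn_integral_cmult nn_integral_multc mult_ac)
  finally show ?thesis .
 next
  case False
  have "(NI x. NI y. h t x y) <= (NI x. ind {0..1} t*(ind B x*(ennreal (2 ^ DIM('b))*J)))"
  proof (rule nn_integral_mono)
   fix x
   have "(NI y. h t x y) <= (NI y. ind {0..1} t*(ind B x*k (t *\<^sub>R x+(1 - t) *\<^sub>R y)))"
    using hle(2)[of t x] by (intro nn_integral_mono) (simp add: algebra_simps)
   also have "... = ind {0..1} t*(ind B x*(NI y. k (t *\<^sub>R x+(1 - t) *\<^sub>R y)))"
    by (simp add: nn_integral_cmult)
   also have "... <= ind {0..1} t*(ind B x*(ennreal (2 ^ DIM('b))*J))"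
    unfolding J_def using False by (intro mult_left_mono nn_integral_affine_le) auto
   finally show "(NI y. h t x y) <= ind {0..1} t*(ind B x*(ennreal (2 ^ DIM('b))*J))" .
  qed
  also have "... = ind {0..1} t*(ennreal (2 ^ DIM('b))*emeasure lborel B*J)"
   by (simp add: nn_integral_cmult nn_integral_multc mult_ac)
  finally show ?thesis .
 qed
 have pt: "ind B x*ind B y*ennreal \<bar>w x - w y\<bar> <= ennreal (2*R)*(NI t. h t x y)" for x y
 proof (cases "x \<in> B & y \<in> B")
  case True
  hence "norm (x - y) <= 2*R"
   using dist_triangle2[of x y z] by (auto simp: B_def dist_norm dist_commute norm_minus_commute)
  hence "ennreal (norm (x - y))*(NI t. ind {0..1} t*ennreal (norm (g (y+t *\<^sub>R (x - y))))) <=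
   ennreal (2*R)*(NI t. ind {0..1} t*ennreal (norm (g (y+t *\<^sub>R (x - y)))))"
   by (intro mult_right_mono ennreal_leI) auto
  thus ?thesis using True C1_segment_bound[OF w, of x y] by (simp add: h_def)
 qed auto
 have "(NI x. NI y. ind B x*ind B y*ennreal \<bar>w x - w y\<bar>) <= (NI x. NI y. ennreal (2*R)*(NI t. h t x y))"
  by (intro nn_integral_mono pt)
 also have "... = ennreal (2*R)*(NI x. NI y. NI t. h t x y)"
 proof -
  have "(NI y. ennreal (2*R)*(NI t. h t x y)) = ennreal (2*R)*(NI y. NI t. h t x y)" for x
   unfolding h_def by (rule nn_integral_cmult) measurable
  thus ?thesis by (simp only:) (rule nn_integral_cmult, unfold h_def, measurable)
 qed
 also have "(NI x. NI y. NI t. h t x y) = (NI x. NI t. NI y. h t x y)"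
  unfolding h_def by (intro nn_integral_cong lborel_pair.Fubini') measurable
 also have "... = (NI t. NI x. NI y. h t x y)" unfolding h_def by (intro lborel_pair.Fubini') measurable
 also have "... <= (NI t. ind {0..1::real} t*(ennreal (2 ^ DIM('b))*emeasure lborel B*J))"
  by (rule nn_integral_mono) (rule inner)
 also have "... = ennreal (2 ^ DIM('b))*emeasure lborel B*J" by (simp add: nn_integral_multc)
 finally have "(NI x. NI y. ind B x*ind B y*ennreal \<bar>w x - w y\<bar>) <=
  ennreal (2*R)*(ennreal (2 ^ DIM('b))*emeasure lborel B*J)" by (simp add: mult_left_mono)
 thus ?thesis using R by (simp add: J_def k_def ennreal_mult mult.assoc)
qed

text \<open>A relative isoperimetric inequality for an arbitrary set, the gradient of its indicator being
  replaced by that of a \<open>C\<^sup>1\<close> function close to the indicator in \<open>L\<^sup>1\<close>.\<close>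
lemma isoperimetric_ball:
 fixes w :: "'b::euclidean_space => real" assumes w: "C1 w g" and R: "R > 0" and E: "E \<in> sets borel"
  and L1: "integ (%x. w x - ind E x)" shows "vol (ball z R \<inter> E) * vol (ball z R - E) <=
  2*R*2 ^ DIM('b) * vol (ball z R)*(LI x. ind (ball z R) x*norm (g x))
 +2 * vol (ball z R)*(LI x. \<bar>w x - ind E x\<bar>)"
proof -
 define B where "B = ball z R"
 note [measurable] = E
 have [measurable]: "g \<in> Borel" "w \<in> Borel" using w by measurable
 have [measurable]: "B \<in> sets borel" by (simp add: B_def)
 have fin: "emeasure lborel B < \<infinity>" unfolding B_def by (rule emeasure_bounded_finite) simp
 have finA: "emeasure lborel A = ennreal (vol A)" if "A <= B" "A \<in> sets borel" for A
  using emeasure_mono[OF that(1), of lborel] fin that(2)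
  by (intro emeasure_eq_ennreal_measure) (auto simp: top_unique)
 have gi: "integ (%x. ind B x*norm (g x))"
 proof -
  have "integ (%x. ind (cball z R) x *\<^sub>R norm (g x))"
   by (rule borel_integrable_compact) (auto intro!: continuous_intros C1_continuous_grad[OF w])
  thus ?thesis by (rule B_integrable_bound) (auto simp: B_def indicator_def)
 qed
 have L: "(NI x. ennreal \<bar>w x - ind E x\<bar>) = ennreal (LI x. \<bar>w x - ind E x\<bar>)"
  using L1 by (intro nn_integral_eq_integral) auto
 have G: "(NI x. ind B x*ennreal (norm (g x))) = ennreal (LI x. ind B x*norm (g x))"
  using gi by (subst nn_integral_eq_integral[symmetric]) (auto intro!: nn_integral_cong simp: indicator_def)
 have "emeasure lborel (B \<inter> E)*emeasure lborel (B - E) = (NI x. NI y. ind (B \<inter> E) x*ind (B - E) y)"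
  by (simp add: nn_integral_cmult nn_integral_multc)
 also have "... <= (NI x. NI y. ind B x*ind B y*ennreal \<bar>w x - w y\<bar>
  +(ind B x*ind B y*ennreal \<bar>w x - ind E x\<bar>+ind B x*ind B y*ennreal \<bar>w y - ind E y\<bar>))"
 proof (intro nn_integral_mono)
  fix x y
  show "ind (B \<inter> E) x*ind (B - E) y <= ind B x*ind B y*ennreal \<bar>w x - w y\<bar>
  +(ind B x*ind B y*ennreal \<bar>w x - ind E x\<bar>+ind B x*ind B y*ennreal \<bar>w y - ind E y\<bar>)"
  proof (cases "x \<in> B \<inter> E & y \<in> B - E")
   case True
   \<comment> \<open>For x in E and y outside E either w separates x from y, or w is far from the
     indicator at one of the two points; the three terms add up to at least one.\<close>
   hence "1 <= \<bar>w x - w y\<bar>+(\<bar>w x - ind E x\<bar>+\<bar>w y - ind E y\<bar>)" by auto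
   hence "ennreal 1 <= ennreal (\<bar>w x - w y\<bar>+(\<bar>w x - ind E x\<bar>+\<bar>w y - ind E y\<bar>))" by (rule ennreal_leI)
   thus ?thesis using True by (simp add: ennreal_plus)
  qed auto
 qed
 also have "... = (NI x. NI y. ind B x*ind B y*ennreal \<bar>w x - w y\<bar>)
  +((NI x. NI y. ind B x*ind B y*ennreal \<bar>w x - ind E x\<bar>)
  +(NI x. NI y. ind B x*ind B y*ennreal \<bar>w y - ind E y\<bar>))" by (simp add: nn_integral_add)
 also have "(NI x. NI y. ind B x*ind B y*ennreal \<bar>w x - ind E x\<bar>)
   <= (NI x. NI y. ind B y*ennreal \<bar>w x - ind E x\<bar>)" by (intro nn_integral_mono) (auto simp: indicator_def)
 also have "(NI x. NI y. ind B y*ennreal \<bar>w x - ind E x\<bar>) = emeasure lborel B*ennreal (LI x. \<bar>w x - ind E x\<bar>)"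
  by (simp add: nn_integral_multc nn_integral_cmult L[symmetric])
 also have "(NI x. NI y. ind B x*ind B y*ennreal \<bar>w y - ind E y\<bar>)
   <= (NI x. NI y. ind B x*ennreal \<bar>w y - ind E y\<bar>)" by (intro nn_integral_mono) (auto simp: indicator_def)
 also have "(NI x. NI y. ind B x*ennreal \<bar>w y - ind E y\<bar>) = emeasure lborel B*ennreal (LI x. \<bar>w x - ind E x\<bar>)"
  by (simp add: nn_integral_multc nn_integral_cmult L[symmetric])
 also have "(NI x. NI y. ind B x*ind B y*ennreal \<bar>w x - w y\<bar>)
  <= ennreal (2*R*2 ^ DIM('b))*emeasure lborel B*ennreal (LI x. ind B x*norm (g x))"
  using poincare_ball_nn[OF w R, of z] unfolding B_def[symmetric] G .
 finally have "emeasure lborel (B \<inter> E)*emeasure lborel (B - E) <=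
   ennreal (2*R*2 ^ DIM('b))*emeasure lborel B*ennreal (LI x. ind B x*norm (g x)) +
   (emeasure lborel B*ennreal (LI x. \<bar>w x - ind E x\<bar>)+emeasure lborel B*ennreal (LI x. \<bar>w x - ind E x\<bar>))"
  by (simp add: add_mono)
 also have "... = ennreal (2*R*2 ^ DIM('b) * vol B*(LI x. ind B x*norm (g x)) +
   (vol B*(LI x. \<bar>w x - ind E x\<bar>)+vol B*(LI x. \<bar>w x - ind E x\<bar>)))"
 proof -
  have "ennreal c*ennreal m*ennreal G+(ennreal m*ennreal L+ennreal m*ennreal L) = ennreal (c*m*G+(m*L+m*L))"
   if "0 <= c" "0 <= m" "0 <= G" "0 <= L" for c m G L
   using that by (simp only: ennreal_mult ennreal_plus mult_nonneg_nonneg add_nonneg_nonneg)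
  thus ?thesis using R unfolding finA[OF order_refl \<open>B \<in> sets borel\<close>] by simp
 qed
 finally have "vol (B \<inter> E) * vol (B - E) <= 2*R*2 ^ DIM('b) * vol B*(LI x. ind B x*norm (g x)) +
   (vol B*(LI x. \<bar>w x - ind E x\<bar>)+vol B*(LI x. \<bar>w x - ind E x\<bar>))"
 proof (subst (asm) (1 2) finA)
  assume "ennreal (vol (B \<inter> E))*ennreal (vol (B - E)) <=
   ennreal (2*R*2 ^ DIM('b) * vol B*(LI x. ind B x*norm (g x)) +
   (vol B*(LI x. \<bar>w x - ind E x\<bar>)+vol B*(LI x. \<bar>w x - ind E x\<bar>)))"
  thus ?thesis by (subst (asm) ennreal_mult[symmetric], simp, simp, subst (asm) ennreal_le_iff) (use R in auto)
 qed auto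
 thus ?thesis by (simp add: B_def)
qed

section \<open>Mollified sets of finite perimeter\<close>

lemma bounded_linear_id_le: "bounded_linear (%x::'b::euclidean_space. x)" "norm (x::'b) <= norm x"
 by (auto intro: bounded_linear_ident)

lemma lipschitz_01:
 assumes h: "!!t. (h has_real_derivative h' t) (at t)" "!!t. 0 <= t ==> t <= 1 ==> 0 <= h' t & h' t <= C"
  and t: "s \<in> {0..1}" "t \<in> {0..1}" shows "\<bar>h s - h t\<bar> <= C*\<bar>s - t\<bar>"
proof -
 have "norm (h s - h t) <= C*norm (s - t)"
 proof (rule field_differentiable_bound[where S="{0..1}" and f'=h'])
  show "norm (h' t) <= C" if "t \<in> {0..1}" for t using h(2)[of t] that by auto
 qed (use t h(1) in "auto intro: has_field_derivative_at_within")
 thus ?thesis by simp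
qed

lemma cv_compact_support:
 fixes theta :: "'b::euclidean_space => 'c::{banach,second_countable_topology}"
 assumes E: "E <= ball 0 R" and th: "!!x. norm x >= r ==> theta x = 0" and x: "x \<notin> cball 0 (R+r)"
 shows "cv (ind E :: 'b => real) theta x = 0"
proof -
 have z: "ind E y *\<^sub>R theta (x - y) = 0" for y
 proof (cases "y \<in> E")
  case True
  hence "norm y < R" using E by auto
  hence "norm (x - y) >= r" using x norm_triangle_ineq2[of x y] by simp
  thus ?thesis using th by simp
 qed simp
 show ?thesis unfolding cv_def z by simp
qed

text \<open>For fixed r the error \<open>D r*L s\<close> vanishes as s tends to 0, so the lower
  limit of F dominates every value F r. It therefore reaches the supremum, which no value
  exceeds.\<close>

lemma tendsto_SUP_at_right_0:
 fixes F :: "real => real" assumes lsc: "!!r s. r > 0 ==> s > 0 ==> F r <= F s+D r*L s"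
  and L: "(L \<longlongrightarrow> 0) (at_right 0)" and bound: "!!r. r > 0 ==> F r <= B"
 shows "(F \<longlongrightarrow> (SUP r\<in>{0<..}. F r)) (at_right 0)"
proof (rule tendstoI)
 fix e :: real assume e: "e > 0"
 let ?T = "SUP r\<in>{0<..}. F r"
 have bdd: "bdd_above (F ` {0<..})" by (auto intro!: bdd_aboveI[of _ B] bound)
 have "?T - e/2 < ?T" using e by simp
 then obtain r where r: "r > 0" "?T - e/2 < F r" by (subst (asm) less_cSUP_iff[OF _ bdd]) auto
 have "((%s. D r*L s) \<longlongrightarrow> 0) (at_right 0)" by (rule tendsto_mult_right_zero[OF L])
 hence "\<forall>\<^sub>F s in at_right 0. D r*L s < e/2" by (rule order_tendstoD) (use e in simp)
 moreover have "\<forall>\<^sub>F s in at_right (0::real). s > 0" by (simp add: eventually_at_right_less)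
 ultimately show "\<forall>\<^sub>F s in at_right 0. dist (F s) ?T < e"
 proof eventually_elim
  case (elim s)
  have "?T - e < F s" using lsc[OF r(1) elim(2)] r(2) elim(1) by linarith
  moreover have "F s <= ?T" using elim(2) by (intro cSUP_upper bdd) simp
  ultimately show ?case by (simp add: dist_real_def)
 qed
qed

text \<open>The mollified indicator \<open>mi E r\<close> of a bounded set and its gradient; the boundedness of
  \<open>pm E r\<close> as \<open>r \<rightarrow> 0\<close> expresses that \<open>E\<close> has finite perimeter.\<close>
definition mi :: "'b::euclidean_space set => real => 'b => real" where
 "mi E r = cv (ind E) (mol r)"

definition dmi :: "'b::euclidean_space set => real => 'b => 'b" where
 "dmi E r = cv (ind E :: 'b => real) (dmol r)"

definition pm :: "'b::euclidean_space set => real => real" where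
 "pm E r = (LI x. norm (dmi E r x))"

locale borel_set =
 fixes E :: "'b::euclidean_space set" assumes E_borel [measurable]: "E \<in> sets borel"

locale bounded_borel = borel_set E for E :: "'b::euclidean_space set" + assumes E_bounded: "bounded E"
begin

lemma E_integrable: "integ (ind E :: 'b => real)"
 using emeasure_bounded_finite[OF E_bounded] by (auto simp: integrable_indicator_iff)

lemma C1_mi: "r > 0 ==> C1 (mi E r) (dmi E r)"
 unfolding mi_def dmi_def by (rule C1_cv[OF E_integrable C1_mol compact_cball mol_support])

lemma mi_support: obtains R where "!!r x. r > 0 ==> x \<notin> cball 0 (R+r) ==> mi E r x = 0"
proof -
 obtain R where R: "E <= ball 0 R" using bounded_subset_ballD[OF E_bounded] by blast
 show ?thesis by (rule that[of R]) (use R in "auto simp: mi_def intro!: cv_compact_support mol_eq_0")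
qed

lemma mi_bounds: assumes "r > 0" shows "0 <= mi E r x" "mi E r x <= 1"
proof -
 obtain B where B: "!!x. norm (mol r (x::'b)) <= B" using mol_bounded[OF assms] by (metis real_norm_def)
 show "0 <= mi E r x" unfolding mi_def cv_def by (auto simp: mol_nonneg)
 have "mi E r x <= (LI y. mol r (x - y))" unfolding mi_def cv_def
  by (intro integral_mono cv_integrable_point[OF E_integrable mol_measurable B] lborel_integrable_reflect[OF mol_integrable[OF assms]])
    (auto simp: indicator_def mol_nonneg)
 thus "mi E r x <= 1" by (subst (asm) lborel_integral_reflect) (auto simp: mol_integral[OF assms])
qed

lemma mi_measurable [measurable]: "mi E r \<in> Borel" unfolding mi_def by measurable
lemma dmi_measurable [measurable]: "dmi E r \<in> Borel" unfolding dmi_def by measurable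

lemma mi_integrable: "r > 0 ==> integ (mi E r)" unfolding mi_def by (intro cv_integrable E_integrable mol_integrable)

lemma dmi_integrable: "r > 0 ==> integ (dmi E r)"
 unfolding dmi_def by (intro cv_integrable E_integrable dmol_integrable)

lemma mi_L1: "((%r. LI x. \<bar>mi E r x - ind E x\<bar>) \<longlongrightarrow> 0) (at_right 0)"
 using L1_approx_integrable[OF E_integrable] by (simp add: L1_approx_def mi_def)

lemma pm_lsc: assumes r: "r > 0" and s: "s > 0"
 shows "pm E r <= pm E s+(LI x. norm (dmol r (x::'b)))*(LI x. \<bar>mi E s x - ind E x\<bar>)"
proof -
 obtain R where R: "!!r x. r > 0 ==> x \<notin> cball 0 (R+r) ==> mi E r x = 0" using mi_support by metis
 show ?thesis
  using gradient_mass_lsc[OF E_integrable C1_mi[OF s] compact_cball[of 0 "R+s"] R[OF s] bounded_linear_id_le r]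
  by (simp add: pm_def dmi_def abs_minus_commute)
qed

lemma tendsto_cmult_zero: "(f \<longlongrightarrow> 0) F ==> ((%x. c*f x) \<longlongrightarrow> (0::real)) F"
 using tendsto_mult_right_zero .

end

locale finite_perimeter = bounded_borel E for E :: "'b::euclidean_space set" +
 fixes T0 :: real assumes pm_bounded: "!!r. r > 0 ==> pm E r <= T0"
begin

text \<open>The perimeter of E, reached through gradient masses of C^1 functions instead of a
  gradient measure. By \<open>pm_tendsto\<close> the supremum is also the limit.\<close>

definition T :: real where "T = (SUP r\<in>{0<..}. pm E r)"

lemma pm_le_T: "r > 0 ==> pm E r <= T"
 unfolding T_def by (rule cSUP_upper) (auto intro!: bdd_aboveI[of _ T0] pm_bounded)

lemma pm_tendsto: "(pm E \<longlongrightarrow> T) (at_right 0)"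
 unfolding T_def by (rule tendsto_SUP_at_right_0[OF pm_lsc mi_L1 pm_bounded])

text \<open>Splitting \<open>C \<cdot> id\<close> into \<open>h\<close> and \<open>C \<cdot> id - h\<close>, lower semicontinuity of the second summand
  bounds the first from above.\<close>
lemma strictness: assumes h: "!!t. (h has_real_derivative h' t) (at t)" "continuous_on UNIV h'" "h 0 = 0" "h 1 = 1"
  and C: "C >= 1" "!!t. 0 <= t ==> t <= 1 ==> 0 <= h' t & h' t <= C" and e: "e > 0"
 shows "\<forall>\<^sub>F r in at_right 0. (LI x. h' (mi E r x)*norm (dmi E r x)) <= T+e"
proof -
 obtain R where R: "!!r x. r > 0 ==> x \<notin> cball 0 (R+r) ==> mi E r x = 0" using mi_support by metis
 have "((%r. (C - 1)*(T - pm E r)) \<longlongrightarrow> (C - 1)*(T - T)) (at_right 0)"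
  by (intro tendsto_intros pm_tendsto)
 hence "((%r. (C - 1)*(T - pm E r)) \<longlongrightarrow> 0) (at_right 0)" by simp
 hence "\<forall>\<^sub>F r in at_right 0. (C - 1)*(T - pm E r) < e/2" by (rule order_tendstoD) (use e in simp)
 hence "\<forall>\<^sub>F r in at_right 0. (C - 1)*(T - pm E r) < e/2 & r > 0"
  by (intro eventually_conj) (simp_all add: eventually_at_right_less)
 \<comment> \<open>The scale rho at which almost the whole perimeter is visible is fixed before r
   tends to 0, because the constant of the error term depends on rho.\<close>
 then obtain rho where rho: "rho > 0" "(C - 1)*(T - pm E rho) < e/2"
  using eventually_happens'[of "at_right (0::real)"] by (auto simp: trivial_limit_at_right_real)
 define D where "D = (LI x. norm (dmol rho (x::'b)))*C"
 have "((%s. D*(LI x. \<bar>mi E s x - ind E x\<bar>)) \<longlongrightarrow> 0) (at_right 0)"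
  by (rule tendsto_cmult_zero[OF mi_L1])
 hence "\<forall>\<^sub>F s in at_right 0. D*(LI x. \<bar>mi E s x - ind E x\<bar>) < e/2"
  by (rule order_tendstoD) (use e in simp)
 moreover have "\<forall>\<^sub>F s in at_right (0::real). s > 0" by (simp add: eventually_at_right_less)
 ultimately show ?thesis
 proof eventually_elim
  case (elim r)
  define k where "k t = C*t - h t" for t
  define k' where "k' t = C - h' t" for t
  have kd: "(k has_real_derivative k' t) (at t)" for t
   unfolding k_def[abs_def] k'_def by (auto intro!: derivative_eq_intros h(1))
  have kc: "continuous_on UNIV k'" unfolding k'_def by (intro continuous_intros h(2))
  have [measurable]: "h' \<in> Borel" using h(2) by (rule borel_measurable_continuous_onI)
  note v01 = mi_bounds[OF elim(2)]
  note C1v = C1_compose[OF C1_mi[OF elim(2)] kd kc]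
  have lip: "\<bar>k s - k t\<bar> <= C*\<bar>s - t\<bar>" if "s \<in> {0..1}" "t \<in> {0..1}" for s t
   by (rule lipschitz_01[OF kd _ that]) (use C in "auto simp: k'_def")
  have cE: "integ (%x. (C - 1)*ind E x :: real)" by (intro integrable_mult_right E_integrable)
  have ki: "k (mi E r x) = 0" if "x \<notin> cball 0 (R+r)" for x using R[OF elim(2) that] h(3) by (simp add: k_def)
  \<comment> \<open>\<open>k\<close> is 0 at 0 and C - 1 at 1, so \<open>k (mi E r x)\<close>
    approximates (C - 1) times the indicator. It is nondecreasing on [0,1], hence its gradient mass
    is exactly C times that of \<open>mi E r\<close> minus the mass to be bounded.\<close>
  have lsc: "(LI x. norm (cv (%x. (C - 1)*ind E x) (dmol rho) x)) <=
   (LI x. norm (k' (mi E r x) *\<^sub>R dmi E r x)) +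
   (LI x. norm (dmol rho (x::'b)))*(LI x. \<bar>(C - 1)*ind E x - k (mi E r x)\<bar>)"
   by (rule gradient_mass_lsc[OF cE C1v compact_cball ki bounded_linear_id_le rho(1)])
  have "cv (%x. (C - 1)*ind E x) (dmol rho) x = (C - 1) *\<^sub>R dmi E rho x" for x
   by (simp add: cv_def dmi_def flip: scaleR_scaleR)
  hence l1: "(LI x. norm (cv (%x. (C - 1)*ind E x) (dmol rho) x)) = (C - 1)*pm E rho" using C(1) by (simp add: pm_def)
  have hi: "integ (%x. h' (mi E r x)*norm (dmi E r x))"
  proof (rule B_integrable_bound[OF integrable_mult_right[OF integrable_norm[OF dmi_integrable[OF elim(2)]], of C]])
   show "AE x in lborel. norm (h' (mi E r x)*norm (dmi E r x)) <= norm (C*norm (dmi E r x))"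
   proof (rule AE_I2)
    fix x show "norm (h' (mi E r x)*norm (dmi E r x)) <= norm (C*norm (dmi E r x))"
     using C(2)[OF v01(1)[of x] v01(2)[of x]] C(1) by (simp add: abs_mult mult_right_mono)
   qed
  qed measurable
  have "norm (k' (mi E r x) *\<^sub>R dmi E r x) = C*norm (dmi E r x) - h' (mi E r x)*norm (dmi E r x)" for x
   using C(2)[OF v01(1)[of x] v01(2)[of x]] by (simp add: k'_def left_diff_distrib)
  hence l2: "(LI x. norm (k' (mi E r x) *\<^sub>R dmi E r x)) = C*pm E r - (LI x. h' (mi E r x)*norm (dmi E r x))"
   using hi dmi_integrable[OF elim(2)] by (simp add: pm_def)
  have l3: "(LI x. \<bar>(C - 1)*ind E x - k (mi E r x)\<bar>) <= (LI x. C*\<bar>mi E r x - ind E x\<bar>)"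
  proof (rule integral_mono)
   show "integ (%x. \<bar>(C - 1)*ind E x - k (mi E r x)\<bar>)"
    using integrable_compact_support[OF C1_continuous[OF C1v] compact_cball[of 0 "R+r"] ki] cE by auto
   show "integ (%x. C*\<bar>mi E r x - ind E x\<bar>)" using mi_integrable[OF elim(2)] E_integrable by auto
   show "\<bar>(C - 1)*ind E x - k (mi E r x)\<bar> <= C*\<bar>mi E r x - ind E x\<bar>" for x
   proof -
    have "(C - 1)*ind E x = k (ind E x)" using h(3,4) by (auto simp: indicator_def k_def)
    thus ?thesis using lip[of "ind E x" "mi E r x"] v01[of x] by (auto simp: abs_minus_commute)
   qed
  qed
  hence "(LI x. norm (dmol rho (x::'b)))*(LI x. \<bar>(C - 1)*ind E x - k (mi E r x)\<bar>)
    <= (LI x. norm (dmol rho (x::'b)))*(C*(LI x. \<bar>mi E r x - ind E x\<bar>))" by (intro mult_left_mono) auto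
  hence "(LI x. h' (mi E r x)*norm (dmi E r x)) <= C*pm E r - (C - 1)*pm E rho+D*(LI x. \<bar>mi E r x - ind E x\<bar>)"
   using lsc unfolding l1 l2 D_def by (simp add: mult.assoc)
  moreover have "C*pm E r <= C*T" using pm_le_T[OF elim(2)] C(1) by simp
  ultimately show ?case using elim(1) rho(2) by (simp add: algebra_simps)
 qed
qed

end

definition psi :: "real => real => real" where "psi k t = psq (1 - k*(1 - t))"
definition dpsi :: "real => real => real" where "dpsi k t = 2*max 0 (1 - k*(1 - t))*k"

lemma psi_derivative: "(psi k has_real_derivative dpsi k t) (at t)" unfolding psi_def[abs_def] dpsi_def
 by (rule DERIV_chain'[where g=psq, OF _ psq_derivative, THEN DERIV_cong]) (auto intro!: derivative_eq_intros)

lemma continuous_dpsi: "continuous_on S (dpsi k)" unfolding dpsi_def by (intro continuous_intros)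

lemma psi_0: "k >= 1 ==> psi k 0 = 0" by (simp add: psi_def)
lemma psi_1: "psi k 1 = 1" by (simp add: psi_def)
lemma psi_nonneg: "0 <= psi k t" by (simp add: psi_def)
lemma psi_le_1: "k > 0 ==> t <= 1 ==> psi k t <= 1" using psq_mono[of "1 - k*(1 - t)" 1] by (simp add: psi_def)
lemma psi_eq_0: "k > 0 ==> t <= 1 - 1/k ==> psi k t = 0" by (simp add: psi_def field_simps)
lemma dpsi_nonneg: "k > 0 ==> 0 <= dpsi k t" by (simp add: dpsi_def)
lemma dpsi_le: "k > 0 ==> t <= 1 ==> dpsi k t <= 2*k" by (simp add: dpsi_def)
lemma dpsi_ge: assumes "k > 0" "t >= 1 - 1/(2*k)" shows "dpsi k t >= k"
proof -
 have "k*(1 - t) <= k*(1/(2*k))" using assms by (intro mult_left_mono) auto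
 hence "1 - k*(1 - t) >= 1/2" using assms(1) by simp
 moreover define m where "m = max 0 (1 - k*(1 - t))"
 ultimately have "2*m >= 1" by simp
 hence "2*m*k >= 1*k" using assms(1) by (intro mult_right_mono) simp_all
 thus ?thesis by (simp add: dpsi_def m_def)
qed

context finite_perimeter begin

text \<open>This is a Chebyshev estimate: \<open>strictness\<close> bounds the gradient mass
  weighted by \<open>dpsi k\<close>, and on the upper half of the ramp of \<open>psi k\<close> that
  weight is at least k.\<close>

lemma high_density_mass: assumes k: "k >= 1" and e: "e > 0"
 shows "\<forall>\<^sub>F r in at_right 0. (LI x. ind {x. mi E r x >= 1 - 1/(2*k)} x*norm (dmi E r x)) <= (T+e)/k"
proof -
 have "\<forall>\<^sub>F r in at_right 0. (LI x. dpsi k (mi E r x)*norm (dmi E r x)) <= T+e"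
  by (rule strictness[OF psi_derivative continuous_dpsi psi_0[OF k] psi_1, of "2*k"])
    (use k e dpsi_nonneg dpsi_le in auto)
 moreover have "\<forall>\<^sub>F s in at_right (0::real). s > 0" by (simp add: eventually_at_right_less)
 ultimately show ?thesis
 proof eventually_elim
  case (elim r)
  have [measurable]: "dpsi k \<in> Borel" by (rule borel_measurable_continuous_onI) (rule continuous_dpsi)
  have "(LI x. k*(ind {x. mi E r x >= 1 - 1/(2*k)} x*norm (dmi E r x))) <= (LI x. dpsi k (mi E r x)*norm (dmi E r x))"
  proof (rule integral_mono)
   show "integ (%x. k*(ind {x. mi E r x >= 1 - 1/(2*k)} x*norm (dmi E r x)))"
    by (rule B_integrable_bound[OF integrable_mult_right[OF integrable_norm[OF dmi_integrable[OF elim(2)]], of k]])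
      (auto simp: indicator_def)
   show "integ (%x. dpsi k (mi E r x)*norm (dmi E r x))"
   proof (rule B_integrable_bound[OF integrable_mult_right[OF integrable_norm[OF dmi_integrable[OF elim(2)]], of "2*k"]])
    show "AE x in lborel. norm (dpsi k (mi E r x)*norm (dmi E r x)) <= norm (2*k*norm (dmi E r x))"
     using mi_bounds[OF elim(2)] k dpsi_nonneg[of k] dpsi_le[of k] by (auto simp: abs_mult intro!: mult_right_mono)
   qed measurable
   show "k*(ind {x. mi E r x >= 1 - 1/(2*k)} x*norm (dmi E r x)) <= dpsi k (mi E r x)*norm (dmi E r x)" for x
    using k dpsi_ge[of k "mi E r x"] dpsi_nonneg[of k "mi E r x"] by (auto simp: indicator_def mult_right_mono)
  qed
  thus ?case using elim(1) k by (simp add: field_simps)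
 qed
qed

end

section \<open>Sets of small codimension-one content\<close>

text \<open>A codimension-one content with balls given as pairs of centre and radius. Bounding
  finite partial sums avoids enumerating the cover, and the covering lemma can supply an index set
  of any kind.\<close>

definition small_cover :: "'b::euclidean_space set => real => bool" where
 "small_cover Q e \<longleftrightarrow> (EX C::('b \<times> real) set. (ALL c:C. snd c > 0) & Q <= (\<Union>c\<in>C. cball (fst c) (snd c)) &
   (ALL I. finite I & I <= C --> (\<Sum>c\<in>I. snd c ^ (DIM('b) - 1)) <= e))"

lemma small_cover_mono: "small_cover Q d ==> d <= e ==> small_cover Q e"
 unfolding small_cover_def by (meson order_trans)

lemma content_ball_power:
 assumes "0 <= r" shows "vol (ball (x::'b::euclidean_space) r) = unit_ball_vol (real DIM('b))*r ^ DIM('b)"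
 using content_ball[OF assms, of x] by simp

definition coE :: "'b::euclidean_space set => 'b => real => real" where
 "coE E x r = vol (ball x r - E)"

definition dset :: "'b::euclidean_space set => real => 'b set" where
 "dset E delta = {x. ALL epsilon>0. EX r. 0 < r & r < epsilon & coE E x r > delta * vol (ball x r)}"

lemma emeasure_subset_ball: assumes "A <= ball (x::'b::euclidean_space) r" shows "emeasure lborel A < top"
 using emeasure_bounded_finite[OF bounded_subset[OF bounded_ball assms]] by simp

lemma measure_mono_ball:
 assumes "A <= B" "B <= ball (x::'b::euclidean_space) r" "A \<in> sets borel" "B \<in> sets borel"
 shows "vol A <= vol B"
 by (rule measure_mono_fmeasurable) (use assms emeasure_subset_ball[OF assms(2)] in "auto simp: fmeasurable_def")

lemma (in borel_set) coE_mono: "ball x r <= ball y s ==> coE E x r <= coE E y s"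
 unfolding coE_def by (rule measure_mono_ball[of _ _ y s]) auto

context bounded_borel begin

lemma complement_mass: assumes r: "r > 0" shows "1 - mi E r x = (LI y. ind (- E) y*mol r (x - y))"
  and "integ (%y. ind (- E) y*mol r (x - y))"
proof -
 obtain B where B: "!!x. norm (mol r (x::'b)) <= B" using mol_bounded[OF r] by (metis real_norm_def)
 have i1: "integ (%y. mol r (x - y))" by (rule lborel_integrable_reflect[OF mol_integrable[OF r]])
 have i2: "integ (%y. ind E y *\<^sub>R mol r (x - y))"
  by (rule cv_integrable_point[OF E_integrable mol_measurable B])
 have eq: "ind (- E) y*mol r (x - y) = mol r (x - y) - ind E y *\<^sub>R mol r (x - y)" for y
  by (auto simp: indicator_def)
 have "(LI y. mol r (x - y)) = 1" by (subst lborel_integral_reflect) (auto simp: mol_integral[OF r])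
 thus "1 - mi E r x = (LI y. ind (- E) y*mol r (x - y))"
  unfolding eq B_integral_diff[OF i1 i2] by (simp add: mi_def cv_def)
 show "integ (%y. ind (- E) y*mol r (x - y))" unfolding eq by (rule B_integrable_diff[OF i1 i2])
qed

lemma indicator_ball_integrable: "A \<in> sets borel ==> A <= ball (x::'b) r ==> integ (%y. c*ind A y :: real)"
 by (intro integrable_mult_right) (auto simp: integrable_indicator_iff emeasure_subset_ball)

text \<open>The kernel is bounded below on the ball of half the radius and vanishes off the full
  ball. Together with \<open>coE_ge\<close> this brackets \<open>1 - mi E r x\<close> between
  multiples of the complement mass at radii r/2 and r.\<close>

lemma coE_le: assumes r: "r > 0" and c: "!!x. norm x <= r/2 ==> mol r (x::'b) >= c"
 shows "c*coE E x (r/2) <= 1 - mi E r x"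
proof -
 have "(LI y. c*ind (ball x (r/2) - E) y) <= (LI y. ind (- E) y*mol r (x - y))"
 proof (rule integral_mono)
  show "integ (%y. c*ind (ball x (r/2) - E) y)" by (rule indicator_ball_integrable) auto
  show "c*ind (ball x (r/2) - E) y <= ind (- E) y*mol r (x - y)" for y
   using c[of "x - y"] by (auto simp: indicator_def dist_norm mol_nonneg)
 qed (rule complement_mass[OF r])
 thus ?thesis unfolding complement_mass(1)[OF r] coE_def by simp
qed

lemma coE_ge: assumes r: "r > 0" and c: "!!x. mol r (x::'b) <= c" shows "1 - mi E r x <= c*coE E x r"
proof -
 have "(LI y. ind (- E) y*mol r (x - y)) <= (LI y. c*ind (ball x r - E) y)"
 proof (rule integral_mono)
  show "integ (%y. c*ind (ball x r - E) y)" by (rule indicator_ball_integrable) auto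
  show "ind (- E) y*mol r (x - y) <= c*ind (ball x r - E) y" for y
   using c[of "x - y"] by (auto simp: indicator_def dist_norm mol_eq_0[OF r] not_less)
 qed (rule complement_mass[OF r])
 thus ?thesis unfolding complement_mass(1)[OF r] coE_def by simp
qed

end

context finite_perimeter begin

text \<open>Perimeter inside the balls is estimated by looking at it through the coarser scale r.
  The isoperimetric inequality gives each ball gradient mass of order rho^(n-1) for
  \<open>mi E s\<close> with s small. Spread out at scale r, this mass stays inside G, while outside
  G the spread mass still dominates \<open>norm (dmi E r x)\<close>. As the total is at most T, what
  remains for the balls is the mass of \<open>dmi E r\<close> on G plus the defect
  \<open>T - pm E r\<close>.\<close>

lemma ball_packing:
 fixes rho :: "'b => real" assumes r: "r > 0" and d: "d > 0" and I: "finite I" "!!x. x \<in> I ==> rho x > 0"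
  and disj: "disjoint_family_on (%x. ball x (rho x)) I"
  and dens: "!!x. x \<in> I ==> d*(vol (ball x (rho x)))\<^sup>2 <=
    vol (ball x (rho x) \<inter> E) * vol (ball x (rho x) - E)"
  and G: "G \<in> sets borel" "!!x z. x \<in> I ==> z \<in> ball x (rho x) ==> ball z r <= G"
 shows "d*unit_ball_vol (real DIM('b))*(\<Sum>x\<in>I. rho x ^ (DIM('b) - 1)) <=
  2*2 ^ DIM('b)*((LI x. ind G x*norm (dmi E r x))+T - pm E r)"
proof -
 note [measurable] = G(1)
 define L where "L s = (LI x. \<bar>mi E s x - ind E x\<bar>)" for s
 define Cr where "Cr = (LI x. norm (dmol r (x::'b)))"
 define H where "H = (LI x. ind G x*norm (dmi E r x))+T - pm E r"
 define S where "S = (\<Sum>x\<in>I. 1/rho x)"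
 have main: "d*unit_ball_vol (real DIM('b))*(\<Sum>x\<in>I. rho x ^ (DIM('b) - 1)) <=
   2*2 ^ DIM('b)*(H+2*Cr*L s)+2*L s*S" if s: "s > 0" for s
 proof -
  define k where "k x = norm (dmi E s x)" for x
  have ki: "integ k" unfolding k_def by (rule integrable_norm[OF dmi_integrable[OF s]])
  have [measurable]: "k \<in> Borel" unfolding k_def by measurable
  have k0: "0 <= k x" for x by (simp add: k_def)
  have ikB: "integ (%y. ind A y*k y)" if "A \<in> sets borel" for A
   by (rule B_integrable_bound[OF ki]) (use that in "auto simp: indicator_def")
  have Li: "integ (%x. mi E s x - ind E x)" by (intro B_integrable_diff mi_integrable s E_integrable)
  have L0: "L s >= 0" by (simp add: L_def)
  have each: "d*unit_ball_vol (real DIM('b))*rho x ^ (DIM('b) - 1) <=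
    2*2 ^ DIM('b)*(LI y. ind (ball x (rho x)) y*k y)+2*L s*(1/rho x)" if x: "x \<in> I" for x
  proof -
   define m where "m = vol (ball x (rho x))"
   define J where "J = (LI y. ind (ball x (rho x)) y*k y)"
   note rx = I(2)[OF x]
   have m: "m > 0" using rx by (simp add: m_def)
   have "d*m\<^sup>2 <= 2*rho x*2 ^ DIM('b)*m*J+2*m*L s"
    using isoperimetric_ball[OF C1_mi[OF s] rx E_borel Li, of x] dens[OF x]
    unfolding m_def J_def k_def L_def by linarith
   hence "m*(d*m) <= m*(2*rho x*2 ^ DIM('b)*J+2*L s)" by (simp add: power2_eq_square algebra_simps)
   hence "d*m <= 2*rho x*2 ^ DIM('b)*J+2*L s" using m by simp
   moreover have "m = unit_ball_vol (real DIM('b))*(rho x ^ (DIM('b) - 1)*rho x)"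
    unfolding m_def using rx content_ball_power[of "rho x" x] power_minus_mult[of "DIM('b)" "rho x"] by simp
   ultimately have "rho x*(d*unit_ball_vol (real DIM('b))*rho x ^ (DIM('b) - 1)) <=
     rho x*(2*2 ^ DIM('b)*J+2*L s*(1/rho x))" using rx by (simp add: algebra_simps)
   thus ?thesis using rx unfolding J_def by (simp only: mult_le_cancel_left_pos)
  qed
  have "d*unit_ball_vol (real DIM('b))*(\<Sum>x\<in>I. rho x ^ (DIM('b) - 1)) <=
    (\<Sum>x\<in>I. 2*2 ^ DIM('b)*(LI y. ind (ball x (rho x)) y*k y)+2*L s*(1/rho x))"
   unfolding sum_distrib_left by (rule sum_mono) (rule each)
  also have "... = 2*2 ^ DIM('b)*(\<Sum>x\<in>I. LI y. ind (ball x (rho x)) y*k y)+2*L s*S"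
   by (simp add: sum.distrib sum_distrib_left S_def)
  also have "(\<Sum>x\<in>I. LI y. ind (ball x (rho x)) y*k y) = (LI y. (\<Sum>x\<in>I. ind (ball x (rho x)) y*k y))"
   by (rule B_integral_sum[symmetric]) (auto intro: ikB)
  \<comment> \<open>On the balls the weight \<open>cv (ind G) (mol r)\<close> equals one, since the
    r-ball around each of their points lies in G; disjointness keeps the sum of indicators below
    one.\<close>
  also have "... <= (LI y. k y*cv (ind G) (mol r) y)"
  proof (rule integral_mono)
   show "integ (%y. \<Sum>x\<in>I. ind (ball x (rho x)) y*k y)" by (rule B_integrable_sum) (auto intro: ikB)
   have cb: "0 <= cv (ind G) (mol r) y & cv (ind G) (mol r) y <= 1" for y
   proof
    show "0 <= cv (ind G) (mol r) y" unfolding cv_def by (auto simp: mol_nonneg)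
    have "cv (ind G) (mol r) y <= (LI z. mol r (y - z))" unfolding cv_def
    proof (rule integral_mono)
     show i: "integ (%z. mol r (y - z))" by (rule lborel_integrable_reflect[OF mol_integrable[OF r]])
     show "integ (%z. ind G z *\<^sub>R mol r (y - z))" by (rule B_integrable_bound[OF i]) (auto simp: indicator_def)
    qed (auto simp: indicator_def mol_nonneg)
    thus "cv (ind G) (mol r) y <= 1" by (subst (asm) lborel_integral_reflect) (auto simp: mol_integral[OF r])
   qed
   show "integ (%y. k y*cv (ind G) (mol r) y)"
   proof (rule B_integrable_bound[OF ki])
    show "AE y in lborel. norm (k y*cv (ind G) (mol r) y) <= norm (k y)"
     using cb k0 by (auto simp: abs_mult intro!: mult_left_le)
   qed measurable
   fix y
   show "(\<Sum>x\<in>I. ind (ball x (rho x)) y*k y) <= k y*cv (ind G) (mol r) y"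
   proof (cases "EX x:I. y \<in> ball x (rho x)")
    case True
    then obtain x where x: "x \<in> I" "y \<in> ball x (rho x)" by blast
    have "ind (ball x' (rho x')) y = (0::real)" if "x' \<in> I - {x}" for x'
    proof -
     have "y \<notin> ball x' (rho x')" using disj that x unfolding disjoint_family_on_def by blast
     thus ?thesis by simp
    qed
    hence "(\<Sum>x\<in>I. ind (ball x (rho x)) y*k y) = k y" using x I(1) by (subst sum.remove[of I x]) auto
    moreover have "cv (ind G) (mol r) y = 1"
    proof -
     have "ind G z *\<^sub>R mol r (y - z) = mol r (y - z)" for z
     proof (cases "dist y z < r")
      case True
      thus ?thesis using G(2)[OF x] by auto
     qed (simp add: mol_eq_0[OF r] dist_norm)
     hence "cv (ind G) (mol r) y = (LI z. mol r (y - z))" unfolding cv_def by (simp only:)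
     also have "... = 1" by (subst lborel_integral_reflect) (auto simp: mol_integral[OF r])
     finally show ?thesis .
    qed
    ultimately show ?thesis by simp
   next
    case False
    hence "(\<Sum>x\<in>I. ind (ball x (rho x)) y*k y) = 0" by (intro sum.neutral) (auto simp: indicator_def)
    thus ?thesis using k0[of y] cb[of y] by simp
   qed
  qed
  \<comment> \<open>Self-adjointness moves the mollification from G to the fine gradient mass, where
    it can be compared with the gradient at scale r.\<close>
  also have "... = (LI y. ind G y*cv k (mol r) y)"
   by (rule cv_sym[where B=1, symmetric]) (auto simp: ki mol_integrable[OF r] mol_minus indicator_def)
  also have "... <= H+2*Cr*L s"
  proof -
   define D where "D = cv (mi E s) (dmol r)"
   have [measurable]: "D \<in> Borel" unfolding D_def by measurable
   have Di: "integ D" unfolding D_def by (intro cv_integrable mi_integrable s dmol_integrable r)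
   have ci: "integ (cv k (mol r))" by (intro cv_integrable ki mol_integrable r)
   obtain R where R: "!!r x. r > 0 ==> x \<notin> cball 0 (R+r) ==> mi E r x = 0" using mi_support by metis
   have Dle: "norm (D x) <= cv k (mol r) x" for x unfolding D_def k_def
    by (rule cv_parts_norm_le[OF C1_mi[OF s] compact_cball[of 0 "R+s"] R[OF s] C1_mol mol_nonneg bounded_linear_id_le(1)])
   obtain B where B: "!!x. norm (dmol r (x::'b)) <= B"
    using bounded_compact_support[OF C1_continuous_grad[OF C1_mol] compact_cball dmol_support[OF r]] by blast
   have "D x - dmi E r x = cv (%y. mi E s y - ind E y) (dmol r) x" for x
    unfolding D_def dmi_def by (rule cv_diff[OF mi_integrable[OF s] E_integrable dmol_measurable B, symmetric])
   hence X: "(LI x. norm (D x - dmi E r x)) <= Cr*L s"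
    using cv_L1[OF Li dmol_integrable[OF r]] by (simp add: Cr_def L_def mult.commute)
   have iG: "integ (%y. ind G y*norm (D y))" "integ (%y. ind G y*norm (dmi E r y))"
    by (rule B_integrable_bound[OF Di], auto simp: indicator_def)
      (rule B_integrable_bound[OF dmi_integrable[OF r]], auto simp: indicator_def)
   note ii = integrable_norm[OF Di] integrable_norm[OF dmi_integrable[OF r]] integrable_norm[OF B_integrable_diff[OF Di dmi_integrable[OF r]]]
   \<comment> \<open>The integrand added on the right is nonnegative everywhere and pays for the
     complement of G: the mass on G is written as the whole mass minus the lower bound for the
     outside.\<close>
   have "(LI y. ind G y*cv k (mol r) y) <=
     (LI y. (ind G y*norm (dmi E r y)+norm (D y - dmi E r y))+(cv k (mol r) y - (norm (dmi E r y) - norm (D y - dmi E r y))))"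
   proof (rule integral_mono)
    show "integ (%y. ind G y*cv k (mol r) y)" by (rule B_integrable_bound[OF ci]) (auto simp: indicator_def)
    show "integ (%y. (ind G y*norm (dmi E r y)+norm (D y - dmi E r y))+(cv k (mol r) y - (norm (dmi E r y) - norm (D y - dmi E r y))))"
     by (intro B_integrable_add B_integrable_diff iG ii ci)
    show "ind G y*cv k (mol r) y <= (ind G y*norm (dmi E r y)+norm (D y - dmi E r y))+(cv k (mol r) y - (norm (dmi E r y) - norm (D y - dmi E r y)))" for y
    proof -
     have *: "norm (dmi E r y) <= cv k (mol r) y+norm (D y - dmi E r y)"
      using Dle[of y] norm_triangle_ineq2[of "dmi E r y" "D y"] norm_minus_commute[of "D y" "dmi E r y"] by linarith
     have "0 <= norm (D y - dmi E r y)" by simp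
     with*have "0 <= norm (D y - dmi E r y)+(cv k (mol r) y - (norm (dmi E r y) - norm (D y - dmi E r y)))" by linarith
     thus ?thesis by (cases "y \<in> G") auto
    qed
   qed
   also have "... = ((LI y. ind G y*norm (dmi E r y))+(LI y. norm (D y - dmi E r y)))
     +((LI y. cv k (mol r) y) - (pm E r - (LI y. norm (D y - dmi E r y))))" unfolding pm_def
    by (simp add: iG ii ci Di dmi_integrable[OF r])
   also have "(LI y. cv k (mol r) y) = pm E s"
    by (simp add: integral_cv[OF ki mol_integrable[OF r]] mol_integral[OF r]) (simp add: pm_def k_def[abs_def])
   finally show ?thesis using X pm_le_T[OF s] by (simp add: H_def)
  qed
  finally show ?thesis by simp
 qed
 \<comment> \<open>Now s tends to 0 with r and the balls fixed. The finite sum of the 1/rho does not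
   depend on s, so every term with \<open>L s\<close> disappears.\<close>
 have "((%s. 2*2 ^ DIM('b)*(H+2*Cr*L s)+2*L s*S) \<longlongrightarrow> 2*2 ^ DIM('b)*(H+2*Cr*0)+2*0*S) (at_right 0)"
  unfolding L_def by (intro tendsto_intros mi_L1)
 moreover have "\<forall>\<^sub>F s in at_right 0. d*unit_ball_vol (real DIM('b))*(\<Sum>x\<in>I. rho x ^ (DIM('b) - 1)) <=
   2*2 ^ DIM('b)*(H+2*Cr*L s)+2*L s*S"
  using main eventually_at_right_less[of "0::real"] by (auto elim: eventually_mono)
 ultimately show ?thesis
  using tendsto_lowerbound[of _ _ "at_right (0::real)"] by (fastforce simp: H_def trivial_limit_at_right_real)
qed

end

context bounded_borel begin

text \<open>By dyadic scales: the first scale at which the complement has density above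
  \<open>delta / 2\<^sup>n\<close>; one scale earlier it has not, so the density is at most \<open>delta\<close>.\<close>
lemma intermediate_density: assumes x: "x \<in> dset E delta" and d: "0 < delta" "delta <= 1/2" and r: "r > 0"
  and small: "coE E x r <= delta/2 ^ DIM('b) * vol (ball x r)"
 obtains rho where "0 < rho" "rho < r"
  "delta/(2*2 ^ DIM('b))*(vol (ball x rho))\<^sup>2 <= vol (ball x rho \<inter> E) * vol (ball x rho - E)"
proof -
 let ?n = "DIM('b)"
 let ?m = "%r. vol (ball x r)"
 define s where "s j = r/2 ^ j" for j :: nat
 have s0: "s j > 0" for j using r by (simp add: s_def)
 have sS: "s j = 2 * s (Suc j)" for j by (simp add: s_def)
 have dbl: "?m (2*t) = 2 ^ ?n*?m t" if "t > 0" for t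
  using that content_ball_power[of t x] content_ball_power[of "2*t" x] by (simp add: power_mult_distrib)
 define P where "P j \<longleftrightarrow> coE E x (s j) > delta/2 ^ ?n*?m (s j)" for j
 have "EX j. P j"
 proof (rule ccontr)
  assume "\<nexists>j. P j"
  hence nP: "coE E x (s j) <= delta/2 ^ ?n*?m (s j)" for j by (auto simp: P_def not_less)
  obtain t where t: "0 < t" "t < r" "coE E x t > delta*?m t" using x r unfolding dset_def by auto
  have "EX j. s (Suc j) < t"
  proof -
   obtain N where "(1/2::real) ^ N < t/r" using real_arch_pow_inv[of "t/r" "1/2"] t r by auto
   hence "s N < t" using r by (simp add: s_def power_divide field_simps)
   moreover have "s (Suc N) < s N" using sS[of N] s0[of "Suc N"] by linarith
   ultimately show ?thesis by (intro exI[of _ N]) linarith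
  qed
  \<comment> \<open>The radius t lies between two consecutive dyadic radii, so replacing it by
    \<open>s j\<close> enlarges the ball volume at most by the factor 2^n contained in the threshold
    of P.\<close>
  define j where "j = (LEAST j. s (Suc j) < t)"
  have j1: "s (Suc j) < t" unfolding j_def using \<open>EX j. s (Suc j) < t\<close> by (rule LeastI_ex)
  have j2: "t <= s j"
  proof (cases j)
   case 0 thus ?thesis using t by (simp add: s_def)
  next
   case (Suc i)
   hence "\<not> s (Suc i) < t" using not_less_Least[of i "%j. s (Suc j) < t"] by (simp add: j_def)
   thus ?thesis using Suc by simp
  qed
  have "coE E x t <= coE E x (s j)" by (rule coE_mono) (use j2 in "rule subset_ball")
  also have "... <= delta/2 ^ ?n*?m (s j)" by (rule nP)
  also have "... <= delta/2 ^ ?n*?m (2*t)"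
   using d j1 sS[of j] by (intro mult_left_mono measure_mono_ball[of _ _ x "2*t"] subset_ball) auto
  also have "... = delta*?m t" using dbl[OF t(1)] by simp
  finally show False using t(3) by simp
 qed
 define j where "j = (LEAST j. P j)"
 have Pj: "P j" unfolding j_def using \<open>EX j. P j\<close> by (rule LeastI_ex)
 have "\<not> P 0" using small by (simp add: P_def s_def)
 then obtain i where i: "j = Suc i" using Pj by (cases j) auto
 hence "\<not> P i" using not_less_Least[of i P] by (simp add: j_def)
 have "coE E x (s j) <= coE E x (s i)" by (rule coE_mono, rule subset_ball) (use sS[of i] s0[of "Suc i"] i in simp)
 also have "... <= delta/2 ^ ?n*?m (s i)" using \<open>\<not> P i\<close> by (simp add: P_def)
 also have "... = delta*?m (s j)" using dbl[OF s0[of j]] sS[of i] i by simp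
 finally have up: "coE E x (s j) <= delta*?m (s j)" .
 have lo: "coE E x (s j) >= delta/2 ^ ?n*?m (s j)" using Pj by (simp add: P_def)
 have "?m (s j) = vol (ball x (s j) \<inter> E)+vol (ball x (s j) - E)"
 proof -
  have fin: "emeasure lborel (ball x (s j) \<inter> E) ~= \<infinity>" "emeasure lborel (ball x (s j) - E) ~= \<infinity>"
   using emeasure_subset_ball[of "ball x (s j) \<inter> E" x "s j"] emeasure_subset_ball[of "ball x (s j) - E" x "s j"] by auto
  have "(ball x (s j) \<inter> E) \<union> (ball x (s j) - E) = ball x (s j)" by blast
  thus ?thesis using measure_Union[OF fin] by fastforce
 qed
 hence "vol (ball x (s j) \<inter> E) >= (1 - delta)*?m (s j)" using up by (simp add: coE_def algebra_simps)
 moreover have "(1 - delta)*?m (s j) >= 1/2*?m (s j)" using d by (intro mult_right_mono) auto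
 ultimately have half: "vol (ball x (s j) \<inter> E) >= 1/2*?m (s j)" by linarith
 \<comment> \<open>E fills at least half of the ball and the complement at least the fraction
   delta/2^n, which explains the constant in the conclusion.\<close>
 have "1/2*?m (s j)*(delta/2 ^ ?n*?m (s j)) <= vol (ball x (s j) \<inter> E) * vol (ball x (s j) - E)"
  by (rule mult_mono) (use half lo d in "auto simp: coE_def")
 hence "delta/(2*2 ^ ?n)*(?m (s j))\<^sup>2 <= vol (ball x (s j) \<inter> E) * vol (ball x (s j) - E)"
  by (simp add: power2_eq_square mult_ac)
 moreover have "s j < r" using i r by (simp add: s_def field_simps) (metis less_1_mult one_less_numeral_iff one_less_power semiring_norm(76) zero_less_Suc mult.commute mult_less_cancel_left2 power_Suc)
 ultimately show ?thesis using that s0 by blast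
qed

end

text \<open>At a point of the bad set the complement is rare at radius r/4 but frequent at
  arbitrarily small radii, so \<open>intermediate_density\<close> supplies a ball of radius below
  r/4 with both parts present. Vitali's lemma selects disjoint balls whose fivefold enlargements
  cover. Close to these balls the mollification at scale r/8 is still near one, which is the set G
  required by \<open>ball_packing\<close>.\<close>

lemma (in finite_perimeter) bad_set_cover:
 obtains A C1 where "A > 0" "C1 > 0"
  "!!delta k r. 0 < delta ==> delta <= 1/2 ==> k >= C1/delta ==> r > 0 ==>
   small_cover {x\<in>dset E delta. mi E r x >= 1 - 1/k}
    (A/delta*((LI x. ind {x. mi E (r/8) x >= 1 - C1/k} x*norm (dmi E (r/8) x))+T - pm E (r/8)))"
proof -
 let ?n = "DIM('b)"
 let ?omega = "unit_ball_vol (real ?n)"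
 obtain c0 where c0: "c0 > 0" "!!r x. r > 0 ==> norm x <= r/2 ==> mol r (x::'b) >= c0/r ^ ?n" using mol_lower by metis
 obtain c1 where c1: "c1 > 0" "!!r x. r > 0 ==> mol r (x::'b) <= c1/r ^ ?n" using mol_upper by metis
 have om: "?omega > 0" by simp
 \<comment> \<open>The first summand carries closeness to one from scale r to scale r/8; the second
   makes the density of the complement at radius r/4 as small as \<open>intermediate_density\<close>
   requires.\<close>
 define C1 where "C1 = 8 ^ ?n*c1/c0+8 ^ ?n/(c0*?omega)"
 \<comment> \<open>The factor 5^(n-1) comes from the enlarged balls of the covering lemma, one
   factor 2*2^n from the product of the two densities and the other from
   \<open>ball_packing\<close>.\<close>
 define A where "A = 5 ^ (?n - 1)*(2*2 ^ ?n)*(2*2 ^ ?n)/?omega"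
 have A: "A > 0" using om by (simp add: A_def)
 have C1: "C1 > 0" unfolding C1_def using c0 c1 om by (intro add_pos_pos divide_pos_pos mult_pos_pos) auto
 show ?thesis
 proof (rule that[OF A C1])
  fix delta k r :: real assume d: "0 < delta" "delta <= 1/2" and k: "k >= C1/delta" and r: "r > 0"
  define Q where "Q = {x\<in>dset E delta. mi E r x >= 1 - 1/k}"
  define G where "G = {x. mi E (r/8) x >= 1 - C1/k}"
  have kpos: "k > 0" using k C1 d by (meson divide_pos_pos less_le_trans)
  have Gm: "G \<in> sets borel" unfolding G_def by measurable
  have big: "coE E x (r/2) <= r ^ ?n/(c0*k)" if "x \<in> Q" for x
  proof -
   have "c0/r ^ ?n*coE E x (r/2) <= 1/k" using coE_le[OF r c0(2)[OF r], of x] that by (auto simp: Q_def)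
   thus ?thesis using c0 r kpos by (simp add: field_simps)
  qed
  have "EX rho. 0 < rho & rho < r/4 & delta/(2*2 ^ ?n)*(vol (ball x rho))\<^sup>2 <= vol (ball x rho \<inter> E) * vol (ball x rho - E)"
   if x: "x \<in> Q" for x
  proof -
   have "C1 <= k*delta" using k d by (simp add: field_simps)
   hence "8 ^ ?n/(c0*?omega) <= k*delta"
   proof -
    have "0 <= 8 ^ ?n*c1/c0" using c0 c1 by simp
    thus ?thesis using \<open>C1 <= k*delta\<close> unfolding C1_def by linarith
   qed
   hence ineq: "8 ^ ?n <= k*delta*(c0*?omega)" using c0 om by (simp add: pos_divide_le_eq)
   have "coE E x (r/4) <= coE E x (r/2)" by (rule coE_mono, rule subset_ball) (use r in simp)
   also have "... <= r ^ ?n/(c0*k)" by (rule big[OF x])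
   also have "... <= delta/2 ^ ?n*(?omega*(r/4) ^ ?n)"
   proof -
    have "8 ^ ?n*r ^ ?n <= k*delta*(c0*?omega)*r ^ ?n" using ineq r by (intro mult_right_mono) auto
    moreover have "(8::real) ^ ?n = 2 ^ ?n*4 ^ ?n" by (simp flip: power_mult_distrib)
    ultimately show ?thesis using c0 kpos by (simp add: power_divide field_simps)
   qed
   also have "... = delta/2 ^ ?n * vol (ball x (r/4))" using r by (simp add: content_ball_power)
   finally have sm: "coE E x (r/4) <= delta/2 ^ ?n * vol (ball x (r/4))" .
   have "x \<in> dset E delta" using x by (simp add: Q_def)
   from intermediate_density[OF this d _ sm] r show ?thesis by auto
  qed
  then obtain rho where rho: "!!x. x \<in> Q ==> 0 < rho x" "!!x. x \<in> Q ==> rho x < r/4"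
   "!!x. x \<in> Q ==> delta/(2*2 ^ ?n)*(vol (ball x (rho x)))\<^sup>2 <= vol (ball x (rho x) \<inter> E) * vol (ball x (rho x) - E)"
   by metis
  have cov: "Q <= (\<Union>x\<in>Q. cball x (rho x))" using rho(1) by (auto intro!: bexI simp: less_imp_le)
  have rad: "0 < rho x & rho x <= r/4" if "x \<in> Q" for x using rho(1,2)[OF that] by simp
  obtain C where C: "C <= Q" "pairwise (%i j. disjnt (cball i (rho i)) (cball j (rho j))) C"
    "Q <= (\<Union>x\<in>C. cball x (5*rho x))" by (rule Vitali_covering_lemma_cballs[OF cov rad]) blast
  define X where "X = (LI x. ind G x*norm (dmi E (r/8) x))+T - pm E (r/8)"
  have bound: "(\<Sum>x\<in>I. (5*rho x) ^ (?n - 1)) <= A/delta*X" if I: "finite I" "I <= C" for I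
  proof -
   have r8: "r/8 > 0" using r by simp
   have gen: "c > 0 ==> c*a <= b ==> a <= b/c" for a b c :: real by (simp add: field_simps)
   have "delta/(2*2 ^ ?n)*?omega*(\<Sum>x\<in>I. rho x ^ (?n - 1)) <= 2*2 ^ ?n*X" unfolding X_def
   proof (rule ball_packing[OF r8 _ I(1) _ _ _ Gm])
    show "disjoint_family_on (%x. ball x (rho x)) I" unfolding disjoint_family_on_def
    proof safe
     fix i j z assume "i \<in> I" "j \<in> I" "i ~= j" "z \<in> ball i (rho i)" "z \<in> ball j (rho j)"
     moreover from this have "disjnt (cball i (rho i)) (cball j (rho j))" using C(2) I(2) by (meson pairwiseD subsetD)
     ultimately show "z \<in> {}" unfolding disjnt_def using ball_subset_cball by blast
    qed
    fix x assume x: "x \<in> I"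
    hence xQ: "x \<in> Q" using I C by auto
    show "delta/(2*2 ^ ?n)*(vol (ball x (rho x)))\<^sup>2 <= vol (ball x (rho x) \<inter> E) * vol (ball x (rho x) - E)" "rho x > 0"
     using rho xQ by auto
    fix z assume z: "z \<in> ball x (rho x)"
    show "ball z (r/8) <= G"
    proof
     fix y assume y: "y \<in> ball z (r/8)"
     have "dist x y < r/4+r/8" using z y rho(2)[OF xQ] dist_triangle[of x y z] by simp
     hence sub: "ball y (r/8) <= ball x (r/2)"
     proof -
      show ?thesis
      proof
       fix z' assume "z' \<in> ball y (r/8)"
       thus "z' \<in> ball x (r/2)" using \<open>dist x y < r/4+r/8\<close> dist_triangle[of x z' y] by simp
      qed
     qed
     have "1 - mi E (r/8) y <= c1/(r/8) ^ ?n*coE E y (r/8)" by (rule coE_ge[OF r8 c1(2)[OF r8]])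
     also have "... <= c1/(r/8) ^ ?n*(r ^ ?n/(c0*k))"
      using coE_mono[OF sub] big[OF xQ] c1 r by (intro mult_left_mono) auto
     also have "... = (8 ^ ?n*c1/c0)/k" using r c0 kpos by (simp add: power_divide field_simps)
     also have "... <= C1/k" using kpos c0 om by (intro divide_right_mono) (auto simp: C1_def)
     finally show "y \<in> G" by (simp add: G_def)
    qed
   qed (use d in auto)
   hence "(\<Sum>x\<in>I. rho x ^ (?n - 1)) <= (2*2 ^ ?n*X)/(delta/(2*2 ^ ?n)*?omega)"
    using d om by (intro gen) simp_all
   hence "5 ^ (?n - 1)*(\<Sum>x\<in>I. rho x ^ (?n - 1)) <= 5 ^ (?n - 1)*((2*2 ^ ?n*X)/(delta/(2*2 ^ ?n)*?omega))"
    by (rule mult_left_mono) simp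
   also have "... = A/delta*X" using d om by (simp add: A_def field_simps)
   finally show ?thesis by (simp add: power_mult_distrib sum_distrib_left)
  qed
  have "small_cover Q (A/delta*X)" unfolding small_cover_def
  proof (intro exI[of _ "(%x. (x, 5*rho x)) ` C"] conjI allI impI)
   show "ALL c:(%x. (x, 5*rho x)) ` C. snd c > 0" using rho(1) C(1) by auto
   show "Q <= (\<Union>c\<in>(%x. (x, 5*rho x)) ` C. cball (fst c) (snd c))" using C(3) by simp
   fix I assume I: "finite I & I <= (%x. (x, 5*rho x)) ` C"
   then obtain J where J: "finite J" "J <= C" "I = (%x. (x, 5*rho x)) ` J"
    using finite_subset_image[of I "%x. (x, 5*rho x)" C] by auto
   have "(\<Sum>c\<in>I. snd c ^ (?n - 1)) = (\<Sum>x\<in>J. (5*rho x) ^ (?n - 1))"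
    unfolding J(3) by (subst sum.reindex) (auto intro: inj_onI)
   also have "... <= A/delta*X" by (rule bound[OF J(1,2)])
   finally show "(\<Sum>c\<in>I. snd c ^ (?n - 1)) <= A/delta*X" .
  qed
  thus "small_cover {x\<in>dset E delta. mi E r x >= 1 - 1/k}
    (A/delta*((LI x. ind {x. mi E (r/8) x >= 1 - C1/k} x*norm (dmi E (r/8) x))+T - pm E (r/8)))"
   unfolding Q_def X_def G_def .
 qed
qed

text \<open>Both terms in the bound of \<open>bad_set_cover\<close> become small: the gradient mass
  on high density points is of order 1/k, and the perimeter defect tends to 0 with r. Hence k is
  chosen first and r afterwards.\<close>

lemma (in finite_perimeter) bad_set_small_cover: assumes d: "0 < delta" "delta <= 1/2" and e: "e > 0"
 obtains k0 where "k0 >= 1" "!!k. k >= k0 ==> \<forall>\<^sub>F r in at_right 0. small_cover {x\<in>dset E delta. mi E r x >= 1 - 1/k} e"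
proof -
 obtain A C1 where AC: "A > 0" "C1 > 0"
  "!!delta k r. 0 < delta ==> delta <= 1/2 ==> k >= C1/delta ==> r > 0 ==>
   small_cover {x\<in>dset E delta. mi E r x >= 1 - 1/k}
    (A/delta*((LI x. ind {x. mi E (r/8) x >= 1 - C1/k} x*norm (dmi E (r/8) x))+T - pm E (r/8)))"
  using bad_set_cover by blast
 \<comment> \<open>Half of the admissible amount for each of the two terms: the factor A/delta times
   2e' gives back e.\<close>
 define e' where "e' = e*delta/A/2"
 have e': "e' > 0" using e d AC by (simp add: e'_def)
 have T0: "T >= 0" using pm_le_T[of 1] by (auto simp: pm_def intro: order_trans[rotated])
 define k0 where "k0 = max 1 (max (C1/delta) (max (2*C1) (2*C1*(T+1)/e')))"
 show ?thesis
 proof (rule that[of k0])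
  show "k0 >= 1" by (simp add: k0_def)
  fix k assume "k >= k0"
  hence k: "k >= C1/delta" "k >= 2*C1" "k >= 2*C1*(T+1)/e'" "k >= 1" by (auto simp: k0_def)
  \<comment> \<open>The rescaling makes the level 1 - 1/(2k') of \<open>high_density_mass\<close>
    equal to the level 1 - C1/k of the covering estimate.\<close>
  define k' where "k' = k/(2*C1)"
  have k'1: "k' >= 1" using k AC by (simp add: k'_def)
  have k'2: "1/(2*k') = C1/k" using AC by (simp add: k'_def)
  have k'3: "(T+1)/k' <= e'" using k(3,4) e' AC by (simp add: k'_def field_simps)
  have f: "filterlim (%r::real. r/8) (at_right 0) (at_right 0)"
   by (intro tendsto_imp_filterlim_at_right) (auto intro!: tendsto_eq_intros simp: eventually_at_right_less)
  have "\<forall>\<^sub>F r in at_right 0. (LI x. ind {x. mi E r x >= 1 - 1/(2*k')} x*norm (dmi E r x)) <= (T+1)/k'"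
   by (rule high_density_mass[OF k'1]) simp
  moreover have "\<forall>\<^sub>F r in at_right 0. pm E r > T - e'"
   using order_tendstoD(1)[OF pm_tendsto, of "T - e'"] e' by simp
  ultimately have "\<forall>\<^sub>F r in at_right 0. (LI x. ind {x. mi E r x >= 1 - C1/k} x*norm (dmi E r x)) <= e' & pm E r > T - e'"
   unfolding k'2 by eventually_elim (use k'3 in linarith)
  from eventually_compose_filterlim[OF this f] eventually_at_right_less[of "0::real"]
  show "\<forall>\<^sub>F r in at_right 0. small_cover {x\<in>dset E delta. mi E r x >= 1 - 1/k} e"
  proof eventually_elim
   case (elim r)
   have "A/delta*((LI x. ind {x. mi E (r/8) x >= 1 - C1/k} x*norm (dmi E (r/8) x))+T - pm E (r/8)) <= A/delta*(2*e')"
    using elim AC d by (intro mult_left_mono) auto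
   also have "... = e" using AC d by (simp add: e'_def)
   finally show ?case using AC(3)[OF d k(1) elim(2)] small_cover_mono by blast
  qed
 qed
qed

text \<open>A differentiable substitute for the maximum of the cut-offs: it is one as soon as one of
  them is one, and its gradient is bounded by the sum of their gradients however much they
  overlap.\<close>

lemma C1_one_minus_prod:
 assumes "finite I" "!!i. i \<in> I ==> C1 (ph i) (g i)" "!!i x. i \<in> I ==> 0 <= ph i x & ph i x <= (1::real)"
 shows "EX G. C1 (%x. 1 - (\<Prod>i\<in>I. 1 - ph i x)) G & (ALL x. norm (G x) <= (\<Sum>i\<in>I. norm (g i x)))"
 using assms
proof (induct I rule: finite_induct)
 case empty
 thus ?case using C1_const[of 0] by auto
next
 case (insert j I)
 then obtain G where G: "C1 (%x. 1 - (\<Prod>i\<in>I. 1 - ph i x)) G" "!!x. norm (G x) <= (\<Sum>i\<in>I. norm (g i x))" by auto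
 define P where "P x = (\<Prod>i\<in>I. 1 - ph i x)" for x
 have P01: "0 <= P x" "P x <= 1" for x unfolding P_def using insert(5) by (auto intro!: prod_nonneg prod_le_1)
 have eq: "(%x. 1 - (\<Prod>i\<in>insert j I. 1 - ph i x)) = (%x. (1 - P x)+ph j x*(1 - (1 - P x)))"
  using insert(1,2) by (auto simp: P_def fun_eq_iff algebra_simps)
 have "C1 (%x. (1 - P x)+ph j x*(1 - (1 - P x))) (%x. G x+(ph j x *\<^sub>R (0 - G x)+(1 - (1 - P x)) *\<^sub>R g j x))"
  using G(1) insert(4)[of j] unfolding P_def[symmetric] by (intro C1_add C1_mult C1_diff C1_const) auto
 moreover have "norm (G x+(ph j x *\<^sub>R (0 - G x)+(1 - (1 - P x)) *\<^sub>R g j x)) <= (\<Sum>i\<in>insert j I. norm (g i x))" for x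
 proof -
  have "G x+(ph j x *\<^sub>R (0 - G x)+(1 - (1 - P x)) *\<^sub>R g j x) = (1 - ph j x) *\<^sub>R G x+P x *\<^sub>R g j x"
   by (simp add: algebra_simps)
  also have "norm ... <= (1 - ph j x)*norm (G x)+P x*norm (g j x)"
   using insert(5)[of j x] P01[of x] norm_triangle_ineq[of "(1 - ph j x) *\<^sub>R G x" "P x *\<^sub>R g j x"] by simp
  also have "... <= 1*norm (G x)+1*norm (g j x)"
   using insert(5)[of j x] P01[of x] by (intro add_mono mult_right_mono) auto
  also have "... <= (\<Sum>i\<in>insert j I. norm (g i x))" using G(2)[of x] insert(1,2) by simp
  finally show ?thesis .
 qed
 ultimately show ?case unfolding eq by blast
qed

text \<open>The gradient is at most 16/r, with 4 from \<open>dstep_le\<close> and 4/r from the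
  quadratic profile, and it lives on a ball of radius 2r. Its mass thus scales like r^(n-1), the
  quantity summed in \<open>small_cover\<close>.\<close>

lemma ball_cutoff:
 fixes a :: "'b::euclidean_space" assumes r: "r > 0"
 obtains ph g where "C1 ph g" "!!x. 0 <= ph x & ph x <= 1" "!!x. x \<in> ball a r ==> ph x = 1"
  "!!x. x \<notin> ball a (2*r) ==> ph x = 0" "integ g"
  "(LI x. norm (g x)) <= 16*2 ^ DIM('b)*unit_ball_vol (real DIM('b))*r ^ (DIM('b) - 1)"
proof -
 let ?n = "DIM('b)"
 \<comment> \<open>This profile is at least 1 on the ball of radius r and at most -2 off the ball of
   radius 2r.\<close>
 define s where "s x = 2+(- 1/r\<^sup>2)*((x - a) \<bullet> (x - a))" for x
 define ph where "ph x = step (s x)" for x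
 define g where "g x = dstep (s x) *\<^sub>R (0+((- 1/r\<^sup>2) *\<^sub>R (2 *\<^sub>R (x - a))+((x - a) \<bullet> (x - a)) *\<^sub>R 0))" for x
 have "C1 s (%x. 0+((- 1/r\<^sup>2) *\<^sub>R (2 *\<^sub>R (x - a))+((x - a) \<bullet> (x - a)) *\<^sub>R 0))"
  unfolding s_def by (intro C1_add C1_mult C1_const C1_shift[OF C1_inner_self, simplified])
 hence C: "C1 ph g" unfolding ph_def g_def by (intro C1_compose[OF _ step_derivative continuous_dstep])
 have 1: "ph x = 1" if "x \<in> ball a r" for x
 proof -
  have "(x - a) \<bullet> (x - a) <= r\<^sup>2"
   using that r by (simp add: dist_norm norm_minus_commute power_mono flip: power2_norm_eq_inner)
  hence "s x >= 1" using r by (simp add: s_def field_simps)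
  thus ?thesis by (simp add: ph_def step_1)
 qed
 have 0: "ph x = 0" if "x \<notin> ball a (2*r)" for x
 proof -
  have "(2*r)\<^sup>2 <= (norm (x - a))\<^sup>2"
   using that r by (intro power_mono) (auto simp: dist_norm norm_minus_commute)
  hence "4*r\<^sup>2 <= (x - a) \<bullet> (x - a)" by (simp add: power_mult_distrib power2_norm_eq_inner)
  hence "4 <= (x - a) \<bullet> (x - a)/r\<^sup>2" using r by (simp add: pos_le_divide_eq)
  hence "s x <= 0" by (simp add: s_def)
  thus ?thesis by (simp add: ph_def step_0)
 qed
 have g0: "g x = 0" if "x \<notin> cball a (2*r)" for x
  by (rule C1_zero_outside[OF C closed_cball 0 that]) (use 0 in auto)
 have gi: "integ g" by (rule integrable_compact_support[OF C1_continuous_grad[OF C] compact_cball g0])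
 have gle: "norm (g x) <= 16/r*ind (cball a (2*r)) x" for x
 proof (cases "x \<in> cball a (2*r)")
  case True
  have "norm (g x) = dstep (s x)*(2/r\<^sup>2*norm (x - a))" using r by (simp add: g_def dstep_nonneg)
  also have "... <= 4*(2/r\<^sup>2*(2*r))"
   using True r by (intro mult_mono dstep_le) (auto simp: dist_norm norm_minus_commute)
  also have "... = 16/r" using r by (simp add: power2_eq_square)
  finally show ?thesis using True by simp
 qed (simp add: g0)
 have ii: "integ (%x. 16/r*ind (cball a (2*r)) x :: real)"
  by (intro integrable_mult_right) (auto simp: integrable_indicator_iff emeasure_bounded_finite[simplified])
 have "(LI x. norm (g x)) <= (LI x. 16/r*ind (cball a (2*r)) x)"
  by (rule integral_mono[OF integrable_norm[OF gi] ii gle])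
 also have "... = 16/r*(unit_ball_vol (real ?n)*(2*r) ^ ?n)" using r content_cball[of "2*r" a] by simp
 also have "... = 16*2 ^ ?n*unit_ball_vol (real ?n)*r ^ (?n - 1)"
  using r power_minus_mult[of ?n r, symmetric] by (simp add: power_mult_distrib)
 finally have "(LI x. norm (g x)) <= 16*2 ^ ?n*unit_ball_vol (real ?n)*r ^ (?n - 1)" .
 moreover have "0 <= ph x & ph x <= 1" for x by (simp add: ph_def step_bounds)
 ultimately show ?thesis using that C 1 0 gi by blast
qed

lemma small_coverE:
 fixes Q :: "'b::euclidean_space set" assumes "small_cover Q e"
 obtains C :: "('b \<times> real) set" where "ALL c:C. snd c > 0" "Q <= (\<Union>c\<in>C. cball (fst c) (snd c))"
  "!!I. finite I ==> I <= C ==> (\<Sum>c\<in>I. snd c ^ (DIM('b) - 1)) <= e"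
 using assms unfolding small_cover_def by (elim exE conjE) simp

section \<open>Absolute continuity of divergences with respect to content\<close>

text \<open>A density \<open>f\<close> with respect to \<open>M\<close> that is, on \<open>U\<close>, the divergence of a bounded vector field;
  only the resulting bound on test functions matters.\<close>
locale gradient_bound =
 fixes M :: "'b::euclidean_space measure" and f :: "'b => real" and U :: "'b set" and A :: real
 assumes sets_M [measurable_cong, simp]: "sets M = sets borel" and f_int: "integrable M f" and U_open: "open U"
  and dim2: "DIM('b) >= 2" and A_nonneg: "A >= 0"
  and grad_le: "!!ph g K. C1 ph g ==> compact K ==> K <= U ==> (!!x. x \<notin> K ==> ph x = 0) ==>
    \<bar>LINT x|M. ph x*f x\<bar> <= A*(LI x. norm (g x))"
begin

definition \<mu> :: "'b measure" where "\<mu> = density M (%x. ennreal \<bar>f x\<bar>)"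

lemma f_measurable [measurable]: "f \<in> borel_measurable M" using f_int by auto

lemma space_M [simp]: "space M = UNIV" using sets_eq_imp_space_eq[OF sets_M] by simp

lemma sets_mu [measurable_cong, simp]: "sets \<mu> = sets borel" by (simp add: \<mu>_def)

lemma finite_mu: "finite_measure \<mu>"
proof (rule finite_measureI)
 have "emeasure \<mu> (space \<mu>) = (\<integral>\<^sup>+x. ennreal (norm (f x)) \<partial>M)"
  unfolding \<mu>_def by (subst emeasure_density) (auto intro!: nn_integral_cong)
 thus "emeasure \<mu> (space \<mu>) ~= \<infinity>" using f_int by (simp add: integrable_iff_bounded)
qed

lemma int_ind: "X \<in> sets borel ==> integrable M (%x. ind X x*f x)"
 by (rule B_integrable_bound[OF f_int]) (auto simp: indicator_def)

lemma measure_mu: "X \<in> sets borel ==> measure \<mu> X = (LINT x|M. ind X x*\<bar>f x\<bar>)"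
proof -
 assume X: "X \<in> sets borel"
 have "emeasure \<mu> X = (\<integral>\<^sup>+x. ennreal (ind X x*\<bar>f x\<bar>) \<partial>M)"
  unfolding \<mu>_def using X by (subst emeasure_density) (auto intro!: nn_integral_cong simp: indicator_def)
 also have "... = ennreal (LINT x|M. ind X x*\<bar>f x\<bar>)"
  using integrable_abs[OF int_ind[OF X]] by (intro nn_integral_eq_integral) (auto simp: abs_mult)
 finally show ?thesis by (simp add: measure_def)
qed

lemma int_le_mu: "X \<in> sets borel ==> \<bar>LINT x|M. ind X x*f x\<bar> <= measure \<mu> X"
 using integral_norm_bound[of M "%x. ind X x*f x"] by (simp add: measure_mu abs_mult)

text \<open>A cut-off adapted to a cover of small content has small gradient mass, so its integral
  against f is small. Keeping its support in a thin neighbourhood of Q makes that integral close to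
  the one over Q.\<close>

lemma compact_null: assumes Q: "compact Q" "Q <= U" and small: "!!e. e > 0 ==> small_cover Q e"
 shows "(LINT x|M. ind Q x*f x) = 0"
proof (cases "Q = {}")
 case False
 let ?n = "DIM('b)"
 interpret finite_measure \<mu> by (rule finite_mu)
 have [measurable]: "Q \<in> sets borel" using Q by (simp add: borel_compact)
 have Ub: "U \<in> sets borel" using U_open by simp
 define W where "W = A*(16*2 ^ ?n*unit_ball_vol (real ?n)*2 ^ (?n - 1))"
 have W: "W >= 0" using A_nonneg by (simp add: W_def)
 have "\<bar>LINT x|M. ind Q x*f x\<bar> <= e" if e: "e > 0" for e :: real
 proof -
  have "U - Q \<in> sets borel" using Ub by measurable
  \<comment> \<open>Outside K the set U - Q has little mass. Removing K leaves an open neighbourhood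
    of Q in which the cut-off sees almost nothing but Q.\<close>
  then obtain K where K: "compact K" "K <= U - Q" "measure \<mu> (U - Q - K) < e/2"
   using inner_compact_approx[OF finite_mu sets_mu, of "U - Q" "e/2"] e by auto
  define V where "V = U - K"
  have V: "open V" "Q <= V" "V <= U" using K Q U_open compact_imp_closed[OF K(1)] by (auto simp: V_def open_Diff)
  obtain t where t: "t > 0" "{x. infdist x Q <= t} <= V"
   using compact_in_open_separated[OF False Q(1) V(1,2)] by blast
  \<comment> \<open>The first entry forces all radii below t/6, for which the exponent n - 1 must be
    positive; the second makes the gradient mass of the cut-off small, with W+1 in place of W to
    allow W = 0.\<close>
  define e1 where "e1 = min ((t/6) ^ (?n - 1)) (e/2/(W+1))"
  have e1: "e1 > 0" using t e W by (simp add: e1_def)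
  obtain C :: "('b \<times> real) set" where C: "ALL c:C. snd c > 0" "Q <= (\<Union>c\<in>C. cball (fst c) (snd c))"
   "!!I. finite I ==> I <= C ==> (\<Sum>c\<in>I. snd c ^ (?n - 1)) <= e1"
   by (rule small_coverE[OF small[OF e1]]) (rule that; blast)
  have rad: "snd c <= t/6" if "c \<in> C" for c
  proof -
   have "snd c ^ (?n - 1) <= (t/6) ^ (?n - 1)" using C(3)[of "{c}"] that by (simp add: e1_def)
   moreover have "?n - 1 > 0" using dim2 by simp
   ultimately show ?thesis using power_mono_iff[of "snd c" "t/6" "?n - 1"] C(1) that t by auto
  qed
  have "Q <= (\<Union>c\<in>C. ball (fst c) (2 * snd c))"
  proof
   fix x assume "x \<in> Q"
   then obtain c where "c \<in> C" "x \<in> cball (fst c) (snd c)" using C(2) by blast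
   thus "x \<in> (\<Union>c\<in>C. ball (fst c) (2 * snd c))" using C(1) by (auto intro!: bexI[of _ c])
  qed
  then obtain I0 where I0: "I0 <= C" "finite I0" "Q <= (\<Union>c\<in>I0. ball (fst c) (2 * snd c))"
   by (rule compactE_image[OF Q(1), rotated]) auto
  \<comment> \<open>Only balls that meet Q are kept. With radii below t/6, their fourfold
    enlargements, which contain the support of the cut-off, stay within distance t of Q.\<close>
  define I where "I = {c\<in>I0. ball (fst c) (2 * snd c) \<inter> Q ~= {}}"
  have I: "I <= C" "finite I" using I0 by (auto simp: I_def)
  have I3: "Q <= (\<Union>c\<in>I. ball (fst c) (2 * snd c))"
  proof
   fix x assume "x \<in> Q"
   then obtain c where "c \<in> I0" "x \<in> ball (fst c) (2 * snd c)" using I0(3) by blast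
   thus "x \<in> (\<Union>c\<in>I. ball (fst c) (2 * snd c))" using \<open>x \<in> Q\<close> by (intro UN_I[of c]) (auto simp: I_def)
  qed
  define H where "H c ph g \<longleftrightarrow> C1 ph g & (ALL x. 0 <= ph x & ph x <= 1) & (ALL x:ball (fst c) (2 * snd c). ph x = 1) &
    (ALL x. x \<notin> ball (fst c) (2*(2 * snd c)) --> ph x = 0) & integ g &
    (LI x. norm (g x)) <= 16*2 ^ ?n*unit_ball_vol (real ?n)*(2 * snd c) ^ (?n - 1)"
   for c :: "'b \<times> real" and ph g
  have "EX ph g. H c ph g" if "c \<in> I" for c
  proof -
   have c2: "2 * snd c > 0" using that I(1) C(1) by auto
   show ?thesis unfolding H_def by (rule ball_cutoff[OF c2, of "fst c"]) blast
  qed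
  then obtain ph g where H: "!!c. c \<in> I ==> H c (ph c) (g c)" by metis
  hence P: "!!c. c \<in> I ==> C1 (ph c) (g c)" "!!c x. c \<in> I ==> 0 <= ph c x & ph c x <= 1"
    "!!c x. c \<in> I ==> x \<in> ball (fst c) (2 * snd c) ==> ph c x = 1"
    "!!c x. c \<in> I ==> x \<notin> ball (fst c) (2*(2 * snd c)) ==> ph c x = 0" "!!c. c \<in> I ==> integ (g c)"
    "!!c. c \<in> I ==> (LI x. norm (g c x)) <= 16*2 ^ ?n*unit_ball_vol (real ?n)*(2 * snd c) ^ (?n - 1)"
   unfolding H_def by simp_all
  define \<Phi> where "\<Phi> x = 1 - (\<Prod>c\<in>I. 1 - ph c x)" for x
  obtain G where G: "C1 \<Phi> G" "!!x. norm (G x) <= (\<Sum>c\<in>I. norm (g c x))"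
   unfolding \<Phi>_def using C1_one_minus_prod[OF I(2), of ph g] P(1,2) by blast
  have prod01: "0 <= (\<Prod>c\<in>I. 1 - ph c x) & (\<Prod>c\<in>I. 1 - ph c x) <= 1" for x
   using P(2) by (auto intro!: prod_nonneg prod_le_1)
  have Phi01: "0 <= \<Phi> x" "\<Phi> x <= 1" for x using prod01[of x] by (auto simp: \<Phi>_def)
  have Phi1: "\<Phi> x = 1" if xQ: "x \<in> Q" for x
  proof -
   obtain c where c: "c \<in> I" "x \<in> ball (fst c) (2 * snd c)" using I3 xQ by blast
   hence "(\<Prod>c\<in>I. 1 - ph c x) = 0" using P(3)[OF c] by (intro prod_zero[OF I(2)]) (auto intro: bexI[of _ c])
   thus ?thesis by (simp add: \<Phi>_def)
  qed
  have comp: "compact {x. infdist x Q <= t}" by (rule compact_infdist_le[OF False Q(1) t(1)])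
  have Phi0: "\<Phi> x = 0" if "x \<notin> {x. infdist x Q <= t}" for x
  proof -
   have "ph c x = 0" if c: "c \<in> I" for c
   proof (rule P(4)[OF c])
    obtain z where z: "z \<in> ball (fst c) (2 * snd c)" "z \<in> Q" using c by (auto simp: I_def)
    have "infdist x Q <= dist x z" using z(2) by (rule infdist_le)
    hence "t < dist x z" using \<open>x \<notin> {x. infdist x Q <= t}\<close> by simp
    also have "dist x z <= dist (fst c) x+dist (fst c) z" by (metis dist_commute dist_triangle)
    finally show "x \<notin> ball (fst c) (2*(2 * snd c))" using z(1) rad[of c] c I(1) by auto
   qed
   thus ?thesis by (simp add: \<Phi>_def)
  qed
  have PhiV: "\<Phi> x = 0" if "x \<notin> V" for x using Phi0[of x] t(2) that by blast
  have "(LI x. norm (G x)) <= (LI x. (\<Sum>c\<in>I. norm (g c x)))"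
  proof (rule integral_mono[OF _ _ G(2)])
   show "integ (%x. norm (G x))"
    by (rule integrable_norm, rule integrable_compact_support[OF C1_continuous_grad[OF G(1)] comp])
      (rule C1_zero_outside[OF G(1) compact_imp_closed[OF comp] Phi0])
  qed (auto intro!: B_integrable_sum P(5))
  also have "... = (\<Sum>c\<in>I. LI x. norm (g c x))" by (rule B_integral_sum) (auto intro!: P(5))
  also have "... <= (\<Sum>c\<in>I. 16*2 ^ ?n*unit_ball_vol (real ?n)*(2 * snd c) ^ (?n - 1))"
   by (rule sum_mono) (rule P(6))
  also have "... = 16*2 ^ ?n*unit_ball_vol (real ?n)*2 ^ (?n - 1)*(\<Sum>c\<in>I. snd c ^ (?n - 1))"
   by (simp add: power_mult_distrib sum_distrib_left mult.assoc)
  also have "... <= 16*2 ^ ?n*unit_ball_vol (real ?n)*2 ^ (?n - 1)*e1" by (intro mult_left_mono C(3) I) auto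
  finally have "A*(LI x. norm (G x)) <= W*e1"
   using mult_left_mono[OF _ A_nonneg] by (fastforce simp: W_def mult.assoc)
  also have "... <= W*(e/2/(W+1))" using W by (intro mult_left_mono) (auto simp: e1_def)
  also have "... <= e/2" using W e by (simp add: field_simps)
  finally have b1: "\<bar>LINT x|M. \<Phi> x*f x\<bar> <= e/2"
   using grad_le[OF G(1) comp _ Phi0] t(2) V(3) by fastforce
  have [measurable]: "\<Phi> \<in> Borel" using G(1) by measurable
  have Phif: "integrable M (%x. \<Phi> x*f x)"
   by (rule B_integrable_bound[OF f_int]) (use Phi01 in "auto simp: abs_mult intro!: mult_left_le_one_le")
  have Vb: "V - Q \<in> sets borel" using V(1) by measurable
  have "\<bar>(LINT x|M. \<Phi> x*f x) - (LINT x|M. ind Q x*f x)\<bar> = \<bar>LINT x|M. \<Phi> x*f x - ind Q x*f x\<bar>"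
   by (subst B_integral_diff[OF Phif int_ind]) auto
  also have "... <= (LINT x|M. ind (V - Q) x*\<bar>f x\<bar>)"
  proof (rule B_integral_norm_bound_integral[of _ "%x. \<Phi> x*f x - ind Q x*f x", simplified])
   show "integrable M (%x. \<Phi> x*f x - ind Q x*f x)" using Phif int_ind[of Q] by auto
   show "integrable M (%x. ind (V - Q) x*\<bar>f x\<bar>)" using integrable_abs[OF int_ind[OF Vb]] by (simp add: abs_mult)
   fix x
   show "\<bar>\<Phi> x*f x - ind Q x*f x\<bar> <= ind (V - Q) x*\<bar>f x\<bar>"
   proof (cases "x \<in> Q")
    case False
    thus ?thesis using Phi01[of x] PhiV[of x] by (cases "x \<in> V") (auto simp: abs_mult intro!: mult_left_le_one_le)
   qed (simp add: Phi1)
  qed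
  also have "... = measure \<mu> (V - Q)" by (rule measure_mu[OF Vb, symmetric])
  also have "V - Q = U - Q - K" by (auto simp: V_def)
  finally show ?thesis using b1 K(3) by linarith
 qed
 thus ?thesis by (metis abs_le_zero_iff field_le_epsilon add.left_neutral)
qed simp

text \<open>Inner regularity extends \<open>compact_null\<close> to all Borel subsets of Q; applied
  to the parts where f is positive and negative it gives zero for the variation.\<close>

lemma null_set: assumes Q: "Q \<in> sets borel" "Q <= U" and small: "!!e. e > 0 ==> small_cover Q e"
 shows "measure \<mu> Q = 0"
proof -
 interpret finite_measure \<mu> by (rule finite_mu)
 have sub: "small_cover X e" if "X <= Q" "e > 0" for X e
  using small[OF that(2)] that(1) unfolding small_cover_def by (meson order_trans)
 have z: "(LINT x|M. ind X x*f x) = 0" if X: "X \<in> sets borel" "X <= Q" for X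
 proof -
  have "\<bar>LINT x|M. ind X x*f x\<bar> <= e" if e: "e > 0" for e :: real
  proof -
   obtain K where K: "compact K" "K <= X" "measure \<mu> (X - K) < e"
    using inner_compact_approx[OF finite_mu sets_mu X(1) e] by blast
   have Kb: "K \<in> sets borel" using K(1) by (rule borel_compact)
   have "(%x. ind X x*f x) = (%x. ind K x*f x+ind (X - K) x*f x)" using K(2) by (auto simp: fun_eq_iff indicator_def)
   hence "(LINT x|M. ind X x*f x) = (LINT x|M. ind K x*f x)+(LINT x|M. ind (X - K) x*f x)"
    using int_ind[OF Kb] int_ind[of "X - K"] X(1) Kb by simp
   also have "(LINT x|M. ind K x*f x) = 0" by (rule compact_null[OF K(1)]) (use K X Q sub in auto)
   finally show ?thesis using int_le_mu[of "X - K"] X(1) Kb K(3) by simp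
  qed
  thus ?thesis by (metis abs_le_zero_iff field_le_epsilon add.left_neutral)
 qed
 define P where "P = Q \<inter> {x. f x > 0}"
 define N where "N = Q \<inter> {x. f x < 0}"
 have fb: "f \<in> Borel" using f_measurable by (simp cong: measurable_cong_sets)
 have PN: "P \<in> sets borel" "N \<in> sets borel" "P <= Q" "N <= Q" using Q(1) fb by (auto simp: P_def N_def)
 have "(%x. ind Q x*\<bar>f x\<bar>) = (%x. ind P x*f x - ind N x*f x)"
  by (auto simp: fun_eq_iff indicator_def P_def N_def)
 hence "measure \<mu> Q = (LINT x|M. ind P x*f x) - (LINT x|M. ind N x*f x)"
  using int_ind[OF PN(1)] int_ind[OF PN(2)] by (simp add: measure_mu[OF Q(1)])
 thus ?thesis using z PN by simp
qed

lemma small_cover_UN: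
 fixes Q :: "nat => 'b set" assumes "!!j::nat. small_cover (Q j) ((1/2) ^ j)"
 shows "small_cover (\<Union>j\<in>{J..}. Q j) (2*(1/2) ^ J)"
proof -
 let ?n = "DIM('b)"
 obtain C where C: "!!j. ALL c:C j. snd c > 0" "!!j. Q j <= (\<Union>c\<in>C j. cball (fst c) (snd c))"
  "!!j I. finite I ==> I <= C j ==> (\<Sum>c\<in>I. snd c ^ (?n - 1)) <= (1/2) ^ j"
 proof -
  define W where "W j C \<longleftrightarrow> (ALL c:C. snd c > 0) & Q j <= (\<Union>c\<in>C. cball (fst c) (snd c)) &
   (ALL I. finite I --> I <= C --> (\<Sum>c\<in>I. snd c ^ (?n - 1)) <= (1/2) ^ j)" for j C
  have "EX C. W j C" for j using assms[of j] by (rule small_coverE) (auto simp: W_def)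
  then obtain C where "!!j. W j (C j)" by metis
  thus ?thesis by (intro that[of C]) (simp_all add: W_def)
 qed
 show ?thesis unfolding small_cover_def
 proof (intro exI[of _ "\<Union>j\<in>{J..}. C j"] conjI allI impI)
  show "ALL c:\<Union>j\<in>{J..}. C j. 0 < snd c" using C(1) by blast
  show "(\<Union>j\<in>{J..}. Q j) <= (\<Union>c\<in>\<Union>j\<in>{J..}. C j. cball (fst c) (snd c))" using C(2) by blast
  fix I assume I: "finite I & I <= (\<Union>j\<in>{J..}. C j)"
  hence "ALL c:I. EX j>=J. c \<in> C j" by auto
  then obtain h where h: "!!c. c \<in> I ==> h c >= J & c \<in> C (h c)" by metis
  define N where "N = Max (insert J (h ` I))"
  have hN: "h c <= N" if "c \<in> I" for c using I that by (auto simp: N_def)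
  have "(\<Sum>c\<in>I. snd c ^ (?n - 1)) = (\<Sum>j\<in>{J..N}. \<Sum>c\<in>{c\<in>I. h c = j}. snd c ^ (?n - 1))"
   by (rule sum.group[symmetric]) (use I h hN in auto)
  also have "... <= (\<Sum>j\<in>{J..N}. (1/2) ^ j)" by (intro sum_mono C(3)) (use I h in auto)
  also have "... <= 2*(1/2) ^ J"
  proof (cases "J <= N")
   case True
   hence "(\<Sum>j\<in>{J..N}. (1/2::real) ^ j) = ((1/2) ^ J - (1/2) ^ Suc N)/(1/2)"
    using sum_gp[of "1/2::real" J N] by simp
   thus ?thesis by simp
  qed simp
  finally show "(\<Sum>c\<in>I. snd c ^ (?n - 1)) <= 2*(1/2) ^ J" .
 qed
qed

lemma small_cover_subset: "small_cover Y e ==> X <= Y ==> small_cover X e"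
 unfolding small_cover_def by (meson order_trans)

text \<open>A Borel-Cantelli argument. If sets with content 2^-j all had mass at least e, the set of
  points lying in infinitely many of them would still have mass at least e, while its content is
  below every positive number, against \<open>null_set\<close>.\<close>

lemma small_cover_absolutely_continuous: assumes e: "e > 0"
 obtains d where "d > 0" "!!Q. Q \<in> sets borel ==> Q <= U ==> small_cover Q d ==> measure \<mu> Q < e"
proof (rule ccontr)
 interpret finite_measure \<mu> by (rule finite_mu)
 assume "\<not> thesis"
 hence "ALL d>0. EX Q. Q \<in> sets borel & Q <= U & small_cover Q d & measure \<mu> Q >= e"
  using that by (meson not_less)
 hence "ALL j::nat. EX Q. Q \<in> sets borel & Q <= U & small_cover Q ((1/2) ^ j) & measure \<mu> Q >= e" by simp
 then obtain Q :: "nat => 'b set" where Q: "!!j. Q j \<in> sets borel" "!!j. Q j <= U" "!!j. small_cover (Q j) ((1/2) ^ j)" "!!j. measure \<mu> (Q j) >= e"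
  by metis
 define X where "X J = (\<Union>j\<in>{J..}. Q j)" for J
 have Xb: "X J \<in> sets borel" for J unfolding X_def using Q(1) by auto
 have "(%J. measure \<mu> (X J)) \<longlonglongrightarrow> measure \<mu> (\<Inter>J. X J)"
  by (rule finite_Lim_measure_decseq) (use Xb in "auto simp: X_def decseq_def intro: order_trans")
 moreover have "measure \<mu> (X J) >= e" for J
 proof -
  have "measure \<mu> (Q J) <= measure \<mu> (X J)" by (rule finite_measure_mono) (use Xb in "auto simp: X_def")
  thus ?thesis using Q(4)[of J] by simp
 qed
 ultimately have "measure \<mu> (\<Inter>J. X J) >= e" by (intro LIMSEQ_le_const) auto
 moreover have "measure \<mu> (\<Inter>J. X J) = 0"
 proof (rule null_set)
  show "(\<Inter>J. X J) \<in> sets borel" using Xb by auto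
  have "X 0 <= U" using Q(2) by (auto simp: X_def)
  thus "(\<Inter>J. X J) <= U" by blast
  fix d :: real assume "d > 0"
  then obtain J where "(1/2) ^ J < d/2" using real_arch_pow_inv[of "d/2" "1/2"] by auto
  hence "2*(1/2) ^ J <= d" by simp
  hence "small_cover (X J) d" unfolding X_def using small_cover_UN[OF Q(3)] small_cover_mono by blast
  thus "small_cover (\<Inter>J. X J) d" by (rule small_cover_subset) blast
 qed
 ultimately show False using e by simp
qed

end

section \<open>The points at which a set fails to have density one\<close>

definition N1 :: "'b::euclidean_space set => 'b set" where "N1 E = (\<Union>j::nat. dset E (1/(real j+2)))"

context borel_set begin

lemma coE_left_continuous: assumes "c < coE E x r" "0 <= c"
 obtains r' where "0 < r'" "r' < r" "c < coE E x r'"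
proof -
 have r: "r > 0"
 proof (rule ccontr)
  assume "\<not> r > 0"
  hence "ball x r - E = {}" by (simp add: ball_empty)
  hence "coE E x r = 0" by (simp only: coE_def measure_empty)
  thus False using assms by simp
 qed
 define s where "s j = r - r/(real j+2)" for j :: nat
 have s: "0 < s j" "s j < r" for j using r by (auto simp: s_def field_simps add_pos_nonneg)
 have inc: "s i <= s j" if "i <= j" for i j
  using that r unfolding s_def by (intro diff_left_mono divide_left_mono) auto
 have UN: "(\<Union>j. ball x (s j) - E) = ball x r - E"
 proof -
  have "EX j. dist x y < s j" if "dist x y < r" for y
  proof -
   define t where "t = (r - dist x y)/r"
   have "t > 0" using that r by (simp add: t_def)
   then obtain j where j: "1/real (Suc j) < t" using nat_approx_posE by blast
   have "1/(real j+2) <= 1/real (Suc j)" by (simp add: frac_le)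
   hence "r*(1/(real j+2)) < r*t" using j r by (intro mult_strict_left_mono) auto
   thus ?thesis using r by (intro exI[of _ j]) (simp add: s_def t_def)
  qed
  moreover have "dist x y < r" if "dist x y < s j" for y j using that s(2)[of j] by linarith
  ultimately show ?thesis by auto
 qed
 have "(%j. coE E x (s j)) \<longlonglongrightarrow> coE E x r" unfolding coE_def UN[symmetric]
 proof (rule Lim_measure_incseq)
  show "range (%j. ball x (s j) - E) <= sets lborel" by auto
  show "incseq (%j. ball x (s j) - E)" using inc by (fastforce simp: incseq_def)
  show "emeasure lborel (\<Union>j. ball x (s j) - E) ~= \<infinity>" unfolding UN using emeasure_subset_ball[of "ball x r - E" x r] by auto
 qed
 hence "\<forall>\<^sub>F j in sequentially. c < coE E x (s j)" using assms(1) by (rule order_tendstoD)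
 then obtain j where "c < coE E x (s j)" using eventually_happens'[OF sequentially_bot] by blast
 thus ?thesis using that s by blast
qed

text \<open>For fixed r the points whose ball contains more than a given amount of complement form
  an open set. The strict inequality in \<open>dset\<close> makes it a countable intersection of
  unions of such sets.\<close>

lemma dset_borel [measurable]: assumes "delta >= 0" shows "dset E delta \<in> sets borel"
proof -
 have op: "open {x. coE E x r > c}" if "c >= 0" for r c unfolding open_dist
 proof
  fix x assume "x \<in> {x. coE E x r > c}"
  then obtain r' where r': "0 < r'" "r' < r" "c < coE E x r'" using coE_left_continuous[of c x r] \<open>c >= 0\<close> by auto
  show "EX e>0. ALL y. dist y x < e --> y \<in> {x. coE E x r > c}"
  proof (intro exI[of _ "r - r'"] conjI allI impI)
   fix y assume d: "dist y x < r - r'"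
   have "ball x r' <= ball y r"
   proof
    fix z assume "z \<in> ball x r'"
    thus "z \<in> ball y r" using d dist_triangle[of y z x] by simp
   qed
   thus "y \<in> {x. coE E x r > c}" using coE_mono[of x r' y r] r'(3) by simp
  qed (use r' in simp)
 qed
 have "dset E delta = (\<Inter>j::nat. \<Union>r\<in>{0<..<1/real (Suc j)}. {x. coE E x r > delta * vol (ball (0::'b) r)})"
 proof -
  have ball0: "vol (ball x r) = vol (ball (0::'b) r)" if "r > 0" for x :: 'b and r
   using that by (simp add: content_ball_power)
  show ?thesis
  proof (intro set_eqI iffI)
   fix x assume "x \<in> dset E delta"
   thus "x \<in> (\<Inter>j::nat. \<Union>r\<in>{0<..<1/real (Suc j)}. {x. coE E x r > delta * vol (ball (0::'b) r)})"
   proof (intro INT_I)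
    fix j :: nat
    have "1/real (Suc j) > 0" by simp
    then obtain r where "0 < r" "r < 1/real (Suc j)" "coE E x r > delta * vol (ball x r)"
     using \<open>x \<in> dset E delta\<close> unfolding dset_def by blast
    thus "x \<in> (\<Union>r\<in>{0<..<1/real (Suc j)}. {x. coE E x r > delta * vol (ball (0::'b) r)})"
     using ball0[of r x] by (intro UN_I[of r]) auto
   qed
  next
   fix x assume x: "x \<in> (\<Inter>j::nat. \<Union>r\<in>{0<..<1/real (Suc j)}. {x. coE E x r > delta * vol (ball (0::'b) r)})"
   show "x \<in> dset E delta" unfolding dset_def
   proof (intro CollectI allI impI)
    fix e :: real assume "e > 0"
    then obtain j where j: "1/real (Suc j) < e" using nat_approx_posE by blast
    obtain r where "r \<in> {0<..<1/real (Suc j)}" "coE E x r > delta * vol (ball (0::'b) r)" using x by blast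
    thus "EX r>0. r < e & delta * vol (ball x r) < coE E x r" using j ball0[of r x] by (intro exI[of _ r]) auto
   qed
  qed
 qed
 moreover have "(\<Union>r\<in>{0<..<1/real (Suc j)}. {x. coE E x r > delta * vol (ball (0::'b) r)}) \<in> sets borel" for j
  by (intro borel_open open_UN ballI op) (use assms in auto)
 ultimately show ?thesis by auto
qed

lemma N1_borel [measurable]: "N1 E \<in> sets borel" unfolding N1_def by auto

lemma dset_antimono: "delta <= delta' ==> dset E delta' <= dset E delta"
 unfolding dset_def by (force intro: le_less_trans[OF mult_right_mono])

lemma N1_iff: "x \<in> N1 E \<longleftrightarrow> (EX delta>0. x \<in> dset E delta)"
proof
 assume "EX delta>0. x \<in> dset E delta"
 then obtain delta where d: "delta > 0" "x \<in> dset E delta" by blast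
 then obtain j where j: "1/real (Suc j) < delta" using nat_approx_posE by blast
 have "1/(real j+2) <= 1/real (Suc j)" by (simp add: frac_le)
 hence "1/(real j+2) <= delta" using j by linarith
 thus "x \<in> N1 E" using dset_antimono d(2) unfolding N1_def by blast
next
 assume "x \<in> N1 E"
 then obtain j where "x \<in> dset E (1/(real j+2))" unfolding N1_def by blast
 thus "EX delta>0. x \<in> dset E delta" by (intro exI[of _ "1/(real j+2)"]) auto
qed

end

context bounded_borel begin

lemma mi_tendsto_1: assumes "x \<notin> N1 E" shows "((%r. mi E r x) \<longlongrightarrow> 1) (at_right 0)"
proof (rule tendstoI)
 fix e :: real assume e: "e > 0"
 let ?n = "DIM('b)"
 let ?omega = "unit_ball_vol (real ?n)"
 obtain c1 where c1: "c1 > 0" "!!r x. r > 0 ==> mol r (x::'b) <= c1/r ^ ?n" using mol_upper by metis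
 \<comment> \<open>With this density the upper bound for the kernel turns complement density delta
   into an error of e/2.\<close>
 define delta where "delta = e/(2*c1*?omega)"
 have d: "delta > 0" using e c1 by (simp add: delta_def)
 hence "x \<notin> dset E delta" using assms N1_iff by blast
 then obtain s where "s > 0" "\<not> (EX r. 0 < r & r < s & coE E x r > delta * vol (ball x r))"
  unfolding dset_def by blast
 hence s: "s > 0" "!!r. 0 < r ==> r < s ==> coE E x r <= delta * vol (ball x r)" by (auto simp: not_less[symmetric])
 have "\<forall>\<^sub>F r in at_right 0. 0 < r & r < s"
  unfolding eventually_at_right_field using s(1) by (auto intro!: exI[of _ s])
 thus "\<forall>\<^sub>F r in at_right 0. dist (mi E r x) 1 < e"
 proof eventually_elim
  case (elim r)
  have "1 - mi E r x <= c1/r ^ ?n*coE E x r" by (rule coE_ge) (use elim c1 in auto)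
  also have "... <= c1/r ^ ?n*(delta*(?omega*r ^ ?n))"
   using s(2)[of r] elim c1 by (intro mult_left_mono) (auto simp: content_ball_power)
  also have "... = e/2"
  proof -
   have "?omega > 0" by simp
   hence "?omega ~= 0" by linarith
   thus ?thesis using elim c1 by (simp add: delta_def)
  qed
  also have "... < e" using e by simp
  finally show ?case using mi_bounds(2)[of r x] elim by (simp add: dist_real_def)
 qed
qed

end

locale density_limit = finite_perimeter E T0+gradient_bound M f U A
 for E :: "'b::euclidean_space set" and T0 and M :: "'b measure" and f U A
begin

lemma psi_measurable [measurable]: "psi k \<in> Borel" unfolding psi_def psq_def by measurable

text \<open>In the limit, \<open>psi k\<close> of the mollified indicator selects exactly the points of density one:
  at the remaining points the mollification at scale \<open>r\<close> is close to one only on a set of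
  small content.\<close>
lemma psi_limit: assumes e: "e > 0"
 obtains k0 where "k0 >= 1" "!!k. k >= k0 ==>
  \<forall>\<^sub>F r in at_right 0. (LINT x|\<mu>. ind U x*\<bar>psi k (mi E r x) - ind (- N1 E) x\<bar>) < e"
proof -
 interpret finite_measure \<mu> by (rule finite_mu)
 have [measurable]: "U \<in> sets borel" using U_open by simp
 \<comment> \<open>The points missed by the threshold 1/(j+2) decrease to the empty set, so one
   fixed threshold loses only e/3 of the mass. The offset 2 keeps the threshold at most 1/2, as
   \<open>intermediate_density\<close> requires.\<close>
 define D where "D j = U \<inter> N1 E - dset E (1/(real j+2))" for j :: nat
 have Db: "D j \<in> sets borel" for j unfolding D_def by measurable
 have "(%j. measure \<mu> (D j)) \<longlonglongrightarrow> measure \<mu> (\<Inter>j. D j)"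
 proof (rule finite_Lim_measure_decseq)
  show "range D <= sets \<mu>" using Db by auto
  have "dset E (1/(real i+2)) <= dset E (1/(real j+2))" if "i <= j" for i j
   by (rule dset_antimono) (use that in "simp add: frac_le")
  thus "decseq D" unfolding decseq_def D_def by blast
 qed
 moreover have "(\<Inter>j. D j) = {}" unfolding D_def N1_def by blast
 ultimately have "(%j. measure \<mu> (D j)) \<longlonglongrightarrow> 0" by simp
 hence "\<forall>\<^sub>F j in sequentially. measure \<mu> (D j) < e/3" using e by (intro order_tendstoD) auto
 then obtain J where J: "measure \<mu> (D J) < e/3" using eventually_happens'[OF sequentially_bot] by blast
 define delta where "delta = 1/(real J+2)"
 have d: "0 < delta" "delta <= 1/2" by (auto simp: delta_def frac_le)
 have e3: "e/3 > 0" using e by simp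
 obtain d' where d': "d' > 0" "!!Q. Q \<in> sets borel ==> Q <= U ==> small_cover Q d' ==> measure \<mu> Q < e/3"
  using small_cover_absolutely_continuous[OF e3] by blast
 obtain k0 where k0: "k0 >= 1" "!!k. k >= k0 ==> \<forall>\<^sub>F r in at_right 0. small_cover {x\<in>dset E delta. mi E r x >= 1 - 1/k} d'"
  using bad_set_small_cover[OF d d'(1)] by blast
 show ?thesis
 proof (rule that[OF k0(1)])
  fix k assume k: "k >= k0"
  hence kpos: "k > 0" using k0(1) by simp
  have int_b: "integrable \<mu> h" if "h \<in> Borel" "!!x. \<bar>h x\<bar> <= 1" for h :: "'b => real"
   by (rule integrable_const_bound[of _ 1]) (use that in auto)
  have "((%r. LINT x|\<mu>. ind (U - N1 E) x*\<bar>psi k (mi E r x) - 1\<bar>) \<longlongrightarrow> 0) (at_right 0)"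
   unfolding tendsto_at_iff_sequentially
  proof (intro allI impI)
   fix X :: "nat => real" assume X: "ALL i. X i \<in> {0<..} - {0}" "X \<longlonglongrightarrow> 0"
   have Xf: "filterlim X (at_right 0) sequentially"
    using X by (auto simp: filterlim_at intro!: always_eventually) (metis less_irrefl)
   have "(%i. LINT x|\<mu>. ind (U - N1 E) x*\<bar>psi k (mi E (X i) x) - 1\<bar>) \<longlonglongrightarrow> (LINT x|\<mu>. 0)"
   proof (rule integral_dominated_convergence[where w="%x. 1"])
    show "integrable \<mu> (%x. 1 :: real)" by (rule int_b) auto
    show "AE x in \<mu>. norm (ind (U - N1 E) x*\<bar>psi k (mi E (X i) x) - 1\<bar>) <= 1" for i
    proof (rule AE_I2)
     fix x
     show "norm (ind (U - N1 E) x*\<bar>psi k (mi E (X i) x) - 1\<bar>) <= 1"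
      using psi_nonneg[of k "mi E (X i) x"] psi_le_1[OF kpos mi_bounds(2)[of "X i" x]] X(1) by (auto simp: indicator_def)
    qed
    show "AE x in \<mu>. (%i. ind (U - N1 E) x*\<bar>psi k (mi E (X i) x) - 1\<bar>) \<longlonglongrightarrow> 0"
    proof (rule AE_I2)
     fix x
     show "(%i. ind (U - N1 E) x*\<bar>psi k (mi E (X i) x) - 1\<bar>) \<longlonglongrightarrow> 0"
     proof (cases "x \<in> U - N1 E")
      case True
      hence "(%i. mi E (X i) x) \<longlonglongrightarrow> 1" using filterlim_compose[OF mi_tendsto_1 Xf] by auto
      moreover have "isCont (psi k) 1" using DERIV_isCont[OF psi_derivative] .
      ultimately have "(%i. psi k (mi E (X i) x)) \<longlonglongrightarrow> psi k 1" by (rule isCont_tendsto_compose[rotated])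
      hence "(%i. \<bar>psi k (mi E (X i) x) - 1\<bar>) \<longlonglongrightarrow> \<bar>psi k 1 - 1\<bar>" by (intro tendsto_intros)
      thus ?thesis using True by (simp add: psi_1)
     qed simp
    qed
   qed measurable
   thus "((%r. LINT x|\<mu>. ind (U - N1 E) x*\<bar>psi k (mi E r x) - 1\<bar>) \<circ> X) \<longlonglongrightarrow> 0" by (simp add: o_def)
  qed
  hence "\<forall>\<^sub>F r in at_right 0. (LINT x|\<mu>. ind (U - N1 E) x*\<bar>psi k (mi E r x) - 1\<bar>) < e/3"
   using e by (intro order_tendstoD) auto
  with k0(2)[OF k] eventually_at_right_less[of "0::real"]
  show "\<forall>\<^sub>F r in at_right 0. (LINT x|\<mu>. ind U x*\<bar>psi k (mi E r x) - ind (- N1 E) x\<bar>) < e"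
  proof eventually_elim
   case (elim r)
   \<comment> \<open>A point of U in \<open>N1 E\<close> lies in Q, or in \<open>D J\<close>, or its
     mollification is below 1 - 1/k and \<open>psi k\<close> vanishes there. So Q and
     \<open>D J\<close> carry the whole error outside the points of density one.\<close>
   define Q where "Q = U \<inter> {x\<in>dset E delta. mi E r x >= 1 - 1/k}"
   have Qb: "Q \<in> sets borel"
   proof -
    have "dset E delta \<in> sets borel" using d by (intro dset_borel) auto
    moreover have "{x. mi E r x >= 1 - 1/k} \<in> sets borel" by measurable
    ultimately have "U \<inter> (dset E delta \<inter> {x. mi E r x >= 1 - 1/k}) \<in> sets borel" by measurable
    thus ?thesis by (simp add: Q_def Int_def)
   qed
   have Qm: "measure \<mu> Q < e/3" by (rule d'(2)[OF Qb]) (auto simp: Q_def intro: small_cover_subset[OF elim(1)])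
   have p01: "0 <= psi k (mi E r x) & psi k (mi E r x) <= 1" for x
    using psi_nonneg psi_le_1[OF kpos mi_bounds(2)[OF elim(2)]] by blast
   have "(LINT x|\<mu>. ind U x*\<bar>psi k (mi E r x) - ind (- N1 E) x\<bar>) <=
     (LINT x|\<mu>. ind (U - N1 E) x*\<bar>psi k (mi E r x) - 1\<bar>+(ind (D J) x+ind Q x))"
   proof (rule integral_mono)
    show "integrable \<mu> (%x. ind U x*\<bar>psi k (mi E r x) - ind (- N1 E) x\<bar>)"
     using p01 by (intro int_b) (auto simp: indicator_def)
    show "integrable \<mu> (%x. ind (U - N1 E) x*\<bar>psi k (mi E r x) - 1\<bar>+(ind (D J) x+ind Q x))"
     using p01 Qb Db by (intro B_integrable_add int_b) (auto simp: indicator_def)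
    fix x
    show "ind U x*\<bar>psi k (mi E r x) - ind (- N1 E) x\<bar> <=
     ind (U - N1 E) x*\<bar>psi k (mi E r x) - 1\<bar>+(ind (D J) x+ind Q x)"
    proof (cases "x \<in> U & x \<in> N1 E")
     case True
     show ?thesis
     proof (cases "x \<in> dset E delta")
      case in_d: True
      show ?thesis
      proof (cases "mi E r x >= 1 - 1/k")
       case True
       hence "x \<in> Q" using in_d \<open>x \<in> U & x \<in> N1 E\<close> by (simp add: Q_def)
       thus ?thesis using p01[of x] \<open>x \<in> U & x \<in> N1 E\<close> by (auto simp: indicator_def)
      next
       case False
       hence "psi k (mi E r x) = 0" by (intro psi_eq_0[OF kpos]) simp
       thus ?thesis using \<open>x \<in> U & x \<in> N1 E\<close> by simp
      qed
     next
      case False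
      hence "x \<in> D J" using True by (simp add: D_def delta_def)
      thus ?thesis using p01[of x] True by (auto simp: indicator_def)
     qed
    next
     case False
     thus ?thesis by (cases "x \<in> U") simp_all
    qed
   qed
   also have "... = (LINT x|\<mu>. ind (U - N1 E) x*\<bar>psi k (mi E r x) - 1\<bar>)+(measure \<mu> (D J)+measure \<mu> Q)"
   proof -
    have "integrable \<mu> (%x. ind (U - N1 E) x*\<bar>psi k (mi E r x) - 1\<bar>)"
     using p01 by (intro int_b) (auto simp: indicator_def)
    moreover have "integrable \<mu> (ind (D J) :: 'b => real)" "integrable \<mu> (ind Q :: 'b => real)"
     using Db Qb by (auto intro!: int_b simp: indicator_def)
    moreover have "space \<mu> = UNIV" using sets_eq_imp_space_eq[OF sets_mu] by simp
    ultimately show ?thesis using Db Qb by simp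
   qed
   also have "... < e" using elim(3) J Qm by linarith
   finally show ?case .
  qed
 qed
qed

end

section \<open>Signed measures and their densities\<close>

text \<open>For a fixed direction q, the set on which g x \<bullet> q exceeds the norm of q must be
  null, as is seen by testing the hypothesis on it. Countably many dense directions suffice, and q =
  g x gives the bound.\<close>

lemma AE_density_norm_le_1:
 fixes g :: "'a => 'b::euclidean_space" assumes fin: "finite_measure M" and g: "integrable M g"
  and le: "!!E. E \<in> sets M ==> norm (LINT x|M. ind E x *\<^sub>R g x) <= measure M E"
 shows "AE x in M. norm (g x) <= 1"
proof -
 interpret finite_measure M by fact
 have [measurable]: "g \<in> borel_measurable M" using g by auto
 obtain D :: "'b set" where D: "countable D" "!!X. open X ==> X ~= {} ==> EX d:D. d \<in> X"
  by (rule countable_dense_setE) blast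
 have "AE x in M. g x \<bullet> q <= norm q" for q
 proof -
  define E where "E = {x\<in>space M. g x \<bullet> q > norm q}"
  have E [measurable]: "E \<in> sets M" unfolding E_def by measurable
  define h where "h x = ind E x*(g x \<bullet> q - norm q)" for x
  have i1: "integrable M (%x. ind E x *\<^sub>R g x)" by (rule B_integrable_bound[OF g]) (auto simp: indicator_def)
  have heq: "h x = (ind E x *\<^sub>R g x) \<bullet> q - norm q*ind E x" for x by (auto simp: h_def indicator_def)
  have i2: "integrable M (%x. (ind E x *\<^sub>R g x) \<bullet> q)" by (rule integrable_inner_left) (rule i1)
  have i3: "integrable M (%x. norm q*ind E x)" by (intro integrable_mult_right) (auto simp: integrable_indicator_iff emeasure_eq_measure)
  have hi: "integrable M h" unfolding heq by (rule B_integrable_diff[OF i2 i3])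
  have "integral\<^sup>L M h = (LINT x|M. ind E x *\<^sub>R g x) \<bullet> q - norm q*measure M E"
   unfolding heq B_integral_diff[OF i2 i3] integral_inner_left[OF i1] using E by (simp add: sets.sets_into_space Int_absorb2)
  also have "... <= norm (LINT x|M. ind E x *\<^sub>R g x)*norm q - norm q*measure M E"
   using Cauchy_Schwarz_ineq2[of "LINT x|M. ind E x *\<^sub>R g x" q] by linarith
  also have "... <= 0" using mult_right_mono[OF le[OF E], of "norm q"] by (simp add: mult.commute)
  finally have "integral\<^sup>L M h <= 0" .
  moreover have h0: "AE x in M. 0 <= h x" by (auto simp: h_def E_def indicator_def)
  ultimately have "integral\<^sup>L M h = 0" using integral_nonneg_AE[OF h0] by linarith
  hence "AE x in M. h x = 0" using integral_nonneg_eq_0_iff_AE[OF hi h0] by simp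
  thus ?thesis by (rule AE_mp) (auto simp: h_def E_def indicator_def intro!: AE_I2 split: if_splits)
 qed
 hence "AE x in M. ALL q:D. g x \<bullet> q <= norm q" using D(1) by (subst AE_ball_countable) auto
 thus ?thesis
 proof (rule AE_mp, intro AE_I2 impI)
  fix x assume *: "ALL q:D. g x \<bullet> q <= norm q"
  have "ALL q. g x \<bullet> q <= norm q"
  proof (rule ccontr)
   assume "\<not> ?thesis"
   hence ne: "{q. norm q < g x \<bullet> q} ~= {}" by (auto simp: not_le)
   have "open {q. norm q < g x \<bullet> q}" by (intro open_Collect_less continuous_intros)
   from D(2)[OF this ne] * show False by fastforce
  qed
  hence "g x \<bullet> g x <= norm (g x)" by blast
  hence "norm (g x)*norm (g x) <= 1*norm (g x)" by (simp add: dot_square_norm power2_eq_square)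
  thus "norm (g x) <= 1" by (metis mult_right_le_imp_le norm_ge_zero le_less zero_le_one)
 qed
qed

section \<open>The total variation of a vector measure\<close>

lemma borel_sub_simps [simp]: "borel_sub \<Omega> {}" by (simp add: borel_sub_def)

lemma borel_sub_ops:
 "borel_sub \<Omega> A ==> borel_sub \<Omega> B ==> borel_sub \<Omega> (A \<inter> B)"
 "borel_sub \<Omega> A ==> borel_sub \<Omega> B ==> borel_sub \<Omega> (A - B)"
 "borel_sub \<Omega> A ==> borel_sub \<Omega> B ==> borel_sub \<Omega> (A \<union> B)"
 "(!!n::nat. borel_sub \<Omega> (C n)) ==> borel_sub \<Omega> (\<Union>n. C n)" by (auto simp: borel_sub_def)

lemma borel_sub_finite_UN: "(!!n. n \<in> I ==> borel_sub \<Omega> (C n)) ==> finite I ==> borel_sub \<Omega> (\<Union>n\<in>I. C n)"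
 by (auto simp: borel_sub_def)

locale vmeas =
 fixes \<Omega> :: "'a::euclidean_space set" and \<mu> :: "'a set => 'b::real_normed_vector"
 assumes vm: "vmeasure_on \<Omega> \<mu>"
begin

lemma sums: "(!!n. borel_sub \<Omega> (A n)) ==> disjoint_family A ==> (%n. \<mu> (A n)) sums \<mu> (\<Union>n. A n)"
 using vm unfolding vmeasure_on_def by blast

lemma empty: "\<mu> {} = 0"
proof -
 have "(%n::nat. \<mu> {}) sums \<mu> (\<Union>n::nat. {})" by (rule sums) (auto simp: disjoint_family_on_def)
 hence "(%n::nat. \<mu> {}) \<longlonglongrightarrow> 0" using summable_LIMSEQ_zero sums_summable by blast
 thus ?thesis by (simp add: LIMSEQ_const_iff)
qed

lemma finite_UN: assumes "!!n. n < N ==> borel_sub \<Omega> (A n)" "disjoint_family_on A {..<N::nat}"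
 shows "\<mu> (\<Union>n<N. A n) = (\<Sum>n<N. \<mu> (A n))"
proof -
 define A' where "A' n = (if n < N then A n else {})" for n
 have "(%n. \<mu> (A' n)) sums \<mu> (\<Union>n. A' n)"
  by (rule sums) (use assms in "auto simp: A'_def disjoint_family_on_def")
 moreover have "(%n. \<mu> (A' n)) sums (\<Sum>n<N. \<mu> (A' n))" by (rule sums_finite) (auto simp: A'_def empty)
 moreover have "(\<Union>n. A' n) = (\<Union>n<N. A n)" by (auto simp: A'_def split: if_splits)
 ultimately show ?thesis using sums_unique2 by (fastforce simp: A'_def)
qed

lemma Un: "borel_sub \<Omega> A ==> borel_sub \<Omega> B ==> A \<inter> B = {} ==> \<mu> (A \<union> B) = \<mu> A+\<mu> B"
 using finite_UN[of 2 "%n. if n = 0 then A else B"]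
 by (auto simp: disjoint_family_on_def lessThan_Suc numeral_2_eq_2 Un_commute add.commute Int_commute)

abbreviation tv :: "'a set => ennreal" where "tv \<equiv> total_variation \<Omega> \<mu>"

definition parts :: "'a set => (nat => 'a set) set" where
 "parts E = {A. (ALL n. borel_sub \<Omega> (A n)) & disjoint_family A & (\<Union>n. A n) = E}"

lemma tv_eq: "tv E = (SUP A\<in>parts E. \<Sum>n. ennreal (norm (\<mu> (A n))))"
 by (simp add: total_variation_def parts_def)

lemma trivial_part: assumes "borel_sub \<Omega> E"
 shows "(%n. if n = 0 then E else {}) \<in> parts E" "(\<Sum>n::nat. ennreal (norm (\<mu> (if n = 0 then E else {})))) = ennreal (norm (\<mu> E))"
proof -
 show "(%n. if n = 0 then E else {}) \<in> parts E" using assms by (auto simp: parts_def disjoint_family_on_def)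
 have "(\<Sum>n::nat. ennreal (norm (\<mu> (if n = 0 then E else {})))) = (\<Sum>n\<in>{0::nat}. ennreal (norm (\<mu> (if n = 0 then E else {}))))"
  by (rule suminf_finite) (auto simp: empty)
 thus "(\<Sum>n::nat. ennreal (norm (\<mu> (if n = 0 then E else {})))) = ennreal (norm (\<mu> E))" by simp
qed

lemma norm_le_tv: "borel_sub \<Omega> E ==> ennreal (norm (\<mu> E)) <= tv E"
 unfolding tv_eq trivial_part(2)[symmetric] by (rule SUP_upper) (rule trivial_part(1))

lemma parts_nonempty: "borel_sub \<Omega> E ==> parts E ~= {}" using trivial_part(1) by blast

lemma suminf_swap:
 fixes f :: "nat => nat => ennreal" shows "(\<Sum>m. \<Sum>n. f m n) = (\<Sum>n. \<Sum>m. f m n)"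
 using nn_integral_suminf[of "%n m. f m n" "count_space UNIV"] by (simp add: nn_integral_count_space_nat)

lemma norm_suminf_le: assumes "(f :: nat => 'b) sums s" shows "ennreal (norm s) <= (\<Sum>n. ennreal (norm (f n)))"
proof (rule LIMSEQ_le_const2)
 have "(%n. \<Sum>i<n. f i) \<longlonglongrightarrow> s" using assms by (simp add: sums_def)
 thus "(%n. ennreal (norm (\<Sum>i<n. f i))) \<longlonglongrightarrow> ennreal (norm s)" by (intro tendsto_ennrealI tendsto_norm)
 have "ennreal (norm (\<Sum>i<n. f i)) <= (\<Sum>n. ennreal (norm (f n)))" for n
 proof -
  have "ennreal (norm (\<Sum>i<n. f i)) <= ennreal (\<Sum>i<n. norm (f i))" by (intro ennreal_leI norm_sum)
  also have "... = (\<Sum>i<n. ennreal (norm (f i)))" by (simp add: sum_ennreal)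
  also have "... <= (\<Sum>n. ennreal (norm (f n)))" by (rule sum_le_suminf) auto
  finally show ?thesis .
 qed
 thus "EX N. ALL n>=N. ennreal (norm (\<Sum>i<n. f i)) <= (\<Sum>n. ennreal (norm (f n)))" by blast
qed

lemma tv_UN_le: assumes A: "!!n. borel_sub \<Omega> (A n)" "disjoint_family (A :: nat => 'a set)"
 shows "tv (\<Union>n. A n) <= (\<Sum>n. tv (A n))" unfolding tv_eq[of "\<Union>n. A n"]
proof (rule SUP_least)
 fix B assume "B \<in> parts (\<Union>n. A n)"
 hence B: "!!n. borel_sub \<Omega> (B n)" "disjoint_family B" "(\<Union>n. B n) = (\<Union>n. A n)" by (auto simp: parts_def)
 have "(\<Sum>m. ennreal (norm (\<mu> (B m)))) <= (\<Sum>m. \<Sum>n. ennreal (norm (\<mu> (B m \<inter> A n))))"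
 proof (rule suminf_le)
  fix m
  have "(%n. \<mu> (B m \<inter> A n)) sums \<mu> (\<Union>n. B m \<inter> A n)"
   by (rule sums) (use A B in "auto simp: disjoint_family_on_def intro: borel_sub_ops")
  moreover have "(\<Union>n. B m \<inter> A n) = B m" using B(3) by blast
  ultimately show "ennreal (norm (\<mu> (B m))) <= (\<Sum>n. ennreal (norm (\<mu> (B m \<inter> A n))))"
   using norm_suminf_le by metis
 qed auto
 also have "... = (\<Sum>n. \<Sum>m. ennreal (norm (\<mu> (B m \<inter> A n))))" by (rule suminf_swap)
 also have "... <= (\<Sum>n. tv (A n))"
 proof (rule suminf_le)
  fix n
  have "disjoint_family (%m. B m \<inter> A n)" using B(2) unfolding disjoint_family_on_def by blast
  moreover have "(\<Union>m. B m \<inter> A n) = A n" using B(3) by blast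
  ultimately have "(%m. B m \<inter> A n) \<in> parts (A n)" using A B by (auto simp: parts_def intro: borel_sub_ops)
  thus "(\<Sum>m. ennreal (norm (\<mu> (B m \<inter> A n)))) <= tv (A n)" unfolding tv_eq by (rule SUP_upper)
 qed auto
 finally show "(\<Sum>m. ennreal (norm (\<mu> (B m)))) <= (\<Sum>n. tv (A n))" .
qed

text \<open>Partitions of disjoint sets are flattened into one partition of the union through the
  pairing of natural numbers.\<close>

lemma family_le_tv: assumes A: "disjoint_family (A :: nat => 'a set)" and B: "!!n. B n \<in> parts (A n)"
 shows "(\<Sum>n. \<Sum>m. ennreal (norm (\<mu> (B n m)))) <= tv (\<Union>n. A n)"
proof -
 have B': "borel_sub \<Omega> (B n m)" "disjoint_family (B n)" "(\<Union>m. B n m) = A n" for n m using B by (auto simp: parts_def)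
 define C where "C i = (case prod_decode i of (n, m) => B n m)" for i
 have "C \<in> parts (\<Union>n. A n)" unfolding parts_def
 proof (intro CollectI conjI allI)
  show "borel_sub \<Omega> (C i)" for i using B'(1) by (auto simp: C_def split: prod.split)
  have *: "B n m \<inter> B n' m' = {}" if "(n, m) ~= (n', m')" for n m n' m'
  proof (cases "n = n'")
   case True
   thus ?thesis using that B'(2)[of n] by (auto simp: disjoint_family_on_def)
  next
   case False
   hence "A n \<inter> A n' = {}" using A by (auto simp: disjoint_family_on_def)
   thus ?thesis using B'(3)[of n] B'(3)[of n'] by blast
  qed
  show "disjoint_family C" unfolding disjoint_family_on_def
  proof (intro ballI impI)
   fix i j :: nat assume "i ~= j"
   hence "prod_decode i ~= prod_decode j" by (simp add: prod_decode_eq)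
   moreover obtain n m n' m' where "prod_decode i = (n, m)" "prod_decode j = (n', m')" by (metis surj_pair)
   ultimately show "C i \<inter> C j = {}" using *[of n m n' m'] by (simp add: C_def)
  qed
  show "(\<Union>i. C i) = (\<Union>n. A n)"
  proof (intro set_eqI iffI)
   fix x assume "x \<in> (\<Union>n. A n)"
   then obtain n m where "x \<in> B n m" using B'(3) by blast
   hence "x \<in> C (prod_encode (n, m))" by (simp add: C_def)
   thus "x \<in> (\<Union>i. C i)" by blast
  next
   fix x assume "x \<in> (\<Union>i. C i)"
   then obtain i where "x \<in> C i" by blast
   thus "x \<in> (\<Union>n. A n)" using B'(3) unfolding C_def by (cases "prod_decode i") blast
  qed
 qed
 hence "(\<Sum>i. ennreal (norm (\<mu> (C i)))) <= tv (\<Union>n. A n)" unfolding tv_eq by (rule SUP_upper)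
 moreover have "(\<Sum>i. ennreal (norm (\<mu> (C i)))) = (\<Sum>n. \<Sum>m. ennreal (norm (\<mu> (B n m))))"
  unfolding C_def
  using suminf_ennreal_2dimen[of "%n. \<Sum>m. ennreal (norm (\<mu> (B n m)))" "%(n, m). ennreal (norm (\<mu> (B n m)))"]
  by (simp only: split_def fst_conv snd_conv o_def)
 ultimately show ?thesis by simp
qed

text \<open>One inequality refines a partition of the union by the given sets. The other glues
  partitions that are optimal up to e/2^(n+1), which presupposes that the variation is
  finite.\<close>

lemma tv_UN: assumes A: "!!n. borel_sub \<Omega> (A n)" "disjoint_family (A :: nat => 'a set)"
 shows "(\<Sum>n. tv (A n)) = tv (\<Union>n. A n)"
proof (rule antisym)
 show "(\<Sum>n. tv (A n)) <= tv (\<Union>n. A n)"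
 proof (cases "tv (\<Union>n. A n) = \<infinity>")
  case False
  have single_le: "f n <= (\<Sum>k. f k)" for f :: "nat => ennreal" and n using sum_le_suminf[of f "{n}"] by simp
  have tvA: "tv (A n) <= tv (\<Union>n. A n)" for n unfolding tv_eq[of "A n"]
  proof (rule SUP_least)
   fix B assume B: "B \<in> parts (A n)"
   define B' where "B' k = (if k = n then B else (%j. if j = 0 then A k else {}))" for k
   have "B' k \<in> parts (A k)" for k using B trivial_part(1)[OF A(1)[of k]] by (auto simp: B'_def)
   from family_le_tv[OF A(2) this] have "(\<Sum>k. \<Sum>m. ennreal (norm (\<mu> (B' k m)))) <= tv (\<Union>n. A n)" .
   moreover have "(\<Sum>m. ennreal (norm (\<mu> (B' n m)))) <= (\<Sum>k. \<Sum>m. ennreal (norm (\<mu> (B' k m))))"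
    by (rule single_le)
   ultimately show "(\<Sum>m. ennreal (norm (\<mu> (B m)))) <= tv (\<Union>n. A n)" by (simp add: B'_def)
  qed
  show ?thesis
  proof (rule ennreal_le_epsilon)
   fix e :: real assume e: "e > 0"
   have "EX B:parts (A n). tv (A n) < (\<Sum>m. ennreal (norm (\<mu> (B m))))+ennreal (e*(1/2) ^ Suc n)" for n
   proof (rule SUP_approx_ennreal[OF _ parts_nonempty[OF A(1)] tv_eq])
    show "0 < e*(1/2) ^ Suc n" using e by simp
    show "tv (A n) ~= \<infinity>" using tvA[of n] False by (auto simp: top_unique)
   qed
   then obtain B where B: "!!n. B n \<in> parts (A n)"
    "!!n. tv (A n) < (\<Sum>m. ennreal (norm (\<mu> (B n m))))+ennreal (e*(1/2) ^ Suc n)" by metis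
   have "(\<Sum>n. tv (A n)) <= (\<Sum>n. (\<Sum>m. ennreal (norm (\<mu> (B n m))))+ennreal (e*(1/2) ^ Suc n))"
    by (rule suminf_le) (use B(2) in \<open>blast intro: less_imp_le\<close>, simp_all)
   also have "... = (\<Sum>n. \<Sum>m. ennreal (norm (\<mu> (B n m))))+(\<Sum>n. ennreal (e*(1/2) ^ Suc n))"
    by (rule suminf_add[symmetric]) auto
   also have "(\<Sum>n. ennreal (e*(1/2) ^ Suc n)) = ennreal e"
   proof (rule suminf_ennreal_eq)
    show "(%n. e*(1/2) ^ Suc n) sums e" using sums_mult[OF power_half_series, of e] by simp
   qed (use e in simp)
   finally show "(\<Sum>n. tv (A n)) <= tv (\<Union>n. A n)+ennreal e"
    using family_le_tv[OF A(2) B(1)] by (meson add_right_mono order_trans)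
  qed
 qed simp
qed (rule tv_UN_le[OF A])

lemma tv_empty: "tv {} = 0"
proof -
 have "(\<Sum>n. ennreal (norm (\<mu> (A n)))) = 0" if "A \<in> parts {}" for A
 proof -
  have A: "A n = {}" for n using that by (auto simp: parts_def)
  show ?thesis unfolding A empty by simp
 qed
 hence "tv {} <= 0" unfolding tv_eq by (intro SUP_least) (simp only: order_refl)
 thus ?thesis by simp
qed

lemma tv_Un: assumes "borel_sub \<Omega> A" "borel_sub \<Omega> B" "A \<inter> B = {}"
 shows "tv (A \<union> B) = tv A+tv B"
proof -
 define C where "C n = (if n = 0 then A else if n = Suc 0 then B else {})" for n
 have "(\<Sum>n. tv (C n)) = tv (\<Union>n. C n)"
  by (rule tv_UN) (use assms in "auto simp: C_def disjoint_family_on_def")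
 moreover have "(\<Sum>n. tv (C n)) = (\<Sum>n\<in>{0, Suc 0}. tv (C n))"
  by (rule suminf_finite) (auto simp: C_def tv_empty)
 moreover have "(\<Union>n. C n) = A \<union> B" by (auto simp: C_def split: if_splits)
 ultimately show ?thesis by (simp add: C_def)
qed

end

locale real_vmeas = vmeas \<Omega> \<mu> for \<Omega> :: "'a::euclidean_space set" and \<mu> :: "'a set => real"
begin

text \<open>Grouping the pieces of a partition by sign yields a subset whose measure is so large
  that it and its remainder both have measure at least one in absolute value. One of the two retains
  infinite variation and the other is split off.\<close>

lemma infinite_split: assumes E: "borel_sub \<Omega> E" "tv E = \<infinity>"
 shows "EX A. borel_sub \<Omega> A & A <= E & \<bar>\<mu> A\<bar> >= 1 & tv (E - A) = \<infinity>"
proof -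
 \<comment> \<open>Half of the partition sum, all of one sign, still exceeds the measure of E by 1
   in absolute value, and this surplus is what remains on the other side of the split.\<close>
 define c where "c = 2*(\<bar>\<mu> E\<bar>+1)"
 have "ennreal c < tv E" using E by simp
 then obtain B where B: "B \<in> parts E" "ennreal c < (\<Sum>n. ennreal (norm (\<mu> (B n))))"
  unfolding tv_eq less_SUP_iff by blast
 hence B': "!!n. borel_sub \<Omega> (B n)" "disjoint_family B" "(\<Union>n. B n) = E" by (auto simp: parts_def)
 obtain N where N: "c < (\<Sum>n<N. \<bar>\<mu> (B n)\<bar>)"
 proof -
  have "ennreal c < (SUP N. \<Sum>n<N. ennreal (norm (\<mu> (B n))))" using B(2) by (simp add: suminf_eq_SUP)
  then obtain N where "ennreal c < (\<Sum>n<N. ennreal (norm (\<mu> (B n))))" unfolding less_SUP_iff by blast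
  hence "ennreal c < ennreal (\<Sum>n<N. \<bar>\<mu> (B n)\<bar>)" by (simp add: sum_ennreal)
  moreover have "0 <= c" by (simp add: c_def)
  ultimately show ?thesis using that by (simp only: ennreal_less_iff)
 qed
 define X where "X P = (\<Union>n<N. if P n then B n else {})" for P
 have Xm: "\<mu> (X P) = (\<Sum>n<N. if P n then \<mu> (B n) else 0)" for P unfolding X_def
  by (subst finite_UN) (use B' in "auto simp: disjoint_family_on_def empty intro!: sum.cong")
 have Xb: "borel_sub \<Omega> (X P)" "X P <= E" for P
  unfolding X_def using B' by (auto intro!: borel_sub_finite_UN split: if_splits)
 define P where "P n \<longleftrightarrow> \<mu> (B n) >= 0" for n
 have "(\<Sum>n<N. \<bar>\<mu> (B n)\<bar>) = \<mu> (X P) - \<mu> (X (%n. \<not> P n))"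
  unfolding Xm sum_subtractf[symmetric] by (intro sum.cong) (auto simp: P_def)
 hence "c/2 <= \<bar>\<mu> (X P)\<bar> \<or> c/2 <= \<bar>\<mu> (X (%n. \<not> P n))\<bar>" using N by linarith
 then obtain Q where "c/2 <= \<bar>\<mu> (X Q)\<bar>" by blast
 then obtain Y where Y: "borel_sub \<Omega> Y" "Y <= E" "\<bar>\<mu> E\<bar>+1 <= \<bar>\<mu> Y\<bar>"
  using Xb[of Q] by (auto simp: c_def field_simps)
 have YE: "Y \<union> (E - Y) = E" "Y \<inter> (E - Y) = {}" using Y by auto
 have Zb: "borel_sub \<Omega> (E - Y)" using E Y by (intro borel_sub_ops)
 have "\<mu> E = \<mu> Y+\<mu> (E - Y)" using Un[OF Y(1) Zb YE(2)] YE(1) by simp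
 hence Z1: "\<bar>\<mu> (E - Y)\<bar> >= 1" using Y(3) by linarith
 have "tv Y+tv (E - Y) = \<infinity>" using tv_Un[OF Y(1) Zb YE(2)] YE(1) E(2) by simp
 hence "tv Y = \<infinity> \<or> tv (E - Y) = \<infinity>" by simp
 thus ?thesis
 proof
  assume "tv (E - Y) = \<infinity>"
  thus ?thesis using Y by (intro exI[of _ Y]) auto
 next
  assume "tv Y = \<infinity>"
  moreover have "E - (E - Y) = Y" using Y by auto
  ultimately show ?thesis using Z1 Zb by (intro exI[of _ "E - Y"]) auto
 qed
qed

text \<open>Repeated splitting would produce disjoint sets of measure at least one in absolute
  value, whereas countable additivity makes these measures tend to zero.\<close>

lemma tv_finite: assumes "borel_sub \<Omega> E" shows "tv E < \<infinity>"
proof (rule ccontr)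
 assume "\<not> tv E < \<infinity>"
 hence inf: "tv E = \<infinity>" by (simp add: less_top[symmetric])
 define A where "A X = (SOME A. borel_sub \<Omega> A & A <= X & \<bar>\<mu> A\<bar> >= 1 & tv (X - A) = \<infinity>)" for X
 have A: "borel_sub \<Omega> (A X) & A X <= X & \<bar>\<mu> (A X)\<bar> >= 1 & tv (X - A X) = \<infinity>" if "borel_sub \<Omega> X" "tv X = \<infinity>" for X
  unfolding A_def using someI_ex[OF infinite_split[OF that]] .
 define X where "X n = ((%Y. Y - A Y) ^^ n) E" for n
 have X0: "X 0 = E" and XS: "X (Suc n) = X n - A (X n)" for n by (simp_all add: X_def)
 have X: "borel_sub \<Omega> (X n) & tv (X n) = \<infinity>" for n
 proof (induct n)
  case (Suc n)
  thus ?case using A[of "X n"] by (auto simp: XS intro: borel_sub_ops)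
 qed (use assms inf in "simp add: X0")
 have dec: "X m <= X n" if "n <= m" for n m by (rule lift_Suc_antimono_le[OF _ that]) (auto simp: XS)
 have disj: "A (X n) \<inter> A (X m) = {}" if "n < m" for n m
 proof -
  have "A (X m) <= X (Suc n)" using A[of "X m"] X[of m] dec[of "Suc n" m] that by auto
  thus ?thesis by (auto simp: XS)
 qed
 have "disjoint_family (%n. A (X n))"
  unfolding disjoint_family_on_def using disj by (metis Int_commute linorder_neqE_nat)
 hence "(%n. \<mu> (A (X n))) sums \<mu> (\<Union>n. A (X n))" by (intro sums) (use A X in auto)
 hence "(%n. \<mu> (A (X n))) \<longlonglongrightarrow> 0" using summable_LIMSEQ_zero sums_summable by blast
 hence "\<forall>\<^sub>F n in sequentially. \<bar>\<mu> (A (X n))\<bar> < 1"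
  using order_tendstoD(2)[OF tendsto_rabs_zero, of "%n. \<mu> (A (X n))" sequentially 1] by simp
 then obtain n where "\<bar>\<mu> (A (X n))\<bar> < 1" using eventually_happens'[OF sequentially_bot] by blast
 thus False using A[of "X n"] X[of n] by linarith
qed

end

locale euclidean_vmeas = vmeas \<Omega> \<mu> for \<Omega> :: "'a::euclidean_space set" and \<mu> :: "'a set => 'b::euclidean_space" +
 assumes Omega_borel [measurable]: "\<Omega> \<in> sets borel"
begin

lemma component: "real_vmeas \<Omega> (%E. \<mu> E \<bullet> i)"
 by standard (use sums in "auto simp: vmeasure_on_def intro!: bounded_linear.sums[OF bounded_linear_inner_left]")

lemma tv_finite: "borel_sub \<Omega> E ==> tv E < \<infinity>"
proof -
 assume E: "borel_sub \<Omega> E"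
 have "tv E <= (\<Sum>i\<in>Basis. total_variation \<Omega> (%E. \<mu> E \<bullet> i) E)" unfolding tv_eq
 proof (rule SUP_least)
  fix A assume A: "A \<in> parts E"
  have "(\<Sum>n. ennreal (norm (\<mu> (A n)))) <= (\<Sum>n. \<Sum>i\<in>Basis. ennreal \<bar>\<mu> (A n) \<bullet> i\<bar>)"
  proof (rule suminf_le)
   fix n
   have "ennreal (norm (\<mu> (A n))) <= ennreal (\<Sum>i\<in>Basis. \<bar>\<mu> (A n) \<bullet> i\<bar>)" by (intro ennreal_leI norm_le_l1)
   thus "ennreal (norm (\<mu> (A n))) <= (\<Sum>i\<in>Basis. ennreal \<bar>\<mu> (A n) \<bullet> i\<bar>)" by (simp add: sum_ennreal)
  qed auto
  also have "... = (\<Sum>i\<in>Basis. \<Sum>n. ennreal \<bar>\<mu> (A n) \<bullet> i\<bar>)" by (rule suminf_sum) auto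
  also have "... <= (\<Sum>i\<in>Basis. total_variation \<Omega> (%E. \<mu> E \<bullet> i) E)"
  proof (rule sum_mono)
   fix i :: 'b
   interpret c: real_vmeas \<Omega> "%E. \<mu> E \<bullet> i" by (rule component)
   have "A \<in> c.parts E" using A by (simp add: parts_def c.parts_def)
   hence "(\<Sum>n. ennreal (norm (\<mu> (A n) \<bullet> i))) <= c.tv E" unfolding c.tv_eq by (rule SUP_upper)
   thus "(\<Sum>n. ennreal \<bar>\<mu> (A n) \<bullet> i\<bar>) <= total_variation \<Omega> (%E. \<mu> E \<bullet> i) E" by simp
  qed
  finally show "(\<Sum>n. ennreal (norm (\<mu> (A n)))) <= (\<Sum>i\<in>Basis. total_variation \<Omega> (%E. \<mu> E \<bullet> i) E)" .
 qed
 also have "... < \<infinity>"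
  using real_vmeas.tv_finite[OF component E] by (simp add: ennreal_sum_less_top[simplified])
 finally show ?thesis .
qed

text \<open>The total variation measure is extended by zero to all Borel sets of the space, so that
  later integrals run over the whole space instead of a restricted one.\<close>

definition kappa :: "'a measure" where "kappa = measure_of UNIV (sets borel) (%E. tv (E \<inter> \<Omega>))"

lemma sets_kappa [measurable_cong, simp]: "sets kappa = sets borel" and space_kappa [simp]: "space kappa = UNIV"
 unfolding kappa_def using sets.sigma_algebra_axioms[of "borel :: 'a measure"] sets.space_closed[of "borel :: 'a measure"]
 by (auto simp: sets_measure_of space_measure_of sigma_algebra.sigma_sets_eq)

lemma int_Omega: "E \<in> sets borel ==> borel_sub \<Omega> (E \<inter> \<Omega>)" by (auto simp: borel_sub_def)

lemma emeasure_kappa: "E \<in> sets borel ==> emeasure kappa E = tv (E \<inter> \<Omega>)"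
proof (rule emeasure_measure_of[OF kappa_def])
 show "countably_additive (sets kappa) (%E. tv (E \<inter> \<Omega>))"
 proof (rule countably_additiveI)
  fix A :: "nat => 'a set" assume A: "range A <= sets kappa" "disjoint_family A" "\<Union> (range A) \<in> sets kappa"
  have "(\<Sum>i. tv (A i \<inter> \<Omega>)) = tv (\<Union>i. A i \<inter> \<Omega>)"
   by (rule tv_UN) (use A in "auto simp: int_Omega disjoint_family_on_def")
  thus "(\<Sum>i. tv (A i \<inter> \<Omega>)) = tv (\<Union> (range A) \<inter> \<Omega>)" by simp
 qed
qed (auto simp: positive_def tv_empty)

lemma finite_kappa: "finite_measure kappa"
 by (rule finite_measureI) (use tv_finite[OF int_Omega[of UNIV]] in "auto simp: emeasure_kappa")

lemma norm_le_kappa: "borel_sub \<Omega> E ==> norm (\<mu> E) <= measure kappa E"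
proof -
 interpret finite_measure kappa by (rule finite_kappa)
 assume E: "borel_sub \<Omega> E"
 hence "ennreal (norm (\<mu> E)) <= emeasure kappa E"
  using norm_le_tv[OF E] emeasure_kappa[of E] by (auto simp: borel_sub_def Int_absorb2)
 thus ?thesis by (simp add: emeasure_eq_measure)
qed

lemma sums_cut: assumes A: "range A <= sets borel" "disjoint_family (A :: nat => 'a set)"
 shows "(%n. \<mu> (A n \<inter> \<Omega>)) sums \<mu> ((\<Union>n. A n) \<inter> \<Omega>)"
proof -
 have "(%n. \<mu> (A n \<inter> \<Omega>)) sums \<mu> (\<Union>n. A n \<inter> \<Omega>)"
  by (rule sums) (use A in "auto simp: int_Omega disjoint_family_on_def")
 thus ?thesis by simp
qed

text \<open>Radon-Nikodym is applied to the sum of \<open>kappa\<close> and the component, which is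
  nonnegative because \<open>kappa\<close> dominates; subtracting 1 from its density gives the
  density of the component.\<close>

lemma component_density: assumes i: "i \<in> Basis"
 shows "EX g. integrable kappa g & (ALL E:sets borel. \<mu> (E \<inter> \<Omega>) \<bullet> i = (LINT x|kappa. ind E x*g x))"
proof -
 interpret finite_measure kappa by (rule finite_kappa)
 have b: "\<bar>\<mu> (E \<inter> \<Omega>) \<bullet> i\<bar> <= measure kappa E" if "E \<in> sets borel" for E
 proof -
  have "\<bar>\<mu> (E \<inter> \<Omega>) \<bullet> i\<bar> <= norm (\<mu> (E \<inter> \<Omega>))" using Basis_le_norm[OF i] .
  also have "... <= measure kappa (E \<inter> \<Omega>)" by (rule norm_le_kappa[OF int_Omega[OF that]])
  also have "... <= measure kappa E" using that by (intro finite_measure_mono) auto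
  finally show ?thesis .
 qed
 define N where "N = measure_of UNIV (sets borel) (%E. ennreal (measure kappa E+\<mu> (E \<inter> \<Omega>) \<bullet> i))"
 have sN: "sets N = sets borel" "space N = UNIV"
  unfolding N_def using sets.sigma_algebra_axioms[of "borel :: 'a measure"] sets.space_closed[of "borel :: 'a measure"]
  by (auto simp: sets_measure_of space_measure_of sigma_algebra.sigma_sets_eq)
 have eN: "emeasure N E = ennreal (measure kappa E+\<mu> (E \<inter> \<Omega>) \<bullet> i)" if "E \<in> sets borel" for E
 proof (rule emeasure_measure_of[OF N_def])
  show "countably_additive (sets N) (%E. ennreal (measure kappa E+\<mu> (E \<inter> \<Omega>) \<bullet> i))"
  proof (rule countably_additiveI)
   fix A :: "nat => 'a set" assume A: "range A <= sets N" "disjoint_family A" "\<Union> (range A) \<in> sets N"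
   show "(\<Sum>n. ennreal (measure kappa (A n)+\<mu> (A n \<inter> \<Omega>) \<bullet> i)) = ennreal (measure kappa (\<Union> (range A))+\<mu> (\<Union> (range A) \<inter> \<Omega>) \<bullet> i)"
   proof (rule suminf_ennreal_eq)
    show "0 <= measure kappa (A n)+\<mu> (A n \<inter> \<Omega>) \<bullet> i" for n using b[of "A n"] A(1) sN by force
    show "(%n. measure kappa (A n)+\<mu> (A n \<inter> \<Omega>) \<bullet> i) sums (measure kappa (\<Union> (range A))+\<mu> (\<Union> (range A) \<inter> \<Omega>) \<bullet> i)"
     using A sN by (intro sums_add bounded_linear.sums[OF bounded_linear_inner_left] sums_cut finite_measure_UNION) auto
   qed
  qed
  show "positive (sets N) (%E. ennreal (measure kappa E+\<mu> (E \<inter> \<Omega>) \<bullet> i))" by (simp add: positive_def empty)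
 qed (use that sN in auto)
 have ac: "absolutely_continuous kappa N" unfolding absolutely_continuous_def
 proof
  fix E assume "E \<in> null_sets kappa"
  hence E: "E \<in> sets borel" "measure kappa E = 0" by (auto simp: null_sets_def measure_def)
  thus "E \<in> null_sets N" using b[OF E(1)] eN[OF E(1)] sN by (auto simp: null_sets_def)
 qed
 then obtain h where h: "h \<in> borel_measurable kappa" "density kappa h = N" using Radon_Nikodym[OF ac] sN by auto
 have Nfin: "finite_measure N" by (rule finite_measureI) (simp add: sN eN)
 have hint: "(\<integral>\<^sup>+x. h x*ind E x \<partial>kappa) = emeasure N E" if "E \<in> sets borel" for E
  using h that by (simp add: emeasure_density flip: h(2))
 have "(\<integral>\<^sup>+x. h x \<partial>kappa) ~= \<infinity>" using hint[of UNIV] eN[of UNIV] by simp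
 hence hfin: "AE x in kappa. h x ~= \<infinity>" using h(1) nn_integral_PInf_AE by blast
 have [measurable]: "h \<in> Borel" using h(1) by (simp cong: measurable_cong_sets)
 define k where "k x = enn2real (h x)" for x
 have kh: "AE x in kappa. ennreal (k x) = h x" using hfin by eventually_elim (simp add: k_def less_top[symmetric])
 have kE: "has_bochner_integral kappa (%x. ind E x*k x) (measure kappa E+\<mu> (E \<inter> \<Omega>) \<bullet> i)" if E: "E \<in> sets borel" for E
 proof (rule has_bochner_integral_nn_integral)
  note [measurable] = E
  show "(%x. ind E x*k x) \<in> borel_measurable kappa" unfolding k_def by measurable
  show "AE x in kappa. 0 <= ind E x*k x" by (auto simp: k_def)
  show "0 <= measure kappa E+\<mu> (E \<inter> \<Omega>) \<bullet> i" using b[OF E] by linarith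
  have "(\<integral>\<^sup>+x. ennreal (ind E x*k x) \<partial>kappa) = (\<integral>\<^sup>+x. h x*ind E x \<partial>kappa)"
   by (rule nn_integral_cong_AE) (use kh in eventually_elim, auto simp: indicator_def)
  thus "(\<integral>\<^sup>+x. ennreal (ind E x*k x) \<partial>kappa) = ennreal (measure kappa E+\<mu> (E \<inter> \<Omega>) \<bullet> i)"
   using hint[OF E] eN[OF E] by simp
 qed
 have ki: "integrable kappa k" using kE[of UNIV] by (auto simp: has_bochner_integral_iff)
 show ?thesis
 proof (intro exI[of _ "%x. k x - 1"] conjI ballI)
  show "integrable kappa (%x. k x - 1)" using ki by auto
  fix E :: "'a set" assume E: "E \<in> sets borel"
  have i1: "integrable kappa (ind E :: 'a => real)" using E by (simp add: integrable_indicator_iff emeasure_eq_measure)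
  have "(LINT x|kappa. ind E x*(k x - 1)) = (LINT x|kappa. ind E x*k x - ind E x)" by (simp add: right_diff_distrib)
  also have "... = (measure kappa E+\<mu> (E \<inter> \<Omega>) \<bullet> i) - measure kappa E"
   using kE[OF E] i1 E by (subst B_integral_diff) (auto simp: has_bochner_integral_iff)
  finally show "\<mu> (E \<inter> \<Omega>) \<bullet> i = (LINT x|kappa. ind E x*(k x - 1))" by simp
 qed
qed

text \<open>The components are assembled, and domination of the measure by its variation on every
  set becomes a pointwise bound through \<open>AE_density_norm_le_1\<close>.\<close>

lemma density:
 obtains g :: "'a => 'b" where "integrable kappa g" "!!E. E \<in> sets borel ==> \<mu> (E \<inter> \<Omega>) = (LINT x|kappa. ind E x *\<^sub>R g x)"
  "AE x in kappa. norm (g x) <= 1"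
proof -
 obtain h where h: "!!i. i \<in> Basis ==> integrable kappa (h i)"
  "!!i E. i \<in> Basis ==> E \<in> sets borel ==> \<mu> (E \<inter> \<Omega>) \<bullet> i = (LINT x|kappa. ind E x*h i x)"
  using component_density by metis
 define g where "g x = (\<Sum>i\<in>Basis. h i x *\<^sub>R i)" for x
 have gi: "integrable kappa g" unfolding g_def by (intro B_integrable_sum integrable_scaleR_left h) auto
 have gE: "integrable kappa (%x. ind E x *\<^sub>R g x)" if "E \<in> sets borel" for E
  by (rule B_integrable_bound[OF gi]) (use that gi in "auto simp: indicator_def")
 have eq: "\<mu> (E \<inter> \<Omega>) = (LINT x|kappa. ind E x *\<^sub>R g x)" if E: "E \<in> sets borel" for E
 proof (rule euclidean_eqI)
  fix i :: 'b assume i: "i \<in> Basis"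
  have "(LINT x|kappa. ind E x *\<^sub>R g x) \<bullet> i = (LINT x|kappa. (ind E x *\<^sub>R g x) \<bullet> i)"
   using gE[OF E] by (rule integral_inner_left[symmetric])
  also have "(%x. (ind E x *\<^sub>R g x) \<bullet> i) = (%x. ind E x*h i x)"
   using i by (simp add: g_def inner_sum_left inner_Basis if_distrib cong: if_cong)
  finally show "\<mu> (E \<inter> \<Omega>) \<bullet> i = (LINT x|kappa. ind E x *\<^sub>R g x) \<bullet> i" using h(2)[OF i E] by simp
 qed
 have "AE x in kappa. norm (g x) <= 1"
 proof (rule AE_density_norm_le_1[OF finite_kappa gi])
  interpret finite_measure kappa by (rule finite_kappa)
  fix E assume "E \<in> sets kappa"
  hence E: "E \<in> sets borel" by simp
  have "norm (\<mu> (E \<inter> \<Omega>)) <= measure kappa (E \<inter> \<Omega>)" by (rule norm_le_kappa[OF int_Omega[OF E]])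
  also have "... <= measure kappa E" using E by (intro finite_measure_mono) auto
  finally show "norm (LINT x|kappa. ind E x *\<^sub>R g x) <= measure kappa E" using eq[OF E] by simp
 qed
 thus ?thesis using that gi eq by blast
qed

end

section \<open>Smooth test functions\<close>

text \<open>The Hahn decomposition is explicit: the supremum over subsets of E is attained on the
  part of E where g is positive. \<open>ennreal\<close> sends negative numbers to 0, so
  \<open>ennreal (g x)\<close> already is the positive part.\<close>

lemma pos_meas_density:
 fixes kappa :: "'a::euclidean_space measure" and \<mu> :: "'a set => real"
 assumes fin: "finite_measure kappa" and s [measurable_cong, simp]: "sets kappa = sets borel" and g: "integrable kappa g"
  and Om [measurable]: "\<Omega> \<in> sets borel"
  and mu: "!!E. borel_sub \<Omega> E ==> \<mu> E = (LINT x|kappa. ind E x*g x)"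
 shows "pos_meas \<Omega> \<mu> = restrict_space (density kappa (%x. ennreal (g x))) \<Omega>"
proof -
 have sp: "space kappa = UNIV" using sets_eq_imp_space_eq[OF s] by simp
 have gm: "g \<in> borel_measurable kappa" using g by auto
 hence [measurable]: "g \<in> Borel" by (simp cong: measurable_cong_sets)
 define R where "R = restrict_space (density kappa (%x. ennreal (g x))) \<Omega>"
 have spR: "space R = \<Omega>" by (simp add: R_def space_restrict_space sp)
 have seR: "sets R = {E. borel_sub \<Omega> E}"
 proof
  show "sets R <= {E. borel_sub \<Omega> E}" by (auto simp: R_def sets_restrict_space borel_sub_def)
  show "{E. borel_sub \<Omega> E} <= sets R"
  proof
   fix E assume "E \<in> {E. borel_sub \<Omega> E}"
   hence "E = \<Omega> \<inter> E" "E \<in> sets kappa" by (auto simp: borel_sub_def)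
   thus "E \<in> sets R" unfolding R_def sets_restrict_space by (simp only: sets_density) (rule image_eqI)
  qed
 qed
 have ig: "integrable kappa (%x. ind E x*g x)" if "E \<in> sets borel" for E
  by (rule B_integrable_bound[OF g]) (use that in "auto simp: indicator_def")
 have em: "emeasure R E = (SUP F \<in> {F. borel_sub \<Omega> F & F <= E}. ennreal (\<mu> F))" if E: "borel_sub \<Omega> E" for E
 proof (rule antisym)
  have Eb: "E \<in> sets borel" "E <= \<Omega>" using E by (auto simp: borel_sub_def)
  have eR: "emeasure R E = (\<integral>\<^sup>+x. ennreal (g x)*ind E x \<partial>kappa)"
   unfolding R_def using Eb by (subst emeasure_restrict_space) (auto simp: emeasure_density)
  define F where "F = E \<inter> {x. g x > 0}"
  have Fb: "F \<in> sets borel" "borel_sub \<Omega> F" "F <= E" using Eb by (auto simp: F_def borel_sub_def)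
  have "(\<integral>\<^sup>+x. ennreal (g x)*ind E x \<partial>kappa) = (\<integral>\<^sup>+x. ennreal (ind F x*g x) \<partial>kappa)"
   by (intro nn_integral_cong) (auto simp: F_def indicator_def ennreal_neg)
  also have "... = ennreal (\<mu> F)"
   unfolding mu[OF Fb(2)] by (rule nn_integral_eq_integral[OF ig[OF Fb(1)]]) (auto simp: F_def indicator_def)
  also have "... <= (SUP F \<in> {F. borel_sub \<Omega> F & F <= E}. ennreal (\<mu> F))" using Fb by (intro SUP_upper) auto
  finally show "emeasure R E <= (SUP F \<in> {F. borel_sub \<Omega> F & F <= E}. ennreal (\<mu> F))" unfolding eR .
  show "(SUP F \<in> {F. borel_sub \<Omega> F & F <= E}. ennreal (\<mu> F)) <= emeasure R E"
  proof (rule SUP_least)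
   fix F' assume "F' \<in> {F. borel_sub \<Omega> F & F <= E}"
   hence F': "borel_sub \<Omega> F'" "F' <= E" "F' \<in> sets borel" by (auto simp: borel_sub_def)
   have "\<mu> F' <= \<mu> F" unfolding mu[OF F'(1)] mu[OF Fb(2)]
    by (rule integral_mono[OF ig[OF F'(3)] ig[OF Fb(1)]]) (use F'(2) in "auto simp: F_def indicator_def")
   hence "ennreal (\<mu> F') <= ennreal (\<mu> F)" by (rule ennreal_leI)
   also have "... = (\<integral>\<^sup>+x. ennreal (ind F x*g x) \<partial>kappa)"
    unfolding mu[OF Fb(2)] by (rule nn_integral_eq_integral[OF ig[OF Fb(1)], symmetric]) (auto simp: F_def indicator_def)
   also have "... = emeasure R E" unfolding eR by (intro nn_integral_cong) (auto simp: F_def indicator_def ennreal_neg)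
   finally show "ennreal (\<mu> F') <= emeasure R E" .
  qed
 qed
 have "pos_meas \<Omega> \<mu> = measure_of (space R) (sets R) (%E. SUP F \<in> {F. borel_sub \<Omega> F & F <= E}. ennreal (\<mu> F))"
  by (simp add: pos_meas_def spR seR)
 also have "... = measure_of (space R) (sets R) (emeasure R)"
  by (rule measure_of_eq[OF sets.space_closed]) (use em seR sets.sigma_sets_eq[of R] in auto)
 also have "... = R" by (rule measure_of_of_measure)
 finally show ?thesis by (simp add: R_def)
qed

lemma sm_integral_density:
 fixes kappa :: "'a::euclidean_space measure" and \<mu> :: "'a set => real"
 assumes fin: "finite_measure kappa" and s [measurable_cong, simp]: "sets kappa = sets borel" and g: "integrable kappa g"
  and Om [measurable]: "\<Omega> \<in> sets borel"
  and mu: "!!E. borel_sub \<Omega> E ==> \<mu> E = (LINT x|kappa. ind E x*g x)"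
  and phi [measurable]: "ph \<in> Borel" and B: "!!x. \<bar>ph x\<bar> <= B"
 shows "sm_integral \<Omega> \<mu> ph = (LINT x|kappa. ind \<Omega> x*ph x*g x)"
proof -
 have gm: "g \<in> borel_measurable kappa" using g by auto
 hence [measurable]: "g \<in> Borel" by (simp cong: measurable_cong_sets)
 have sp: "space kappa = UNIV" using sets_eq_imp_space_eq[OF s] by simp
 have half: "integral\<^sup>L (pos_meas \<Omega> \<mu>) ph = (LINT x|kappa. max 0 (g x)*(ind \<Omega> x*ph x))"
  if g: "integrable kappa g" and mu: "!!E. borel_sub \<Omega> E ==> \<mu> E = (LINT x|kappa. ind E x*g x)"
   and [measurable]: "g \<in> Borel" for g :: "'a => real" and \<mu>
 proof -
  have eq: "(%x. ennreal (g x)) = (%x. ennreal (max 0 (g x)))" by (auto simp: fun_eq_iff max_def ennreal_neg)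
  have "integral\<^sup>L (pos_meas \<Omega> \<mu>) ph = (LINT x|density kappa (%x. ennreal (max 0 (g x))). ind \<Omega> x*ph x)"
  proof -
   have "pos_meas \<Omega> \<mu> = restrict_space (density kappa (%x. ennreal (g x))) \<Omega>"
    by (rule pos_meas_density[OF fin s g Om]) (rule mu)
   thus ?thesis unfolding eq by (simp add: integral_restrict_space sp)
  qed
  also have "... = (LINT x|kappa. max 0 (g x)*(ind \<Omega> x*ph x))" by (subst integral_density) auto
  finally show ?thesis .
 qed
 have h1: "integral\<^sup>L (pos_meas \<Omega> \<mu>) ph = (LINT x|kappa. max 0 (g x)*(ind \<Omega> x*ph x))"
  by (rule half[OF g mu]) auto
 have "integrable kappa (%x. - g x)" using g by simp
 hence h2: "integral\<^sup>L (pos_meas \<Omega> (%E. - \<mu> E)) ph = (LINT x|kappa. max 0 (- g x)*(ind \<Omega> x*ph x))"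
  by (rule half) (auto simp: mu)
 have i: "integrable kappa (%x. max 0 (c*g x)*(ind \<Omega> x*ph x))" if "\<bar>c\<bar> = 1" for c
 proof (rule B_integrable_bound[OF integrable_mult_right[OF g, of "B"]])
  show "AE x in kappa. norm (max 0 (c*g x)*(ind \<Omega> x*ph x)) <= norm (B*g x)"
  proof (rule AE_I2)
   fix x
   have m: "\<bar>max 0 (c*g x)\<bar> <= \<bar>g x\<bar>" using that by (auto simp: max_def abs_if split: if_splits)
   have p: "\<bar>ind \<Omega> x*ph x\<bar> <= \<bar>B\<bar>" using B[of x] by (auto simp: indicator_def)
   show "norm (max 0 (c*g x)*(ind \<Omega> x*ph x)) <= norm (B*g x)"
    using mult_mono[OF m p] by (simp add: abs_mult mult.commute)
  qed
 qed measurable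
 have "sm_integral \<Omega> \<mu> ph = (LINT x|kappa. max 0 (1*g x)*(ind \<Omega> x*ph x)) - (LINT x|kappa. max 0 ((-1)*g x)*(ind \<Omega> x*ph x))"
  by (simp add: sm_integral_def h1 h2)
 also have "... = (LINT x|kappa. max 0 (1*g x)*(ind \<Omega> x*ph x) - max 0 ((-1)*g x)*(ind \<Omega> x*ph x))"
  by (rule B_integral_diff[symmetric]) (rule i, simp)+
 also have "... = (LINT x|kappa. ind \<Omega> x*ph x*g x)" by (rule B_integral_cong) (auto simp: max_def)
 finally show ?thesis .
qed

section \<open>Flat functions and smooth bumps\<close>

definition Ep :: "real poly => real => real" where
 "Ep p t = (if t > 0 then poly p (1/t)*exp (- (1/t)) else 0)"

lemma poly_times_exp_tendsto_0: "((%z. poly p z*exp (- z)) \<longlongrightarrow> (0::real)) at_top"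
proof -
 have "((%z. \<Sum>i\<le>degree p. coeff p i*(z ^ i/exp z)) \<longlongrightarrow> (\<Sum>i\<le>degree p. coeff p i*0)) at_top"
  by (intro tendsto_intros tendsto_power_div_exp_0)
 thus ?thesis by (simp add: poly_altdef sum_distrib_right exp_minus divide_inverse mult.assoc)
qed

text \<open>In the variable z = 1/t the derivative replaces p by z^2 (p - p'), so the family is
  closed under differentiation. At 0 the exponential beats every polynomial.\<close>

lemma Ep_derivative: "(Ep p has_real_derivative Ep ([:0, 0, 1:]*(p - pderiv p)) t) (at t)"
proof (cases t "0::real" rule: linorder_cases)
 case less
 have "((%t. 0) has_real_derivative Ep ([:0, 0, 1:]*(p - pderiv p)) t) (at t)" using less by (simp add: Ep_def)
 thus ?thesis by (rule DERIV_cong_ev[THEN iffD2, rotated -1, OF _ refl _ refl])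
    (use less in \<open>auto simp: Ep_def eventually_nhds intro!: exI[of _ "{..<0}"]\<close>)
next
 case greater
 have "((%t. poly p (1/t)*exp (- (1/t))) has_real_derivative
   (poly (pderiv p) (1/t)*(- 1/t\<^sup>2))*exp (- (1/t))+(exp (- (1/t))*(1/t\<^sup>2))*poly p (1/t)) (at t)"
 proof (rule DERIV_mult)
  have 1: "((%t. 1/t) has_real_derivative - 1/t\<^sup>2) (at t)"
   using greater by (auto intro!: derivative_eq_intros simp: power2_eq_square)
  show "((%t. poly p (1/t)) has_real_derivative poly (pderiv p) (1/t)*(- 1/t\<^sup>2)) (at t)"
   by (rule DERIV_chain2[OF poly_DERIV 1])
  show "((%t. exp (- (1/t))) has_real_derivative exp (- (1/t))*(1/t\<^sup>2)) (at t)"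
   by (rule DERIV_chain2[OF DERIV_exp]) (use DERIV_minus[OF 1] in simp)
 qed
 moreover have "(poly (pderiv p) (1/t)*(- 1/t\<^sup>2))*exp (- (1/t))+(exp (- (1/t))*(1/t\<^sup>2))*poly p (1/t)
   = Ep ([:0, 0, 1:]*(p - pderiv p)) t" using greater by (simp add: Ep_def field_simps power2_eq_square)
 ultimately have "((%t. poly p (1/t)*exp (- (1/t))) has_real_derivative Ep ([:0, 0, 1:]*(p - pderiv p)) t) (at t)"
  by simp
 thus ?thesis by (rule DERIV_cong_ev[THEN iffD2, rotated -1, OF _ refl _ refl])
    (use greater in \<open>auto simp: Ep_def eventually_nhds intro!: exI[of _ "{0<..}"]\<close>)
next
 case equal
 have "((%h. poly (pCons 0 p) (inverse h)*exp (- inverse h)) \<longlongrightarrow> 0) (at_right (0::real))"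
  by (rule filterlim_compose[OF poly_times_exp_tendsto_0 filterlim_inverse_at_top_right])
 hence r: "((%h. (Ep p (0+h) - Ep p 0)/h) \<longlongrightarrow> 0) (at_right 0)" by (rule Lim_transform_eventually)
    (auto simp: Ep_def eventually_at_filter field_simps intro!: always_eventually)
 have "((%h. 0) \<longlongrightarrow> (0::real)) (at_left (0::real))" by simp
 hence l: "((%h. (Ep p (0+h) - Ep p 0)/h) \<longlongrightarrow> 0) (at_left 0)"
  by (rule Lim_transform_eventually) (auto simp: Ep_def eventually_at_filter intro!: always_eventually)
 have "((%h. (Ep p (0+h) - Ep p 0)/h) \<longlongrightarrow> 0) (at 0)" using l r by (rule filterlim_split_at)
 thus ?thesis using equal by (simp add: DERIV_def Ep_def)
qed

text \<open>This class is closed under partial derivatives, which turns smoothness into an induction.\<close>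
inductive radial :: "real => ('b::euclidean_space => real) => bool" for epsilon where
 base: "radial epsilon (%x. Ep p (epsilon\<^sup>2 - x \<bullet> x))"
| coord: "radial epsilon f ==> radial epsilon (%x. (x \<bullet> v)*f x)"
| add: "radial epsilon f ==> radial epsilon g ==> radial epsilon (%x. f x+g x)"
| scale: "radial epsilon f ==> radial epsilon (%x. c*f x)"

lemma radial_C1: "radial epsilon f ==> EX G. C1 f G & (ALL v. radial epsilon (%x. G x \<bullet> v))"
proof (induct rule: radial.induct)
 case (base p)
 let ?p = "[:0, 0, 1:]*(p - pderiv p)"
 have c: "continuous_on UNIV (Ep q)" for q by (intro continuous_at_imp_continuous_on ballI DERIV_isCont[OF Ep_derivative])
 have "C1 (%x. Ep p (epsilon\<^sup>2 - x \<bullet> x)) (%x. Ep ?p (epsilon\<^sup>2 - x \<bullet> x) *\<^sub>R (0 - 2 *\<^sub>R x))"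
  by (rule C1_compose[OF C1_diff[OF C1_const C1_inner_self] Ep_derivative c])
 moreover have "radial epsilon (%x. (-2)*((x \<bullet> v)*Ep ?p (epsilon\<^sup>2 - x \<bullet> x)))" for v by (intro radial.intros)
 hence "radial epsilon (%x. (Ep ?p (epsilon\<^sup>2 - x \<bullet> x) *\<^sub>R (0 - 2 *\<^sub>R x)) \<bullet> v)" for v by (simp add: mult.commute mult.left_commute)
 ultimately show ?case by blast
next
 case (coord f w)
 then obtain G where G: "C1 f G" "!!v. radial epsilon (%x. G x \<bullet> v)" by blast
 have "C1 (%x. x \<bullet> w) (%x. w)" by (auto simp: C1_def inner_commute intro!: derivative_eq_intros)
 from C1_mult[OF this G(1)] have "C1 (%x. (x \<bullet> w)*f x) (%x. (x \<bullet> w) *\<^sub>R G x+f x *\<^sub>R w)" .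
 moreover have "radial epsilon (%x. (x \<bullet> w)*(G x \<bullet> v)+(w \<bullet> v)*f x)" for v by (intro radial.intros coord G)
 hence "radial epsilon (%x. ((x \<bullet> w) *\<^sub>R G x+f x *\<^sub>R w) \<bullet> v)" for v by (simp add: inner_add_left mult.commute)
 ultimately show ?case by blast
next
 case (add f g)
 then obtain G H where "C1 f G" "!!v. radial epsilon (%x. G x \<bullet> v)" "C1 g H" "!!v. radial epsilon (%x. H x \<bullet> v)" by blast
 thus ?case by (intro exI[of _ "%x. G x+H x"]) (auto simp: inner_add_left intro!: C1_add radial.add)
next
 case (scale f c)
 then obtain G where G: "C1 f G" "!!v. radial epsilon (%x. G x \<bullet> v)" by blast
 from C1_mult[OF C1_const G(1), of c] show ?case
  by (intro exI[of _ "%x. c *\<^sub>R G x"]) (auto intro!: radial.scale G)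
qed

lemma radial_support: "radial epsilon f ==> epsilon > 0 ==> x \<notin> cball 0 epsilon ==> f x = 0"
proof (induct rule: radial.induct)
 case (base p)
 hence "epsilon\<^sup>2 <= (norm x)\<^sup>2" by (intro power_mono) auto
 thus ?case by (simp add: Ep_def power2_norm_eq_inner)
qed auto

lemma smooth_bump: assumes e: "epsilon > 0"
 obtains theta :: "'b::euclidean_space => real" and K where "!!vs. set vs <= Basis ==> EX G. C1 (pderivs vs theta) G"
  "!!vs x. set vs <= Basis ==> x \<notin> cball 0 epsilon ==> pderivs vs theta x = 0"
  "!!x. theta x >= 0" "(LI x. theta x) > 0"
proof -
 define theta where "theta x = Ep 1 (epsilon\<^sup>2 - x \<bullet> x)" for x :: 'b
 have pd: "radial epsilon (pderivs vs theta)" for vs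
 proof (induct vs)
  case Nil show ?case unfolding pderivs.simps theta_def by (rule radial.base)
 next
  case (Cons v vs)
  then obtain G where "C1 (pderivs vs theta) G" "radial epsilon (%x. G x \<bullet> v)" using radial_C1 by blast
  thus ?case by (simp add: C1_frechet)
 qed
 obtain G where G: "C1 theta G" using radial_C1[OF pd[of "[]"]] by auto
 have z: "theta x = 0" if "x \<notin> cball 0 epsilon" for x using radial_support[OF pd[of "[]"] e that] by simp
 have nn: "theta x >= 0" for x by (simp add: theta_def Ep_def)
 have n0: "theta 0 ~= 0" using e by (simp add: theta_def Ep_def)
 have int: "integ theta" by (rule integrable_compact_support[OF C1_continuous[OF G] compact_cball z])
 have pos: "(LI x. theta x) > 0" by (rule integral_pos_continuous[OF C1_continuous[OF G] int nn n0])
 show ?thesis by (rule that[of theta]) (use radial_C1[OF pd] radial_support[OF pd e] nn pos in blast)+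
qed

lemma pderivs_cv:
 fixes theta :: "'b::euclidean_space => real" assumes f: "integ f"
  and th: "!!vs. set vs <= Basis ==> EX G. C1 (pderivs vs theta) G"
  and z: "!!vs x. set vs <= Basis ==> x \<notin> cball 0 epsilon ==> pderivs vs theta x = 0" and vs: "set vs <= Basis"
 shows "pderivs vs (cv f theta) = cv f (pderivs vs theta)" using vs
proof (induct vs)
 case (Cons v vs)
 hence vs: "set vs <= Basis" and IH: "pderivs vs (cv f theta) = cv f (pderivs vs theta)" by auto
 obtain G where G: "C1 (pderivs vs theta) G" using th[OF vs] by blast
 have G0: "!!x. x \<notin> cball 0 epsilon ==> G x = 0" using C1_zero_outside[OF G closed_cball z[OF vs]] by blast
 obtain B where B: "!!x. norm (G x) <= B"
  using bounded_compact_support[OF C1_continuous_grad[OF G] compact_cball G0] by blast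
 have Gm: "G \<in> Borel" using G by measurable
 have "pderivs (v # vs) (cv f theta) x = cv f (pderivs (v # vs) theta) x" for x
 proof -
  have "pderivs (v # vs) (cv f theta) x = cv f G x \<bullet> v"
   by (simp only: pderivs.simps IH C1_frechet[OF C1_cv[OF f G compact_cball z[OF vs]]])
  also have "... = (LI y. (f y *\<^sub>R G (x - y)) \<bullet> v)"
   unfolding cv_def by (rule integral_inner_left[symmetric]) (rule cv_integrable_point[OF f Gm B])
  also have "... = cv f (pderivs (v # vs) theta) x" unfolding cv_def pderivs.simps C1_frechet[OF G] by simp
  finally show ?thesis .
 qed
 thus ?case by blast
qed simp

lemma test_function_cv:
 fixes theta :: "'b::euclidean_space => real" assumes f: "integ f" "!!x. x \<notin> K ==> f x = 0"
  and th: "!!vs. set vs <= Basis ==> EX G. C1 (pderivs vs theta) G"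
  and z: "!!vs x. set vs <= Basis ==> x \<notin> cball 0 epsilon ==> pderivs vs theta x = 0"
  and K': "compact K'" "K' <= \<Omega>" "!!x y. x \<in> K ==> norm y <= epsilon ==> x+y \<in> K'"
 shows "test_function \<Omega> (cv f theta)" "!!x. x \<notin> K' ==> cv f theta x = 0"
proof -
 show z': "cv f theta x = 0" if x: "x \<notin> K'" for x
 proof -
  have z0: "f y *\<^sub>R theta (x - y) = 0" for y
  proof (cases "y \<in> K")
   case True
   have "\<not> norm (x - y) <= epsilon" using K'(3)[OF True, of "x - y"] x by auto
   thus ?thesis using z[of "[]" "x - y"] by simp
  qed (simp add: f(2))
  show ?thesis unfolding cv_def z0 by simp
 qed
 have sub: "closure {x. cv f theta x ~= 0} <= K'"
  by (rule closure_minimal) (use z' K'(1) in "auto intro: compact_imp_closed")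
 show "test_function \<Omega> (cv f theta)" unfolding test_function_def
 proof (intro conjI allI impI)
  fix vs :: "'b list" assume vs: "set vs <= Basis"
  obtain G where G: "C1 (pderivs vs theta) G" using th[OF vs] by blast
  show "pderivs vs (cv f theta) differentiable_on UNIV"
  proof -
   have eq: "pderivs vs (cv f theta) = cv f (pderivs vs theta)" by (rule pderivs_cv[OF f(1) th z vs])
   have "C1 (cv f (pderivs vs theta)) (cv f G)" by (rule C1_cv[OF f(1) G compact_cball[of 0 epsilon] z[OF vs]])
   from C1_derivative[OF this] show ?thesis unfolding eq differentiable_on_def differentiable_def by blast
  qed
 next
  show "compact (closure {x. cv f theta x ~= 0})"
   using sub K'(1) by (meson bounded_closure_image bounded_subset closed_closure compact_eq_bounded_closed)
  show "closure {x. cv f theta x ~= 0} <= \<Omega>" using sub K'(2) by blast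
 qed
qed

lemma average_close:
 fixes h :: "'b::euclidean_space => 'c::{banach,second_countable_topology}"
 assumes th: "!!x. theta x >= 0" "integ theta" "integral\<^sup>L lborel theta = 1" "!!x. x \<notin> cball 0 epsilon ==> theta x = 0"
  and i: "integ (%y. theta (x - y) *\<^sub>R h y)" and close: "!!y. norm (x - y) <= epsilon ==> norm (h y - h x) <= e"
 shows "norm ((LI y. theta (x - y) *\<^sub>R h y) - h x) <= e"
proof -
 have [measurable]: "theta \<in> Borel" using th(2) by auto
 have ti: "integ (%y. theta (x - y))" by (rule lborel_integrable_reflect[OF th(2)])
 have one: "(LI y. theta (x - y)) = 1" by (subst lborel_integral_reflect) (auto simp: th(3))
 have "(LI y. theta (x - y) *\<^sub>R h y) - h x = (LI y. theta (x - y) *\<^sub>R h y) - (LI y. theta (x - y) *\<^sub>R h x)"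
  using ti one by simp
 also have "... = (LI y. theta (x - y) *\<^sub>R h y - theta (x - y) *\<^sub>R h x)"
  by (rule B_integral_diff[symmetric]) (use i ti in auto)
 also have "norm ... <= (LI y. e*theta (x - y))"
 proof (rule B_integral_norm_bound_integral)
  show "norm (theta (x - y) *\<^sub>R h y - theta (x - y) *\<^sub>R h x) <= e*theta (x - y)" for y
  proof (cases "norm (x - y) <= epsilon")
   case True
   have "theta (x - y)*norm (h y - h x) <= theta (x - y)*e" by (rule mult_left_mono[OF close[OF True] th(1)])
   thus ?thesis using th(1)[of "x - y"] by (simp add: scaleR_diff_right[symmetric] mult.commute)
  next
   case False
   thus ?thesis using th(4)[of "x - y"] by simp
  qed
 qed (use i ti in auto)
 also have "... = e" using one by simp
 finally show ?thesis .
qed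

text \<open>Convolution with a smooth kernel converges to the function and to its gradient,
  uniformly in both cases. The compact set K' is fixed before e, so that uniform errors can be
  integrated over it.\<close>

lemma smooth_approx:
 fixes ph :: "'b::euclidean_space => real"
 assumes phi: "C1 ph g" "compact K" "K <= \<Omega>" "!!x. x \<notin> K ==> ph x = 0" and Om: "open \<Omega>"
 obtains K' where "compact K'" "K' <= \<Omega>" "!!e. e > 0 ==> EX \<psi> G. test_function \<Omega> \<psi> & C1 \<psi> G &
  (ALL x. \<bar>\<psi> x - ph x\<bar> <= e) & (ALL x. norm (G x - g x) <= e) & (ALL x. x \<notin> K' --> \<psi> x = 0)"
proof (cases "K = {}")
 case True
 hence p0: "ph = (%x. 0)" using phi(4) by auto
 hence "g x = 0" for x using C1_zero_outside[OF phi(1) closed_empty] by simp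
 hence g0: "g = (%x. 0)" by auto
 have pz: "pderivs vs (%x::'b. 0) = (%x. 0)" for vs
 proof (induct vs)
  case (Cons v vs)
  thus ?case by (simp add: C1_frechet[OF C1_const])
 qed simp
 have "test_function \<Omega> (%x::'b. 0)" by (auto simp: test_function_def pz)
 thus ?thesis by (intro that[of "{}"]) (auto simp: p0 g0 intro!: exI[of _ "%x. 0"] C1_const)
next
 case False
 have g0: "!!x. x \<notin> K ==> g x = 0"
  using C1_zero_outside[OF phi(1) compact_imp_closed[OF phi(2)] phi(4)] by blast
 obtain d where d: "d > 0" "{x. infdist x K <= d} <= \<Omega>"
  using compact_in_open_separated[OF False phi(2) Om phi(3)] by blast
 define K' where "K' = {x. infdist x K <= d}"
 have K': "compact K'" unfolding K'_def by (rule compact_infdist_le[OF False phi(2) d(1)])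
 have uc: "uniformly_continuous_on UNIV g"
  by (rule uniformly_continuous_compact_support[OF C1_continuous_grad[OF phi(1)] phi(2) g0])
 have uc2: "uniformly_continuous_on UNIV ph"
  by (rule uniformly_continuous_compact_support[OF C1_continuous[OF phi(1)] phi(2,4)])
 have phi_i: "integ ph" by (rule integrable_compact_support[OF C1_continuous[OF phi(1)] phi(2,4)])
 show ?thesis
 proof (rule that[of K'])
  fix e :: real assume e: "e > 0"
  obtain d1 where d1: "d1 > 0" "!!x y. dist y x < d1 ==> dist (g y) (g x) < e"
   using uc e unfolding uniformly_continuous_on_def by (metis UNIV_I)
  obtain d2 where d2: "d2 > 0" "!!x y. dist y x < d2 ==> dist (ph y) (ph x) < e"
   using uc2 e unfolding uniformly_continuous_on_def by (metis UNIV_I)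
  define epsilon where "epsilon = min d (min d1 d2)/2"
  have eps: "epsilon > 0" "epsilon < d" "epsilon < d1" "epsilon < d2" using d d1 d2 by (auto simp: epsilon_def)
  obtain theta :: "'b => real" where th: "!!vs. set vs <= Basis ==> EX G. C1 (pderivs vs theta) G"
   "!!vs x. set vs <= Basis ==> x \<notin> cball 0 epsilon ==> pderivs vs theta x = 0"
   "!!x. theta x >= 0" "(LI x. theta x) > 0" using smooth_bump[OF eps(1)] by metis
  define Z where "Z = (LI x. theta x)"
  obtain G where G: "C1 theta G" using th(1)[of "[]"] by auto
  have th0: "!!x. x \<notin> cball 0 epsilon ==> theta x = 0" using th(2)[of "[]"] by simp
  have thi: "integ theta" by (rule integrable_compact_support[OF C1_continuous[OF G] compact_cball th0])
  define f where "f y = ph y*(1/Z)" for y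
  have fC: "C1 f (%y. ph y *\<^sub>R 0+(1/Z) *\<^sub>R g y)" unfolding f_def by (rule C1_mult[OF phi(1) C1_const])
  have f0: "x \<notin> K ==> f x = 0" for x by (simp add: f_def phi(4))
  have fi: "integ f" unfolding f_def using phi_i by simp
  have inK': "x+y \<in> K'" if "x \<in> K" "norm y <= epsilon" for x y
  proof -
   have "infdist (x+y) K <= dist (x+y) x" by (rule infdist_le[OF that(1)])
   thus ?thesis using that(2) eps(2) by (simp add: K'_def dist_norm)
  qed
  have K'Om: "K' <= \<Omega>" using d(2) by (simp add: K'_def)
  define theta' where "theta' x = theta x/Z" for x
  have th': "!!x. theta' x >= 0" "integ theta'" "integral\<^sup>L lborel theta' = 1" "!!x. x \<notin> cball 0 epsilon ==> theta' x = 0"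
   using th(3,4) thi th0 by (auto simp: theta'_def[abs_def] Z_def)
  have th'c: "continuous_on UNIV (%y. theta' (x - y))" for x
   unfolding theta'_def by (intro continuous_intros continuous_on_compose2[OF C1_continuous[OF G, of UNIV]]) (use th(4) in "auto simp: Z_def")
  have e1: "cv f theta x = (LI y. theta' (x - y) *\<^sub>R ph y)" for x
   unfolding cv_def f_def theta'_def by (intro B_integral_cong) (auto simp: field_simps)
  have e2: "cv f G x = (LI y. theta' (x - y) *\<^sub>R g y)" for x
   unfolding theta'_def by (subst cv_parts[OF fC phi(2) f0 G]) simp_all
  have i1: "integ (%y. theta' (x - y) *\<^sub>R ph y)" for x
   by (rule integrable_compact_support[OF _ phi(2)]) (auto simp: phi(4) intro!: continuous_intros th'c C1_continuous[OF phi(1)])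
  have i2: "integ (%y. theta' (x - y) *\<^sub>R g y)" for x
   by (rule integrable_compact_support[OF _ phi(2)]) (auto simp: g0 intro!: continuous_intros th'c C1_continuous_grad[OF phi(1)])
  show "EX \<psi> G. test_function \<Omega> \<psi> & C1 \<psi> G &
   (ALL x. \<bar>\<psi> x - ph x\<bar> <= e) & (ALL x. norm (G x - g x) <= e) & (ALL x. x \<notin> K' --> \<psi> x = 0)"
  proof (intro exI[of _ "cv f theta"] exI[of _ "cv f G"] conjI allI impI)
   show "test_function \<Omega> (cv f theta)" by (rule test_function_cv(1)[OF fi f0 th(1,2) K' K'Om inK'])
   show "x \<notin> K' ==> cv f theta x = 0" for x by (rule test_function_cv(2)[OF fi f0 th(1,2) K' K'Om inK'])
   show "C1 (cv f theta) (cv f G)" by (rule C1_cv[OF fi G compact_cball th0])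
   show "\<bar>cv f theta x - ph x\<bar> <= e" for x unfolding e1 real_norm_def[symmetric]
   proof (rule average_close[OF th' i1])
    fix y assume "norm (x - y) <= epsilon"
    thus "norm (ph y - ph x) <= e" using d2(2)[of y x] eps(4) by (simp add: dist_norm norm_minus_commute)
   qed
   show "norm (cv f G x - g x) <= e" for x unfolding e2
   proof (rule average_close[OF th' i2])
    fix y assume "norm (x - y) <= epsilon"
    thus "norm (g y - g x) <= e" using d1(2)[of y x] eps(3) by (simp add: dist_norm norm_minus_commute)
   qed
  qed
 qed (use K' d in "auto simp: K'_def")
qed

text \<open>Both sides are continuous under uniform convergence of functions and gradients supported
  in a common compact set, in the constant W by its volume and by the mass of
  \<open>g\<close>.\<close>

lemma test_function_extension:
 fixes A :: "'a::euclidean_space => 'a" assumes A: "A \<in> Borel" "!!x. norm (A x) <= M"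
  and g: "integrable kappa g" and k [simp]: "sets kappa = sets borel" and Om: "open \<Omega>"
  and eq: "!!\<psi> G. test_function \<Omega> \<psi> ==> C1 \<psi> G ==> (LI x. A x \<bullet> G x) = - (LINT x|kappa. \<psi> x*g x)"
  and phi: "C1 ph G" "compact K" "K <= \<Omega>" "!!x. x \<notin> K ==> ph x = 0"
 shows "(LI x. A x \<bullet> G x) = - (LINT x|kappa. ph x*g x)"
proof -
 note [measurable] = A(1)
 have M: "M >= 0" using A(2)[of 0] norm_ge_zero order_trans by blast
 obtain K' where K': "compact K'" "K' <= \<Omega>" "!!e. e > 0 ==> EX \<psi> G'. test_function \<Omega> \<psi> & C1 \<psi> G' &
  (ALL x. \<bar>\<psi> x - ph x\<bar> <= e) & (ALL x. norm (G' x - G x) <= e) & (ALL x. x \<notin> K' --> \<psi> x = 0)"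
  using smooth_approx[OF phi(1-3) _ Om] phi(4) by (metis (no_types, lifting))
 define S where "S = K \<union> K'"
 have S: "compact S" using phi(2) K'(1) by (simp add: S_def compact_Un)
 have Si: "integ (%x. c*ind S x :: real)" for c using S emeasure_bounded_finite[OF compact_imp_bounded[OF S]]
  by (intro integrable_mult_right) (auto simp: integrable_indicator_iff borel_compact)
 define W where "W = M * vol S+(LINT x|kappa. \<bar>g x\<bar>)"
 have W: "W >= 0" using M by (simp add: W_def)
 have intA: "integ (%x. A x \<bullet> H x)" if H: "C1 h H" "!!x. x \<notin> S ==> h x = 0" for h H
 proof -
  have H0: "x \<notin> S ==> H x = 0" for x using C1_zero_outside[OF H(1) compact_imp_closed[OF S] H(2)] by blast
  have "integ H" by (rule integrable_compact_support[OF C1_continuous_grad[OF H(1)] S H0])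
  hence "integ (%x. M*norm (H x))" by simp
  thus ?thesis
  proof (rule B_integrable_bound)
   have [measurable]: "H \<in> Borel" using H(1) by measurable
   show "(%x. A x \<bullet> H x) \<in> borel_measurable lborel" by measurable
   show "AE x in lborel. norm (A x \<bullet> H x) <= norm (M*norm (H x))"
   proof (rule AE_I2)
    fix x
    have "\<bar>A x \<bullet> H x\<bar> <= norm (A x)*norm (H x)" by (rule Cauchy_Schwarz_ineq2)
    also have "... <= M*norm (H x)" by (rule mult_right_mono[OF A(2)]) simp
    finally show "norm (A x \<bullet> H x) <= norm (M*norm (H x))" using M by simp
   qed
  qed
 qed
 have intg: "integrable kappa (%x. h x*g x)" if H: "C1 h H" "!!x. x \<notin> S ==> h x = 0" for h H
 proof -
  obtain B where B: "!!x. norm (h x) <= B" using bounded_compact_support[OF C1_continuous[OF H(1)] S H(2)] by blast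
  have [measurable]: "h \<in> borel_measurable kappa" using C1_measurable[OF H(1)] by (simp cong: measurable_cong_sets)
  have [measurable]: "g \<in> borel_measurable kappa" using g by auto
  show ?thesis
  proof (rule B_integrable_bound[OF integrable_mult_right[OF g, of B]])
   show "AE x in kappa. norm (h x*g x) <= norm (B*g x)"
   proof (rule AE_I2)
    fix x show "norm (h x*g x) <= norm (B*g x)"
     using mult_right_mono[OF order_trans[OF B abs_ge_self], of "\<bar>g x\<bar>"] by (simp add: abs_mult)
   qed
  qed measurable
 qed
 have "\<bar>(LI x. A x \<bullet> G x)+(LINT x|kappa. ph x*g x)\<bar> <= e*W" if e: "e > 0" for e
 proof -
  obtain \<psi> G' where P: "test_function \<Omega> \<psi>" "C1 \<psi> G'" "!!x. \<bar>\<psi> x - ph x\<bar> <= e" "!!x. norm (G' x - G x) <= e" "!!x. x \<notin> K' ==> \<psi> x = 0"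
   using K'(3)[OF e] by blast
  have p0: "ph x = 0" "\<psi> x = 0" if "x \<notin> S" for x using that phi(4) P(5) by (auto simp: S_def)
  have G0: "G x = 0" "G' x = 0" if "x \<notin> S" for x
   using C1_zero_outside[OF phi(1) compact_imp_closed[OF S] p0(1) that]
    C1_zero_outside[OF P(2) compact_imp_closed[OF S] p0(2) that] by blast+
  have "\<bar>(LI x. A x \<bullet> G x) - (LI x. A x \<bullet> G' x)\<bar> = \<bar>LI x. A x \<bullet> G x - A x \<bullet> G' x\<bar>"
   by (subst B_integral_diff[OF intA[OF phi(1) p0(1)] intA[OF P(2) p0(2)]]) auto
  also have "... <= (LI x. (M*e)*ind S x)"
  proof (rule B_integral_norm_bound_integral[of _ "%x. A x \<bullet> G x - A x \<bullet> G' x", simplified real_norm_def])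
   show "integ (%x. A x \<bullet> G x - A x \<bullet> G' x)"
    by (intro B_integrable_diff intA[OF phi(1) p0(1)] intA[OF P(2) p0(2)])
   fix x
   have "\<bar>A x \<bullet> G x - A x \<bullet> G' x\<bar> <= norm (A x)*norm (G x - G' x)"
    using Cauchy_Schwarz_ineq2[of "A x" "G x - G' x"] by (simp add: inner_diff_right)
   also have "... <= M*(e*ind S x)"
    using P(4)[of x] G0[of x] A(2)[of x] e M by (intro mult_mono) (auto simp: indicator_def norm_minus_commute)
   finally show "\<bar>A x \<bullet> G x - A x \<bullet> G' x\<bar> <= M*e*ind S x" by simp
  qed (rule Si)
  also have "... = e*(M * vol S)" using S by (simp add: borel_compact)
  finally have 1: "\<bar>(LI x. A x \<bullet> G x) - (LI x. A x \<bullet> G' x)\<bar> <= e*(M * vol S)" .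
  have "\<bar>(LINT x|kappa. ph x*g x) - (LINT x|kappa. \<psi> x*g x)\<bar> = \<bar>LINT x|kappa. ph x*g x - \<psi> x*g x\<bar>"
   by (subst B_integral_diff[OF intg[OF phi(1) p0(1)] intg[OF P(2) p0(2)]]) auto
  also have "... <= (LINT x|kappa. e*\<bar>g x\<bar>)"
  proof (rule B_integral_norm_bound_integral[of _ "%x. ph x*g x - \<psi> x*g x", simplified real_norm_def])
   show "integrable kappa (%x. ph x*g x - \<psi> x*g x)"
    by (intro B_integrable_diff intg[OF phi(1) p0(1)] intg[OF P(2) p0(2)])
   show "\<bar>ph x*g x - \<psi> x*g x\<bar> <= e*\<bar>g x\<bar>" for x
    using mult_right_mono[OF P(3)[of x], of "\<bar>g x\<bar>"] by (simp add: abs_mult[symmetric] left_diff_distrib abs_minus_commute)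
  qed (use g in auto)
  also have "... = e*(LINT x|kappa. \<bar>g x\<bar>)" by simp
  finally show ?thesis using 1 eq[OF P(1,2)] by (simp add: W_def distrib_left)
 qed
 hence "\<bar>(LI x. A x \<bullet> G x)+(LINT x|kappa. ph x*g x)\<bar> <= 0"
 proof -
  assume *: "!!e. e > 0 ==> \<bar>(LI x. A x \<bullet> G x)+(LINT x|kappa. ph x*g x)\<bar> <= e*W"
  show ?thesis
  proof (rule field_le_epsilon)
   fix e :: real assume "e > 0"
   hence "\<bar>(LI x. A x \<bullet> G x)+(LINT x|kappa. ph x*g x)\<bar> <= e/(W+1)*W" using W by (intro *) simp
   also have "... <= e" using W \<open>e > 0\<close> by (simp add: field_simps)
   finally show "\<bar>(LI x. A x \<bullet> G x)+(LINT x|kappa. ph x*g x)\<bar> <= 0+e" by simp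
  qed
 qed
 thus ?thesis by simp
qed

section \<open>Subgraphs\<close>

lemma fst_borel [measurable]: "fst \<in> borel_measurable (borel :: ('a::euclidean_space \<times> 'b::euclidean_space) measure)"
 by (rule borel_measurable_continuous_onI) (intro continuous_intros)

lemma snd_borel [measurable]: "snd \<in> borel_measurable (borel :: ('a::euclidean_space \<times> 'b::euclidean_space) measure)"
 by (rule borel_measurable_continuous_onI) (intro continuous_intros)

lemma C1_fst:
 fixes f :: "'a::euclidean_space => real"
 assumes "C1 f g" shows "C1 (%p::'a \<times> 'b::euclidean_space. f (fst p)) (%p. (g (fst p), 0))" unfolding C1_def
proof safe
 fix a :: 'a and b :: 'b
 have "(f \<circ> fst has_derivative (%h. g a \<bullet> h) \<circ> fst) (at (a, b))"
  using assms by (intro diff_chain_at) (auto simp: C1_def intro!: derivative_eq_intros)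
 thus "((%p. f (fst p)) has_derivative (%h. (g (fst (a, b)), 0) \<bullet> h)) (at (a, b))"
  by (simp add: o_def inner_prod_def)
next
 show "continuous_on UNIV (%p::'a \<times> 'b. (g (fst p), 0::'b))"
  by (intro continuous_intros continuous_on_compose2[OF C1_continuous_grad[OF assms, of UNIV]]) auto
qed

lemma C1_snd: "C1 (%p::'a::euclidean_space \<times> real. snd p) (%p. (0, 1))"
 unfolding C1_def by (auto simp: inner_prod_def intro!: derivative_eq_intros continuous_intros)

lemma C1_slice:
 fixes f :: "'a::euclidean_space \<times> real => real"
 assumes "C1 f g" shows "C1 (%x. f (x, s)) (%x. fst (g (x, s)))" unfolding C1_def
proof safe
 fix x
 have "(f \<circ> (%x. (x, s)) has_derivative (%h. g (x, s) \<bullet> h) \<circ> (%h. (h, 0))) (at x)"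
  using assms by (intro diff_chain_at) (auto simp: C1_def intro!: derivative_eq_intros)
 thus "((%x. f (x, s)) has_derivative (%h. fst (g (x, s)) \<bullet> h)) (at x)" by (simp add: o_def inner_prod_def)
next
 show "continuous_on UNIV (%x. fst (g (x, s)))"
  by (intro continuous_intros continuous_on_compose2[OF C1_continuous_grad[OF assms, of UNIV]]) auto
qed

lemma nn_integral_product:
 fixes F :: "'a::euclidean_space \<times> real => ennreal" assumes [measurable]: "F \<in> Borel"
 shows "(NI p. F p) = (NI x. NI s. F (x, s))" and "(NI p. F p) = (NI s. NI x. F (x, s))"
proof -
 have [measurable]: "F \<in> borel_measurable (lborel \<Otimes>\<^sub>M lborel)" unfolding lborel_prod by simp
 show "(NI p. F p) = (NI x. NI s. F (x, s))"
  unfolding lborel_prod[symmetric] by (rule lborel.nn_integral_fst[symmetric]) measurable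
 show "(NI p. F p) = (NI s. NI x. F (x, s))"
  unfolding lborel_prod[symmetric] by (rule lborel_pair.nn_integral_snd[symmetric]) measurable
qed

lemma integral_le_iterated:
 fixes F :: "'a::euclidean_space \<times> real => real"
 assumes F: "F \<in> Borel" "!!p. F p >= 0" and G: "integ G" "!!x. G x >= 0"
  and le: "!!x. (NI s. ennreal (F (x, s))) <= ennreal (G x)" shows "integ F" "(LI p. F p) <= (LI x. G x)"
proof -
 note [measurable] = F(1)
 have "(NI p. ennreal (F p)) = (NI x. NI s. ennreal (F (x, s)))" by (rule nn_integral_product) measurable
 also have "... <= (NI x. ennreal (G x))" by (intro nn_integral_mono le)
 also have "... = ennreal (LI x. G x)" by (rule nn_integral_eq_integral[OF G(1)]) (simp add: G(2))
 finally have *: "(NI p. ennreal (F p)) <= ennreal (LI x. G x)" .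
 show i: "integ F"
 proof (rule integrableI_bounded)
  have "(NI p. ennreal (norm (F p))) = (NI p. ennreal (F p))" using F(2) by simp
  also have "... < \<infinity>" using*by (simp add: le_less_trans)
  finally show "(NI p. ennreal (norm (F p))) < \<infinity>" .
 qed (use F in simp)
 have "ennreal (LI p. F p) <= ennreal (LI x. G x)" using*nn_integral_eq_integral[OF i] F(2) by simp
 thus "(LI p. F p) <= (LI x. G x)" using G(2) by (simp add: ennreal_le_iff)
qed

text \<open>In the height variable the rescaled derivative of the transition is a probability
  density. Smoothing a graph vertically therefore leaves its horizontal gradient mass
  unchanged.\<close>

lemma dstep_nn_integral: assumes h: "h > 0" shows "(NI s. ennreal (dstep ((c - s)/h)/h)) = 1"
proof -
 have [measurable]: "dstep \<in> Borel" by (rule borel_measurable_continuous_onI[OF continuous_dstep])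
 have eq: "(NI s. ennreal (dstep ((c - s)/h))) = ennreal h*(NI s. ennreal (dstep s))"
  using nn_integral_real_affine[of "%s. ennreal (dstep ((c - s)/h))" "-h" c] h by simp
 have "(NI s. ennreal (dstep s)) = (NI s. ennreal (dstep s)*ind {0..1} s)"
 proof (rule nn_integral_cong)
  fix s :: real
  have "dstep s = 0" if "s \<notin> {0..1}"
  proof (cases "s < 0")
   case False
   hence "psq s >= 1" using that by simp
   thus ?thesis by (simp add: dstep_def)
  qed (simp add: dstep_def)
  thus "ennreal (dstep s) = ennreal (dstep s)*ind {0..1} s" by (auto simp: indicator_def)
 qed
 also have "... = ennreal (step 1 - step 0)"
  by (rule nn_integral_FTC_Icc) (auto intro: step_derivative has_field_derivative_at_within dstep_nonneg)
 also have "... = 1" by (simp add: step_0 step_1)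
 finally have one: "(NI s. ennreal (dstep s)) = 1" .
 have "(NI s. ennreal (dstep ((c - s)/h)/h)) = (NI s. ennreal (1/h)*ennreal (dstep ((c - s)/h)))"
  using h by (intro nn_integral_cong) (simp add: ennreal_mult[symmetric] dstep_nonneg)
 also have "... = ennreal (1/h)*(ennreal h*1)" unfolding one[symmetric] eq[symmetric] by (rule nn_integral_cmult) measurable
 also have "... = 1" using h by (simp add: ennreal_mult[symmetric])
 finally show ?thesis .
qed

definition sub_graph :: "real => ('a::euclidean_space => real) => ('a \<times> real) set" where
 "sub_graph l w = {p. l < snd p & snd p < l+w (fst p)}"

text \<open>A bounded function with compact support and of bounded variation, the latter being
  expressed by the bound \<open>T0\<close> on mollified gradients; \<open>l\<close> is the bottom of
  its subgraph.\<close>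

locale bv_bump =
 fixes w :: "'a::euclidean_space => real" and L l :: real and K :: "'a set" and T0 :: real
 assumes w_borel [measurable]: "w \<in> Borel" and w_bounds: "!!x. 0 <= w x" "!!x. w x <= L"
  and K: "compact K" "!!x. x \<notin> K ==> w x = 0"
  and w_bv: "!!rho. rho > 0 ==> (LI x. norm (cv w (dmol rho) x)) <= T0"
begin

definition E :: "('a \<times> real) set" where "E = sub_graph l w"

lemma E_borel [measurable]: "E \<in> sets borel" unfolding E_def sub_graph_def by measurable

lemma E_bounded: "bounded E"
proof (rule bounded_subset)
 show "bounded (K \<times> {l..l+L})" using K(1) by (intro bounded_Times compact_imp_bounded) auto
 show "E <= K \<times> {l..l+L}"
 proof
  fix p assume p: "p \<in> E"
  hence "w (fst p) ~= 0" by (auto simp: E_def sub_graph_def)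
  hence "fst p \<in> K" using K(2) by blast
  moreover have "snd p \<in> {l..l+L}" using p w_bounds(2)[of "fst p"] by (auto simp: E_def sub_graph_def)
  ultimately show "p \<in> K \<times> {l..l+L}" by (simp add: mem_Times_iff)
 qed
qed

sublocale bounded_borel E by standard (rule E_borel, rule E_bounded)

lemma L_nonneg: "L >= 0" using w_bounds[of undefined] by linarith

lemma w_integrable: "integ w"
proof (rule B_integrable_bound[where f="%x. L*ind K x :: real"])
 show "integ (%x. L*ind K x :: real)" using K(1) emeasure_bounded_finite[OF compact_imp_bounded[OF K(1)]]
  by (intro integrable_mult_right) (auto simp: integrable_indicator_iff borel_compact)
 show "AE x in lborel. norm (w x) <= norm (L*ind K x)" using w_bounds K(2) L_nonneg by (auto simp: indicator_def)
qed simp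

lemma slice_integral: "(NI s. ind E (x, s)) = ennreal (w x)"
proof -
 have "(NI s. ind E (x, s)) = (NI s. ind {l<..<l+w x} s)"
  by (intro nn_integral_cong) (auto simp: E_def sub_graph_def indicator_def)
 also have "... = ennreal (w x)" using w_bounds(1)[of x] by simp
 finally show ?thesis .
qed

definition K1 :: "'a set" where "K1 = (\<Union>x\<in>K. \<Union>y\<in>cball 0 1. {x+y})"

lemma K1: "compact K1" unfolding K1_def by (rule compact_sums'[OF K(1) compact_cball])

definition W :: "real => 'a => real" where "W rho = cv w (mol rho)"

lemma W_props: assumes r: "0 < rho" "rho <= 1"
 shows "C1 (W rho) (cv w (dmol rho))" "0 <= W rho x" "W rho x <= L" "x \<notin> K1 ==> W rho x = 0"
proof -
 obtain B where B: "!!x. norm (mol rho (x::'a)) <= B" using mol_bounded[OF r(1)] by (metis real_norm_def)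
 have ti: "integ (%y. L*mol rho (x - y))"
  by (intro integrable_mult_right lborel_integrable_reflect[OF mol_integrable[OF r(1)]])
 show "C1 (W rho) (cv w (dmol rho))"
  unfolding W_def by (rule C1_cv[OF w_integrable C1_mol compact_cball mol_support[OF r(1)]])
 show "0 <= W rho x" unfolding W_def cv_def by (auto simp: mol_nonneg w_bounds)
 have "W rho x <= (LI y. L*mol rho (x - y))" unfolding W_def cv_def
  by (intro integral_mono cv_integrable_point[OF w_integrable mol_measurable B] ti) (auto intro!: mult_right_mono w_bounds mol_nonneg)
 also have "... = L*(LI y. mol rho (x - y))" by simp
 also have "(LI y. mol rho (x - y)) = 1" by (subst lborel_integral_reflect) (auto simp: mol_integral[OF r(1)])
 finally show "W rho x <= L" by simp
 assume x: "x \<notin> K1"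
 have z: "w y *\<^sub>R mol rho (x - y) = 0" for y
 proof (cases "y \<in> K")
  case True
  have "\<not> norm (x - y) <= 1"
  proof
   assume "norm (x - y) <= 1"
   hence "y+(x - y) \<in> K1" unfolding K1_def using True by (intro UN_I[of y] UN_I[of "x - y"]) auto
   thus False using x by simp
  qed
  thus ?thesis using mol_eq_0[OF r(1), of "x - y"] r(2) by simp
 qed (simp add: K(2))
 show "W rho x = 0" unfolding W_def cv_def z by simp
qed

text \<open>A C^1 approximation of the indicator of the subgraph: one smoothed jump at the mollified
  graph minus another at the bottom. The parameter h is both the mollification scale and the
  thickness of the jumps.\<close>

definition g :: "real => 'a \<times> real => real" where
 "g h p = step ((l+W h (fst p) - snd p)/h) - step ((l - snd p)/h)"

definition dg :: "real => 'a \<times> real => 'a \<times> real" where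
 "dg h p = ((dstep ((l+W h (fst p) - snd p)/h)/h) *\<^sub>R cv w (dmol h) (fst p),
   dstep ((l - snd p)/h)/h - dstep ((l+W h (fst p) - snd p)/h)/h)"

lemma C1_g: assumes h: "0 < h" "h <= 1" shows "C1 (g h) (dg h)"
proof -
 have 1: "C1 (%p. (1/h)*(l+W h (fst p) - snd p)) (%p. (1/h) *\<^sub>R (0+(cv w (dmol h) (fst p), 0) - (0, 1))+(l+W h (fst p) - snd p) *\<^sub>R 0)"
  by (intro C1_mult C1_const C1_diff C1_add C1_fst[OF W_props(1)[OF h]] C1_snd)
 have 2: "C1 (%p::'a \<times> real. (1/h)*(l - snd p)) (%p. (1/h) *\<^sub>R (0 - (0, 1))+(l - snd p) *\<^sub>R 0)"
  by (intro C1_mult C1_const C1_diff C1_snd)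
 have "C1 (%p. step ((1/h)*(l+W h (fst p) - snd p)) - step ((1/h)*(l - snd p)))
   (%p. dstep ((1/h)*(l+W h (fst p) - snd p)) *\<^sub>R ((1/h) *\<^sub>R (0+(cv w (dmol h) (fst p), 0) - (0, 1))+(l+W h (fst p) - snd p) *\<^sub>R 0)
    - dstep ((1/h)*(l - snd p)) *\<^sub>R ((1/h) *\<^sub>R (0 - (0, 1))+(l - snd p) *\<^sub>R 0))"
  by (intro C1_diff C1_compose[OF 1 step_derivative continuous_dstep] C1_compose[OF 2 step_derivative continuous_dstep])
 moreover have "(%p. step ((1/h)*(l+W h (fst p) - snd p)) - step ((1/h)*(l - snd p))) = g h"
  by (simp add: g_def fun_eq_iff)
 moreover have "(%p. dstep ((1/h)*(l+W h (fst p) - snd p)) *\<^sub>R ((1/h) *\<^sub>R (0+(cv w (dmol h) (fst p), 0) - (0, 1))+(l+W h (fst p) - snd p) *\<^sub>R 0)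
    - dstep ((1/h)*(l - snd p)) *\<^sub>R ((1/h) *\<^sub>R (0 - (0, 1))+(l - snd p) *\<^sub>R 0)) = dg h"
  by (simp add: dg_def fun_eq_iff)
 ultimately show ?thesis by simp
qed

lemma g_support: assumes h: "0 < h" "h <= 1" and p: "p \<notin> K1 \<times> {l - h..l+L}" shows "g h p = 0"
proof (cases "fst p \<in> K1")
 case True
 hence "snd p < l - h \<or> snd p > l+L" using p by (auto simp: mem_Times_iff)
 thus ?thesis
 proof
  assume "snd p < l - h"
  hence "(l - snd p)/h >= 1" "(l+W h (fst p) - snd p)/h >= 1"
   using h W_props(2)[OF h, of "fst p"] by (auto simp: pos_le_divide_eq)
  thus ?thesis by (simp add: g_def step_1)
 next
  assume "snd p > l+L"
  hence "(l - snd p)/h <= 0" "(l+W h (fst p) - snd p)/h <= 0"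
   using h W_props(3)[OF h, of "fst p"] L_nonneg by (auto simp: pos_divide_le_eq)
  thus ?thesis by (simp add: g_def step_0)
 qed
qed (use W_props(4)[OF h, of "fst p"] in "simp add: g_def")

lemma g_support_compact: "compact (K1 \<times> {l - h..l+L})" by (intro compact_Times K1) simp

lemma K1_indicator_integrable: "integ (%x. c*ind K1 x :: real)"
 using K1 emeasure_bounded_finite[OF compact_imp_bounded[OF K1]]
 by (intro integrable_mult_right) (auto simp: integrable_indicator_iff borel_compact)

lemma dg_measurable [measurable]: assumes "0 < h" "h <= 1" shows "dg h \<in> Borel" using C1_g[OF assms] by measurable

lemma dg_fst_mass:
 assumes h: "0 < h" "h <= 1" shows "(LI p. norm (fst (dg h p))) <= T0" "integ (%p. norm (fst (dg h p)))"
proof -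
 have [measurable]: "dg h \<in> Borel" by (rule dg_measurable[OF h])
 have [measurable]: "dstep \<in> Borel" by (rule borel_measurable_continuous_onI[OF continuous_dstep])
 have Gi: "integ (%x. norm (cv w (dmol h) x))" by (intro integrable_norm cv_integrable w_integrable dmol_integrable h)
 have le: "(NI s. ennreal (norm (fst (dg h (x, s))))) <= ennreal (norm (cv w (dmol h) x))" for x
 proof -
  have "(NI s. ennreal (norm (fst (dg h (x, s))))) = (NI s. ennreal (dstep (((l+W h x) - s)/h)/h)*ennreal (norm (cv w (dmol h) x)))"
   using h by (intro nn_integral_cong) (simp add: dg_def ennreal_mult[symmetric] dstep_nonneg abs_mult)
  also have "... = (NI s. ennreal (dstep (((l+W h x) - s)/h)/h))*ennreal (norm (cv w (dmol h) x))"
   by (rule nn_integral_multc) measurable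
  also have "... = ennreal (norm (cv w (dmol h) x))" by (simp add: dstep_nn_integral[OF h(1)])
  finally show ?thesis by simp
 qed
 have m: "(%p. norm (fst (dg h p))) \<in> Borel" by measurable
 show "integ (%p. norm (fst (dg h p)))" by (rule integral_le_iterated(1)[OF m _ Gi _ le]) auto
 have "(LI p. norm (fst (dg h p))) <= (LI x. norm (cv w (dmol h) x))"
  by (rule integral_le_iterated(2)[OF m _ Gi _ le]) auto
 also have "... <= T0" by (rule w_bv[OF h(1)])
 finally show "(LI p. norm (fst (dg h p))) <= T0" .
qed

lemma dg_snd_mass:
 assumes h: "0 < h" "h <= 1" shows "(LI p. \<bar>snd (dg h p)\<bar>) <= 2 * vol K1" "integ (%p. \<bar>snd (dg h p)\<bar>)"
proof -
 have [measurable]: "dg h \<in> Borel" by (rule dg_measurable[OF h])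
 have [measurable]: "dstep \<in> Borel" by (rule borel_measurable_continuous_onI[OF continuous_dstep])
 have le: "(NI s. ennreal \<bar>snd (dg h (x, s))\<bar>) <= ennreal (2*ind K1 x)" for x
 proof (cases "x \<in> K1")
  case True
  have "(NI s. ennreal \<bar>snd (dg h (x, s))\<bar>) <= (NI s. ennreal (dstep ((l - s)/h)/h)+ennreal (dstep (((l+W h x) - s)/h)/h))"
  proof (rule nn_integral_mono)
   fix s
   have "0 <= dstep ((l - s)/h)/h" "0 <= dstep (((l+W h x) - s)/h)/h" using h by (auto simp: dstep_nonneg)
   moreover from this have "\<bar>snd (dg h (x, s))\<bar> <= dstep ((l - s)/h)/h+dstep (((l+W h x) - s)/h)/h"
    unfolding dg_def snd_conv fst_conv by linarith
   ultimately show "ennreal \<bar>snd (dg h (x, s))\<bar> <= ennreal (dstep ((l - s)/h)/h)+ennreal (dstep (((l+W h x) - s)/h)/h)"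
    by (simp only: ennreal_leI flip: ennreal_plus)
  qed
  also have "... = 1+1" by (subst nn_integral_add) (auto simp: dstep_nn_integral[OF h(1)] h)
  finally show ?thesis using True by simp
 qed (use W_props(4)[OF h, of x] in "simp add: dg_def")
 have m: "(%p. \<bar>snd (dg h p)\<bar>) \<in> Borel" by measurable
 show "integ (%p. \<bar>snd (dg h p)\<bar>)"
  by (rule integral_le_iterated(1)[OF m _ K1_indicator_integrable _ le]) auto
 have "(LI p. \<bar>snd (dg h p)\<bar>) <= (LI x. 2*ind K1 x)"
  by (rule integral_le_iterated(2)[OF m _ K1_indicator_integrable _ le]) auto
 thus "(LI p. \<bar>snd (dg h p)\<bar>) <= 2 * vol K1" using K1 by (simp add: borel_compact)
qed

text \<open>On a vertical line the two functions differ only between the graphs of w and its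
  mollification and in two strips of height h.\<close>

lemma g_L1: assumes h: "0 < h" "h <= 1"
 shows "(LI p. \<bar>ind E p - g h p\<bar>) <= (LI x. \<bar>W h x - w x\<bar>)+2*h * vol K1"
proof -
 have [measurable]: "g h \<in> Borel" using C1_g[OF h] by measurable
 have Wm [measurable]: "W h \<in> Borel" using W_props(1)[OF h] by measurable
 have i: "integ (%x. \<bar>W h x - w x\<bar>)"
  unfolding W_def by (intro integrable_abs B_integrable_diff cv_integrable w_integrable mol_integrable h)
 have Ki: "integ (%x. (2*h)*ind K1 x :: real)" by (rule K1_indicator_integrable)
 have "K <= K1" unfolding K1_def by (fastforce intro: bexI[of _ 0])
 have le: "(NI s. ennreal \<bar>ind E (x, s) - g h (x, s)\<bar>) <= ennreal (\<bar>W h x - w x\<bar>+(2*h)*ind K1 x)" for x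
 proof (cases "x \<in> K1")
  case True
  define a b where "a = min (l+w x) (l+W h x)" and "b = max (l+w x) (l+W h x)"
  have "(NI s. ennreal \<bar>ind E (x, s) - g h (x, s)\<bar>) <=
    (NI s. ind {a..b} s+(ind {l+W h x - h..l+W h x} s+ind {l - h..l} s))"
  proof (rule nn_integral_mono)
   fix s
   note b1 = step_bounds[of "(l+W h x - s)/h"] and b2 = step_bounds[of "(l - s)/h"]
   have A: "\<bar>(if s < l+W h x then 1 else 0) - step ((l+W h x - s)/h)\<bar> <= ind {l+W h x - h..l+W h x} s"
    using b1 step_1[of "(l+W h x - s)/h"] step_0[of "(l+W h x - s)/h"] h
    by (auto simp: indicator_def pos_le_divide_eq pos_divide_le_eq)
   have B: "\<bar>(if s < l then 1 else 0) - step ((l - s)/h)\<bar> <= ind {l - h..l} s"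
    using b2 step_1[of "(l - s)/h"] step_0[of "(l - s)/h"] h
    by (auto simp: indicator_def pos_le_divide_eq pos_divide_le_eq)
   have C: "\<bar>(if s < l+w x then 1 else 0) - (if s < l+W h x then 1 else 0)\<bar> <= (ind {a..b} s :: real)"
    by (auto simp: a_def b_def indicator_def)
   have "\<bar>ind E (x, s) - g h (x, s)\<bar> <= ind {a..b} s+(ind {l+W h x - h..l+W h x} s+ind {l - h..l} s)"
   proof (cases "s = l")
    \<comment> \<open>At the single height s = l the subgraph is open, so its indicator is not the
      difference of the two half-line indicators used for other heights.\<close>
    case True
    have "\<bar>ind E (x, s) - g h (x, s)\<bar> <= 1"
    proof -
     have "g h (x, s) = step ((l+W h x - s)/h)" using True by (simp add: g_def step_0)
     thus ?thesis using b1 True by (simp add: E_def sub_graph_def)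
    qed
    thus ?thesis using True h by (simp add: indicator_def)
   next
    case False
    have "ind E (x, s) = (if s < l+w x then 1 else 0) - (if s < l then 1 else (0::real))"
     using False w_bounds(1)[of x] by (auto simp: E_def sub_graph_def indicator_def)
    thus ?thesis using A B C unfolding g_def fst_conv snd_conv by linarith
   qed
   hence "ennreal \<bar>ind E (x, s) - g h (x, s)\<bar> <= ennreal (ind {a..b} s+(ind {l+W h x - h..l+W h x} s+ind {l - h..l} s))"
    by (rule ennreal_leI)
   thus "ennreal \<bar>ind E (x, s) - g h (x, s)\<bar> <= ind {a..b} s+(ind {l+W h x - h..l+W h x} s+ind {l - h..l} s)"
    by (simp add: ennreal_plus ennreal_indicator)
  qed
  also have "... = ennreal (b - a)+(ennreal h+ennreal h)" using h by (simp add: nn_integral_add a_def b_def)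
  also have "... = ennreal (\<bar>W h x - w x\<bar>+2*h)"
  proof -
   have e: "\<bar>W h x - w x\<bar>+2*h = (b - a)+(h+h)" by (auto simp: a_def b_def)
   have "0 <= b - a" "0 <= h" "0 <= h+h" using h by (auto simp: a_def b_def)
   thus ?thesis unfolding e by (simp only: ennreal_plus)
  qed
  finally show ?thesis using True by simp
 next
  case False
  hence "w x = 0" "W h x = 0" using K(2) \<open>K <= K1\<close> W_props(4)[OF h] by auto
  hence "ind E (x, s) = (0::real)" "g h (x, s) = 0" for s by (auto simp: E_def sub_graph_def g_def)
  thus ?thesis by simp
 qed
 have "(LI p. \<bar>ind E p - g h p\<bar>) <= (LI x. \<bar>W h x - w x\<bar>+(2*h)*ind K1 x)"
  by (rule integral_le_iterated(2)[OF _ _ _ _ le]) (use i Ki h in auto)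
 also have "... = (LI x. \<bar>W h x - w x\<bar>)+2*h * vol K1" using i Ki K1 by (simp add: borel_compact)
 finally show ?thesis .
qed

text \<open>Lower semicontinuity with the competitors \<open>g h\<close>, h tending to 0: their
  horizontal mass is at most T0, and each vertical line over K1 contributes at most 2 to the
  vertical mass.\<close>

lemma perimeter_bounds: assumes r: "r > 0" shows "(LI p. norm (fst (dmi E r p))) <= T0" "pm E r <= T0+2 * vol K1"
proof -
 define Cr where "Cr = (LI p. norm (dmol r (p :: 'a \<times> real)))"
 define err where "err h = (LI x. \<bar>W h x - w x\<bar>)+2*h * vol K1" for h
 have err0: "((%h. A+Cr*err h) \<longlongrightarrow> A+Cr*(0+2*0 * vol K1)) (at_right 0)" for A
  unfolding err_def W_def by (intro tendsto_intros L1_approx_integrable[OF w_integrable, unfolded L1_approx_def])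
 have Cr: "Cr >= 0" by (simp add: Cr_def)
 have ev: "\<forall>\<^sub>F h in at_right (0::real). 0 < h & h <= 1"
  unfolding eventually_at_right_field by (auto intro!: exI[of _ 1])
 have b: "(LI p. norm (fst (dmi E r p))) <= T0+Cr*err h" "pm E r <= (T0+2 * vol K1)+Cr*err h"
  if h: "0 < h" "h <= 1" for h
 proof -
  have P: "bounded_linear (fst :: 'a \<times> real => 'a)" "!!x. norm (fst (x :: 'a \<times> real)) <= norm x"
   by (auto intro: bounded_linear_fst norm_fst_le)
  have gs: "!!p. p \<notin> K1 \<times> {l - h..l+L} ==> g h p = 0" by (rule g_support[OF h])
  have ce: "Cr*(LI p. \<bar>ind E p - g h p\<bar>) <= Cr*err h"
   unfolding err_def by (rule mult_left_mono[OF g_L1[OF h] Cr])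
  show "(LI p. norm (fst (dmi E r p))) <= T0+Cr*err h"
   using gradient_mass_lsc[OF E_integrable C1_g[OF h] g_support_compact[of h] gs P r] dg_fst_mass(1)[OF h] ce
   unfolding Cr_def dmi_def by linarith
  have "(LI p. norm (dg h p)) <= (LI p. norm (fst (dg h p))+\<bar>snd (dg h p)\<bar>)"
  proof (rule integral_mono)
   show "integ (%p. norm (dg h p))"
    by (rule integrable_norm, rule integrable_compact_support[OF C1_continuous_grad[OF C1_g[OF h]] g_support_compact])
      (rule C1_zero_outside[OF C1_g[OF h] compact_imp_closed[OF g_support_compact[of h]] gs])
   show "norm (dg h p) <= norm (fst (dg h p))+\<bar>snd (dg h p)\<bar>" for p
    using norm_Pair_le[of "fst (dg h p)" "snd (dg h p)"] by simp
  qed (intro B_integrable_add dg_fst_mass(2)[OF h] dg_snd_mass(2)[OF h])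
  also have "... <= T0+2 * vol K1" using dg_fst_mass[OF h] dg_snd_mass[OF h] by simp
  finally show "pm E r <= (T0+2 * vol K1)+Cr*err h"
   using gradient_mass_lsc[OF E_integrable C1_g[OF h] g_support_compact[of h] gs bounded_linear_id_le r] ce
   unfolding Cr_def pm_def dmi_def by linarith
 qed
 show "(LI p. norm (fst (dmi E r p))) <= T0"
  using tendsto_lowerbound[OF err0 eventually_mono[OF ev], of "LI p. norm (fst (dmi E r p))" T0] b(1)
  by (simp add: trivial_limit_at_right_real)
 show "pm E r <= T0+2 * vol K1"
  using tendsto_lowerbound[OF err0 eventually_mono[OF ev], of "pm E r" "T0+2 * vol K1"] b(2)
  by (simp add: trivial_limit_at_right_real)
qed

end

section \<open>The horizontal gradient mass on slices\<close>

lemma norm_fst_le': "norm (fst p) <= norm p" by (metis norm_fst_le prod.collapse)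

text \<open>The jump in s at the level c does no harm: the profile is differentiated only in x with
  s fixed, both in the divergence identity \<open>div_slices\<close> and in
  \<open>slice_lsc\<close>.\<close>

definition zeta :: "real => real => real => real => real" where
 "zeta k c s t = (if s <= c then 1 - psi k (1 - t) else psi k t)"

definition dzeta :: "real => real => real => real => real" where
 "dzeta k c s t = (if s <= c then dpsi k (1 - t) else dpsi k t)"

lemma zeta_derivative: "(zeta k c s has_real_derivative dzeta k c s t) (at t)"
proof (cases "s <= c")
 case True
 have "((%t. 1 - t) has_real_derivative (-1)) (at t)" by (auto intro!: derivative_eq_intros)
 from DERIV_chain2[OF psi_derivative this]
 have "((%t. psi k (1 - t)) has_real_derivative dpsi k (1 - t)*(-1)) (at t)" .
 from DERIV_diff[OF DERIV_const[of 1] this] show ?thesis using True by (simp add: zeta_def[abs_def] dzeta_def)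
qed (use psi_derivative in "simp add: zeta_def[abs_def] dzeta_def")

lemma continuous_dzeta: "continuous_on S (dzeta k c s)"
proof -
 have "continuous_on S (%t. dpsi k (1 - t))"
  by (intro continuous_on_compose2[OF continuous_dpsi[of UNIV]] continuous_intros) auto
 thus ?thesis using continuous_dpsi by (cases "s <= c") (auto simp: dzeta_def[abs_def])
qed

abbreviation "zt E r k c p \<equiv> zeta k c (snd p) (mi E r p)"
abbreviation "dzt E r k c p \<equiv> dzeta k c (snd p) (mi E r p)"

lemma zeta_0_1: "k >= 1 ==> zeta k c s 0 = 0" "k >= 1 ==> zeta k c s 1 = 1" by (auto simp: zeta_def psi_0 psi_1)

lemma dzeta_bounds: assumes "k >= 1" "0 <= t" "t <= 1" shows "0 <= dzeta k c s t" "dzeta k c s t <= 2*k"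
 using assms dpsi_nonneg[of k] dpsi_le[of k] by (auto simp: dzeta_def)

lemma mol_mass: assumes "rho > 0" shows "(NI x. ennreal (mol rho (x - y))) = 1"
proof -
 have "integ (%x. mol rho (x+(- y)))" by (rule lborel_integrable_translate[OF mol_integrable[OF assms]])
 moreover have "(LI x. mol rho (x+(- y))) = 1"
  by (subst lborel_integral_translate) (auto simp: mol_integral[OF assms])
 ultimately show ?thesis by (subst nn_integral_eq_integral) (auto simp: mol_nonneg)
qed

context bv_bump begin

definition PT :: "real => ('a => real) => real" where
 "PT rho h = (LI x. h x*norm (cv w (dmol rho) x))"

lemma PT_integrable: assumes "rho > 0" "h \<in> Borel" "!!x. 0 <= h x" "!!x. h x <= 1"
 shows "integ (%x. h x*norm (cv w (dmol rho) x))"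
proof (rule B_integrable_bound[where f="%x. norm (cv w (dmol rho) x)"])
 note [measurable] = assms(2)
 show "integ (%x. norm (cv w (dmol rho) x))"
  by (intro integrable_norm cv_integrable w_integrable dmol_integrable assms(1))
 show "AE x in lborel. norm (h x*norm (cv w (dmol rho) x)) <= norm (norm (cv w (dmol rho) x))"
  using assms(3,4) by (auto simp: abs_mult intro!: mult_left_le_one_le)
 show "(%x. h x*norm (cv w (dmol rho) x)) \<in> borel_measurable lborel" by measurable
qed

text \<open>Localised lower semicontinuity for functions that are C^1 only on slices. The mollified
  gradient of w is a convolution of the indicator of E in x alone, integrated over s, and the
  derivative may be moved to G slice by slice. The number \<open>kappa\<close> is the oscillation of
  the weight within distance rho.\<close>

lemma slice_gradient_lsc:
 fixes G :: "'a \<times> real => real" and D :: "'a \<times> real => 'a"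
 assumes r: "rho > 0" and h [measurable]: "h \<in> Borel"
  and hk: "!!x y. norm (x - y) <= rho ==> h x <= h y+kappa" "!!x. 0 <= h x" "!!x. h x <= 1" "kappa >= 0"
  and GD: "!!s. C1 (%x. G (x, s)) (%x. D (x, s))" "compact S" "!!x s. x \<notin> S ==> G (x, s) = 0"
  and G [measurable]: "integ G" and D: "D \<in> Borel" "integ (%p. norm (D p))"
 shows "PT rho h <= (LI p. h (fst p)*norm (D p))+kappa*(LI p. norm (D p))
  +(LI x. norm (dmol rho (x::'a)))*(LI p. \<bar>ind E p - G p\<bar>)"
proof -
 note [measurable] = D(1) G
 have [measurable]: "G \<in> Borel" using G by auto
 define Cr where "Cr = (LI x. norm (dmol rho (x::'a)))"
 have Cr: "Cr >= 0" by (simp add: Cr_def)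
 obtain B where B: "!!x. norm (dmol rho (x::'a)) <= B"
  using bounded_compact_support[OF C1_continuous_grad[OF C1_mol] compact_cball dmol_support[OF r]] by blast
 obtain Bm where Bm: "!!x. norm (mol rho (x::'a)) <= Bm" using mol_bounded[OF r] by (metis real_norm_def)
 have ym: "(%y. dmol rho (x - y)) \<in> Borel" "(%y. mol rho (x - y)) \<in> Borel" for x :: 'a by measurable
 note mm [measurable] = measurable_compose[OF fst_borel ym(1)] measurable_compose[OF fst_borel ym(2)]
 have fst_raw [measurable (raw)]: "(%z. fst (k z)) \<in> borel_measurable N" if "k \<in> measurable N borel" for k :: "'z => 'a \<times> real" and N
  by (rule measurable_compose[OF that fst_borel])
 have ki: "integ (%p. u p *\<^sub>R k (x - fst p))"
  if u: "integ u" and km: "(%p :: 'a \<times> real. k (x - fst p)) \<in> Borel" and k: "!!x. norm (k x) <= c"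
  for u :: "'a \<times> real => real" and k :: "'a => 'a" and x c
 proof (rule B_integrable_bound[OF integrable_mult_right[OF u, of c]])
  show "AE p in lborel. norm (u p *\<^sub>R k (x - fst p)) <= norm (c*u p)"
   unfolding norm_scaleR real_norm_def abs_mult mult.commute[of "\<bar>c\<bar>"]
   by (intro AE_I2 mult_left_mono order_trans[OF k abs_ge_self]) simp
 qed (use u km in "auto intro!: borel_measurable_scaleR")
 note i = ki[OF E_integrable mm(1) B] ki[OF G mm(1) B]
 have iD: "integ (%p. mol rho (x - fst p) *\<^sub>R D p)" for x
 proof (rule B_integrable_bound[OF integrable_mult_right[OF D(2), of Bm]])
  show "AE p in lborel. norm (mol rho (x - fst p) *\<^sub>R D p) <= norm (Bm*norm (D p))"
   unfolding norm_scaleR real_norm_def abs_mult abs_norm_cancel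
   by (intro AE_I2 mult_right_mono order_trans[OF Bm[unfolded real_norm_def] abs_ge_self]) simp
 qed measurable
 \<comment> \<open>Vertical integration of the indicator of the subgraph gives back w, so the
   horizontal kernel can be applied to the indicator in the product space.\<close>
 have w: "cv w (dmol rho) x = (LI p. ind E p *\<^sub>R dmol rho (x - fst p))" for x
 proof -
  have "has_bochner_integral lborel (%s. ind E (y, s) :: real) (w y)" for y
  proof (rule has_bochner_integral_nn_integral)
   have "(%s. ind {l<..<l+w y} s :: real) = (%s. ind E (y, s))" by (auto simp: E_def sub_graph_def indicator_def)
   moreover have "(%s. ind {l<..<l+w y} s :: real) \<in> borel_measurable lborel" by measurable
   ultimately show "(%s. ind E (y, s) :: real) \<in> borel_measurable lborel" by simp
  qed (auto simp: w_bounds slice_integral ennreal_indicator)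
  hence "w y *\<^sub>R dmol rho (x - y) = (LI s. ind E (y, s) *\<^sub>R dmol rho (x - y))" for y
   by (simp add: has_bochner_integral_iff)
  thus ?thesis using lborel_pair.integral_fst[of "%y s. ind E (y, s) *\<^sub>R dmol rho (x - y)"] i(1)[of x]
   by (simp add: cv_def lborel_prod split_def)
 qed
 have cp: "cv (%x. G (x, s)) (dmol rho) x = (LI y. mol rho (x - y) *\<^sub>R D (y, s))" for s x
  by (rule cv_parts[OF GD C1_mol])
 have parts: "(LI p. G p *\<^sub>R dmol rho (x - fst p)) = (LI p. mol rho (x - fst p) *\<^sub>R D p)" for x
  using lborel_pair.integral_snd[of "%y s. G (y, s) *\<^sub>R dmol rho (x - y)"] i(2)[of x]
   lborel_pair.integral_snd[of "%y s. mol rho (x - y) *\<^sub>R D (y, s)"] iD[of x] cp[of _ x]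
  by (simp add: cv_def lborel_prod split_def)
 have nb: "ennreal (norm (LI p. H p)) <= (NI p. ennreal (norm (H p)))" for H :: "'a \<times> real => 'a"
  by (cases "integ H") (auto simp: integral_norm_bound_ennreal not_integrable_integral_eq)
 define e where "e p = ind E p - G p" for p
 have [measurable]: "e \<in> Borel" unfolding e_def by measurable
 have ei: "integ (%p. \<bar>e p\<bar>)" unfolding e_def using E_integrable G by auto
 have pt: "ennreal (norm (cv w (dmol rho) x)) <= (NI p. ennreal \<bar>e p\<bar>*ennreal (norm (dmol rho (x - fst p)))+ennreal (norm (D p))*ennreal (mol rho (x - fst p)))" for x
 proof -
  have "cv w (dmol rho) x = (LI p. e p *\<^sub>R dmol rho (x - fst p))+(LI p. mol rho (x - fst p) *\<^sub>R D p)"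
   unfolding parts[symmetric] w e_def scaleR_left_diff_distrib using i[of x] by simp
  hence "ennreal (norm (cv w (dmol rho) x)) <= ennreal (norm (LI p. e p *\<^sub>R dmol rho (x - fst p)))+ennreal (norm (LI p. mol rho (x - fst p) *\<^sub>R D p))"
   by (simp add: norm_triangle_ineq ennreal_leI flip: ennreal_plus)
  also have "... <= (NI p. ennreal (norm (e p *\<^sub>R dmol rho (x - fst p))))+(NI p. ennreal (norm (mol rho (x - fst p) *\<^sub>R D p)))"
   by (intro add_mono nb)
  also have "... = (NI p. ennreal \<bar>e p\<bar>*ennreal (norm (dmol rho (x - fst p)))+ennreal (norm (D p))*ennreal (mol rho (x - fst p)))"
   by (subst nn_integral_add[symmetric]) (auto simp: mol_nonneg ennreal_mult mult.commute)
  finally show ?thesis .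
 qed
 have dk: "(NI x. ennreal (h x)*ennreal (norm (dmol rho (x - y)))) <= ennreal Cr" for y :: 'a
 proof -
  have "integ (%x. norm (dmol rho (x+(- y))))"
   by (rule lborel_integrable_translate[OF integrable_norm[OF dmol_integrable[OF r]]])
  moreover have "(LI x. norm (dmol rho (x+(- y)))) = Cr" unfolding Cr_def by (rule lborel_integral_translate) measurable
  ultimately have "(NI x. ennreal (norm (dmol rho (x - y)))) = ennreal Cr" by (subst nn_integral_eq_integral) auto
  moreover have "ennreal (h x)*c <= c" for x c using mult_right_mono[OF ennreal_leI[OF hk(3)], of c x] by simp
  ultimately show ?thesis by (metis (no_types, lifting) nn_integral_mono)
 qed
 \<comment> \<open>The weight is moved from x to y at the price \<open>kappa\<close>; beyond
   distance rho the kernel vanishes.\<close>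
 have mk: "(NI x. ennreal (h x)*ennreal (mol rho (x - y))) <= ennreal (h y+kappa)" for y
 proof -
  have "(NI x. ennreal (h x)*ennreal (mol rho (x - y))) <= (NI x. ennreal (h y+kappa)*ennreal (mol rho (x - y)))"
  proof (rule nn_integral_mono)
   fix x show "ennreal (h x)*ennreal (mol rho (x - y)) <= ennreal (h y+kappa)*ennreal (mol rho (x - y))"
    using hk(1)[of x y] mol_eq_0[OF r, of "x - y"] by (cases "norm (x - y) <= rho") (auto intro!: mult_right_mono ennreal_leI)
  qed
  also have "... = ennreal (h y+kappa)" by (subst nn_integral_cmult) (auto simp: mol_mass[OF r])
  finally show ?thesis .
 qed
 have "ennreal (PT rho h) = (NI x. ennreal (h x)*ennreal (norm (cv w (dmol rho) x)))" unfolding PT_def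
  by (subst nn_integral_eq_integral[OF PT_integrable[OF r h hk(2,3)], symmetric]) (auto simp: hk(2) ennreal_mult)
 also have "... <= (NI x. ennreal (h x)*(NI p. ennreal \<bar>e p\<bar>*ennreal (norm (dmol rho (x - fst p)))+ennreal (norm (D p))*ennreal (mol rho (x - fst p))))"
  by (intro nn_integral_mono mult_left_mono pt) simp
 also have "... = (NI x. NI p. ennreal \<bar>e p\<bar>*(ennreal (h x)*ennreal (norm (dmol rho (x - fst p))))+ennreal (norm (D p))*(ennreal (h x)*ennreal (mol rho (x - fst p))))"
  by (intro nn_integral_cong) (simp add: distrib_left mult.left_commute flip: nn_integral_cmult)
 also have "... = (NI p. NI x. ennreal \<bar>e p\<bar>*(ennreal (h x)*ennreal (norm (dmol rho (x - fst p))))+ennreal (norm (D p))*(ennreal (h x)*ennreal (mol rho (x - fst p))))"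
  by (rule lborel_pair.Fubini'[symmetric]) measurable
 also have "... = (NI p. ennreal \<bar>e p\<bar>*(NI x. ennreal (h x)*ennreal (norm (dmol rho (x - fst p))))+ennreal (norm (D p))*(NI x. ennreal (h x)*ennreal (mol rho (x - fst p))))"
  by (intro nn_integral_cong) (simp add: nn_integral_add nn_integral_cmult)
 also have "... <= (NI p. ennreal \<bar>e p\<bar>*ennreal Cr+ennreal (norm (D p))*ennreal (h (fst p)+kappa))"
  by (intro nn_integral_mono add_mono mult_left_mono dk mk) auto
 also have "... = (NI p. ennreal (Cr*\<bar>e p\<bar>+(h (fst p)*norm (D p)+kappa*norm (D p))))"
  using hk(2,4) Cr by (intro nn_integral_cong) (simp add: algebra_simps flip: ennreal_mult ennreal_plus)
 also have "... = ennreal (Cr*(LI p. \<bar>e p\<bar>)+((LI p. h (fst p)*norm (D p))+kappa*(LI p. norm (D p))))"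
 proof -
  have "integ (%p. h (fst p)*norm (D p))"
   by (rule B_integrable_bound[OF D(2)]) (auto simp: abs_mult hk(2,3) intro!: mult_left_le_one_le)
  thus ?thesis using ei D(2) hk(2,4) Cr by (subst nn_integral_eq_integral) auto
 qed
 finally have "PT rho h <= Cr*(LI p. \<bar>e p\<bar>)+((LI p. h (fst p)*norm (D p))+kappa*(LI p. norm (D p)))"
  by (subst (asm) ennreal_le_iff) (use Cr hk(2,4) in "auto intro!: add_nonneg_nonneg")
 thus ?thesis by (simp add: Cr_def e_def)
qed

text \<open>The profiles fix 0 and 1 and are C-Lipschitz on [0,1]; hence they keep the mollified
  indicator close to the indicator in L^1, with the factor C.\<close>

lemma slice_lsc: assumes rho: "rho > 0" and r: "r > 0" and h [measurable]: "h \<in> Borel"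
  and hk: "!!x y. norm (x - y) <= rho ==> h x <= h y+kappa" "!!x. 0 <= h x" "!!x. h x <= 1" "kappa >= 0"
  and z: "!!s t. (z s has_real_derivative z' s t) (at t)" "!!s. continuous_on UNIV (z' s)"
   "!!s. z s 0 = 0" "!!s. z s 1 = 1" "!!s t. 0 <= t ==> t <= 1 ==> 0 <= z' s t & z' s t <= C"
  and zm: "(%p. z (snd p) (mi E r p)) \<in> Borel" "(%p. z' (snd p) (mi E r p)) \<in> Borel"
 shows "PT rho h <= (LI p. h (fst p)*(z' (snd p) (mi E r p)*norm (fst (dmi E r p))))
  +kappa*(LI p. z' (snd p) (mi E r p)*norm (fst (dmi E r p)))
  +(LI x. norm (dmol rho (x::'a)))*(C*(LI p. \<bar>mi E r p - ind E p\<bar>))"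
proof -
 note [measurable] = zm
 note v01 = mi_bounds[OF r]
 have C0: "C >= 0" using z(5)[of 0 0] by linarith
 have lip: "\<bar>z s t - z s t'\<bar> <= C*\<bar>t - t'\<bar>" if "t \<in> {0..1}" "t' \<in> {0..1}" for s t t'
  by (rule lipschitz_01[OF z(1,5) that])
 obtain R where R: "!!r x. r > 0 ==> x \<notin> cball 0 (R+r) ==> mi E r x = 0" using mi_support by metis
 define S :: "'a set" where "S = cball 0 (R+r)"
 define G where "G p = z (snd p) (mi E r p)" for p
 define D where "D p = z' (snd p) (mi E r p) *\<^sub>R fst (dmi E r p)" for p
 have [measurable]: "D \<in> Borel"
 proof -
  have "(%p. fst (dmi E r p)) \<in> Borel" using measurable_compose[OF dmi_measurable fst_borel] .
  thus ?thesis unfolding D_def by measurable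
 qed
 have [measurable]: "G \<in> Borel" unfolding G_def by measurable
 have Gi: "integ G" by (rule B_integrable_bound[OF integrable_mult_right[OF mi_integrable[OF r], of C]])
    (use lip[of _ 0] v01 C0 z(3) in "auto simp: G_def abs_mult")
 have nD: "norm (D p) = z' (snd p) (mi E r p)*norm (fst (dmi E r p))" for p using z(5)[OF v01] by (auto simp: D_def)
 have Di: "integ (%p. norm (D p))"
 proof (rule B_integrable_bound[OF integrable_mult_right[OF integrable_norm[OF dmi_integrable[OF r]], of C]])
  show "AE p in lborel. norm (norm (D p)) <= norm (C*norm (dmi E r p))"
  proof (rule AE_I2)
   fix p
   have "z' (snd p) (mi E r p)*norm (fst (dmi E r p)) <= C*norm (dmi E r p)"
    using C0 z(5)[OF v01[of p], of "snd p"] by (intro mult_mono norm_fst_le') auto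
   thus "norm (norm (D p)) <= norm (C*norm (dmi E r p))" using C0 z(5)[OF v01[of p], of "snd p"] by (simp add: nD)
  qed
 qed measurable
 have "PT rho h <= (LI p. h (fst p)*norm (D p))+kappa*(LI p. norm (D p))
  +(LI x. norm (dmol rho (x::'a)))*(LI p. \<bar>ind E p - G p\<bar>)"
 proof (rule slice_gradient_lsc[OF rho h hk _ _ _ Gi _ Di])
  show "C1 (%x. G (x, s)) (%x. D (x, s))" for s
   using C1_compose[OF C1_slice[OF C1_mi[OF r]] z(1) z(2)] by (simp add: G_def D_def)
  show "G (x, s) = 0" if "x \<notin> S" for x s
  proof -
   have "(x, s) \<notin> cball 0 (R+r)" using that norm_fst_le[of x s] by (auto simp: S_def)
   thus ?thesis using R[OF r] z(3) by (simp add: G_def)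
  qed
 qed (auto simp: S_def)
 moreover have "(LI p. \<bar>ind E p - G p\<bar>) <= C*(LI p. \<bar>mi E r p - ind E p\<bar>)"
 proof -
  have "(LI p. \<bar>ind E p - G p\<bar>) <= (LI p. C*\<bar>mi E r p - ind E p\<bar>)"
  proof (rule integral_mono)
   show "\<bar>ind E p - G p\<bar> <= C*\<bar>mi E r p - ind E p\<bar>" for p
    using lip[of "ind E p" "mi E r p" "snd p"] v01[of p] z(3,4)
    by (cases "p \<in> E") (auto simp: G_def abs_minus_commute)
  qed (auto intro!: Gi E_integrable mi_integrable r)
  thus ?thesis by simp
 qed
 moreover from this have "(LI x. norm (dmol rho (x::'a)))*(LI p. \<bar>ind E p - G p\<bar>) <=
  (LI x. norm (dmol rho (x::'a)))*(C*(LI p. \<bar>mi E r p - ind E p\<bar>))" by (rule mult_left_mono) simp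
 ultimately show ?thesis unfolding nD by linarith
qed

end

text \<open>Together with \<open>w_bv\<close> the new assumption says that \<open>T0\<close> is the
  limit of the mollified gradient masses, the total variation of w, and not merely a bound.\<close>

locale bv_bump_tight = bv_bump +
 assumes tight: "!!e. e > 0 ==> \<forall>\<^sub>F rho in at_right 0. T0 - e < PT rho (%_. 1)"
begin

text \<open>An upper bound obtained from lower bounds by complementation, twice. The profile
  complementary to \<open>zeta\<close> shows that the total weighted mass exceeds the total
  variation only a little; the weight 1 - h bounds from below the share not counted by h. The
  difference is the bound for the weight h.\<close>

lemma strict_x:
 assumes k: "k >= 1" and h [measurable]: "h \<in> Borel" "!!x. 0 <= h x" "!!x. h x <= 1" "uniformly_continuous_on UNIV h"
  and B: "\<forall>\<^sub>F rho in at_right 0. PT rho h <= B" and e: "e > 0"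
 shows "\<forall>\<^sub>F r in at_right 0. (LI p. h (fst p)*(dzt E r k c p*norm (fst (dmi E r p)))) <= B+e"
proof -
 have T0: "T0 >= 0" by (rule order_trans[OF B_integral_nonneg perimeter_bounds(1)[of 1]]) auto
 \<comment> \<open>The mass weighted by \<open>dzeta\<close> is at most 2*k*T0, so this oscillation
   costs at most e/4; the summand 1 allows T0 = 0.\<close>
 define kappa where "kappa = e/4/(2*k*T0+1)"
 have kappa: "kappa > 0" "kappa*(2*k*T0) <= e/4"
 proof -
  have X: "0 <= 2*k*T0" using k T0 by simp
  thus "kappa > 0" using e unfolding kappa_def by (intro divide_pos_pos) linarith+
  have "e/4*(2*k*T0) <= e/4*(2*k*T0+1)" using e by (intro mult_left_mono) auto
  moreover have "0 < 2*k*T0+1" using X by linarith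
  ultimately show "kappa*(2*k*T0) <= e/4" unfolding kappa_def times_divide_eq_left by (simp only: pos_divide_le_eq)
 qed
 obtain d where d: "d > 0" "!!x y. norm (x - y) < d ==> \<bar>h x - h y\<bar> < kappa"
  using h(4) kappa(1) unfolding uniformly_continuous_on_def by (auto simp: dist_norm)
 have dev: "\<forall>\<^sub>F rho in at_right (0::real). 0 < rho & rho < d"
  unfolding eventually_at_right_field using d(1) by (auto intro!: exI[of _ d])
 have "\<forall>\<^sub>F rho in at_right (0::real). T0 - e/(8*k) < PT rho (%_. 1)" by (rule tight) (use k e in auto)
 with dev B have "\<forall>\<^sub>F rho in at_right (0::real). 0 < rho & rho < d & PT rho h <= B & T0 - e/(8*k) < PT rho (%_. 1)"
  by eventually_elim simp
 from eventually_happens'[OF _ this]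
 obtain rho where rho: "0 < rho" "rho < d" "PT rho h <= B" "T0 - e/(8*k) < PT rho (%_. 1)"
  by (auto simp: trivial_limit_at_right_real)
 define Cr where "Cr = (LI x. norm (dmol rho (x::'a)))"
 have "((%s. Cr*(4*k)*(LI p. \<bar>mi E s p - ind E p\<bar>)) \<longlongrightarrow> 0) (at_right 0)"
  by (rule tendsto_mult_right_zero[OF mi_L1])
 moreover have "((%s. Cr*(2*k)*(LI p. \<bar>mi E s p - ind E p\<bar>)) \<longlongrightarrow> 0) (at_right 0)"
  by (rule tendsto_mult_right_zero[OF mi_L1])
 ultimately have "((%s. Cr*(2*k)*(LI p. \<bar>mi E s p - ind E p\<bar>)+Cr*(2*k)*(LI p. \<bar>mi E s p - ind E p\<bar>)) \<longlongrightarrow> 0+0) (at_right 0)"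
  by (intro tendsto_add)
 hence "\<forall>\<^sub>F s in at_right 0. Cr*(2*k)*(LI p. \<bar>mi E s p - ind E p\<bar>)+Cr*(2*k)*(LI p. \<bar>mi E s p - ind E p\<bar>) < e/2"
  by (rule order_tendstoD) (use e in simp)
 moreover have "\<forall>\<^sub>F s in at_right (0::real). s > 0" by (simp add: eventually_at_right_less)
 ultimately show ?thesis
 proof eventually_elim
  case (elim r)
  note v01 = mi_bounds[OF elim(2)]
  define err where "err = (LI p. \<bar>mi E r p - ind E p\<bar>)"
  define d0 where "d0 p = norm (fst (dmi E r p))" for p
  \<comment> \<open>The remainder of 2k t after subtracting the profile, normalised by 2k - 1 so
    that it again maps 0 to 0 and 1 to 1; it is nondecreasing on [0,1] because the slope of
    \<open>zeta\<close> there is at most 2k.\<close>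
  define z2 where "z2 s t = (2*k*t - zeta k c s t)/(2*k - 1)" for s t
  define z2' where "z2' s t = (2*k - dzeta k c s t)/(2*k - 1)" for s t
  have km [measurable]: "psi k \<in> Borel" "dpsi k \<in> Borel"
   by (rule borel_measurable_continuous_onI[OF DERIV_continuous_on[OF has_field_derivative_at_within[OF psi_derivative]]])
     (rule borel_measurable_continuous_onI[OF continuous_dpsi])
  have zm [measurable]: "(%p. zt E r k c p) \<in> Borel" "(%p. dzt E r k c p) \<in> Borel"
   unfolding zeta_def dzeta_def by measurable
  have [measurable]: "d0 \<in> Borel"
   unfolding d0_def using measurable_compose[OF dmi_measurable fst_borel] by measurable
  have d0: "d0 p >= 0" "d0 p <= norm (dmi E r p)" for p by (auto simp: d0_def norm_fst_le')
  have d0i: "integ d0" by (rule B_integrable_bound[OF dmi_integrable[OF elim(2)]]) (use d0 in auto)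
  have zi: "integ (%p. q p*d0 p)" if [measurable]: "q \<in> Borel" and q: "!!p. 0 <= q p" "!!p. q p <= 2*k" for q
  proof (rule B_integrable_bound[OF integrable_mult_right[OF d0i, of "2*k"]])
   show "AE p in lborel. norm (q p*d0 p) <= norm (2*k*d0 p)"
    using q d0 k by (auto simp: abs_mult intro!: mult_right_mono)
  qed measurable
  note dz = dzeta_bounds[OF k v01]
  define I where "I q = (LI p. q p*(dzt E r k c p*d0 p))" for q
  have hi: "integ (%p. h (fst p)*(dzt E r k c p*d0 p))"
  proof -
   have "0 <= h (fst p)*dzt E r k c p" "h (fst p)*dzt E r k c p <= 2*k" for p
    using dzeta_bounds[OF k v01[of p], of c "snd p"] h(2,3)[of "fst p"] mult_left_le_one_le[OF dzeta_bounds(1)[OF k v01[of p], of c "snd p"] h(2)[of "fst p"] h(3)[of "fst p"]] by auto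
   thus ?thesis using zi[of "%p. h (fst p)*dzt E r k c p"] by (simp add: mult.assoc)
  qed
  have zi1: "integ (%p. dzt E r k c p*d0 p)" by (rule zi) (use dz in auto)
  have hk: "1 - h x <= 1 - h y+kappa" if "norm (x - y) <= rho" for x y using d(2)[of x y] that rho by auto
  have l1: "PT rho (%x. 1 - h x) <= (LI p. (1 - h (fst p))*(dzt E r k c p*d0 p))
   +kappa*(LI p. dzt E r k c p*d0 p)+Cr*(2*k*err)" unfolding d0_def err_def Cr_def
   by (rule slice_lsc[OF rho(1) elim(2) _ hk _ _ _ zeta_derivative continuous_dzeta zeta_0_1[OF k]])
     (use h kappa dzeta_bounds[OF k] in auto)
  have z2d: "(z2 s has_real_derivative z2' s t) (at t)" for s t
   unfolding z2_def[abs_def] z2'_def using k by (auto intro!: derivative_eq_intros zeta_derivative)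
  have z2c: "continuous_on UNIV (z2' s)" for s
   unfolding z2'_def[abs_def] using k by (intro continuous_intros continuous_dzeta) auto
  have z2b: "0 <= z2' s t & z2' s t <= 2*k/(2*k - 1)" if "0 <= t" "t <= 1" for s t
   unfolding z2'_def using dzeta_bounds[OF k that] k by (auto intro!: divide_right_mono)
  have l2: "PT rho (%x. 1) <= (LI p. 1*(z2' (snd p) (mi E r p)*d0 p))
   +0*(LI p. z2' (snd p) (mi E r p)*d0 p)+Cr*(2*k/(2*k - 1)*err)" unfolding d0_def err_def Cr_def
   by (rule slice_lsc[OF rho(1) elim(2) _ _ _ _ _ z2d z2c _ _ z2b])
     (use k zeta_0_1[OF k] in "auto simp: z2_def z2'_def")
  have i1: "(LI p. (1 - h (fst p))*(dzt E r k c p*d0 p)) =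
    (LI p. dzt E r k c p*d0 p) - (LI p. h (fst p)*(dzt E r k c p*d0 p))"
   using hi zi1 by (simp add: left_diff_distrib)
  have i2: "(2*k - 1)*(LI p. z2' (snd p) (mi E r p)*d0 p) =
    2*k*(LI p. d0 p) - (LI p. dzt E r k c p*d0 p)"
  proof -
   have "(2*k - 1)*(LI p. z2' (snd p) (mi E r p)*d0 p) = (LI p. 2*k*d0 p - dzt E r k c p*d0 p)"
    unfolding integral_mult_right_zero[symmetric] using k by (intro B_integral_cong) (auto simp: z2'_def field_simps)
   thus ?thesis using d0i zi1 by simp
  qed
  have i3: "PT rho (%x. 1 - h x) = PT rho (%x. 1) - PT rho h"
   unfolding PT_def using PT_integrable[OF rho(1), of h] PT_integrable[OF rho(1), of "%_. 1"] h
   by (simp add: left_diff_distrib)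
  have d0T: "(LI p. d0 p) <= T0" unfolding d0_def by (rule perimeter_bounds(1)[OF elim(2)])
  define N1 where "N1 = (LI p. dzt E r k c p*d0 p)"
  define P1 where "P1 = PT rho (%x. 1)"
  have N1le: "N1 <= 2*k*T0"
  proof -
   have "N1 <= (LI p. 2*k*d0 p)"
    unfolding N1_def by (rule integral_mono[OF zi1]) (use d0i d0 dz in "auto intro!: mult_right_mono")
   also have "... <= 2*k*T0" using d0T k by simp
   finally show ?thesis .
  qed
  have "(2*k - 1)*P1 <= (2*k - 1)*((LI p. z2' (snd p) (mi E r p)*d0 p)+Cr*(2*k/(2*k - 1)*err))"
   using l2 k by (intro mult_left_mono) (auto simp: P1_def)
  also have "... = 2*k*(LI p. d0 p) - N1+Cr*(2*k)*err" unfolding distrib_left i2 N1_def[symmetric] using k by simp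
  also have "... <= 2*k*T0 - N1+Cr*(2*k)*err" using d0T k by simp
  finally have a: "N1 <= 2*k*T0 - 2*k*P1+P1+Cr*(2*k)*err" by (simp add: algebra_simps)
  have b: "(LI p. h (fst p)*(dzt E r k c p*d0 p)) <= N1 - (P1 - PT rho h)+kappa*N1+Cr*(2*k)*err"
   using l1 unfolding i1 i3 N1_def P1_def by (simp add: mult.assoc)
  have c: "kappa*N1 <= e/4" using mult_left_mono[OF N1le, of kappa] kappa by linarith
  have "2*k*(T0 - P1) <= 2*k*(e/(8*k))" using rho(4) k by (intro mult_left_mono) (auto simp: P1_def)
  also have "... = e/4" using k by simp
  finally have d: "2*k*T0 - 2*k*P1 <= e/4" by (simp add: algebra_simps)
  show ?case using a b c d rho(3) elim(1) unfolding err_def[symmetric] d0_def[symmetric] by linarith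
 qed
qed

end

section \<open>Approximate limits and densities in the product space\<close>

lemma unit_ball_vol_neq_0 [simp]: "x >= 0 ==> unit_ball_vol x ~= 0" by (metis unit_ball_vol_pos less_irrefl)

lemma N1_density_zero:
 fixes Q :: "'a::euclidean_space set" assumes [measurable]: "Q \<in> sets borel"
 shows "x \<notin> N1 (- Q) \<longleftrightarrow>
  ((%r. vol (Q \<inter> ball x r)/vol (ball x r)) \<longlongrightarrow> 0) (at_right 0)"
proof -
 interpret borel_set "- Q" by standard simp
 have eq: "vol (Q \<inter> ball x r) = coE (- Q) x r" for r unfolding coE_def by (simp add: Diff_eq Int_commute)
 have pos: "vol (ball x r) > 0" if "r > 0" for r using that by (simp add: content_ball_power)
 have neg: "(EX r. 0 < r & r < e & coE (- Q) x r > delta * vol (ball x r)) \<longleftrightarrow>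
   \<not> (ALL r. 0 < r --> r < e --> coE (- Q) x r/vol (ball x r) <= delta)" for e delta
  by (meson pos pos_divide_le_eq not_less)
 have "x \<notin> N1 (- Q) \<longleftrightarrow> (ALL delta>0. EX e>0. ALL r. 0 < r --> r < e --> coE (- Q) x r/vol (ball x r) <= delta)"
  unfolding N1_iff dset_def mem_Collect_eq neg by blast
 also have "... \<longleftrightarrow> (ALL delta>0. \<forall>\<^sub>F r in at_right 0. coE (- Q) x r/vol (ball x r) <= delta)"
  unfolding eventually_at_right_field by auto
 also have "... \<longleftrightarrow> ((%r. coE (- Q) x r/vol (ball x r)) \<longlongrightarrow> 0) (at_right 0)"
 proof
  assume *: "ALL delta>0. \<forall>\<^sub>F r in at_right 0. coE (- Q) x r/vol (ball x r) <= delta"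
  show "((%r. coE (- Q) x r/vol (ball x r)) \<longlongrightarrow> 0) (at_right 0)"
  proof (rule tendstoI)
   fix e :: real assume "e > 0"
   hence "e/2 > 0" by simp
   from *[rule_format, OF this] show "\<forall>\<^sub>F r in at_right 0. dist (coE (- Q) x r/vol (ball x r)) 0 < e"
   proof eventually_elim
    case (elim r)
    moreover have "0 <= coE (- Q) x r/vol (ball x r)" by (simp add: coE_def)
    ultimately show ?case using \<open>e > 0\<close> unfolding dist_real_def by linarith
   qed
  qed
 qed (auto dest: order_tendstoD(2) elim!: eventually_mono)
 finally show ?thesis by (simp only: eq)
qed

lemma content_times:
 fixes A :: "'a::euclidean_space set" and B :: "real set" assumes "A \<in> sets borel" "B \<in> sets borel"
 shows "vol (A \<times> B) = vol A * vol B" using lborel.emeasure_pair_measure_Times[of A lborel B] assms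
 by (simp add: lborel_prod measure_def enn2real_mult)

text \<open>A ball of radius r in the product lies in the cylinder of radius and half-height r, and
  this cylinder lies in the ball of radius 2r. So horizontal densities and product densities agree
  up to constants, provided that membership is governed by Q near the point.\<close>

lemma density_transfer:
 fixes E :: "('a::euclidean_space \<times> real) set"
 assumes E [measurable]: "E \<in> sets borel" and Q [measurable]: "Q \<in> sets borel" and d: "d > 0"
 shows "x \<notin> N1 (- Q) ==> (!!p. p \<in> ball (x, s) d ==> p \<notin> E ==> fst p \<in> Q) ==> (x, s) \<notin> N1 E"
  and "x \<in> N1 (- Q) ==> (!!p. p \<in> ball (x, s) d ==> fst p \<in> Q ==> p \<notin> E) ==> (x, s) \<in> N1 E"
proof -
 interpret Q: borel_set "- Q" by standard simp
 interpret E: borel_set E by standard simp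
 let ?n = "DIM('a)"
 let ?a = "unit_ball_vol (real ?n)" and ?b = "unit_ball_vol (real (?n+1))"
 have ab: "?a > 0" "?b > 0" by simp_all
 have box: "vol ((Q \<inter> ball x r) \<times> ball s r) = coE (- Q) x r*(2*r)" if "r > 0" for r
  using that by (subst content_times) (auto simp: coE_def ball_eq_greaterThanLessThan Diff_eq Int_commute)
 have sm: "(y, t) \<in> ball (x, s) r ==> y \<in> ball x r & t \<in> ball s r" for y t r
  using norm_fst_le'[of "(x, s) - (y, t)"] norm_snd_le[of "s - t" "x - y"] by (auto simp: dist_norm)
 have lg: "(y, t) \<in> ball (x, s) (2*r)" if "y \<in> ball x r" "t \<in> ball s r" for y t r
  using norm_Pair_le[of "x - y" "s - t"] that by (auto simp: dist_norm)
 show "(x, s) \<notin> N1 E" if x: "x \<notin> N1 (- Q)" and sub: "!!p. p \<in> ball (x, s) d ==> p \<notin> E ==> fst p \<in> Q"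
 proof
  assume "(x, s) \<in> N1 E"
  then obtain delta where delta: "delta > 0" "(x, s) \<in> dset E delta" using E.N1_iff by blast
  \<comment> \<open>The cylinder over a base of density delta' then has the volume delta times that
    of the ball of radius r in the product.\<close>
  define delta' where "delta' = delta*?b/(2*?a)"
  have "delta' > 0" using delta ab by (simp add: delta'_def)
  hence "x \<notin> dset (- Q) delta'" using x Q.N1_iff by blast
  then obtain e where e: "e > 0" "!!r. 0 < r ==> r < e ==> coE (- Q) x r <= delta' * vol (ball x r)"
   unfolding dset_def mem_Collect_eq by (meson not_less)
  have "0 < min e d" using e(1) d by simp
  then obtain r where r: "0 < r" "r < min e d" "coE E (x, s) r > delta * vol (ball (x, s) r)"
   using delta(2) unfolding dset_def mem_Collect_eq by blast
  have "coE E (x, s) r <= vol ((Q \<inter> ball x r) \<times> ball s r)" unfolding coE_def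
  proof (rule measure_mono_ball[of _ _ "(x, s)" "2*r"])
   show "ball (x, s) r - E <= (Q \<inter> ball x r) \<times> ball s r"
   proof
    fix p assume p: "p \<in> ball (x, s) r - E"
    hence "fst p \<in> Q" using sub[of p] r(2) by auto
    thus "p \<in> (Q \<inter> ball x r) \<times> ball s r" using sm[of "fst p" "snd p" r] p by (auto simp: mem_Times_iff)
   qed
   show "(Q \<inter> ball x r) \<times> ball s r <= ball (x, s) (2*r)" using lg by blast
  qed (auto simp: borel_Times)
  also have "... <= (delta'*(?a*r ^ ?n))*(2*r)"
   unfolding box[OF r(1)] using e(2)[of r] r by (intro mult_right_mono) (auto simp: content_ball_power)
  also have "... = delta*(?b*r ^ (?n+1))" using ab by (simp add: delta'_def)
  also have "... = delta * vol (ball (x, s) r)" using r(1) by (subst content_ball_power) auto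
  finally show False using r(3) by simp
 qed
 show "(x, s) \<in> N1 E" if x: "x \<in> N1 (- Q)" and sub: "!!p. p \<in> ball (x, s) d ==> fst p \<in> Q ==> p \<notin> E"
 proof -
  obtain delta where delta: "delta > 0" "x \<in> dset (- Q) delta" using x Q.N1_iff by blast
  \<comment> \<open>Here the cylinder is placed in the ball of radius 2r; one of the n+1 factors 2
    is matched by the height 2r, the other n remain.\<close>
  define delta' where "delta' = delta*?a/(?b*2 ^ ?n)"
  have "(x, s) \<in> dset E delta'" unfolding dset_def
  proof safe
   fix e :: real assume e: "e > 0"
   have "0 < min e d/2" using e d by simp
   then obtain r where r: "0 < r" "r < min e d/2" "coE (- Q) x r > delta * vol (ball x r)"
    using delta(2) unfolding dset_def mem_Collect_eq by blast
   have "delta' * vol (ball (x, s) (2*r)) = delta'*(?b*(2*r) ^ (?n+1))" using r(1) by (subst content_ball_power) auto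
   also have "... = delta*(?a*r ^ ?n)*(2*r)" using ab by (simp add: delta'_def power_mult_distrib)
   also have "... < coE (- Q) x r*(2*r)" using r by (intro mult_strict_right_mono) (auto simp: content_ball_power)
   also have "... = vol ((Q \<inter> ball x r) \<times> ball s r)" using box[OF r(1)] by simp
   also have "... <= coE E (x, s) (2*r)" unfolding coE_def
   proof (rule measure_mono_ball[of _ _ "(x, s)" "2*r"])
    show "(Q \<inter> ball x r) \<times> ball s r <= ball (x, s) (2*r) - E"
    proof
     fix p assume p: "p \<in> (Q \<inter> ball x r) \<times> ball s r"
     hence "p \<in> ball (x, s) (2*r)" using lg by (cases p) auto
     thus "p \<in> ball (x, s) (2*r) - E" using sub[of p] p r(2) by auto
    qed
   qed (auto simp: borel_Times)
   finally show "EX r>0. r < e & delta' * vol (ball (x, s) r) < coE E (x, s) r"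
    using r by (intro exI[of _ "2*r"]) auto
  qed
  moreover have "delta' > 0" using delta(1) ab by (simp add: delta'_def)
  ultimately show ?thesis using E.N1_iff by blast
 qed
qed

lemma ap_upper_uminus: "ap_upper \<Omega> u x = - ap_lower \<Omega> (%x. - u x) x"
proof -
 have "{t. P t} = uminus ` {t. P (- t)}" for P :: "real => bool" by (force simp: image_iff intro: exI[of _ "- x" for x])
 from this[of "%t. ((%r. measure lebesgue ({y\<in>\<Omega>. - u y < t} \<inter> ball x r)/measure lebesgue (ball x r)) \<longlongrightarrow> 0) (at_right 0)"]
 show ?thesis by (simp add: ap_upper_def ap_lower_def Inf_real_def)
qed

locale bounded_fun =
 fixes \<Omega> :: "'a::euclidean_space set" and v :: "'a => real" and C :: real
 assumes \<Omega>: "open \<Omega>" and v_borel [measurable]: "v \<in> Borel" and v_bound: "!!x. \<bar>v x\<bar> <= C"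
begin

lemma \<Omega>_borel [measurable]: "\<Omega> \<in> sets borel" using \<Omega> by simp

definition low :: "real => 'a set" where "low t = {y\<in>\<Omega>. v y < t}"

lemma low_borel [measurable]: "low t \<in> sets borel" unfolding low_def by measurable

lemma N1_mono: "A <= B ==> x \<in> N1 (- A) ==> A \<in> sets borel ==> B \<in> sets borel ==> x \<in> N1 (- B)"
proof (rule ccontr)
 assume *: "A <= B" "x \<in> N1 (- A)" and [measurable]: "A \<in> sets borel" "B \<in> sets borel" and "x \<notin> N1 (- B)"
 hence "((%r. vol (B \<inter> ball x r)/vol (ball x r)) \<longlongrightarrow> 0) (at_right 0)"
  by (simp add: N1_density_zero)
 hence "((%r. vol (A \<inter> ball x r)/vol (ball x r)) \<longlongrightarrow> 0) (at_right 0)"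
  by (rule Lim_null_comparison[rotated])
    (use*in "auto intro!: always_eventually divide_right_mono measure_mono_ball[of _ _ x]")
 thus False using *(2) N1_density_zero[of A x] by simp
qed

lemma full_density: assumes "x \<in> \<Omega>" shows "x \<in> N1 (- \<Omega>)"
proof (rule ccontr)
 assume "x \<notin> N1 (- \<Omega>)"
 hence lim: "((%r. vol (\<Omega> \<inter> ball x r)/vol (ball x r)) \<longlongrightarrow> 0) (at_right 0)"
  by (simp add: N1_density_zero)
 obtain d where d: "d > 0" "ball x d <= \<Omega>" using \<Omega> assms openE by blast
 have "\<forall>\<^sub>F r in at_right 0. vol (\<Omega> \<inter> ball x r)/vol (ball x r) = 1"
  unfolding eventually_at_right_field
 proof (intro exI[of _ d] conjI allI impI)
  fix r assume r: "0 < r" "r < d"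
  hence "\<Omega> \<inter> ball x r = ball x r" using d by auto
  moreover have "vol (ball x r) > 0" using r by (simp add: content_ball_power)
  ultimately show "vol (\<Omega> \<inter> ball x r)/vol (ball x r) = 1" by simp
 qed (use d in simp)
 from tendsto_cong[THEN iffD1, OF this lim] have "((%r::real. 1 :: real) \<longlongrightarrow> 0) (at_right 0)" .
 thus False by (simp add: tendsto_const_iff trivial_limit_at_right_real)
qed

lemma N1_Un: "x \<in> N1 (- (A \<union> B)) ==> A \<in> sets borel ==> B \<in> sets borel ==> x \<in> N1 (- A) \<or> x \<in> N1 (- B)"
proof (rule ccontr)
 assume *: "x \<in> N1 (- (A \<union> B))" and [measurable]: "A \<in> sets borel" "B \<in> sets borel" and "\<not> (x \<in> N1 (- A) \<or> x \<in> N1 (- B))"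
 hence "((%r. vol (A \<inter> ball x r)/vol (ball x r)+vol (B \<inter> ball x r)/vol (ball x r)) \<longlongrightarrow> 0) (at_right 0)" (is "(?g \<longlongrightarrow> 0) _")
  by (intro tendsto_add_zero) (simp_all add: N1_density_zero)
 note lim = this
 have le: "norm (vol ((A \<union> B) \<inter> ball x r)/vol (ball x r)) <=
   vol (A \<inter> ball x r)/vol (ball x r)+vol (B \<inter> ball x r)/vol (ball x r)" for r
 proof -
  have "vol ((A \<union> B) \<inter> ball x r) <= vol (A \<inter> ball x r)+vol (B \<inter> ball x r)"
   unfolding Int_Un_distrib2 by (rule measure_Un_le) auto
  from divide_right_mono[OF this, of "vol (ball x r)"] show ?thesis by (simp add: add_divide_distrib)
 qed
 have "((%r. vol ((A \<union> B) \<inter> ball x r)/vol (ball x r)) \<longlongrightarrow> 0) (at_right 0)"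
  by (rule Lim_null_comparison[OF always_eventually lim]) (intro allI le)
 thus False using *(1) N1_density_zero[of "A \<union> B" x] by simp
qed

text \<open>The levels whose sublevel set has density zero form a down-set that contains -C. A level
  above C has all of \<Omega> as sublevel set, which has full density at an interior point, so the
  supremum exists and separates the two cases.\<close>

lemma ap_lower_iff: assumes x: "x \<in> \<Omega>"
 shows "t < ap_lower \<Omega> v x ==> x \<notin> N1 (- low t)" "ap_lower \<Omega> v x < t ==> x \<in> N1 (- low t)"
  "\<bar>ap_lower \<Omega> v x\<bar> <= C"
proof -
 define S where "S = {t. x \<notin> N1 (- low t)}"
 have eq: "ap_lower \<Omega> v x = Sup S"
  unfolding ap_lower_def S_def N1_density_zero[OF low_borel] low_def[symmetric] by simp
 have mono: "s \<in> S" if "t \<in> S" "s <= t" for s t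
  using N1_mono[of "low s" "low t" x] that by (force simp: S_def low_def[of s] low_def[of t])
 have lo: "-C \<in> S"
 proof -
  have "low (-C) = {}" using v_bound by (auto simp: low_def abs_le_iff) (metis minus_le_iff not_less)
  thus ?thesis unfolding S_def by (simp add: N1_density_zero)
 qed
 have hi: "t <= C" if "t \<in> S" for t
 proof (rule ccontr)
  assume "\<not> t <= C"
  hence "v y < t" for y using v_bound[of y] by linarith
  hence "low t = \<Omega>" by (auto simp: low_def)
  thus False using that full_density[OF x] by (simp add: S_def)
 qed
 hence bdd: "bdd_above S" by (intro bdd_aboveI)
 show "x \<notin> N1 (- low t)" if "t < ap_lower \<Omega> v x"
  using that mono lo less_cSup_iff[OF _ bdd, of t] less_imp_le unfolding eq by (auto simp: S_def)
 show "x \<in> N1 (- low t)" if "ap_lower \<Omega> v x < t"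
  using that cSup_upper[OF _ bdd, of t] unfolding eq by (auto simp: S_def)
 have "-C <= Sup S" using cSup_upper[OF lo bdd] .
 moreover have "Sup S <= C" using lo hi by (intro cSup_least) auto
 ultimately show "\<bar>ap_lower \<Omega> v x\<bar> <= C" by (simp add: eq)
qed

definition um :: "'a => real" where "um x = (if x \<in> \<Omega> then ap_lower \<Omega> v x else 0)"

lemma um_borel [measurable]: "um \<in> Borel"
proof (rule borel_measurable_iff_greater[THEN iffD2, rule_format])
 fix t
 have eq: "{x \<in> space borel. t < um x} = (if t < 0 then - \<Omega> else {}) \<union> (\<Omega> \<inter> (\<Union>q\<in>{q\<in>\<rat>. t < q}. - N1 (- low q)))"
 proof (intro set_eqI)
  fix x
  show "x \<in> {x \<in> space borel. t < um x} \<longleftrightarrow> x \<in> (if t < 0 then - \<Omega> else {}) \<union> (\<Omega> \<inter> (\<Union>q\<in>{q\<in>\<rat>. t < q}. - N1 (- low q)))"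
  proof (cases "x \<in> \<Omega>")
   case True
   have "t < ap_lower \<Omega> v x \<longleftrightarrow> (EX q:\<rat>. t < q & x \<notin> N1 (- low q))"
    using ap_lower_iff[OF True] Rats_dense_in_real[of t "ap_lower \<Omega> v x"] by (meson less_le_trans not_less)
   thus ?thesis using True by (auto simp: um_def)
  qed (auto simp: um_def)
 qed
 have "N1 (- low q) \<in> sets borel" for q by (rule borel_set.N1_borel) (standard, simp)
 moreover have "countable {q\<in>\<rat>. t < q}" by (rule countable_subset[OF _ countable_rat]) auto
 ultimately have "(\<Union>q\<in>{q\<in>\<rat>. t < q}. - N1 (- low q)) \<in> sets borel"
  by (intro sets.countable_UN') auto
 thus "{x \<in> space borel. t < um x} \<in> sets borel" unfolding eq by auto
qed

end

section \<open>The flux through a subgraph\<close>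

text \<open>The data are cut off at \<bar>s\<bar> >= a, beyond the range of v, so that integrals in
  s run over a bounded interval. Of the two bounds on b, \<open>Mb\<close> holds everywhere and
  serves integrability and crude constants, whereas \<open>M0\<close> holds almost everywhere and is
  the constant of the final estimate.\<close>

locale pairing = bounded_fun \<Omega> v C for \<Omega> :: "'a::euclidean_space set" and v C +
 fixes b :: "'a => real => 'a" and f :: "'a => real => real" and \<sigma> kappa :: "'a measure" and gD :: "'a => 'a" and a Mb M0 :: real
 assumes aC: "C < a"
  and b_borel [measurable]: "(%p. un b p) \<in> Borel" and b_bound: "!!x s. norm (b x s) <= Mb"
  and b_zero: "!!x s. a <= \<bar>s\<bar> ==> b x s = 0" and b_AE: "AE p in lborel. norm (un b p) <= M0"
  and f_borel [measurable]: "(%p. un f p) \<in> Borel" and f_bound: "!!x s. \<bar>f x s\<bar> <= 1"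
  and f_zero: "!!x s. a <= \<bar>s\<bar> ==> f x s = 0" and sg: "finite_measure \<sigma>" "sets \<sigma> = sets borel"
  and div: "AE s in lborel. ALL ph G K. C1 ph G --> compact K --> K <= \<Omega> --> (ALL x. x \<notin> K --> ph x = 0) -->
    (LI x. b x s \<bullet> G x) = - (LINT x|\<sigma>. ph x*f x s)"
  and kp: "finite_measure kappa" "sets kappa = sets borel" and gD: "integrable kappa gD" "AE x in kappa. norm (gD x) <= 1"
  and v_bv: "!!ph G K. C1 ph G ==> compact K ==> K <= \<Omega> ==> (!!x. x \<notin> K ==> ph x = 0) ==>
    (LI x. v x *\<^sub>R G x) = - (LINT x|kappa. ph x *\<^sub>R gD x)"
begin

lemma sets_sg [measurable_cong, simp]: "sets \<sigma> = sets borel" and sets_kp [measurable_cong, simp]: "sets kappa = sets borel"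
 by (rule sg kp)+

lemma space_sg [simp]: "space \<sigma> = UNIV" "space kappa = UNIV"
 using sets_eq_imp_space_eq[OF sg(2)] sets_eq_imp_space_eq[OF kp(2)] by simp_all

lemma b_measurable [measurable (raw)]:
 "h \<in> measurable N borel ==> h' \<in> measurable N borel ==> (%z. b (h z) (h' z)) \<in> borel_measurable N"
 and f_measurable [measurable (raw)]:
 "h \<in> measurable N borel ==> h' \<in> measurable N borel ==> (%z. f (h z) (h' z)) \<in> borel_measurable N"
 using measurable_compose[of "%z. (h z, h' z)" N borel _ borel, OF _ b_borel]
  measurable_compose[of "%z. (h z, h' z)" N borel _ borel, OF _ f_borel] by (simp_all add: borel_prod[symmetric])

lemma M0_nonneg: "M0 >= 0"
proof -
 have "ae_filter (lborel :: ('a \<times> real) measure) ~= bot" by (simp add: ae_filter_eq_bot_iff)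
 from eventually_happens'[OF this b_AE] show ?thesis using norm_ge_zero order_trans by blast
qed

lemma Mb_nonneg: "Mb >= 0" using b_bound[of undefined undefined] norm_ge_zero order_trans by blast

definition M :: "('a \<times> real) measure" where "M = \<sigma> \<Otimes>\<^sub>M lborel"

lemma sets_M [measurable_cong]: "sets M = sets borel"
 unfolding M_def by (simp add: borel_prod[symmetric] cong: sets_pair_measure_cong)

lemma pair_sf: "pair_sigma_finite \<sigma> lborel"
 by (intro pair_sigma_finite.intro lborel.sigma_finite_measure_axioms) (metis sg(1) finite_measure.axioms(1))

lemma bounded_box_integrable:
 fixes H :: "'a \<times> real => 'c::{banach,second_countable_topology}"
 assumes H: "H \<in> Borel" and b: "!!p. norm (H p) <= c" "!!p. a <= \<bar>snd p\<bar> ==> H p = 0"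
 shows "integrable M H" and "compact K ==> (!!p. fst p \<notin> K ==> H p = 0) ==> integ H"
proof -
 interpret S: finite_measure \<sigma> by (rule sg)
 interpret pair_sigma_finite \<sigma> lborel by (rule pair_sf)
 have [measurable]: "H \<in> borel_measurable M" using H sets_M by (simp cong: measurable_cong_sets)
 have box: "emeasure M (UNIV \<times> {-a..a}) < \<infinity>"
  unfolding M_def by (subst lborel.emeasure_pair_measure_Times) (auto simp: ennreal_mult_less_top S.emeasure_eq_measure emeasure_lborel_Icc_eq)
 have "UNIV \<times> {-a..a} \<in> sets M" unfolding sets_M by (simp add: borel_Times)
 hence i: "integrable M (%p. c*ind (UNIV \<times> {-a..a}) p)" using box by (intro integrable_mult_right) simp
 show "integrable M H" by (rule B_integrable_bound[OF i])
    (use b order_trans[OF b(1) abs_ge_self] in "auto simp: indicator_def mem_Times_iff")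
 assume K: "compact K" "!!p. fst p \<notin> K ==> H p = 0"
 have "compact (K \<times> {-a..a})" using K by (intro compact_Times) auto
 hence i: "integ (%p. c*ind (K \<times> {-a..a}) p)" using emeasure_bounded_finite[OF compact_imp_bounded]
  by (intro integrable_mult_right) (auto simp: integrable_indicator_iff borel_compact)
 have [measurable]: "H \<in> borel_measurable lborel" using H by simp
 show "integ H" by (rule B_integrable_bound[OF i])
    (use b K(2) order_trans[OF b(1) abs_ge_self] in "auto simp: indicator_def mem_Times_iff")
qed

lemma fubini_M: "integrable M H ==> (LINT p|M. H p) = (LI s. LINT x|\<sigma>. H (x, s))"
 for H :: "'a \<times> real => real"
 using pair_sigma_finite.integral_snd[OF pair_sf, of "%x s. H (x, s)"] by (simp add: M_def split_def)

lemma fubini_lborel: "integ H ==> (LI p. H p) = (LI s. LI x. H (x, s))"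
 for H :: "'a \<times> real => real"
 using lborel_pair.integral_snd[of "%x s. H (x, s)"] by (simp add: lborel_prod split_def)

text \<open>Since the lifted field has no vertical component, its divergence identity is the one of
  b on each slice, integrated over s. No regularity of P in s beyond measurability enters.\<close>

lemma div_slices:
 fixes P :: "'a \<times> real => real"
 assumes P: "!!s. C1 (%x. P (x, s)) (%x. D (x, s))" "compact K" "K <= \<Omega>" "!!x s. x \<notin> K ==> P (x, s) = 0"
  and m: "P \<in> Borel" "D \<in> Borel" and bd: "!!p. \<bar>P p\<bar> <= c" "!!p. norm (D p) <= c'"
 shows "(LINT p|M. P p*un f p) = - (LI p. un b p \<bullet> D p)"
proof -
 note [measurable] = m
 have D0: "D (x, s) = 0" if "x \<notin> K" for x s
  using C1_zero_outside[OF P(1) compact_imp_closed[OF P(2)] P(4)] that by blast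
 have c: "c >= 0" using bd(1)[of undefined] by simp
 have iM: "integrable M (%p. P p*un f p)"
 proof (rule bounded_box_integrable(1)[where c=c])
  show "norm (P p*un f p) <= c" for p
   using mult_mono[OF bd(1)[of p] f_bound[of "fst p" "snd p"]] c by (simp add: abs_mult)
 qed (auto simp: f_zero)
 have iL: "integ (%p. un b p \<bullet> D p)"
 proof (rule bounded_box_integrable(2)[where c="Mb*c'" and K=K])
  show "norm (un b p \<bullet> D p) <= Mb*c'" for p
   using Cauchy_Schwarz_ineq2[of "un b p" "D p"] mult_mono[OF b_bound[of "fst p" "snd p"] bd(2)[of p] Mb_nonneg] by simp
 qed (use P(2) D0 in "auto simp: b_zero")
 have "(LI s. LINT x|\<sigma>. P (x, s)*f x s) = (LI s. - (LI x. b x s \<bullet> D (x, s)))"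
 proof (rule integral_cong_AE)
  show "AE s in lborel. (LINT x|\<sigma>. P (x, s)*f x s) = - (LI x. b x s \<bullet> D (x, s))" using div
  proof eventually_elim
   case (elim s)
   from elim[rule_format, OF P(1) P(2,3)] P(4) show ?case by simp
  qed
  have "(%s. LINT x|\<sigma>. P (x, s)*f x s) \<in> borel_measurable lborel"
  proof -
   interpret sigma_finite_measure \<sigma> using sg(1) finite_measure.axioms(1) by blast
   show ?thesis by measurable
  qed
  thus "(%s. LINT x|\<sigma>. P (x, s)*f x s) \<in> borel_measurable lborel" .
 qed measurable
 thus ?thesis using fubini_M[OF iM] fubini_lborel[OF iL] by simp
qed

text \<open>Only the horizontal part of a gradient meets the lifted field, so the everywhere bound
  for b is the constant; the content belongs to the product, of one dimension more.\<close>

sublocale gradient_bound M "%p. un f p" "\<Omega> \<times> UNIV" Mb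
proof
 show "integrable M (%p. un f p)"
  by (rule bounded_box_integrable(1)[where c=1]) (use f_bound f_zero in auto)
 show "open (\<Omega> \<times> (UNIV :: real set))" using \<Omega> by (intro open_Times) auto
 show "2 <= DIM('a \<times> real)" by (simp add: DIM_positive Suc_leI)
 fix ph g and K :: "('a \<times> real) set" assume phi: "C1 ph g" "compact K" "K <= \<Omega> \<times> UNIV" "!!x. x \<notin> K ==> ph x = 0"
 have g0: "!!x. x \<notin> K ==> g x = 0" using C1_zero_outside[OF phi(1) compact_imp_closed[OF phi(2)] phi(4)] by blast
 obtain c where c: "!!p. \<bar>ph p\<bar> <= c"
  using bounded_compact_support[OF C1_continuous[OF phi(1)] phi(2) phi(4)] by (metis real_norm_def)
 obtain c' where c': "!!p. norm (g p) <= c'"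
  using bounded_compact_support[OF C1_continuous_grad[OF phi(1)] phi(2) g0] by metis
 have [measurable]: "ph \<in> Borel" "g \<in> Borel" using phi(1) by measurable
 have fm [measurable]: "(%p. fst (g p)) \<in> Borel" by (rule measurable_compose[OF _ fst_borel]) measurable
 have "(LINT p|M. ph p*un f p) = - (LI p. un b p \<bullet> fst (g p))"
 proof (rule div_slices[where K="fst ` K"])
  show "C1 (%x. ph (x, s)) (%x. fst (g (x, s)))" for s by (rule C1_slice[OF phi(1)])
  show "compact (fst ` K)" by (intro compact_continuous_image phi(2) continuous_intros)
  show "ph (x, s) = 0" if "x \<notin> fst ` K" for x s using phi(4) that by force
  show "norm (fst (g p)) <= c'" for p using norm_fst_le'[of "g p"] c'[of p] by simp
 qed (use phi(3) c in auto)
 also have "norm ... <= (LI p. Mb*norm (g p))" unfolding norm_minus_cancel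
 proof (rule B_integral_norm_bound_integral)
  have gi: "integ g" by (rule integrable_compact_support[OF C1_continuous_grad[OF phi(1)] phi(2) g0])
  thus i: "integ (%p. Mb*norm (g p))" by auto
  have le: "norm (un b p \<bullet> fst (g p)) <= Mb*norm (g p)" for p
   using Cauchy_Schwarz_ineq2[of "un b p" "fst (g p)"] mult_mono[OF b_bound[of "fst p" "snd p"] norm_fst_le'[of "g p"] Mb_nonneg] by simp
  thus "!!p. norm (un b p \<bullet> fst (g p)) <= Mb*norm (g p)" .
  show "integ (%p. un b p \<bullet> fst (g p))"
   by (rule B_integrable_bound[OF i]) (use le Mb_nonneg in auto)
 qed
 finally show "\<bar>LINT p|M. ph p*un f p\<bar> <= Mb*(LI p. norm (g p))" by simp
qed (rule sets_M, rule Mb_nonneg)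

end

text \<open>A test function \<open>ph\<close> together with a cutoff \<open>ch\<close> that equals one near its support.\<close>
locale pairing_cut = pairing +
 fixes ch dch V K' ph G K O1
 assumes ch: "C1 ch dch" "!!x. 0 <= ch x" "!!x. ch x <= 1" "open V" "!!x. x \<in> V ==> ch x = 1"
   "compact K'" "K' <= \<Omega>" "!!x. x \<notin> K' ==> ch x = 0"
  and ph: "C1 ph G" "!!x. 0 <= ph x" "!!x. ph x <= 1" "compact K" "K <= V" "K <= O1" "K <= \<Omega>" "open O1" "!!x. x \<notin> K ==> ph x = 0"
begin

text \<open>On V the top \<open>l+w\<close> of the subgraph is the graph of v. The shift a+1 keeps
  the height positive and places the bottom below -a, where b and f vanish.\<close>

definition w :: "'a => real" where "w x = ch x*(v x+a+1)"
definition "l = - (a+1)"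
definition "L = 2*(a+1)"

lemma cut_measurable [measurable]: "ch \<in> Borel" "dch \<in> Borel"
 "ph \<in> Borel" "G \<in> Borel" "V \<in> sets borel" "O1 \<in> sets borel" "w \<in> Borel"
 using ch(1,4) ph(1,8) by (auto simp: w_def[abs_def]; measurable)+

lemma va: "0 < v x+a+1" "v x+a+1 < L" "\<bar>v x+a+1\<bar> <= L" using v_bound[of x] aC by (auto simp: L_def)

lemma a_pos: "a > 0" using v_bound[of undefined] aC by auto

lemma w_props: "0 <= w x" "w x <= L" "x \<notin> K' ==> w x = 0" "x \<in> V ==> w x = v x+a+1"
 using mult_mono[of "ch x" 1 "v x+a+1" L] va[of x] ch(2,3)[of x] ch(5,8)[of x] by (auto simp: w_def)

lemma dch_0: "x \<in> V ==> dch x = 0" "x \<notin> K' ==> dch x = 0"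
proof -
 show "dch x = 0" if "x \<in> V"
  using C1_zero_outside[OF C1_diff[OF ch(1) C1_const[of 1]], of "- V" x] ch(4,5) that by auto
 show "x \<notin> K' ==> dch x = 0" using C1_zero_outside[OF ch(1) compact_imp_closed[OF ch(6)] ch(8)] by blast
qed

lemma G_0: "x \<notin> K ==> G x = 0" using C1_zero_outside[OF ph(1) compact_imp_closed[OF ph(4)] ph(9)] by blast

lemma va_integrable:
 fixes H :: "'a => 'a" assumes "continuous_on UNIV H" "!!x. x \<notin> K' ==> H x = 0"
 shows "integ (%y. (v y+a+1) *\<^sub>R H y)" "integ (%y. v y *\<^sub>R H y)" "integ H"
proof -
 show i: "integ H" by (rule integrable_compact_support[OF assms(1) ch(6) assms(2)])
 have [measurable]: "H \<in> Borel" using assms(1) by (rule borel_measurable_continuous_onI)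
 have iL: "integ (%y. L*norm (H y))" using i by simp
 have bnd: "norm (t *\<^sub>R H y) <= norm (L*norm (H y))" if "\<bar>t\<bar> <= L" for t y
  unfolding norm_scaleR real_norm_def abs_mult abs_norm_cancel by (rule mult_right_mono) (use that in auto)
 show "integ (%y. (v y+a+1) *\<^sub>R H y)" by (rule B_integrable_bound[OF iL]) (measurable, intro AE_I2 bnd va)
 have "\<bar>v y\<bar> <= L" for y using v_bound[of y] aC a_pos by (auto simp: abs_le_iff L_def)
 thus "integ (%y. v y *\<^sub>R H y)" by (intro B_integrable_bound[OF iL]) (measurable, intro AE_I2 bnd)
qed

text \<open>The product rule for a function of bounded variation and a C^1 cut-off, read after
  mollification: one term with the gradient of \<open>ch\<close>, one with the gradient measure of
  v.\<close>

lemma w_cv: assumes r: "rho > 0"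
 shows "cv w (dmol rho) x = (LI y. ((v y+a+1)*mol rho (x - y)) *\<^sub>R dch y)+(LINT y|kappa. (ch y*mol rho (x - y)) *\<^sub>R gD y)"
proof -
 define m where "m y = mol rho (x - y)" for y
 define dm where "dm y = dmol rho (x - y)" for y
 have m: "C1 m (%y. - dm y)" unfolding m_def dm_def by (rule C1_reflect[OF C1_mol])
 note H = C1_mult[OF ch(1) m]
 have H0: "ch y*m y = 0" if "y \<notin> K'" for y using ch(8)[OF that] by simp
 define A1 where "A1 y = m y *\<^sub>R dch y" for y
 define A2 where "A2 y = ch y *\<^sub>R dm y" for y
 have c: "continuous_on UNIV A1" "continuous_on UNIV A2" unfolding A1_def A2_def
  by (intro continuous_intros C1_continuous[OF m] C1_continuous[OF ch(1)] C1_continuous_grad[OF ch(1)]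
    continuous_on_minus[OF C1_continuous_grad[OF m], simplified])+
 have z: "A1 y = 0" "A2 y = 0" if "y \<notin> K'" for y using ch(8)[OF that] dch_0(2)[OF that] by (auto simp: A1_def A2_def)
 note i = va_integrable[OF c(1) z(1)] va_integrable[OF c(2) z(2)]
 have "(LI y. v y *\<^sub>R (ch y *\<^sub>R - dm y+m y *\<^sub>R dch y)) = - (LINT y|kappa. (ch y*m y) *\<^sub>R gD y)"
  by (rule v_bv[OF H ch(6,7) H0])
 moreover have "(LI y. ch y *\<^sub>R - dm y+m y *\<^sub>R dch y) = 0" by (rule C1_integral_grad_zero[OF H ch(6) H0])
 ultimately have "(LI y. v y *\<^sub>R A1 y) - (LI y. v y *\<^sub>R A2 y) = - (LINT y|kappa. (ch y*m y) *\<^sub>R gD y)"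
  "(LI y. A1 y) - (LI y. A2 y) = 0"
  using i by (simp_all add: A1_def A2_def scaleR_right_diff_distrib flip: B_integral_diff)
 moreover have "(LI y. (v y+a+1) *\<^sub>R A y) = (LI y. v y *\<^sub>R A y)+(a+1) *\<^sub>R (LI y. A y)"
  if "integ (%y. v y *\<^sub>R A y)" "integ A" for A :: "'a => 'a"
  using that by (simp add: scaleR_left_distrib add.assoc flip: B_integral_add Bochner_Integration.integral_scaleR_right)
 ultimately have "(LI y. (v y+a+1) *\<^sub>R A1 y)+(LINT y|kappa. (ch y*m y) *\<^sub>R gD y) = (LI y. (v y+a+1) *\<^sub>R A2 y)"
  using i by (simp add: algebra_simps)
 thus ?thesis by (simp add: cv_def A1_def A2_def m_def dm_def w_def mult.commute mult.left_commute)
qed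

text \<open>By Fubini the mollified weight h is at most the indicator of A, because only points
  within rho of the support of h are reached. This bounds weighted gradient masses by the gradient
  measure on a neighbourhood.\<close>

lemma PT_le: assumes r: "rho > 0" and h [measurable]: "h \<in> Borel" "!!x. 0 <= h x" "!!x. h x <= 1"
  and A [measurable]: "A \<in> sets borel" and hA: "!!x y. h x ~= 0 ==> norm (x - y) < rho ==> y \<in> A"
 shows "(LI x. h x*norm (cv w (dmol rho) x)) <= (LI y. ind A y*((v y+a+1)*norm (dch y)))+measure kappa A"
proof -
 interpret kappa: finite_measure kappa by (rule kp)
 have [measurable]: "gD \<in> Borel" using gD(1) by (metis borel_measurable_integrable measurable_cong_sets sets_kp)
 define q where "q y = (v y+a+1)*norm (dch y)" for y
 have q0: "q y >= 0" for y using va[of y] by (simp add: q_def)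
 have [measurable]: "q \<in> Borel" unfolding q_def by measurable
 have qi: "integ (%y. ind A y*q y)"
 proof (rule B_integrable_bound)
  show "integ (%y. (v y+a+1) *\<^sub>R dch y)" by (rule va_integrable(1)[OF C1_continuous_grad[OF ch(1)] dch_0(2)])
 qed (use va in "auto simp: q_def indicator_def abs_mult")
 have hm: "(NI x. ennreal (h x)*ennreal (mol rho (x - y))) <= ind A y" for y
 proof (cases "y \<in> A")
  case True
  have "(NI x. ennreal (h x)*ennreal (mol rho (x - y))) <= (NI x. ennreal (mol rho (x - y)))"
   using mult_right_mono[OF ennreal_leI[OF h(3)]] by (intro nn_integral_mono) (metis ennreal_1 mult_1 zero_le)
  thus ?thesis using True by (simp add: mol_mass[OF r])
 next
  case False
  have z: "ennreal (h x)*ennreal (mol rho (x - y)) = 0" for x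
   using hA[of x y] False mol_eq_0[OF r, of "x - y"] by (cases "h x = 0"; cases "norm (x - y) < rho") auto
  show ?thesis unfolding z by simp
 qed
 have le: "ennreal (h x*norm (cv w (dmol rho) x)) <= (NI y. ennreal (q y)*(ennreal (h x)*ennreal (mol rho (x - y))))
  +(\<integral>\<^sup>+y. ennreal (h x)*ennreal (mol rho (x - y)) \<partial>kappa)" for x
 proof -
  obtain Bm where Bm: "!!x. norm (mol rho (x::'a)) <= Bm" using mol_bounded[OF r] by (metis real_norm_def)
  have n1: "ennreal (norm (LINT y|M'. H y)) <= (\<integral>\<^sup>+y. ennreal (norm (H y)) \<partial>M')" for M' and H :: "'a => 'a"
   by (cases "integrable M' H") (auto simp: integral_norm_bound_ennreal not_integrable_integral_eq)
  have "ennreal (norm (cv w (dmol rho) x)) <= ennreal (norm (LI y. ((v y+a+1)*mol rho (x - y)) *\<^sub>R dch y))+ennreal (norm (LINT y|kappa. (ch y*mol rho (x - y)) *\<^sub>R gD y))"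
   unfolding w_cv[OF r] by (simp add: norm_triangle_ineq ennreal_leI flip: ennreal_plus)
  also have "... <= (NI y. ennreal (q y)*ennreal (mol rho (x - y)))+(\<integral>\<^sup>+y. ennreal (mol rho (x - y)) \<partial>kappa)"
  proof (intro add_mono order_trans[OF n1])
   show "(NI y. ennreal (norm (((v y+a+1)*mol rho (x - y)) *\<^sub>R dch y))) <= (NI y. ennreal (q y)*ennreal (mol rho (x - y)))"
   proof (rule nn_integral_mono)
    fix y
    have "norm (((v y+a+1)*mol rho (x - y)) *\<^sub>R dch y) = q y*mol rho (x - y)"
     using va(1)[of y] mol_nonneg[of rho "x - y"] by (simp add: q_def abs_mult)
    thus "ennreal (norm (((v y+a+1)*mol rho (x - y)) *\<^sub>R dch y)) <= ennreal (q y)*ennreal (mol rho (x - y))"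
     by (simp only: ennreal_mult[OF q0 mol_nonneg] order_refl)
   qed
   show "(\<integral>\<^sup>+y. ennreal (norm ((ch y*mol rho (x - y)) *\<^sub>R gD y)) \<partial>kappa) <= (\<integral>\<^sup>+y. ennreal (mol rho (x - y)) \<partial>kappa)"
   proof (rule nn_integral_mono_AE)
    show "AE y in kappa. ennreal (norm ((ch y*mol rho (x - y)) *\<^sub>R gD y)) <= ennreal (mol rho (x - y))"
     using gD(2)
    proof eventually_elim
     case (elim y)
     have "norm ((ch y*mol rho (x - y)) *\<^sub>R gD y) = mol rho (x - y)*(ch y*norm (gD y))"
      using ch(2)[of y] mol_nonneg[of rho "x - y"] by (simp add: abs_mult)
     also have "... <= mol rho (x - y)*1"
      using ch(2,3)[of y] elim by (intro mult_left_mono mult_le_one mol_nonneg) auto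
     finally show ?case by (simp add: ennreal_leI)
    qed
   qed
  qed
  finally have "ennreal (h x)*ennreal (norm (cv w (dmol rho) x)) <= ennreal (h x)*((NI y. ennreal (q y)*ennreal (mol rho (x - y)))+(\<integral>\<^sup>+y. ennreal (mol rho (x - y)) \<partial>kappa))"
   by (rule mult_left_mono) simp
  thus ?thesis
   using h(2)[of x] by (simp add: ennreal_mult distrib_left nn_integral_cmult[symmetric] mult.left_commute)
 qed
 have [measurable]: "(%p. mol rho (fst p - snd p)) \<in> borel_measurable (lborel \<Otimes>\<^sub>M kappa)" by measurable
 have ps: "pair_sigma_finite lborel kappa" by (intro pair_sigma_finite.intro lborel.sigma_finite_measure_axioms kappa.sigma_finite_measure_axioms)
 have "(NI x. ennreal (h x*norm (cv w (dmol rho) x))) <= (\<integral>\<^sup>+x. (NI y. ennreal (q y)*(ennreal (h x)*ennreal (mol rho (x - y))))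
  +(\<integral>\<^sup>+y. ennreal (h x)*ennreal (mol rho (x - y)) \<partial>kappa) \<partial>lborel)"
  by (intro nn_integral_mono le)
 also have "... = (NI x. NI y. ennreal (q y)*(ennreal (h x)*ennreal (mol rho (x - y))))
  +(\<integral>\<^sup>+x. \<integral>\<^sup>+y. ennreal (h x)*ennreal (mol rho (x - y)) \<partial>kappa \<partial>lborel)"
  by (rule nn_integral_add) measurable
 also have "(NI x. NI y. ennreal (q y)*(ennreal (h x)*ennreal (mol rho (x - y))))
  = (NI y. NI x. ennreal (q y)*(ennreal (h x)*ennreal (mol rho (x - y))))"
  by (rule lborel_pair.Fubini'[symmetric]) measurable
 also have "... = (NI y. ennreal (q y)*(NI x. ennreal (h x)*ennreal (mol rho (x - y))))"
  by (intro nn_integral_cong nn_integral_cmult) measurable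
 also have "... <= (NI y. ennreal (q y)*ind A y)" by (intro nn_integral_mono mult_left_mono hm) simp
 also have "... = ennreal (LI y. ind A y*q y)"
  by (subst nn_integral_eq_integral[OF qi, symmetric]) (auto simp: q0 ennreal_mult ennreal_indicator mult.commute intro!: nn_integral_cong)
 also have "(\<integral>\<^sup>+x. \<integral>\<^sup>+y. ennreal (h x)*ennreal (mol rho (x - y)) \<partial>kappa \<partial>lborel) = (\<integral>\<^sup>+y. (NI x. ennreal (h x)*ennreal (mol rho (x - y))) \<partial>kappa)"
  by (rule pair_sigma_finite.Fubini'[OF ps, symmetric]) measurable
 also have "... <= (\<integral>\<^sup>+y. ind A y \<partial>kappa)" by (intro nn_integral_mono hm)
 also have "... = ennreal (measure kappa A)" by (simp add: kappa.emeasure_eq_measure)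
 finally have "(NI x. ennreal (h x*norm (cv w (dmol rho) x))) <= ennreal ((LI y. ind A y*q y)+measure kappa A)"
  using q0 by (simp add: add_right_mono)
 hence "(LI x. h x*norm (cv w (dmol rho) x)) <= (LI y. ind A y*q y)+measure kappa A"
  using h(2) q0 by (intro integral_real_bounded) auto
 thus ?thesis by (simp add: q_def)
qed

end

section \<open>Upper limits, clamped levels and the complementary subgraph\<close>

context pairing begin

sublocale neg: bounded_fun \<Omega> "%x. - v x" C by standard (use \<Omega> v_bound in auto)

definition up :: "'a => real" where "up x = - neg.um x"

lemma up_borel [measurable]: "up \<in> Borel" unfolding up_def by measurable

text \<open>If the lower limit exceeded the upper one, two sublevel sets, of v and of -v, would each
  have density zero at x although they cover \<Omega>.\<close>

lemma um_le_up: "um x <= up x"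
proof (cases "x \<in> \<Omega>")
 case True
 show ?thesis
 proof (rule ccontr)
  assume "\<not> um x <= up x"
  then obtain s where s: "up x < s" "s < um x" using dense[of "up x" "um x"] by auto
  obtain t where t: "s < t" "t < um x" using dense[OF s(2)] by blast
  have "- s < neg.um x" using s(1) by (simp add: up_def)
  from dense[OF this] obtain t' where t': "- s < t'" "t' < neg.um x" by blast
  have "low t \<union> neg.low t' = \<Omega>" using t t' by (auto simp: low_def neg.low_def)
  thus False
   using full_density[OF True] N1_Un[of x "low t" "neg.low t'"] ap_lower_iff(1)[OF True, of t] neg.ap_lower_iff(1)[OF True, of t'] t t' True
   by (auto simp: um_def neg.um_def)
 qed
qed (auto simp: up_def um_def neg.um_def)

lemma um_bound: "\<bar>um x\<bar> <= C" "\<bar>up x\<bar> <= C"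
 using ap_lower_iff(3)[of x] neg.ap_lower_iff(3)[of x] v_bound[of x] by (auto simp: up_def um_def neg.um_def)

text \<open>\<open>c\<close> clamped to the interval between the approximate limits.\<close>
definition vc :: "real => 'a => real" where "vc c x = max (um x) (min (up x) c)"

lemma vc_borel [measurable]: "vc c \<in> Borel" unfolding vc_def by measurable

end

context pairing_cut begin

definition T0 :: real where "T0 = (LI y. ind UNIV y*((v y+a+1)*norm (dch y)))+measure kappa UNIV"
definition T2 :: real where "T2 = (LI y. norm (L *\<^sub>R dch y))"

sublocale S: bv_bump w L l K' T0
proof
 fix rho :: real assume "rho > 0"
 from PT_le[OF this, of "%_. 1" UNIV] show "(LI x. norm (cv w (dmol rho) x)) <= T0" by (simp add: T0_def)
qed (use w_props ch(6) in auto)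

sublocale S2: bv_bump "%x. L*ch x" L l K' T2
proof
 fix rho :: real assume r: "rho > 0"
 have "C1 (%x. L*ch x) (%x. L *\<^sub>R dch x)" using C1_mult[OF C1_const ch(1), of L] by simp
 from gradient_mass_lsc[OF integrable_compact_support[OF C1_continuous[OF this] ch(6)] this ch(6) _ bounded_linear_id_le r] ch(8)
 show "(LI x. norm (cv (%x. L*ch x) (dmol rho) x)) <= T2" by (simp add: T2_def)
qed (use ch a_pos in "auto simp: L_def")

text \<open>A bounded stand-in for the complement of the subgraph. Near K and for heights in [-a,a]
  the larger subgraph contains every point, so there it is the complement, and the results for
  bounded sets of finite perimeter apply to it.\<close>

definition E2 :: "('a \<times> real) set" where "E2 = S2.E - S.E"

lemma E_iff: "p \<in> S.E \<longleftrightarrow> l < snd p & snd p < l+w (fst p)" "p \<in> S2.E \<longleftrightarrow> l < snd p & snd p < l+L*ch (fst p)"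
 by (auto simp: S.E_def S2.E_def sub_graph_def)

lemma E_sub: "S.E <= S2.E"
proof
 fix p assume "p \<in> S.E"
 moreover have "w (fst p) <= L*ch (fst p)"
  using mult_left_mono[OF less_imp_le[OF va(2)] ch(2), of "fst p" "fst p"] by (simp add: w_def mult.commute)
 ultimately show "p \<in> S2.E" by (auto simp: E_iff)
qed

sublocale E2: bounded_borel E2
 unfolding E2_def by standard (rule sets.Diff[OF S2.E_borel S.E_borel], rule bounded_subset[OF S2.E_bounded Diff_subset])

lemma dmi_E2: assumes "r > 0" shows "mi E2 r p = mi S2.E r p - mi S.E r p" "dmi E2 r p = dmi S2.E r p - dmi S.E r p"
proof -
 have eq: "(ind E2 :: _ => real) = (%q. ind S2.E q - ind S.E q)"
  using E_sub by (auto simp: E2_def indicator_def fun_eq_iff)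
 obtain B where B: "!!x. norm (mol r (x::'a \<times> real)) <= B" using mol_bounded[OF assms] by (metis real_norm_def)
 obtain B' where B': "!!x. norm (dmol r (x::'a \<times> real)) <= B'"
  using bounded_compact_support[OF C1_continuous_grad[OF C1_mol] compact_cball dmol_support[OF assms]] by blast
 show "mi E2 r p = mi S2.E r p - mi S.E r p" "dmi E2 r p = dmi S2.E r p - dmi S.E r p" unfolding mi_def dmi_def eq
  by (rule cv_diff[OF S2.E_integrable S.E_integrable mol_measurable B]) (rule cv_diff[OF S2.E_integrable S.E_integrable dmol_measurable B'])
qed

sublocale E: density_limit S.E "T0+2 * vol S.K1" M "%p. un f p" "\<Omega> \<times> UNIV" Mb
 by standard (rule S.perimeter_bounds(2))

sublocale E2: density_limit E2 "(T2+2 * vol S2.K1)+(T0+2 * vol S.K1)" M "%p. un f p" "\<Omega> \<times> UNIV" Mb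
proof
 fix r :: real assume r: "r > 0"
 have "pm E2 r <= (LI p. norm (dmi S2.E r p)+norm (dmi S.E r p))"
  unfolding pm_def by (rule integral_mono) (use r in "auto simp: dmi_E2 norm_triangle_ineq4 intro!: integrable_norm E2.dmi_integrable S2.dmi_integrable S.dmi_integrable")
 also have "... = pm S2.E r+pm S.E r"
  unfolding pm_def by (intro B_integral_add integrable_norm S2.dmi_integrable S.dmi_integrable r)
 finally show "pm E2 r <= (T2+2 * vol S2.K1)+(T0+2 * vol S.K1)"
  using S.perimeter_bounds(2)[OF r] S2.perimeter_bounds(2)[OF r] by linarith
qed

lemma room: obtains d where "0 < d" "d < 1" "!!x y. x \<in> K ==> norm (x - y) < d ==> y \<in> V & y \<in> \<Omega> & y \<in> O1"
proof -
 have "open (V \<inter> \<Omega> \<inter> O1)" "K <= V \<inter> \<Omega> \<inter> O1" using ch(4) \<Omega> ph(5-8) by auto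
 then obtain e where e: "e > 0" "(\<Union>x\<in>K. ball x e) <= V \<inter> \<Omega> \<inter> O1"
  using compact_subset_open_imp_ball_epsilon_subset[OF ph(4)] by blast
 show ?thesis by (rule that[of "min e (1/2)"]) (use e in "auto simp: dist_norm subset_iff")
qed

lemma E_near: assumes "norm (x - fst p) < d" "\<bar>s - snd p\<bar> < d" "\<bar>s\<bar> <= a" "d < 1" "fst p \<in> V"
 shows "p \<in> S.E \<longleftrightarrow> snd p < v (fst p)" "p \<in> S2.E" "p \<in> E2 \<longleftrightarrow> v (fst p) <= snd p"
proof -
 have "l < snd p" "snd p < a+1" using assms by (auto simp: l_def)
 thus 1: "p \<in> S.E \<longleftrightarrow> snd p < v (fst p)" and 2: "p \<in> S2.E"
  using w_props(4)[OF assms(5)] ch(5)[OF assms(5)] unfolding E_iff by (auto simp: L_def l_def)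
 thus "p \<in> E2 \<longleftrightarrow> v (fst p) <= snd p" by (auto simp: E2_def)
qed

lemma ball_parts: "p \<in> ball (x, s) d ==> norm (x - fst p) < d & \<bar>s - snd p\<bar> < d" for p :: "'a \<times> real"
 using norm_fst_le'[of "(x, s) - p"] norm_snd_le[of "s - snd p" "x - fst p"] by (cases p) (auto simp: dist_norm)

text \<open>Below a level t between s and the approximate limit the matching sublevel set of v
  decides membership in a small ball, so \<open>density_transfer\<close> applies. The excluded
  heights are the graphs of \<open>um\<close> and \<open>up\<close>, null for \<open>M\<close> by
  \<open>AE_graph\<close>.\<close>

lemma N1_E: assumes x: "x \<in> K" and s: "\<bar>s\<bar> <= a"
 shows "s ~= um x ==> (x, s) \<in> N1 S.E \<longleftrightarrow> um x < s" "s ~= up x ==> (x, s) \<in> N1 E2 \<longleftrightarrow> s < up x"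
proof -
 have xO: "x \<in> \<Omega>" using x ph(7) by blast
 obtain d where d: "0 < d" "d < 1" "!!y. norm (x - y) < d ==> y \<in> V & y \<in> \<Omega> & y \<in> O1" using room x by metis
 have near: "fst p \<in> \<Omega> & (p \<in> S.E \<longleftrightarrow> snd p < v (fst p)) & (p \<in> E2 \<longleftrightarrow> v (fst p) <= snd p) & \<bar>s - snd p\<bar> < e"
  if "p \<in> ball (x, s) (min d e)" for p e using E_near[of x p d s] ball_parts[OF that] s d by auto
 have 1: "(x, s) \<notin> N1 S.E" if h: "s < um x"
 proof -
  obtain t where t: "s < t" "t < um x" using dense[OF h] by blast
  show ?thesis
  proof (rule density_transfer(1)[OF S.E_borel low_borel[of t], of "min d (t - s)"])
   show "x \<notin> N1 (- low t)" using ap_lower_iff(1)[OF xO, of t] t xO by (simp add: um_def)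
   show "fst p \<in> low t" if "p \<in> ball (x, s) (min d (t - s))" "p \<notin> S.E" for p
    using near[OF that(1)] that(2) t by (auto simp: low_def)
  qed (use t d in auto)
 qed
 have 2: "(x, s) \<in> N1 S.E" if h: "um x < s"
 proof -
  obtain t where t: "um x < t" "t < s" using dense[OF h] by blast
  show ?thesis
  proof (rule density_transfer(2)[OF S.E_borel low_borel[of t], of "min d (s - t)"])
   show "x \<in> N1 (- low t)" using ap_lower_iff(2)[OF xO, of t] t xO by (simp add: um_def)
   show "p \<notin> S.E" if "p \<in> ball (x, s) (min d (s - t))" "fst p \<in> low t" for p
    using near[OF that(1)] that(2) t by (auto simp: low_def)
  qed (use t d in auto)
 qed
 have 3: "(x, s) \<notin> N1 E2" if "up x < s"
 proof -
  have "- s < neg.um x" using that by (simp add: up_def)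
  from dense[OF this] obtain t where t: "- s < t" "t < neg.um x" by blast
  show ?thesis
  proof (rule density_transfer(1)[OF E2.E_borel neg.low_borel[of t], of "min d (t+s)"])
   show "x \<notin> N1 (- neg.low t)" using neg.ap_lower_iff(1)[OF xO, of t] t xO by (simp add: neg.um_def)
   show "fst p \<in> neg.low t" if "p \<in> ball (x, s) (min d (t+s))" "p \<notin> E2" for p
    using near[OF that(1)] that(2) t by (auto simp: neg.low_def)
  qed (use t d in auto)
 qed
 have 4: "(x, s) \<in> N1 E2" if "s < up x"
 proof -
  have "neg.um x < - s" using that by (simp add: up_def)
  from dense[OF this] obtain t where t: "neg.um x < t" "t < - s" by blast
  show ?thesis
  proof (rule density_transfer(2)[OF E2.E_borel neg.low_borel[of t], of "min d (- s - t)"])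
   show "x \<in> N1 (- neg.low t)" using neg.ap_lower_iff(2)[OF xO, of t] t xO by (simp add: neg.um_def)
   show "p \<notin> E2" if "p \<in> ball (x, s) (min d (- s - t))" "fst p \<in> neg.low t" for p
    using near[OF that(1)] that(2) t by (auto simp: neg.low_def)
  qed (use t d in auto)
 qed
 show "s ~= um x ==> (x, s) \<in> N1 S.E \<longleftrightarrow> um x < s" using 1 2 by (meson linorder_neqE less_asym)
 show "s ~= up x ==> (x, s) \<in> N1 E2 \<longleftrightarrow> s < up x" using 3 4 by (meson linorder_neqE less_asym)
qed

text \<open>A ball of radius below d around such a point is contained in the larger subgraph, whose
  mollification is therefore one.\<close>

lemma mi_E2:
 assumes "x \<in> K" "\<bar>s\<bar> <= a" and r: "0 < r" "r <= d" "d < 1" "!!y. norm (x - y) < d ==> y \<in> V"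
 shows "mi E2 r (x, s) = 1 - mi S.E r (x, s)"
proof -
 have "mi S2.E r (x, s) = (LI q. mol r ((x, s) - q))" unfolding mi_def cv_def
 proof (rule B_integral_cong[OF refl])
  fix q :: "'a \<times> real"
  show "indicat_real S2.E q *\<^sub>R mol r ((x, s) - q) = mol r ((x, s) - q)"
  proof (cases "q \<in> ball (x, s) r")
   case True
   hence "q \<in> S2.E" using E_near(2)[of x q d s] ball_parts[OF True] r assms(2) by auto
   thus ?thesis by simp
  qed (use mol_eq_0[OF r(1), of "(x, s) - q"] in "auto simp: dist_norm")
 qed
 also have "... = 1" by (subst lborel_integral_reflect) (auto simp: mol_integral[OF r(1)])
 finally show ?thesis using dmi_E2(1)[OF r(1)] by simp
qed

end

section \<open>The flux identity and its limits\<close>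

lemma zeta_01: "k >= 1 ==> 0 <= t ==> t <= 1 ==> 0 <= zeta k c s t & zeta k c s t <= 1"
 using psi_le_1[of k t] psi_le_1[of k "1 - t"] by (auto simp: zeta_def psi_nonneg)

lemma integral_norm_bound_AE:
 fixes f :: "'c => 'd::{banach,second_countable_topology}"
 assumes g: "integrable M g" and le: "AE x in M. norm (f x) <= g x" shows "norm (LINT x|M. f x) <= (LINT x|M. g x)"
proof (cases "integrable M f")
 case True
 thus ?thesis using integral_norm_bound[of M f] integral_mono_AE[OF integrable_norm[OF True] g le] by linarith
next
 case False
 have "AE x in M. 0 <= g x" using le by eventually_elim (rule order_trans[OF norm_ge_zero])
 thus ?thesis using False by (simp add: not_integrable_integral_eq integral_nonneg_AE)
qed

context pairing begin

text \<open>The difference of truth values is 1 on [0,t), -1 on [t,0) and 0 elsewhere, which encodes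
  the oriented integral from 0 to t for both signs of t.\<close>

definition F :: "'a => real => real" where "F x t = (LI s. (of_bool (s < t) - of_bool (s < 0))*f x s)"
definition B :: "'a => real => 'a" where "B x t = (LI s. (of_bool (s < t) - of_bool (s < 0)) *\<^sub>R b x s)"

lemma AE_graph: assumes [measurable]: "g \<in> Borel" shows "AE p in M. snd p ~= g (fst p)" unfolding M_def
proof (rule pair_sigma_finite.AE_pair_measure[OF pair_sf])
 show "{p \<in> space (\<sigma> \<Otimes>\<^sub>M lborel). snd p ~= g (fst p)} \<in> sets (\<sigma> \<Otimes>\<^sub>M lborel)" by measurable
 show "AE x in \<sigma>. AE s in lborel. snd (x, s) ~= g (fst (x, s))" using AE_lborel_singleton by auto
qed

end

context pairing_cut begin

lemma zeta_measurable [measurable]: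
 "(%p. zt S.E r k c p) \<in> Borel" "(%p. dzt S.E r k c p) \<in> Borel"
proof -
 have [measurable]: "dpsi k \<in> Borel" by (rule borel_measurable_continuous_onI[OF continuous_dpsi])
 show "(%p. zt S.E r k c p) \<in> Borel" "(%p. dzt S.E r k c p) \<in> Borel"
  unfolding zeta_def dzeta_def by measurable
qed

text \<open>\<open>psi_limit\<close> is applied to the subgraph for heights above c and to its
  complement \<open>E2\<close> for heights up to c; k is the larger of the two thresholds.\<close>

lemma zeta_limit: assumes e: "e > 0"
 obtains k where "k >= 1" "\<forall>\<^sub>F r in at_right 0.
  \<bar>LINT p|M. ph (fst p)*(zt S.E r k c p - of_bool (snd p < vc c (fst p)))*un f p\<bar> < e"
proof -
 have e2: "e/2 > 0" using e by simp
 obtain k1 where k1: "k1 >= 1" "!!k. k >= k1 ==>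
  \<forall>\<^sub>F r in at_right 0. (LINT p|\<mu>. ind (\<Omega> \<times> UNIV) p*\<bar>psi k (mi S.E r p) - ind (- N1 S.E) p\<bar>) < e/2"
  using E.psi_limit[OF e2] by blast
 obtain k2 where k2: "k2 >= 1" "!!k. k >= k2 ==>
  \<forall>\<^sub>F r in at_right 0. (LINT p|\<mu>. ind (\<Omega> \<times> UNIV) p*\<bar>psi k (mi E2 r p) - ind (- N1 E2) p\<bar>) < e/2"
  using E2.psi_limit[OF e2] by blast
 define k where "k = max k1 k2"
 have k: "k >= k1" "k >= k2" "k >= 1" using k1 by (auto simp: k_def)
 obtain d where d: "0 < d" "d < 1" "!!x y. x \<in> K ==> norm (x - y) < d ==> y \<in> V & y \<in> \<Omega> & y \<in> O1" using room by metis
 have "\<forall>\<^sub>F r in at_right (0::real). 0 < r & r < d"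
  unfolding eventually_at_right_field using d(1) by (auto intro!: exI[of _ d])
 with k1(2)[OF k(1)] k2(2)[OF k(2)] have "\<forall>\<^sub>F r in at_right 0.
  \<bar>LINT p|M. ph (fst p)*(zt S.E r k c p - of_bool (snd p < vc c (fst p)))*un f p\<bar> < e"
 proof eventually_elim
  case (elim r)
  hence r: "0 < r" "r < d" by auto
  note b1 = S.mi_bounds[OF r(1)] and b2 = E2.mi_bounds[OF r(1)]
  have [measurable]: "N1 S.E \<in> sets borel" "N1 E2 \<in> sets borel" "\<Omega> \<times> (UNIV::real set) \<in> sets borel"
   by (auto intro: S.N1_borel E2.N1_borel borel_Times)
  have [measurable]: "(%p. un f p) \<in> borel_measurable M" by (rule f_measurable) auto
  define D where "D E p = ind (\<Omega> \<times> UNIV) p*\<bar>psi k (mi E r p) - ind (- N1 E) p\<bar>" for E and p :: "'a \<times> real"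
  have Dm [measurable]: "D S.E \<in> Borel" "D E2 \<in> Borel" unfolding D_def by measurable
  have p01: "0 <= psi k (mi S.E r p) & psi k (mi S.E r p) <= 1" "0 <= psi k (mi E2 r p) & psi k (mi E2 r p) <= 1" for p
   using psi_nonneg psi_le_1[of k] k(3) b1 b2 by auto
  hence D01: "0 <= D S.E p" "D S.E p <= 1" "0 <= D E2 p" "D E2 p <= 1" for p by (auto simp: D_def indicator_def)
  have toM: "(LINT p|\<mu>. g p) = (LINT p|M. \<bar>un f p\<bar>*g p)" if [measurable]: "g \<in> Borel" for g :: "'a \<times> real => real"
   unfolding \<mu>_def by (subst integral_density) auto
  have iD: "integrable M (%p. \<bar>un f p\<bar>*D S.E p)" "integrable M (%p. \<bar>un f p\<bar>*D E2 p)"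
   by (rule bounded_box_integrable(1)[where c=1]; use f_bound f_zero D01 in "auto simp: abs_mult intro!: mult_le_one")+
  define g where "g p = ph (fst p)*(zt S.E r k c p - of_bool (snd p < vc c (fst p)))" for p :: "'a \<times> real"
  have [measurable]: "g \<in> Borel" unfolding g_def by measurable
  \<comment> \<open>Three graphs are discarded: at the two limits the density is undecided, and at
    height c the truncation is ambiguous.\<close>
  have "AE p in M. snd p ~= um (fst p)" "AE p in M. snd p ~= up (fst p)" "AE p in M. snd p ~= c"
   by (rule AE_graph, measurable)+
  hence ae: "AE p in M. norm (g p*un f p) <= \<bar>un f p\<bar>*D S.E p+\<bar>un f p\<bar>*D E2 p"
  proof eventually_elim
   case (elim p)
   show ?case
   proof (cases "fst p \<in> K & \<bar>snd p\<bar> <= a")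
    case True
    obtain x s where p: "p = (x, s)" by (cases p)
    have xs: "x \<in> K" "\<bar>s\<bar> <= a" "x \<in> \<Omega>" using True p ph(7) by auto
    have n: "(x, s) \<in> N1 S.E \<longleftrightarrow> um x < s" "(x, s) \<in> N1 E2 \<longleftrightarrow> s < up x"
     using N1_E[OF xs(1,2)] elim p by auto
    have m: "mi E2 r (x, s) = 1 - mi S.E r (x, s)" using mi_E2[OF xs(1,2) r(1) _ d(2)] r d xs by auto
    \<comment> \<open>Up to the level c the set \<open>E2\<close> decides and selects s < up x;
      above it the subgraph decides and selects s < um x. Off the discarded heights this is the
      condition s < vc c x.\<close>
    have "\<bar>zeta k c s (mi S.E r (x, s)) - of_bool (s < vc c x)\<bar> <= D S.E p+D E2 p"
    proof (cases "s <= c")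
     case True
     hence "s < vc c x \<longleftrightarrow> s < up x" using elim p um_le_up[of x] by (auto simp: vc_def)
     moreover have "\<bar>(1 - psi k (mi E2 r p)) - of_bool (s < up x)\<bar> = D E2 p"
      using n(2) xs p p01(2)[of p] by (auto simp: D_def)
     ultimately show ?thesis using True D01(1)[of p] m p by (simp add: zeta_def)
    next
     case False
     hence "s < vc c x \<longleftrightarrow> s < um x" by (auto simp: vc_def)
     moreover have "\<bar>psi k (mi S.E r p) - of_bool (s < um x)\<bar> = D S.E p"
      using n(1) xs p p01(1)[of p] elim by (auto simp: D_def)
     ultimately show ?thesis using False D01(3)[of p] p by (simp add: zeta_def)
    qed
    hence "\<bar>g p\<bar> <= 1*(D S.E p+D E2 p)"
     using mult_mono[of "ph x" 1 "\<bar>zeta k c s (mi S.E r (x, s)) - of_bool (s < vc c x)\<bar>" "D S.E p+D E2 p"] ph(2,3)[of x] p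
     by (simp add: g_def abs_mult)
    thus ?thesis using mult_left_mono[of "\<bar>g p\<bar>" "D S.E p+D E2 p" "\<bar>un f p\<bar>"]
     by (simp add: abs_mult mult.commute distrib_left)
   next
    case False
    hence z: "g p*un f p = 0" using ph(9)[of "fst p"] f_zero[of "snd p" "fst p"] by (auto simp: g_def)
    show ?thesis unfolding z norm_zero using D01[of p] by (intro add_nonneg_nonneg mult_nonneg_nonneg) auto
   qed
  qed
  have "norm (LINT p|M. g p*un f p) <= (LINT p|M. \<bar>un f p\<bar>*D S.E p+\<bar>un f p\<bar>*D E2 p)"
   by (rule integral_norm_bound_AE[OF _ ae]) (intro B_integrable_add iD)
  also have "... = (LINT p|\<mu>. D S.E p)+(LINT p|\<mu>. D E2 p)" using iD by (simp add: toM)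
  also have "... < e" using elim(1,2) by (simp add: D_def)
  finally show ?case by (simp add: g_def)
 qed
 thus ?thesis using that k(3) by blast
qed

text \<open>The test function \<open>ph\<close> times the profile is inserted in
  \<open>div_slices\<close>. The subtracted indicator of s < 0 is constant on slices, so it adds no
  gradient of its own, and it matches the lower limit 0 in \<open>F\<close> and \<open>B\<close>. In
  the second part the almost everywhere bound \<open>M0\<close> replaces the cruder
  \<open>Mb\<close>.\<close>

lemma identity: assumes k: "k >= 1" and r: "r > 0"
 shows "(LINT p|M. ph (fst p)*(zt S.E r k c p - of_bool (snd p < 0))*un f p) =
  - (LI p. (zt S.E r k c p - of_bool (snd p < 0))*(un b p \<bullet> G (fst p)))
  - (LI p. ph (fst p)*(dzt S.E r k c p*(un b p \<bullet> fst (dmi S.E r p))))" (is ?thesis1)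
 and "\<bar>LI p. ph (fst p)*(dzt S.E r k c p*(un b p \<bullet> fst (dmi S.E r p)))\<bar> <=
  M0*(LI p. ph (fst p)*(dzt S.E r k c p*norm (fst (dmi S.E r p))))" (is ?thesis2)
proof -
 note v01 = S.mi_bounds[OF r]
 have dz: "0 <= dzt S.E r k c p" "dzt S.E r k c p <= 2*k" for p
  using dzeta_bounds[OF k v01[of p]] by auto
 have zb: "\<bar>zt S.E r k c p - of_bool (snd p < 0)\<bar> <= 1" for p using zeta_01[OF k v01[of p], of c "snd p"] by (auto split: split_of_bool)
 obtain CG where CG: "!!x. norm (G x) <= CG" using bounded_compact_support[OF C1_continuous_grad[OF ph(1)] ph(4) G_0] by metis
 obtain R where R: "!!r x. r > 0 ==> x \<notin> cball 0 (R+r) ==> mi S.E r x = 0" using S.mi_support by metis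
 have "dmi S.E r p = 0" if "p \<notin> cball 0 (R+r)" for p
  by (rule C1_zero_outside[OF S.C1_mi[OF r] closed_cball R[OF r] that])
 from bounded_compact_support[OF C1_continuous_grad[OF S.C1_mi[OF r]] compact_cball this]
 obtain Cd where Cd: "!!p. norm (dmi S.E r p) <= Cd" by blast
 have CG0: "0 <= CG" "0 <= Cd" using CG[of undefined] Cd[of undefined] norm_ge_zero order_trans by blast+
 have [measurable]: "(%p. fst (dmi S.E r p)) \<in> Borel" using measurable_compose[OF S.dmi_measurable fst_borel] .
 define P where "P p = ph (fst p)*(zt S.E r k c p - of_bool (snd p < 0))" for p
 define A1 where "A1 p = (zt S.E r k c p - of_bool (snd p < 0)) *\<^sub>R G (fst p)" for p
 define A2 where "A2 p = (ph (fst p)*dzt S.E r k c p) *\<^sub>R fst (dmi S.E r p)" for p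
 have A2n: "norm (A2 p) = ph (fst p)*(dzt S.E r k c p*norm (fst (dmi S.E r p)))" for p
  using dz(1)[of p] ph(2)[of "fst p"] by (simp add: A2_def abs_mult)
 have bd: "norm (A1 p) <= CG" "norm (A2 p) <= 2*k*Cd" for p
 proof -
  show "norm (A1 p) <= CG" using mult_mono[OF zb[of p] CG[of "fst p"]] by (simp add: A1_def)
  have "ph (fst p)*(dzt S.E r k c p*norm (fst (dmi S.E r p))) <= 1*(2*k*Cd)"
   using dz[of p] ph(2,3)[of "fst p"] norm_fst_le'[of "dmi S.E r p"] Cd[of p] k CG0 by (intro mult_mono) auto
  thus "norm (A2 p) <= 2*k*Cd" unfolding A2n by simp
 qed
 have [measurable]: "A1 \<in> Borel" "A2 \<in> Borel" "P \<in> Borel" unfolding A1_def A2_def P_def by measurable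
 have z: "fst p \<notin> K ==> A1 p = 0" "fst p \<notin> K ==> A2 p = 0" for p using G_0 ph(9) by (auto simp: A1_def A2_def)
 have bi: "norm (un b p \<bullet> A p) <= Mb*c" if "norm (A p) <= c" for A and p :: "'a \<times> real" and c
  using Cauchy_Schwarz_ineq2[of "un b p" "A p"] mult_mono[OF b_bound[of "fst p" "snd p"] that Mb_nonneg] by simp
 have i: "integ (%p. un b p \<bullet> A1 p)" "integ (%p. un b p \<bullet> A2 p)"
  by (rule bounded_box_integrable(2)[OF _ bi[OF bd(1)]], auto simp: b_zero z ph(4) intro: ph(4))
    (rule bounded_box_integrable(2)[OF _ bi[OF bd(2)]], auto simp: b_zero z ph(4) intro: ph(4))
 have "(LINT p|M. P p*un f p) = - (LI p. un b p \<bullet> (A1 p+A2 p))"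
 proof (rule div_slices[OF _ ph(4,7)])
  fix s
  have "C1 (%x. zeta k c s (mi S.E r (x, s)) - of_bool (s < 0)) (%x. dzeta k c s (mi S.E r (x, s)) *\<^sub>R fst (dmi S.E r (x, s)) - 0)"
   by (intro C1_diff C1_const C1_compose[OF C1_slice[OF S.C1_mi[OF r]] zeta_derivative continuous_dzeta])
  from C1_mult[OF ph(1) this] show "C1 (%x. P (x, s)) (%x. A1 (x, s)+A2 (x, s))"
   by (simp add: P_def A1_def A2_def add.commute)
  show "P (x, s) = 0" if "x \<notin> K" for x using ph(9)[OF that] by (simp add: P_def)
  show "\<bar>P p\<bar> <= 1" for p
   using mult_le_one[OF ph(3)[of "fst p"] _ zb[of p]] ph(2)[of "fst p"] by (simp add: P_def abs_mult)
  show "norm (A1 p+A2 p) <= CG+2*k*Cd" for p by (rule norm_triangle_le[OF add_mono[OF bd]])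
 qed measurable
 thus ?thesis1 using i by (simp add: P_def A1_def A2_def inner_add_right mult.assoc)
 have iA2: "integ (%p. M0*norm (A2 p))"
 proof -
  have "integ (dmi S.E r)" by (rule S.dmi_integrable[OF r])
  hence "integ (%p. 2*k*norm (dmi S.E r p))" by simp
  hence "integ (%p. norm (A2 p))"
  proof (rule B_integrable_bound)
   show "AE p in lborel. norm (norm (A2 p)) <= norm (2*k*norm (dmi S.E r p))"
   proof (rule AE_I2)
    fix p
    have "ph (fst p)*(dzt S.E r k c p*norm (fst (dmi S.E r p))) <= 1*(2*k*norm (dmi S.E r p))"
     using dz[of p] ph(2,3)[of "fst p"] norm_fst_le'[of "dmi S.E r p"] k by (intro mult_mono) auto
    thus "norm (norm (A2 p)) <= norm (2*k*norm (dmi S.E r p))" using k by (simp add: A2n[symmetric])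
   qed
  qed measurable
  thus ?thesis by simp
 qed
 have "norm (LI p. un b p \<bullet> A2 p) <= (LI p. M0*norm (A2 p))"
 proof (rule integral_norm_bound_AE[OF iA2])
  show "AE p in lborel. norm (un b p \<bullet> A2 p) <= M0*norm (A2 p)" using b_AE
  proof eventually_elim
   case (elim p)
   thus ?case using Cauchy_Schwarz_ineq2[of "un b p" "A2 p"] mult_right_mono[OF elim norm_ge_zero[of "A2 p"]] by simp
  qed
 qed
 thus ?thesis2 by (simp add: A2n) (simp add: A2_def mult.assoc)
qed

end

context pairing begin

lemma F_integral:
 fixes ph :: "'a => real" assumes [measurable]: "g \<in> Borel" "ph \<in> Borel" and phi: "!!x. \<bar>ph x\<bar> <= 1"
 shows "integrable M (%p. ph (fst p)*(of_bool (snd p < g (fst p)) - of_bool (snd p < 0))*un f p)" (is "integrable M ?H")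
  and "(LINT p|M. ph (fst p)*(of_bool (snd p < g (fst p)) - of_bool (snd p < 0))*un f p) = (LINT x|\<sigma>. ph x*F x (g x))"
proof -
 have "norm (?H p) <= 1" for p
  using mult_mono[OF mult_mono[OF phi[of "fst p"], of "\<bar>of_bool (snd p < g (fst p)) - of_bool (snd p < 0) :: real\<bar>" 1] f_bound[of "fst p" "snd p"]]
  by (simp add: abs_mult)
 thus i: "integrable M ?H" by (intro bounded_box_integrable(1)[where c=1]) (auto simp: f_zero)
 have "(LINT p|M. ?H p) = (LINT x|\<sigma>. LI s. ?H (x, s))"
  using pair_sigma_finite.integral_fst[OF pair_sf, of "%x s. ?H (x, s)"] i by (simp add: M_def split_def)
 also have "... = (LINT x|\<sigma>. ph x*F x (g x))" by (simp add: F_def mult.assoc)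
 finally show "(LINT p|M. ?H p) = (LINT x|\<sigma>. ph x*F x (g x))" .
qed

lemma B_integral:
 fixes G :: "'a => 'a"
 assumes [measurable]: "g \<in> Borel" "G \<in> Borel" and G: "!!x. norm (G x) <= CG" "ALL x. x \<notin> K --> G x = 0" "compact K"
 shows "integ (%p. (of_bool (snd p < g (fst p)) - of_bool (snd p < 0))*(un b p \<bullet> G (fst p)))" (is "integrable _ ?H")
  and "(LI p. (of_bool (snd p < g (fst p)) - of_bool (snd p < 0))*(un b p \<bullet> G (fst p))) = (LI x. B x (g x) \<bullet> G x)"
proof -
 have "norm (?H p) <= Mb*CG" for p
 proof -
  have "\<bar>un b p \<bullet> G (fst p)\<bar> <= Mb*CG"
   using Cauchy_Schwarz_ineq2[of "un b p" "G (fst p)"] mult_mono[OF b_bound[of "fst p" "snd p"] G(1)[of "fst p"] Mb_nonneg] by simp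
  thus ?thesis by (auto split: split_of_bool)
 qed
 thus i: "integ ?H" by (intro bounded_box_integrable(2)[where c="Mb*CG" and K=K]) (auto simp: b_zero G)
 have "(LI p. ?H p) = (LI x. LI s. ?H (x, s))"
  using lborel_pair.integral_fst[of "%x s. ?H (x, s)"] i by (simp add: lborel_prod split_def)
 also have "... = (LI x. B x (g x) \<bullet> G x)"
 proof (rule B_integral_cong[OF refl])
  fix x
  have "integ (%s. (of_bool (s < g x) - of_bool (s < 0)) *\<^sub>R b x s)"
  proof (rule B_integrable_bound)
   show "integ (%s. Mb*ind {-a..a} s :: real)" by (intro integrable_mult_right) (simp add: integrable_indicator_iff emeasure_lborel_Icc_eq)
   show "AE s in lborel. norm ((of_bool (s < g x) - of_bool (s < 0)) *\<^sub>R b x s) <= norm (Mb*ind {-a..a} s :: real)"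
    using b_bound[of x] b_zero[of _ x] Mb_nonneg
    by (intro AE_I2) (auto split: split_of_bool simp: indicator_def not_le abs_le_iff intro: b_zero)
  qed measurable
  thus "(LI s. ?H (x, s)) = B x (g x) \<bullet> G x" unfolding B_def by (simp add: integral_inner_left[symmetric])
 qed
 finally show "(LI p. ?H p) = (LI x. B x (g x) \<bullet> G x)" .
qed

end

context pairing_cut begin

text \<open>The profile fixes 0 and 1 and is 2k-Lipschitz on [0,1], so it inherits the L^1
  convergence of the mollified indicator; near K the indicator is that of s < v x.\<close>

lemma zeta_L1: assumes k: "k >= 1" and r: "r > 0" and CG: "!!x. norm (G x) <= CG"
 shows "\<bar>LI p. (zt S.E r k c p - of_bool (snd p < v (fst p)))*(un b p \<bullet> G (fst p))\<bar> <=
  Mb*CG*(2*k)*(LI p. \<bar>mi S.E r p - ind S.E p\<bar>)"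
proof -
 have i: "integ (%p. \<bar>mi S.E r p - ind S.E p\<bar>)"
  by (intro integrable_abs B_integrable_diff S.mi_integrable S.E_integrable r)
 have CG0: "CG >= 0" using CG[of undefined] norm_ge_zero order_trans by blast
 have "norm (LI p. (zt S.E r k c p - of_bool (snd p < v (fst p)))*(un b p \<bullet> G (fst p))) <=
  (LI p. Mb*CG*(2*k)*\<bar>mi S.E r p - ind S.E p\<bar>)"
 proof (rule integral_norm_bound_AE)
  show "AE p in lborel. norm ((zt S.E r k c p - of_bool (snd p < v (fst p)))*(un b p \<bullet> G (fst p)))
    <= Mb*CG*(2*k)*\<bar>mi S.E r p - ind S.E p\<bar>"
  proof (rule AE_I2)
   fix p :: "'a \<times> real"
   show "norm ((zt S.E r k c p - of_bool (snd p < v (fst p)))*(un b p \<bullet> G (fst p)))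
    <= Mb*CG*(2*k)*\<bar>mi S.E r p - ind S.E p\<bar>"
   proof (cases "fst p \<in> K & \<bar>snd p\<bar> < a")
    case True
    hence "fst p \<in> V" using ph(5) by blast
    hence "p \<in> S.E \<longleftrightarrow> snd p < v (fst p)" using E_near(1)[of "fst p" p "1/2" "snd p"] True by simp
    hence e: "of_bool (snd p < v (fst p)) = zeta k c (snd p) (ind S.E p)"
     using zeta_0_1[OF k] by (auto simp: indicator_def)
    have "\<bar>zt S.E r k c p - of_bool (snd p < v (fst p))\<bar> <= (2*k)*\<bar>mi S.E r p - ind S.E p\<bar>"
     unfolding e by (rule lipschitz_01[OF zeta_derivative]) (use dzeta_bounds[OF k] S.mi_bounds[OF r] in "auto simp: indicator_def")
    moreover have "\<bar>un b p \<bullet> G (fst p)\<bar> <= Mb*CG"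
     using Cauchy_Schwarz_ineq2[of "un b p" "G (fst p)"] mult_mono[OF b_bound[of "fst p" "snd p"] CG[of "fst p"] Mb_nonneg] by simp
    ultimately show ?thesis
     using mult_mono[of "\<bar>un b p \<bullet> G (fst p)\<bar>" "Mb*CG" "\<bar>zt S.E r k c p - of_bool (snd p < v (fst p))\<bar>" "(2*k)*\<bar>mi S.E r p - ind S.E p\<bar>"]
      Mb_nonneg CG0 by (simp add: abs_mult mult.assoc mult.commute mult.left_commute)
   next
    case False
    hence z: "un b p \<bullet> G (fst p) = 0" using G_0[of "fst p"] b_zero[of "snd p" "fst p"] by auto
    show ?thesis unfolding z using Mb_nonneg CG0 k by simp
   qed
  qed
 qed (use i in simp)
 thus ?thesis by simp
qed

text \<open>\<open>strict_x\<close> is used with the test function itself as weight. On its support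
  the cut-off is constant, so the gradient mass of w seen by this weight is that of v in the open
  set \<open>O1\<close>.\<close>

lemma strict: "k >= 1 ==> e > 0 ==> \<forall>\<^sub>F r in at_right 0.
  (LI p. ph (fst p)*(dzt S.E r k c p*norm (fst (dmi S.E r p)))) <= measure kappa O1+e"
proof -
 assume k: "k >= 1" and e: "e > 0"
 interpret kappa: finite_measure kappa by (rule kp)
 have PT1: "S.PT rho (%_. 1) = (LI x. norm (cv w (dmol rho) x))" for rho by (simp add: S.PT_def)
 \<comment> \<open>The product rule gives only the upper bound T0. The complementation in
   \<open>strict_x\<close> needs the exact limit, which is this supremum.\<close>
 define T1 where "T1 = (SUP rho\<in>{0<..}. S.PT rho (%_. 1))"
 have bd: "S.PT rho (%_. 1) <= T0" if "rho > 0" for rho unfolding PT1 by (rule S.w_bv[OF that])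
 have lsc: "S.PT r (%_. 1) <= S.PT s (%_. 1)+(LI x. norm (dmol r (x::'a)))*(LI x. \<bar>cv w (mol s) x - w x\<bar>)"
  if r: "r > 0" and s: "s > 0" for r s
 proof -
  obtain R where R: "K' <= ball 0 R" using bounded_subset_ballD[OF compact_imp_bounded[OF ch(6)]] by blast
  have z: "cv w (mol s) x = 0" if x: "x \<notin> cball 0 (R+s)" for x
  proof -
   have z0: "w y *\<^sub>R mol s (x - y) = 0" for y
   proof (cases "y \<in> K'")
    case True
    hence "norm y < R" using R by auto
    hence "norm (x - y) >= s" using x norm_triangle_ineq2[of x y] by simp
    from mol_eq_0[OF s this] show ?thesis by simp
   qed (simp add: w_props(3))
   show ?thesis unfolding cv_def z0 by simp
  qed
  from gradient_mass_lsc[OF S.w_integrable C1_cv[OF S.w_integrable C1_mol compact_cball[of 0 s] mol_support[OF s]] compact_cball[of 0 "R+s"] z bounded_linear_id_le r]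
  show ?thesis by (simp add: PT1 abs_minus_commute)
 qed
 have tend: "((%rho. S.PT rho (%_. 1)) \<longlongrightarrow> T1) (at_right 0)" unfolding T1_def
  by (rule tendsto_SUP_at_right_0[OF lsc L1_approx_integrable[OF S.w_integrable, unfolded L1_approx_def] bd])
 interpret B: bv_bump_tight w L l K' T1
 proof
  show "(LI x. norm (cv w (dmol rho) x)) <= T1" if "rho > 0" for rho
   unfolding T1_def PT1[symmetric] by (rule cSUP_upper) (use that bd in "auto intro!: bdd_aboveI[of _ T0]")
  fix e :: real assume "e > 0"
  thus "\<forall>\<^sub>F rho in at_right 0. T1 - e < S.PT rho (%_. 1)" by (intro order_tendstoD(1)[OF tend]) simp
 qed (use w_props ch(6) in auto)
 have uc: "uniformly_continuous_on UNIV ph"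
  by (rule uniformly_continuous_compact_support[OF C1_continuous[OF ph(1)] ph(4,9)])
 obtain d where d: "0 < d" "!!x y. x \<in> K ==> norm (x - y) < d ==> y \<in> V & y \<in> \<Omega> & y \<in> O1" using room by metis
 have "\<forall>\<^sub>F rho in at_right (0::real). 0 < rho & rho < d"
  unfolding eventually_at_right_field using d(1) by (auto intro!: exI[of _ d])
 hence ev: "\<forall>\<^sub>F rho in at_right 0. S.PT rho ph <= measure kappa O1"
 proof eventually_elim
  case (elim rho)
  \<comment> \<open>The gradient of the cut-off vanishes on V, and for small rho the mollification
    looks only at points of V in \<open>O1\<close>.\<close>
  have z: "ind (V \<inter> O1) y*((v y+a+1)*norm (dch y)) = 0" for y by (auto simp: indicator_def dch_0(1))
  have "S.PT rho ph <= (LI y. ind (V \<inter> O1) y*((v y+a+1)*norm (dch y)))+measure kappa (V \<inter> O1)"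
   unfolding S.PT_def
  proof (rule PT_le[OF _ _ ph(2,3)])
   show "y \<in> V \<inter> O1" if "ph x ~= 0" "norm (x - y) < rho" for x y
    using d(2)[of x y] ph(9)[of x] that elim by fastforce
  qed (use elim in auto)
  also have "... <= measure kappa O1" unfolding z by (simp add: kappa.finite_measure_mono)
  finally show ?case .
 qed
 show ?thesis by (rule B.strict_x[OF k _ ph(2,3) uc ev e]) simp
qed

text \<open>The flux identity is combined with three errors of size e/3: the selection of density
  one points, the L^1 error of the profile, and the gradient mass. The parameter k is fixed by the
  first before r tends to 0 in all of them.\<close>

theorem cut_bound:
 "\<bar>(LINT x|\<sigma>. ph x*F x (vc c x))+(LI x. B x (v x) \<bullet> G x)\<bar> <= M0*measure kappa O1"
proof (rule field_le_epsilon)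
 fix e :: real assume e: "e > 0"
 obtain CG where CG: "!!x. norm (G x) <= CG" using bounded_compact_support[OF C1_continuous_grad[OF ph(1)] ph(4) G_0] by metis
 have e3: "e/3 > 0" using e by simp
 obtain k where k: "k >= 1" "\<forall>\<^sub>F r in at_right 0.
  \<bar>LINT p|M. ph (fst p)*(zt S.E r k c p - of_bool (snd p < vc c (fst p)))*un f p\<bar> < e/3"
  by (rule zeta_limit[OF e3])
 \<comment> \<open>After multiplication by M0 this error is at most e/3, also when M0 = 0.\<close>
 have e4: "e/(3*(M0+1)) > 0" using e M0_nonneg by simp
 have "((%s. Mb*CG*(2*k)*(LI p. \<bar>mi S.E s p - ind S.E p\<bar>)) \<longlongrightarrow> 0) (at_right 0)"
  by (rule tendsto_mult_right_zero[OF S.mi_L1])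
 hence "\<forall>\<^sub>F s in at_right 0. Mb*CG*(2*k)*(LI p. \<bar>mi S.E s p - ind S.E p\<bar>) < e/3"
  by (rule order_tendstoD) (use e in simp)
 with k(2) strict[OF k(1) e4, of c] eventually_at_right_less[of "0::real"]
 have "\<forall>\<^sub>F r in at_right (0::real). \<bar>(LINT x|\<sigma>. ph x*F x (vc c x))+(LI x. B x (v x) \<bullet> G x)\<bar> <= M0*measure kappa O1+e"
 proof eventually_elim
  case (elim r)
  define z where "z p = zt S.E r k c p" for p
  have z01: "0 <= z p" "z p <= 1" for p
   using zeta_01[OF k(1) S.mi_bounds[OF elim(3), of p], of c "snd p"] by (auto simp: z_def)
  have [measurable]: "z \<in> Borel" unfolding z_def by measurable
  have "integrable M (%p. ph (fst p)*(z p - of_bool (snd p < 0))*un f p)"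
  proof (rule bounded_box_integrable(1)[where c=1])
   fix p :: "'a \<times> real"
   have "\<bar>ph (fst p)\<bar>*\<bar>z p - of_bool (snd p < 0)\<bar>*\<bar>un f p\<bar> <= 1*1*1"
    using z01[of p] ph(2,3)[of "fst p"] f_bound by (intro mult_mono) (auto split: split_of_bool)
   thus "norm (ph (fst p)*(z p - of_bool (snd p < 0))*un f p) <= 1" by (simp add: abs_mult)
  qed (auto simp: f_zero)
  note i1 = this
  have p1: "\<bar>ph x\<bar> <= 1" for x using ph(2,3)[of x] by simp
  have G0: "ALL x. x \<notin> K --> G x = 0" using G_0 by blast
  note FI = F_integral[OF vc_borel[of c] cut_measurable(3) p1] and BI = B_integral[OF v_borel cut_measurable(4) CG G0 ph(4)]
  have "ph (fst p)*(z p - of_bool (snd p < vc c (fst p)))*un f p = ph (fst p)*(z p - of_bool (snd p < 0))*un f p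
   - ph (fst p)*(of_bool (snd p < vc c (fst p)) - of_bool (snd p < 0))*un f p" for p
   by (simp add: algebra_simps)
  hence "(LINT p|M. ph (fst p)*(z p - of_bool (snd p < vc c (fst p)))*un f p) =
   (LINT p|M. ph (fst p)*(z p - of_bool (snd p < 0))*un f p) - (LINT x|\<sigma>. ph x*F x (vc c x))"
   by (simp only: B_integral_diff[OF i1 FI(1)] FI(2))
  moreover have "(LI p. (z p - of_bool (snd p < v (fst p)))*(un b p \<bullet> G (fst p))) =
   (LI p. (z p - of_bool (snd p < 0))*(un b p \<bullet> G (fst p))) - (LI x. B x (v x) \<bullet> G x)"
  proof -
   have "integ (%p. (z p - of_bool (snd p < 0))*(un b p \<bullet> G (fst p)))"
   proof (rule bounded_box_integrable(2)[where c="1*(Mb*CG)" and K=K])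
    fix p :: "'a \<times> real"
    have "\<bar>un b p \<bullet> G (fst p)\<bar> <= Mb*CG"
     using Cauchy_Schwarz_ineq2[of "un b p" "G (fst p)"] mult_mono[OF b_bound[of "fst p" "snd p"] CG[of "fst p"] Mb_nonneg] by simp
    hence "\<bar>z p - of_bool (snd p < 0)\<bar>*\<bar>un b p \<bullet> G (fst p)\<bar> <= 1*(Mb*CG)"
     using z01[of p] by (intro mult_mono) (auto split: split_of_bool)
    thus "norm ((z p - of_bool (snd p < 0))*(un b p \<bullet> G (fst p))) <= 1*(Mb*CG)" by (simp add: abs_mult)
   qed (auto simp: b_zero G_0 ph(4))
   note i2 = this
   have "(z p - of_bool (snd p < v (fst p)))*(un b p \<bullet> G (fst p)) = (z p - of_bool (snd p < 0))*(un b p \<bullet> G (fst p))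
    - (of_bool (snd p < v (fst p)) - of_bool (snd p < 0))*(un b p \<bullet> G (fst p))" for p
    by (simp add: algebra_simps)
   thus ?thesis unfolding BI(2)[symmetric] by (simp only: B_integral_diff[OF i2 BI(1), symmetric])
  qed
  moreover have "M0*(LI p. ph (fst p)*(dzt S.E r k c p*norm (fst (dmi S.E r p)))) <= M0*measure kappa O1+e/3"
  proof -
   have "M0*(e/(3*(M0+1))) <= e/3" using e M0_nonneg by (simp add: field_simps)
   thus ?thesis using mult_left_mono[OF elim(2) M0_nonneg] unfolding distrib_left by linarith
  qed
  ultimately show ?case
   using elim(1,4) identity[OF k(1) elim(3), of c] zeta_L1[OF k(1) elim(3) CG, of c] unfolding z_def by linarith
 qed
 from eventually_happens'[OF _ this] show "\<bar>(LINT x|\<sigma>. ph x*F x (vc c x))+(LI x. B x (v x) \<bullet> G x)\<bar> <= M0*measure kappa O1+e"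
  by (simp add: trivial_limit_at_right_real)
qed

end

section \<open>Bounds for the pairings\<close>

text \<open>\<open>gn\<close> is the density of the divergence of \<open>x \<mapsto> B(x, v(x))\<close> with respect to its total variation \<open>\<tau>\<close>.\<close>
locale pairing_div = pairing +
 fixes \<tau> :: "'a measure" and gn :: "'a => real"
 assumes tau: "finite_measure \<tau>" "sets \<tau> = sets borel" and gn: "integrable \<tau> gn" "AE x in \<tau>. \<bar>gn x\<bar> <= 1"
  and gn_div: "!!ph G K. C1 ph G ==> compact K ==> K <= \<Omega> ==> (!!x. x \<notin> K ==> ph x = 0) ==>
    (LI x. B x (v x) \<bullet> G x) = - (LINT x|\<tau>. ph x*gn x)"
begin

sublocale S: finite_measure \<sigma> by (rule sg)
sublocale K: finite_measure kappa by (rule kp)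
sublocale T: finite_measure \<tau> by (rule tau)

lemma sets_tau [measurable_cong, simp]: "sets \<tau> = sets borel" by (rule tau)
lemma space_tau [simp]: "space \<tau> = UNIV" using sets_eq_imp_space_eq[OF tau(2)] by simp

lemma gn_measurable [measurable]: "gn \<in> Borel"
 using gn(1) by (metis borel_measurable_integrable measurable_cong_sets sets_tau)

lemma test_bound:
 assumes phi: "C1 ph G" "!!x. 0 <= ph x" "!!x. ph x <= 1" "compact K" "K <= O1" "!!x. x \<notin> K ==> ph x = 0" and O1: "open O1" "O1 <= \<Omega>"
 shows "\<bar>(LINT x|\<sigma>. ph x*F x (vc c x)) - (LINT x|\<tau>. ph x*gn x)\<bar> <= M0*measure kappa O1"
proof -
 have KO: "K <= \<Omega>" using phi(5) O1(2) by blast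
 obtain ch dch K' V where ch: "C1 ch dch" "!!x. 0 <= ch x" "!!x. ch x <= 1" "open V" "K <= V" "!!x. x \<in> V ==> ch x = 1"
  "compact K'" "K' <= \<Omega>" "!!x. x \<notin> K' ==> ch x = 0" using C1_cutoff[OF phi(4) \<Omega> KO] by metis
 interpret pairing_cut \<Omega> v C b f \<sigma> kappa gD a Mb M0 ch dch V K' ph G K O1
  by standard (use ch phi O1 KO in auto)
 show ?thesis using cut_bound[of c] gn_div[OF phi(1,4) KO phi(6)] by simp
qed

lemma F_lipschitz:
 assumes "\<bar>s\<bar> <= C" "\<bar>t\<bar> <= C" shows "\<bar>F x s - F x t\<bar> <= \<bar>s - t\<bar>"
proof -
 have i: "integ (%s. (of_bool (s < t) - of_bool (s < 0))*f x s)" for t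
 proof (rule B_integrable_bound)
  show "integ (ind {-a..a} :: real => real)" by (simp add: integrable_indicator_iff emeasure_lborel_Icc_eq)
  show "AE s in lborel. norm ((of_bool (s < t) - of_bool (s < 0))*f x s) <= norm (ind {-a..a} s :: real)"
  proof (rule AE_I2)
   fix s show "norm ((of_bool (s < t) - of_bool (s < 0))*f x s) <= norm (ind {-a..a} s :: real)"
    using f_bound[of x s] f_zero[of s x] by (cases "s \<in> {-a..a}") (auto simp: abs_le_iff split: split_of_bool)
  qed
 qed measurable
 have "F x s - F x t = (LI r. (of_bool (r < s) - of_bool (r < 0))*f x r - (of_bool (r < t) - of_bool (r < 0))*f x r)"
  unfolding F_def by (rule B_integral_diff[OF i i, symmetric])
 also have "norm ... <= (LI r. ind {min s t..max s t} r)"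
 proof (rule integral_norm_bound_AE)
  show "AE r in lborel. norm ((of_bool (r < s) - of_bool (r < 0))*f x r - (of_bool (r < t) - of_bool (r < 0))*f x r) <= ind {min s t..max s t} r"
   using f_bound[of x] by (intro AE_I2) (auto simp: indicator_def split: split_of_bool)
 qed (simp add: integrable_indicator_iff emeasure_lborel_Icc_eq)
 also have "... = \<bar>s - t\<bar>" by (simp add: min_def max_def)
 finally show ?thesis by simp
qed

lemma F_bound: "\<bar>t\<bar> <= C ==> \<bar>F x t\<bar> <= C"
 using F_lipschitz[of t 0 x] order_trans[OF abs_ge_zero v_bound] by (force simp: F_def)

lemma F_measurable [measurable (raw)]:
 assumes [measurable]: "h \<in> measurable N borel" "h' \<in> borel_measurable N"
 shows "(%z. F (h z) (h' z)) \<in> borel_measurable N" unfolding F_def by measurable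

lemma vc_bound: "\<bar>vc c x\<bar> <= C" using um_bound[of x] by (auto simp: vc_def max_def min_def)

text \<open>The pairing as a set function: the divergence of B(x, v(x)), given by its density
  \<open>gn\<close>, minus the measure with density H against \<sigma>. H stands for a choice of
  representative in F.\<close>

definition D :: "('a => real) => 'a set => real" where
 "D H A = (LINT x|\<tau>. ind A x*gn x) - (LINT x|\<sigma>. ind A x*H x)"

definition good :: "('a => real) => bool" where
 "good H \<longleftrightarrow> H \<in> Borel & (ALL x. \<bar>H x\<bar> <= C) & (ALL A:sets borel. A <= \<Omega> --> \<bar>D H A\<bar> <= M0*measure kappa A)"

lemma int_b:
 fixes H :: "'a => real"
 assumes "A \<in> sets borel" shows "H \<in> Borel ==> (!!x. \<bar>H x\<bar> <= c) ==> integrable \<sigma> (%x. ind A x*H x)"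
  and "integrable \<tau> (%x. ind A x*gn x)"
proof -
 show "integrable \<sigma> (%x. ind A x*H x)" if "H \<in> Borel" "!!x. \<bar>H x\<bar> <= c" for c
  by (rule S.integrable_const_bound[of _ "\<bar>c\<bar>"]) (use assms that order_trans[OF that(2) abs_ge_self] in "auto simp: indicator_def")
 show "integrable \<tau> (%x. ind A x*gn x)"
  by (rule B_integrable_bound[OF gn(1)]) (use assms in "auto simp: indicator_def")
qed

text \<open>For compact sets, test functions decreasing in support to K are used inside an open set
  of almost the same \<open>kappa\<close> measure. Borel sets follow by inner regularity for both
  measures that enter \<open>D\<close>.\<close>

lemma good_vc: "good (%x. F x (vc c x))"
proof -
 define H where "H x = F x (vc c x)" for x
 have Hm [measurable]: "H \<in> Borel" unfolding H_def by measurable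
 have Hb: "\<bar>H x\<bar> <= C" for x unfolding H_def by (rule F_bound[OF vc_bound])
 have cpt: "\<bar>D H K\<bar> <= M0*measure kappa K" if K: "compact K" "K <= \<Omega>" for K
 proof (rule field_le_epsilon)
  fix e :: real assume e: "e > 0"
  define e' where "e' = e/(M0+1)"
  have e': "e' > 0" "M0*e' <= e" using e M0_nonneg by (auto simp: e'_def field_simps)
  have [measurable]: "K \<in> sets borel" using K by (simp add: borel_compact)
  \<comment> \<open>Removing from \<Omega> a compact set that carries almost all of \<Omega> - K
    gives the open neighbourhood of K needed for outer approximation.\<close>
  obtain Q where Q: "compact Q" "Q <= \<Omega> - K" "measure kappa ((\<Omega> - K) - Q) < e'"
   using inner_compact_approx[OF kp, of "\<Omega> - K" e'] e'(1) by auto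
  define O1 where "O1 = \<Omega> - Q"
  have O1: "open O1" "O1 <= \<Omega>" "K <= O1" using Q K \<Omega> by (auto simp: O1_def compact_imp_closed)
  have [measurable]: "Q \<in> sets borel" using Q by (simp add: borel_compact)
  have "O1 = K \<union> ((\<Omega> - K) - Q)" using Q K by (auto simp: O1_def)
  hence "measure kappa O1 = measure kappa K+measure kappa ((\<Omega> - K) - Q)"
   by (simp only:) (rule K.finite_measure_Union, auto)
  hence mO: "measure kappa O1 <= measure kappa K+e'" using Q(3) by simp
  obtain ph g K' where p: "!!n::nat. C1 (ph n) (g n)" "!!n x. 0 <= ph n x" "!!n x. ph n x <= 1" "!!n x. x \<in> K ==> ph n x = 1"
   "!!n. compact (K' n)" "!!n. K' n <= O1" "!!n x. x \<notin> K' n ==> ph n x = 0" "!!x. (%n. ph n x) \<longlonglongrightarrow> ind K x"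
  proof (rule C1_cutoff_sequence[OF K(1) O1(1,3)], goal_cases)
   case (1 ph g K')
   show ?case by (rule 1(1)[of ph g K']) (fact 1)+
  qed
  have [measurable]: "ph n \<in> Borel" for n using p(1)[of n] by measurable
  have l1: "(%n. LINT x|\<sigma>. ph n x*H x) \<longlonglongrightarrow> (LINT x|\<sigma>. ind K x*H x)"
  proof (rule integral_dominated_convergence[where w="%x. C"])
   show "AE x in \<sigma>. norm (ph n x*H x) <= C" for n
   proof (rule AE_I2)
    fix x show "norm (ph n x*H x) <= C" using mult_mono[OF p(3)[of n x] Hb[of x]] p(2)[of n x] by (simp add: abs_mult)
   qed
   show "AE x in \<sigma>. (%n. ph n x*H x) \<longlonglongrightarrow> ind K x*H x" by (intro AE_I2 tendsto_mult p tendsto_const)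
  qed auto
  have l2: "(%n. LINT x|\<tau>. ph n x*gn x) \<longlonglongrightarrow> (LINT x|\<tau>. ind K x*gn x)"
  proof (rule integral_dominated_convergence[where w="%x. norm (gn x)"])
   show "AE x in \<tau>. norm (ph n x*gn x) <= norm (gn x)" for n
   proof (rule AE_I2)
    fix x show "norm (ph n x*gn x) <= norm (gn x)" using mult_right_mono[OF p(3)[of n x] abs_ge_zero[of "gn x"]] p(2)[of n x] by (simp add: abs_mult)
   qed
   show "AE x in \<tau>. (%n. ph n x*gn x) \<longlonglongrightarrow> ind K x*gn x" by (intro AE_I2 tendsto_mult p tendsto_const)
  qed (use gn in auto)
  have "\<bar>(LINT x|\<tau>. ind K x*gn x) - (LINT x|\<sigma>. ind K x*H x)\<bar> <= M0*measure kappa O1"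
  proof (rule LIMSEQ_le_const2[OF tendsto_rabs[OF tendsto_diff[OF l2 l1]]])
   have "\<bar>(LINT x|\<sigma>. ph n x*F x (vc c x)) - (LINT x|\<tau>. ph n x*gn x)\<bar> <= M0*measure kappa O1" for n
    by (rule test_bound[OF p(1-3,5-7) O1(1,2)])
   hence "\<bar>(LINT x|\<tau>. ph n x*gn x) - (LINT x|\<sigma>. ph n x*H x)\<bar> <= M0*measure kappa O1" for n
    unfolding H_def by (simp add: abs_minus_commute)
   thus "EX N. ALL n>=N. \<bar>(LINT x|\<tau>. ph n x*gn x) - (LINT x|\<sigma>. ph n x*H x)\<bar> <= M0*measure kappa O1" by blast
  qed
  also have "... <= M0*measure kappa K+e"
   using mult_left_mono[OF mO M0_nonneg] e'(2) unfolding distrib_left by linarith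
  finally show "\<bar>D H K\<bar> <= M0*measure kappa K+e" by (simp add: D_def)
 qed
 have "\<bar>D H A\<bar> <= M0*measure kappa A" if A [measurable]: "A \<in> sets borel" and AO: "A <= \<Omega>" for A
 proof (rule field_le_epsilon)
  fix e :: real assume e: "e > 0"
  have C0: "C >= 0" using v_bound[of undefined] by linarith
  \<comment> \<open>The remainder set costs e' for \<tau>, whose density is at most one, and C*e'
    for \<sigma>, where H is bounded by C; together they give e.\<close>
  define e' where "e' = e/(C+1)"
  have e': "e' > 0" "e'+C*e' = e" using e C0 by (auto simp: e'_def add_divide_distrib[symmetric] field_simps)
  obtain Q1 where Q1: "compact Q1" "Q1 <= A" "measure \<tau> (A - Q1) < e'" using inner_compact_approx[OF tau A e'(1)] by blast
  obtain Q2 where Q2: "compact Q2" "Q2 <= A" "measure \<sigma> (A - Q2) < e'" using inner_compact_approx[OF sg A e'(1)] by blast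
  define Q where "Q = Q1 \<union> Q2"
  have Q: "compact Q" "Q <= A" using Q1 Q2 by (auto simp: Q_def)
  have [measurable]: "Q \<in> sets borel" "Q1 \<in> sets borel" "Q2 \<in> sets borel" using Q Q1 Q2 by (simp_all add: borel_compact)
  have m: "measure \<tau> (A - Q) <= e'" "measure \<sigma> (A - Q) <= e'"
  proof -
   have "A - Q <= A - Q1" "A - Q <= A - Q2" by (auto simp: Q_def)
   hence "measure \<tau> (A - Q) <= measure \<tau> (A - Q1)" "measure \<sigma> (A - Q) <= measure \<sigma> (A - Q2)"
    by (auto intro: T.finite_measure_mono S.finite_measure_mono)
   thus "measure \<tau> (A - Q) <= e'" "measure \<sigma> (A - Q) <= e'" using Q1(3) Q2(3) by linarith+
  qed
  have ind: "ind A x = ind Q x+(ind (A - Q) x :: real)" for x using Q(2) by (auto simp: indicator_def)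
  have "(LINT x|\<tau>. ind A x*gn x) = (LINT x|\<tau>. ind Q x*gn x)+(LINT x|\<tau>. ind (A - Q) x*gn x)"
   unfolding ind distrib_right by (rule B_integral_add) (intro int_b, simp)+
  moreover have "(LINT x|\<sigma>. ind A x*H x) = (LINT x|\<sigma>. ind Q x*H x)+(LINT x|\<sigma>. ind (A - Q) x*H x)"
   unfolding ind distrib_right by (rule B_integral_add) (intro int_b(1)[OF _ Hm Hb], simp)+
  moreover have "norm (LINT x|\<tau>. ind (A - Q) x*gn x) <= (LINT x|\<tau>. ind (A - Q) x)"
   by (rule integral_norm_bound_AE[OF T.integrable_const_bound[of _ 1]]) (use gn(2) in "auto simp: indicator_def elim!: eventually_mono")
  moreover have "norm (LINT x|\<sigma>. ind (A - Q) x*H x) <= (LINT x|\<sigma>. C*ind (A - Q) x)"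
   by (rule integral_norm_bound_AE[OF integrable_mult_right[OF S.integrable_const_bound[of _ 1]]]) (use Hb in "auto simp: indicator_def")
  moreover have "M0*measure kappa Q <= M0*measure kappa A"
   by (intro mult_left_mono M0_nonneg K.finite_measure_mono) (use Q in auto)
  moreover have "C*measure \<sigma> (A - Q) <= C*e'" by (rule mult_left_mono[OF m(2) C0])
  ultimately show "\<bar>D H A\<bar> <= M0*measure kappa A+e"
   using cpt[OF Q(1)] Q(2) AO m(1) e'(2) unfolding D_def by (simp add: subset_trans)
 qed
 thus ?thesis unfolding good_def H_def[symmetric] using Hb by simp
qed

lemma good_convex: assumes H: "good H" "good H'" and t: "0 <= t" "t <= 1" shows "good (%x. (1 - t)*H x+t*H' x)"
proof -
 have conv: "\<bar>(1 - t)*y+t*z\<bar> <= c" if "\<bar>y\<bar> <= c" "\<bar>z\<bar> <= c" for y z c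
  using convex_bound_le[of y c z "1 - t" t] convex_bound_le[of "- y" c "- z" "1 - t" t] that t by (auto simp: abs_le_iff)
 have "D (%x. (1 - t)*H x+t*H' x) A = (1 - t)*D H A+t*D H' A" if A: "A \<in> sets borel" for A
 proof -
  have i: "integrable \<sigma> (%x. (1 - t)*(ind A x*H x))" "integrable \<sigma> (%x. t*(ind A x*H' x))"
   using int_b(1)[OF A, of H C] int_b(1)[OF A, of H' C] H by (auto simp: good_def)
  have "(LINT x|\<sigma>. ind A x*((1 - t)*H x+t*H' x)) = (LINT x|\<sigma>. (1 - t)*(ind A x*H x)+t*(ind A x*H' x))"
   by (simp add: algebra_simps)
  also have "... = (1 - t)*(LINT x|\<sigma>. ind A x*H x)+t*(LINT x|\<sigma>. ind A x*H' x)" using i by simp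
  finally show ?thesis by (simp add: D_def algebra_simps)
 qed
 thus ?thesis using H conv by (auto simp: good_def)
qed

text \<open>Freezing the parameter \<open>c\<close> on the level strips of \<open>h\<close> replaces it by a function.\<close>
lemma good_approx:
 assumes H: "H \<in> Borel" "!!x. \<bar>H x\<bar> <= C" and h [measurable]: "h \<in> Borel" and hb: "!!x. \<bar>h x\<bar> <= cb"
  and good: "!!c. c \<in> X ==> good (Hc c)" and X: "!!n x. n > 0 ==> of_int \<lfloor>real n*h x\<rfloor>/real n \<in> X"
  and close: "!!c x. c \<in> X ==> \<bar>H x - Hc c x\<bar> <= cl*\<bar>h x - c\<bar>" and cl: "cl >= 0"
 shows "good H"
proof -
 have "\<bar>D H A\<bar> <= M0*measure kappa A" if A [measurable]: "A \<in> sets borel" and AO: "A <= \<Omega>" for A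
 proof (rule LIMSEQ_le_const[of "%n. M0*measure kappa A+cl*(1/real n)*measure \<sigma> A"])
  have "(%n. M0*measure kappa A+cl*(1/real n)*measure \<sigma> A) \<longlonglongrightarrow> M0*measure kappa A+cl*0*measure \<sigma> A"
   by (intro tendsto_intros lim_1_over_n)
  thus "(%n. M0*measure kappa A+cl*(1/real n)*measure \<sigma> A) \<longlonglongrightarrow> M0*measure kappa A" by simp
  have "\<bar>D H A\<bar> <= M0*measure kappa A+cl*(1/real n)*measure \<sigma> A" if n: "n > 0" for n
  proof -
   define j where "j x = \<lfloor>real n*h x\<rfloor>" for x
   \<comment> \<open>The strips have width 1/n in the values of h; boundedness of h leaves finitely
     many of them, so that \<open>D H A\<close> is a finite sum over pieces.\<close>
   define J where "J = {- \<lceil>real n*cb\<rceil> .. \<lceil>real n*cb\<rceil>}"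
   define P where "P i = A \<inter> {x. j x = i}" for i
   have [measurable]: "j \<in> measurable borel (count_space UNIV)" unfolding j_def by measurable
   have [measurable]: "P i \<in> sets borel" for i unfolding P_def by measurable
   have jJ: "j x \<in> J" for x
   proof -
    have "\<bar>real n*h x\<bar> <= real n*cb" using mult_left_mono[OF hb, of "real n" x] by (simp add: abs_mult)
    hence "- (real n*cb) <= real n*h x" "real n*h x <= real n*cb" by linarith+
    thus ?thesis unfolding J_def j_def atLeastAtMost_iff by linarith
   qed
   have ind: "ind A x = (\<Sum>i\<in>J. ind (P i) x :: real)" for x
   proof -
    have "(\<Sum>i\<in>J. ind (P i) x) = (\<Sum>i\<in>J. if i = j x then ind A x else (0::real))"
     by (rule sum.cong) (auto simp: P_def indicator_def)
    thus ?thesis using jJ by (simp add: J_def)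
   qed
   have disj: "disjoint_family_on P J" by (auto simp: disjoint_family_on_def P_def)
   have AU: "A = (\<Union>i\<in>J. P i)" using jJ by (auto simp: P_def)
   have Dsum: "D H A = (\<Sum>i\<in>J. D H (P i))" unfolding D_def ind sum_distrib_right sum_subtractf
    by (subst (1 2) B_integral_sum) (auto intro!: int_b int_b(1)[OF _ H])
   have piece: "\<bar>D H (P i)\<bar> <= M0*measure kappa (P i)+cl*(1/real n)*measure \<sigma> (P i)" if "i \<in> J" for i
   proof (cases "P i = {}")
    case False
    then obtain x0 where x0: "j x0 = i" by (auto simp: P_def)
    define c where "c = of_int i/real n"
    have cX: "c \<in> X" using X[OF n, of x0] x0 by (simp add: c_def j_def)
    note g = good[OF cX, unfolded good_def]
    have le: "\<bar>ind (P i) x*Hc c x - ind (P i) x*H x\<bar> <= cl*(1/real n)*ind (P i) x" for x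
    proof (cases "x \<in> P i")
     case True
     hence "of_int i <= real n*h x" "real n*h x < of_int i+1" by (auto simp: P_def j_def)
     moreover have e: "h x - c = (real n*h x - of_int i)/real n" using n by (simp add: c_def field_simps)
     ultimately have "\<bar>h x - c\<bar> <= 1/real n" unfolding e abs_divide by (intro frac_le) (use n in auto)
     hence "\<bar>H x - Hc c x\<bar> <= cl*(1/real n)" using close[OF cX, of x] mult_left_mono[OF _ cl] by force
     thus ?thesis using True by (simp add: abs_minus_commute)
    qed simp
    have i1: "integrable \<sigma> (%x. ind (P i) x*Hc c x)" and i2: "integrable \<sigma> (%x. ind (P i) x*H x)"
     using g H by (auto intro!: int_b(1))
    have "D H (P i) = D (Hc c) (P i)+(LINT x|\<sigma>. ind (P i) x*Hc c x - ind (P i) x*H x)"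
     using i1 i2 by (simp add: D_def)
    moreover have "norm (LINT x|\<sigma>. ind (P i) x*Hc c x - ind (P i) x*H x) <= (LINT x|\<sigma>. cl*(1/real n)*ind (P i) x)"
    proof (rule integral_norm_bound_AE)
     show "integrable \<sigma> (%x. cl*(1/real n)*ind (P i) x)"
      by (intro integrable_mult_right S.integrable_const_bound[of _ 1]) auto
    qed (use le in auto)
    moreover have "P i <= \<Omega>" using AO by (auto simp: P_def)
    hence "\<bar>D (Hc c) (P i)\<bar> <= M0*measure kappa (P i)" using g by simp
    ultimately show ?thesis by simp
   qed (simp add: D_def)
   have "\<bar>D H A\<bar> <= (\<Sum>i\<in>J. \<bar>D H (P i)\<bar>)" unfolding Dsum by (rule sum_abs)
   also have "... <= (\<Sum>i\<in>J. M0*measure kappa (P i)+cl*(1/real n)*measure \<sigma> (P i))" by (rule sum_mono) (rule piece)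
   also have "... = M0*measure kappa A+cl*(1/real n)*measure \<sigma> A"
   proof -
    have "measure kappa A = (\<Sum>i\<in>J. measure kappa (P i))" "measure \<sigma> A = (\<Sum>i\<in>J. measure \<sigma> (P i))"
     unfolding AU by (intro K.finite_measure_finite_Union S.finite_measure_finite_Union disj; auto simp: J_def)+
    thus ?thesis by (simp only: sum.distrib sum_distrib_left)
   qed
   finally show ?thesis .
  qed
  thus "EX N. ALL n>=N. \<bar>D H A\<bar> <= M0*measure kappa A+cl*(1/real n)*measure \<sigma> A" by (intro exI[of _ 1]) auto
 qed
 thus ?thesis unfolding good_def using H by auto
qed

text \<open>Clamping is a contraction and fixes h x, which lies between the two limits. So
  \<open>vc c x\<close> differs from h x by at most \<bar>h x - c\<bar>, and c may be frozen on
  strips with Lipschitz constant 1.\<close>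

lemma good_intermediate: assumes [measurable]: "h \<in> Borel" and h: "!!x. um x <= h x" "!!x. h x <= up x"
 shows "good (%x. F x (h x))"
proof (rule good_approx[where h=h and cb=C and cl=1 and X=UNIV and Hc="%c x. F x (vc c x)"])
 have hC: "\<bar>h x\<bar> <= C" for x using um_bound[of x] h[of x] by linarith
 thus "\<bar>F x (h x)\<bar> <= C" "\<bar>h x\<bar> <= C" for x using F_bound by auto
 fix c x
 have "\<bar>F x (h x) - F x (vc c x)\<bar> <= \<bar>h x - vc c x\<bar>" by (rule F_lipschitz[OF hC vc_bound])
 also have "... <= 1*\<bar>h x - c\<bar>" using h[of x] by (auto simp: vc_def max_def min_def)
 finally show "\<bar>F x (h x) - F x (vc c x)\<bar> <= 1*\<bar>h x - c\<bar>" .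
qed (auto intro: good_vc)

text \<open>For a constant weight this is \<open>good_convex\<close>. A variable weight is frozen on
  its strips; the floor values of a weight in [0,1] stay in [0,1], and the dependence on the weight
  has Lipschitz constant 2C.\<close>

lemma good_mixture: assumes [measurable]: "h \<in> Borel" and h: "!!x. 0 <= h x" "!!x. h x <= 1"
 shows "good (%x. (1 - h x)*F x (um x)+h x*F x (up x))"
proof -
 have C0: "C >= 0" using v_bound[of undefined] by linarith
 have g: "good (%x. F x (um x))" "good (%x. F x (up x))" using um_le_up by (auto intro!: good_intermediate)
 have b: "\<bar>F x (um x)\<bar> <= C" "\<bar>F x (up x)\<bar> <= C" for x using F_bound um_bound by auto
 show ?thesis
 proof (rule good_approx[where h=h and cb=1 and cl="2*C" and X="{0..1}" and Hc="%c x. (1 - c)*F x (um x)+c*F x (up x)"])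
  show "good (%x. (1 - c)*F x (um x)+c*F x (up x))" if "c \<in> {0..1}" for c
   by (rule good_convex[OF g]) (use that in auto)
  show "of_int \<lfloor>real n*h x\<rfloor>/real n \<in> {0..1}" if "n > 0" for n x
  proof -
   have "0 <= real n*h x" "real n*h x <= real n" using h[of x] by (auto intro: mult_left_le)
   hence "0 <= \<lfloor>real n*h x\<rfloor>" "\<lfloor>real n*h x\<rfloor> <= int n" by linarith+
   thus ?thesis using that by (simp add: divide_le_eq)
  qed
  fix c x
  show "\<bar>(1 - h x)*F x (um x)+h x*F x (up x)\<bar> <= C"
   using convex_bound_le[of "F x (um x)" C "F x (up x)" "1 - h x" "h x"] convex_bound_le[of "- F x (um x)" C "- F x (up x)" "1 - h x" "h x"] b[of x] h[of x]
   by (auto simp: abs_le_iff)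
  have "\<bar>(h x - c)*(F x (up x) - F x (um x))\<bar> <= 2*C*\<bar>h x - c\<bar>"
   unfolding abs_mult mult.commute[of "2*C"] using b[of x] by (intro mult_left_mono) auto
  thus "\<bar>((1 - h x)*F x (um x)+h x*F x (up x)) - ((1 - c)*F x (um x)+c*F x (up x))\<bar> <= 2*C*\<bar>h x - c\<bar>"
   by (simp add: algebra_simps)
 qed (use h C0 in auto)
qed

end

section \<open>From the hypotheses to the abstract setting\<close>

lemma interval_integral_of_bool:
 fixes g :: "real => 'b::{banach,second_countable_topology}" assumes [measurable]: "g \<in> Borel"
 shows "(LINT s=ereal 0..ereal t|lborel. g s) = (LI s. (of_bool (s < t) - of_bool (s < 0)) *\<^sub>R g s)"
proof (cases "0 <= t")
 case True
 have "(LI s. ind {0<..<t} s *\<^sub>R g s) = (LI s. (of_bool (s < t) - of_bool (s < 0)) *\<^sub>R g s)"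
  by (rule integral_cong_AE) (use AE_lborel_singleton[of 0] True in "auto simp: indicator_def elim!: eventually_mono")
 thus ?thesis using True by (simp add: interval_lebesgue_integral_def set_lebesgue_integral_def)
next
 case False
 have "(LI s. - (ind {t<..<0} s *\<^sub>R g s)) = (LI s. (of_bool (s < t) - of_bool (s < 0)) *\<^sub>R g s)"
  by (rule integral_cong_AE) (use AE_lborel_singleton[of t] False in "auto simp: indicator_def elim!: eventually_mono")
 thus ?thesis using False by (simp add: interval_lebesgue_integral_def set_lebesgue_integral_def)
qed

lemma borel_version:
 fixes u :: "'a::euclidean_space => real"
 assumes u: "set_borel_measurable lebesgue \<Omega> u" "AE x in lebesgue. x \<in> \<Omega> --> \<bar>u x\<bar> <= C" and C: "C >= 0" and \<Omega> [measurable]: "\<Omega> \<in> sets borel"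
 obtains v where "v \<in> Borel" "!!x. \<bar>v x\<bar> <= C" "!!x. x \<notin> \<Omega> ==> v x = 0" "AE x in lborel. x \<in> \<Omega> --> u x = v x"
proof -
 have "(%x. ind \<Omega> x*u x) \<in> borel_measurable lebesgue" using u(1) by (simp add: set_borel_measurable_def)
 then obtain v0 where v0: "v0 \<in> borel_measurable lborel" "AE x in lborel. ind \<Omega> x*u x = v0 x"
  using completion_ex_borel_measurable_real by blast
 have [measurable]: "v0 \<in> Borel" using v0 by simp
 define v where "v x = ind \<Omega> x*max (- C) (min C (v0 x))" for x
 have "AE x in lborel. x \<in> \<Omega> --> \<bar>u x\<bar> <= C" using u(2) by (simp add: AE_completion_iff)
 with v0(2) have "AE x in lborel. x \<in> \<Omega> --> u x = v x" by eventually_elim (auto simp: v_def)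
 moreover have "v \<in> Borel" unfolding v_def by measurable
 ultimately show ?thesis by (intro that[of v]) (use C in "auto simp: v_def indicator_def")
qed

lemma ap_lower_cong:
 assumes u: "set_borel_measurable lebesgue \<Omega> u" "AE x in lborel. x \<in> \<Omega> --> u x = v x" and v [measurable]: "v \<in> Borel"
  and \<Omega> [measurable]: "\<Omega> \<in> sets borel" shows "ap_lower \<Omega> u = ap_lower \<Omega> v"
proof -
 have "measure lebesgue ({y\<in>\<Omega>. u y < t} \<inter> ball x r) = measure lebesgue ({y\<in>\<Omega>. v y < t} \<inter> ball x r)" for t x r
 proof (rule measure_eq_AE)
  show "AE y in lebesgue. y \<in> {y\<in>\<Omega>. u y < t} \<inter> ball x r \<longleftrightarrow> y \<in> {y\<in>\<Omega>. v y < t} \<inter> ball x r"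
   using u(2) by (auto simp: AE_completion_iff elim!: eventually_mono)
  have [measurable]: "(%y. ind \<Omega> y*u y) \<in> borel_measurable lebesgue" using u(1) by (simp add: set_borel_measurable_def)
  have "{y\<in>space lebesgue. ind \<Omega> y*u y < t} \<in> sets lebesgue" by measurable
  hence "\<Omega> \<inter> ({y\<in>space lebesgue. ind \<Omega> y*u y < t} \<inter> ball x r) \<in> sets lebesgue" by (intro sets.Int) auto
  also have "\<Omega> \<inter> ({y\<in>space lebesgue. ind \<Omega> y*u y < t} \<inter> ball x r) = {y\<in>\<Omega>. u y < t} \<inter> ball x r" by auto
  finally show "{y\<in>\<Omega>. u y < t} \<inter> ball x r \<in> sets lebesgue" .
  have "{y\<in>\<Omega>. v y < t} \<inter> ball x r \<in> sets borel" by measurable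
  thus "{y\<in>\<Omega>. v y < t} \<inter> ball x r \<in> sets lebesgue" by simp
 qed
 thus ?thesis by (simp add: ap_lower_def fun_eq_iff)
qed

text \<open>Three passages at once: from the completed measure to a Borel version, from the two-part
  integral \<open>sm_integral\<close> to an integral against a density, and from smooth to C^1 test
  functions.\<close>

lemma C1_test_identity:
 fixes A A' :: "'a::euclidean_space => 'a"
 assumes A: "set_borel_measurable lebesgue \<Omega> A" "!!ph. test_function \<Omega> ph ==> (LINT x:\<Omega>|lebesgue. A x \<bullet> grad ph x) = - sm_integral \<Omega> \<mu> ph"
  and A': "A' \<in> Borel" "!!x. norm (A' x) <= M" "!!x. x \<notin> \<Omega> ==> A' x = 0" "AE x in lborel. x \<in> \<Omega> --> A x = A' x"
  and g: "finite_measure kappa" "sets kappa = sets borel" "integrable kappa g" "!!E. borel_sub \<Omega> E ==> \<mu> E = (LINT x|kappa. ind E x*g x)"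
  and Om: "open \<Omega>" and phi: "C1 ph G" "compact K" "K <= \<Omega>" "!!x. x \<notin> K ==> ph x = 0"
 shows "(LI x. A' x \<bullet> G x) = - (LINT x|kappa. ph x*g x)"
proof (rule test_function_extension[OF A'(1,2) g(3,2) Om _ phi])
 fix \<psi> G assume t: "test_function \<Omega> \<psi>" and C: "C1 \<psi> G"
 have [measurable]: "A' \<in> Borel" "\<psi> \<in> Borel" "G \<in> Borel" "\<Omega> \<in> sets borel"
  using A' C Om by measurable
 define S where "S = closure {x. \<psi> x ~= 0}"
 have S: "compact S" "S <= \<Omega>" "!!x. x \<notin> S ==> \<psi> x = 0"
  using t closure_subset[of "{x. \<psi> x ~= 0}"] by (auto simp: test_function_def S_def)
 obtain B where B: "!!x. norm (\<psi> x) <= B" using bounded_compact_support[OF C1_continuous[OF C] S(1,3)] by metis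
 have Am: "(%x. ind \<Omega> x *\<^sub>R A x) \<in> borel_measurable lebesgue" using A(1) by (simp add: set_borel_measurable_def)
 have Gm: "G \<in> borel_measurable lebesgue" "A' \<in> borel_measurable lebesgue" by (auto intro: measurable_completion)
 have "(LINT x:\<Omega>|lebesgue. A x \<bullet> grad \<psi> x) = (LINT x|lebesgue. (ind \<Omega> x *\<^sub>R A x) \<bullet> G x)"
  by (simp add: set_lebesgue_integral_def C1_grad[OF C])
 also have "... = (LINT x|lebesgue. A' x \<bullet> G x)"
 proof (rule integral_cong_AE)
  show "AE x in lebesgue. (ind \<Omega> x *\<^sub>R A x) \<bullet> G x = A' x \<bullet> G x"
   using A'(3,4) by (auto simp: AE_completion_iff indicator_def elim!: eventually_mono)
 qed (use Am Gm in measurable)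
 also have "... = (LI x. A' x \<bullet> G x)" by (rule integral_completion) simp
 finally have 1: "(LINT x:\<Omega>|lebesgue. A x \<bullet> grad \<psi> x) = (LI x. A' x \<bullet> G x)" .
 have "sm_integral \<Omega> \<mu> \<psi> = (LINT x|kappa. ind \<Omega> x*\<psi> x*g x)"
  by (rule sm_integral_density[OF g(1-3) _ g(4) _ B[unfolded real_norm_def]]) auto
 also have "... = (LINT x|kappa. \<psi> x*g x)" by (intro B_integral_cong) (use S in "auto simp: indicator_def")
 finally show "(LI x. A' x \<bullet> G x) = - (LINT x|kappa. \<psi> x*g x)" using A(2)[OF t] 1 by simp
qed

lemma lub_meas_space:
 assumes "\<Omega> \<in> sets borel" shows "sets (lub_meas \<Omega> \<mu>) = {E. borel_sub \<Omega> E}" "space (lub_meas \<Omega> \<mu>) = \<Omega>"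
proof -
 have eq: "{E. borel_sub \<Omega> E} = sets (restrict_space borel \<Omega>)"
  using assms by (auto simp: sets_restrict_space_iff borel_sub_def)
 show "sets (lub_meas \<Omega> \<mu>) = {E. borel_sub \<Omega> E}" "space (lub_meas \<Omega> \<mu>) = \<Omega>"
  unfolding lub_meas_def eq using sets.sigma_sets_eq[of "restrict_space borel \<Omega>"] sets.space_closed[of "restrict_space borel \<Omega>"]
  by (simp_all add: space_restrict_space)
qed

text \<open>\<open>measure_of\<close> falls back to the zero measure on a set function that is not
  countably additive. The argument therefore rests on the alternative \<open>alt\<close>: a value is
  the least upper bound itself or zero. In the second case the premise about null sets gives the
  estimate.\<close>

lemma lub_meas_dominates:
 assumes \<Omega>: "\<Omega> \<in> sets borel" and fin: "lub_tv \<Omega> \<mu> \<Omega> < \<infinity>"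
 shows "finite_measure (lub_meas \<Omega> \<mu>)"
  and "vmeasure_on \<Omega> (\<mu> t) ==> borel_sub \<Omega> E ==> (emeasure (lub_meas \<Omega> \<mu>) E = 0 ==> \<mu> t E = 0) ==> \<bar>\<mu> t E\<bar> <= measure (lub_meas \<Omega> \<mu>) E"
proof -
 have alt: "emeasure (lub_meas \<Omega> \<mu>) A = lub_tv \<Omega> \<mu> A \<or> emeasure (lub_meas \<Omega> \<mu>) A = 0" for A
  unfolding lub_meas_def emeasure_measure_of_conv by auto
 show f: "finite_measure (lub_meas \<Omega> \<mu>)"
  by (rule finite_measureI) (use alt[of \<Omega>] fin in "auto simp: lub_meas_space[OF \<Omega>]")
 interpret finite_measure "lub_meas \<Omega> \<mu>" by (rule f)
 assume vm: "vmeasure_on \<Omega> (\<mu> t)" and E: "borel_sub \<Omega> E" and z: "emeasure (lub_meas \<Omega> \<mu>) E = 0 ==> \<mu> t E = 0"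
 interpret real_vmeas \<Omega> "\<mu> t" by standard (rule vm)
 show "\<bar>\<mu> t E\<bar> <= measure (lub_meas \<Omega> \<mu>) E"
 proof (cases "emeasure (lub_meas \<Omega> \<mu>) E = 0")
  case False
  define A where "A n = (if n = 0 then E else {})" for n :: nat
  have A: "A \<in> parts E" using trivial_part(1)[OF E] by (simp add: A_def[abs_def])
  have "(\<Sum>n. tv (A n)) = (\<Sum>n\<in>{0}. tv (A n))" by (rule suminf_finite) (auto simp: A_def tv_empty)
  hence "tv E = (\<Sum>n. total_variation \<Omega> (\<mu> ((%_. t) n)) (A n))" by (simp add: A_def)
  also have "... <= lub_tv \<Omega> \<mu> E"
   unfolding lub_tv_def by (rule SUP_upper2[of "(%_. t, A)"]) (use A in "auto simp: parts_def")
  finally have "ennreal \<bar>\<mu> t E\<bar> <= emeasure (lub_meas \<Omega> \<mu>) E"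
   using norm_le_tv[OF E] alt[of E] False by (auto intro: order_trans)
  thus ?thesis by (simp add: emeasure_eq_measure)
 qed (use z in simp)
qed

text \<open>The bounds 1/(n+1) above the infimum hold off countably many null sets. An open nonempty
  \<Omega> is not negligible, which makes the set of admissible bounds bounded below and its infimum
  meaningful.\<close>

lemma linf_norm_attained:
 fixes \<Omega> :: "'a::euclidean_space set"
 assumes \<Omega>: "open \<Omega>" "\<Omega> ~= {}" and b: "!!x t. x \<in> \<Omega> ==> norm (b x t) <= M"
 shows "AE p in lborel. p \<in> \<Omega> \<times> UNIV --> norm (un b p) <= linf_norm \<Omega> b"
proof -
 define S where "S = {M. AE p in lebesgue. p \<in> \<Omega> \<times> UNIV --> norm (un b p) <= M}"
 have MS: "M \<in> S" using b by (auto simp: S_def)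
 have "0 <= M" if "M \<in> S" for M
 proof (rule ccontr)
  assume "\<not> 0 <= M"
  hence neg: "\<not> norm x <= M" for x :: 'a using norm_ge_zero[of x] by linarith
  have op: "open (\<Omega> \<times> (UNIV :: real set))" using \<Omega> by (intro open_Times) auto
  have "AE p in lebesgue. p \<notin> \<Omega> \<times> (UNIV :: real set)" using that neg by (auto simp: S_def elim!: eventually_mono)
  hence "negligible (\<Omega> \<times> (UNIV :: real set))"
   using op by (auto simp: negligible_iff_null_sets AE_iff_null_sets)
  thus False using open_not_negligible[OF op] \<Omega>(2) by auto
 qed
 hence bdd: "bdd_below S" by (rule bdd_belowI)
 have "AE p in lebesgue. ALL n. p \<in> \<Omega> \<times> UNIV --> norm (un b p) <= linf_norm \<Omega> b+1/real (Suc n)"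
 proof (rule AE_all_countable[THEN iffD2], rule allI)
  fix n
  have "Inf S < linf_norm \<Omega> b+1/real (Suc n)" by (simp add: linf_norm_def S_def)
  then obtain M where "M \<in> S" "M < linf_norm \<Omega> b+1/real (Suc n)" using cInf_less_iff[OF _ bdd] MS by blast
  thus "AE p in lebesgue. p \<in> \<Omega> \<times> UNIV --> norm (un b p) <= linf_norm \<Omega> b+1/real (Suc n)"
   by (auto simp: S_def elim!: eventually_mono)
 qed
 hence "AE p in lebesgue. p \<in> \<Omega> \<times> UNIV --> norm (un b p) <= linf_norm \<Omega> b"
 proof eventually_elim
  case (elim p)
  show ?case
  proof (rule impI, rule field_le_epsilon)
   fix e :: real assume "p \<in> \<Omega> \<times> UNIV" "e > 0"
   moreover obtain n where "1/real (Suc n) < e" using nat_approx_posE[OF \<open>e > 0\<close>] by blast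
   ultimately show "norm (un b p) <= linf_norm \<Omega> b+e" using elim by (meson add_left_mono less_imp_le order_trans)
  qed
 qed
 thus ?thesis by (simp add: AE_completion_iff)
qed

lemma (in euclidean_vmeas) total_variation_le:
 assumes m: "!!A. borel_sub \<Omega> A ==> norm (m A) <= c*measure kappa A" and c: "c >= 0" and E: "borel_sub \<Omega> E"
 shows "total_variation \<Omega> m E <= ennreal c*tv E" unfolding total_variation_def[of \<Omega> m]
proof (rule SUP_least)
 interpret finite_measure kappa by (rule finite_kappa)
 fix A :: "nat => 'a set" assume "A \<in> {A. (ALL n. borel_sub \<Omega> (A n)) & disjoint_family A & (\<Union>n. A n) = E}"
 hence A: "!!n. borel_sub \<Omega> (A n)" "disjoint_family A" "(\<Union>n. A n) = E" by auto
 have "(\<Sum>n. ennreal (norm (m (A n)))) <= (\<Sum>n. ennreal c*emeasure kappa (A n))"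
  using m[OF A(1)] c by (intro suminf_le) (simp_all add: emeasure_eq_measure ennreal_leI flip: ennreal_mult)
 also have "... = ennreal c*emeasure kappa E"
  using A by (simp add: suminf_emeasure borel_sub_def image_subset_iff flip: A(3))
 also have "emeasure kappa E = tv E" using E emeasure_kappa[of E] by (simp add: borel_sub_def Int_absorb2)
 finally show "(\<Sum>n. ennreal (norm (m (A n)))) <= ennreal c*tv E" .
qed

theorem theorem4p7:
  fixes \<Omega> :: "'a::euclidean_space set"
    and b :: "'a \<Rightarrow> real \<Rightarrow> 'a"
    and divb :: "real \<Rightarrow> 'a set \<Rightarrow> real"
    and f :: "'a \<Rightarrow> real \<Rightarrow> real"
    and u :: "'a \<Rightarrow> real"
    and Du :: "'a set \<Rightarrow> 'a"
    and \<nu> :: "'a set \<Rightarrow> real"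
    and lam :: "'a \<Rightarrow> real"
  defines "\<sigma> \<equiv> lub_meas \<Omega> divb"
    and "B \<equiv> (\<lambda>x t. LINT s=ereal 0..ereal t|lborel. b x s)"
    and "F \<equiv> (\<lambda>x t. LINT s=ereal 0..ereal t|lborel. f x s)"
    and "um \<equiv> ap_lower \<Omega> u" and "up \<equiv> ap_upper \<Omega> u"
  assumes dim: "DIM('a) \<ge> 2"
    and \<Omega>: "open \<Omega>"
    (* (b1) *)
    and b1_meas: "(\<lambda>p. b (fst p) (snd p)) \<in> borel_measurable (restrict_space borel (\<Omega> \<times> (UNIV :: real set)))"
    and b1_bdd: "\<exists>M. \<forall>x\<in>\<Omega>. \<forall>t. norm (b x t) \<le> M"
    (* (b2) *)
    and b2: "AE x in lebesgue. x \<in> \<Omega> \<longrightarrow> continuous_on UNIV (b x)"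
    (* (b3): divb t = div_x b_t, and b_t \<in> DM^\<infinity>(\<Omega>) *)
    and b3: "\<forall>t. is_div \<Omega> (\<lambda>x. b x t) (divb t)"
    (* (b4) *)
    and b4: "lub_tv \<Omega> divb \<Omega> < \<infinity>"
    (* f(.,t) = d div b_t / d\<sigma> (jointly Borel version, for a.e. t) *)
    and f_meas: "(\<lambda>p. f (fst p) (snd p)) \<in> borel_measurable (restrict_space borel (\<Omega> \<times> (UNIV :: real set)))"
    and f_dens: "AE t in lborel. \<forall>E. borel_sub \<Omega> E \<longrightarrow>
                   set_integrable \<sigma> E (\<lambda>x. f x t) \<and> divb t E = (LINT x:E|\<sigma>. f x t)"
    (* u \<in> BV(\<Omega>) \<inter> L^\<infinity>(\<Omega>), Du its distributional gradient *)
    and u_BV: "is_BV \<Omega> u Du"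
    and u_Linf: "\<exists>C. AE x in lebesgue. x \<in> \<Omega> \<longrightarrow> \<bar>u x\<bar> \<le> C"
    (* \<nu> = div (B(x, u(x))) *)
    and \<nu>: "is_div \<Omega> (\<lambda>x. B x (u x)) \<nu>"
    (* \<lambda> : \<Omega> \<rightarrow> [0,1] Borel *)
    and lam_meas: "lam \<in> borel_measurable (restrict_space borel \<Omega>)"
    and lam_range: "\<forall>x\<in>\<Omega>. 0 \<le> lam x \<and> lam x \<le> 1"
  shows "\<forall>E. borel_sub \<Omega> E \<longrightarrow>
     total_variation \<Omega>
        (\<lambda>E. - (LINT x:E|\<sigma>. F x ((1 - lam x) * um x + lam x * up x)) + \<nu> E) E
       \<le> ennreal (linf_norm \<Omega> b) * total_variation \<Omega> Du E
   \<and> total_variation \<Omega>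
        (\<lambda>E. - (LINT x:E|\<sigma>. (1 - lam x) * F x (um x) + lam x * F x (up x)) + \<nu> E) E
       \<le> ennreal (linf_norm \<Omega> b) * total_variation \<Omega> Du E"
proof -
 have Ob [measurable]: "\<Omega> \<in> sets borel" using \<Omega> by simp
 obtain Mb0 where Mb0: "!!x t. x \<in> \<Omega> ==> norm (b x t) <= Mb0" using b1_bdd by blast
 define Mb where "Mb = max Mb0 0"
 have Mb: "norm (b x t) <= Mb" if "x \<in> \<Omega>" for x t using Mb0[OF that, of t] by (simp add: Mb_def)
 obtain C0 where C0: "AE x in lebesgue. x \<in> \<Omega> --> \<bar>u x\<bar> <= C0" using u_Linf by blast
 define C where "C = max C0 0"
 have um: "set_borel_measurable lebesgue \<Omega> u"
  using u_BV by (auto simp: is_BV_def set_integrable_def set_borel_measurable_def)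
 have "AE x in lebesgue. x \<in> \<Omega> --> \<bar>u x\<bar> <= C" using C0 by eventually_elim (auto simp: C_def)
 from borel_version[OF um this _ Ob] obtain v where v [measurable]: "v \<in> Borel"
  and vb: "!!x. \<bar>v x\<bar> <= C" and v0: "!!x. x \<notin> \<Omega> ==> v x = 0" and uv: "AE x in lborel. x \<in> \<Omega> --> u x = v x"
  by (auto simp: C_def)
 define a where "a = C+1"
 have aC: "C < a" "0 <= C" by (auto simp: a_def C_def)
 \<comment> \<open>\<sigma> has \<Omega> as its space. Its image under the inclusion is a measure on
   all Borel sets, as products and inner regularity require.\<close>
 define \<sigma>' where "\<sigma>' = distr \<sigma> borel (%x. x)"
 have spS: "sets \<sigma> = {E. borel_sub \<Omega> E}" "space \<sigma> = \<Omega>" unfolding \<sigma>_def by (rule lub_meas_space[OF Ob])+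
 have idm: "(%x. x) \<in> measurable \<sigma> borel" by (rule measurableI) (auto simp: spS borel_sub_def)
 interpret S: finite_measure \<sigma> unfolding \<sigma>_def by (rule lub_meas_dominates(1)[OF Ob b4])
 have fin': "finite_measure \<sigma>'" unfolding \<sigma>'_def by (rule S.finite_measure_distr[OF idm])
 have sets' [measurable_cong, simp]: "sets \<sigma>' = sets borel" by (simp add: \<sigma>'_def)
 have int': "(LINT x|\<sigma>'. g x) = (LINT x|\<sigma>. g x)" if "g \<in> Borel" for g :: "'a => real"
  unfolding \<sigma>'_def by (rule integral_distr[OF idm that])
 have meas': "measure \<sigma>' A = measure \<sigma> (A \<inter> \<Omega>)" if "A \<in> sets borel" for A
  unfolding \<sigma>'_def using that by (subst measure_distr[OF idm]) (auto simp: spS)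
 have joint: "(%p. ind (\<Omega> \<times> (UNIV :: real set)) p *\<^sub>R h p) \<in> Borel"
  if "h \<in> borel_measurable (restrict_space borel (\<Omega> \<times> (UNIV :: real set)))" for h :: "'a \<times> real => 'z::real_normed_vector"
  using that by (subst (asm) borel_measurable_restrict_space_iff) (auto simp: borel_Times)
 define f1 where "f1 x t = ind \<Omega> x*f x t" for x t
 have f1m [measurable]: "(%p. f1 (fst p) (snd p)) \<in> Borel"
  using joint[OF f_meas] by (simp add: f1_def indicator_times)
 have f1m' [measurable (raw)]: "(%z. f1 (h z) (h' z)) \<in> borel_measurable N"
  if "h \<in> measurable N borel" "h' \<in> measurable N borel" for h h' and N :: "'z measure"
  using measurable_compose[of "%z. (h z, h' z)" N borel _ borel, OF _ f1m] that by (simp add: borel_prod[symmetric])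
 \<comment> \<open>For almost every t the truncation to [-1,1] changes f only on a null set. The
   cut-off at a > C affects no integral up to a level in [-C,C], and such are all values of v and of
   its approximate limits.\<close>
 define f0 where "f0 x t = (if \<bar>t\<bar> < a then max (-1) (min 1 (f1 x t)) else 0)" for x t
 define b0 where "b0 x t = (if \<bar>t\<bar> < a then ind \<Omega> x *\<^sub>R b x t else 0)" for x t
 have b0m [measurable]: "(%p. b0 (fst p) (snd p)) \<in> Borel"
 proof -
  have "(%p. ind \<Omega> (fst p) *\<^sub>R un b p) \<in> Borel"
   using joint[OF b1_meas] by (simp add: indicator_times)
  thus ?thesis unfolding b0_def by measurable
 qed
 have b0m' [measurable (raw)]: "(%z. b0 (h z) (h' z)) \<in> borel_measurable N"
  if "h \<in> measurable N borel" "h' \<in> measurable N borel" for h h' and N :: "'z measure"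
  using measurable_compose[of "%z. (h z, h' z)" N borel _ borel, OF _ b0m] that by (simp add: borel_prod[symmetric])
 have b0b: "norm (b0 x t) <= Mb" for x t using Mb[of x t] by (simp add: b0_def indicator_def Mb_def)
 have f1_good: "AE t in lborel. integrable \<sigma>' (%x. f1 x t) & (ALL E. borel_sub \<Omega> E --> divb t E = (LINT x|\<sigma>'. ind E x*f1 x t))
   & (AE x in \<sigma>'. \<bar>f1 x t\<bar> <= 1)" using f_dens
 proof eventually_elim
  case (elim t)
  have OO: "borel_sub \<Omega> \<Omega>" by (simp add: borel_sub_def)
  have "integrable \<sigma> (%x. f1 x t)" using elim[rule_format, OF OO] by (simp add: set_integrable_def f1_def)
  hence i: "integrable \<sigma>' (%x. f1 x t)" unfolding \<sigma>'_def by (subst integrable_distr_eq[OF idm]) auto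
  have d: "divb t E = (LINT x|\<sigma>'. ind E x*f1 x t)" if E: "borel_sub \<Omega> E" for E
  proof -
   have [measurable]: "E \<in> sets borel" using E by (simp add: borel_sub_def)
   have "divb t E = (LINT x|\<sigma>. ind E x*f1 x t)"
    using elim E by (auto simp: set_lebesgue_integral_def f1_def borel_sub_def indicator_def intro!: B_integral_cong)
   thus ?thesis by (simp add: int')
  qed
  \<comment> \<open>Every \<open>divb t\<close> is dominated by \<sigma>, so its density is bounded
    by one.\<close>
  have "AE x in \<sigma>'. norm (f1 x t) <= 1"
  proof (rule AE_density_norm_le_1[OF fin' i])
   fix E assume "E \<in> sets \<sigma>'"
   hence E [measurable]: "E \<in> sets borel" by simp
   have EO: "borel_sub \<Omega> (E \<inter> \<Omega>)" using E by (simp add: borel_sub_def)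
   have "(LINT x|\<sigma>'. ind E x *\<^sub>R f1 x t) = divb t (E \<inter> \<Omega>)"
    unfolding d[OF EO] by (intro B_integral_cong) (auto simp: f1_def indicator_def)
   moreover have "\<bar>divb t (E \<inter> \<Omega>)\<bar> <= measure \<sigma> (E \<inter> \<Omega>)"
    unfolding \<sigma>_def
   proof (rule lub_meas_dominates(2)[OF Ob b4 _ EO])
    show "vmeasure_on \<Omega> (divb t)" using b3 by (simp add: is_div_def)
    \<comment> \<open>As an integral against \<sigma>, \<open>divb t\<close> vanishes on null sets;
      this settles the zero alternative in \<open>lub_meas_dominates\<close>.\<close>
    assume "emeasure (lub_meas \<Omega> divb) (E \<inter> \<Omega>) = 0"
    hence "E \<inter> \<Omega> \<in> null_sets \<sigma>" using EO spS by (simp add: null_sets_def \<sigma>_def)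
    from AE_not_in[OF this] have "(LINT x:(E \<inter> \<Omega>)|\<sigma>. f x t) = (LINT x|\<sigma>. 0)"
     unfolding set_lebesgue_integral_def by (intro integral_eq_zero_AE[THEN trans]) (auto elim!: eventually_mono simp: indicator_def)
    thus "divb t (E \<inter> \<Omega>) = 0" using elim EO by simp
   qed
   ultimately show "norm (LINT x|\<sigma>'. ind E x *\<^sub>R f1 x t) <= measure \<sigma>' E" by (simp add: meas')
  qed
  thus ?case using i d by simp
 qed
 interpret DU: euclidean_vmeas \<Omega> Du by standard (use u_BV in "auto simp: is_BV_def")
 interpret NU: euclidean_vmeas \<Omega> \<nu> by standard (use \<nu> in "auto simp: is_div_def")
 obtain gD where gD: "integrable DU.kappa gD" "!!E. E \<in> sets borel ==> Du (E \<inter> \<Omega>) = (LINT x|DU.kappa. ind E x *\<^sub>R gD x)" "AE x in DU.kappa. norm (gD x) <= 1"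
  using DU.density by blast
 obtain gn where gn: "integrable NU.kappa gn" "!!E. E \<in> sets borel ==> \<nu> (E \<inter> \<Omega>) = (LINT x|NU.kappa. ind E x *\<^sub>R gn x)" "AE x in NU.kappa. norm (gn x) <= 1"
  using NU.density by blast
 show ?thesis
 proof (cases "\<Omega> = {}")
  \<comment> \<open>On the empty set \<open>linf_norm\<close> is an infimum over all real numbers
    and has no usable value, but both variations on the left are zero.\<close>
  case True
  have nul: "total_variation \<Omega> (%E. - (LINT x:E|\<sigma>. h x)+\<nu> E) E = 0" if "borel_sub \<Omega> E" for h :: "'a => real" and E
  proof -
   have "(\<Sum>n. ennreal (norm (- (LINT x:A n|\<sigma>. h x)+\<nu> (A n)))) = 0" if "ALL n. borel_sub \<Omega> (A n)" for A :: "nat => 'a set"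
   proof -
    have "A n = {}" for n using that True by (auto simp: borel_sub_def)
    thus ?thesis by (simp add: set_lebesgue_integral_def NU.empty)
   qed
   thus ?thesis unfolding total_variation_def by (intro antisym[OF SUP_least zero_le]) (blast intro: eq_refl)
  qed
  thus ?thesis by simp
 next
  case False
  define M0 where "M0 = linf_norm \<Omega> b"
  \<comment> \<open>The maximum with 0 makes the constant nonnegative by construction. It disappears
    in \<open>main\<close>, because \<open>ennreal\<close> also sends negative numbers to 0.\<close>
  have bAE: "AE p in lborel. norm (b0 (fst p) (snd p)) <= max 0 M0"
  proof -
   have "AE p in lborel. p \<in> \<Omega> \<times> UNIV --> norm (un b p) <= linf_norm \<Omega> b"
    by (rule linf_norm_attained[OF \<Omega> False Mb])
   thus ?thesis by eventually_elim (auto simp: b0_def M0_def indicator_def mem_Times_iff le_max_iff_disj)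
  qed
  interpret P: pairing \<Omega> v C b0 f0 \<sigma>' DU.kappa gD a Mb "max 0 M0"
  proof (intro pairing.intro bounded_fun.intro pairing_axioms.intro)
   show "AE s in lborel. ALL ph G K. C1 ph G --> compact K --> K <= \<Omega> --> (ALL x. x \<notin> K --> ph x = 0) -->
     (LI x. b0 x s \<bullet> G x) = - (LINT x|\<sigma>'. ph x*f0 x s)" using f1_good
   proof (eventually_elim, intro allI impI)
    fix s ph G and K :: "'a set" assume elim: "integrable \<sigma>' (%x. f1 x s) & (ALL E. borel_sub \<Omega> E --> divb s E = (LINT x|\<sigma>'. ind E x*f1 x s)) & (AE x in \<sigma>'. \<bar>f1 x s\<bar> <= 1)"
     and phi: "C1 ph G" "compact K" "K <= \<Omega>" "ALL x. x \<notin> K --> ph x = 0"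
    have [measurable]: "ph \<in> Borel" using phi(1) by measurable
    show "(LI x. b0 x s \<bullet> G x) = - (LINT x|\<sigma>'. ph x*f0 x s)"
    proof (cases "\<bar>s\<bar> < a")
     case True
     have isd: "is_div \<Omega> (%x. b x s) (divb s)" using b3 by blast
     have "(LI x. b0 x s \<bullet> G x) = - (LINT x|\<sigma>'. ph x*f1 x s)"
     proof (rule C1_test_identity[where A="%x. b x s" and \<mu>="divb s" and M=Mb and K=K])
      show "(%x. b0 x s) \<in> Borel" "norm (b0 x s) <= Mb" for x by (measurable, rule b0b)
     qed (use isd elim phi fin' \<Omega> True in "auto simp: is_div_def b0_def")
     also have "(LINT x|\<sigma>'. ph x*f1 x s) = (LINT x|\<sigma>'. ph x*f0 x s)"
     proof (rule integral_cong_AE)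
      have "AE x in \<sigma>'. \<bar>f1 x s\<bar> <= 1" using elim by blast
      thus "AE x in \<sigma>'. ph x*f1 x s = ph x*f0 x s" by eventually_elim (use True in "auto simp: f0_def")
      show "(%x. ph x*f1 x s) \<in> borel_measurable \<sigma>'" "(%x. ph x*f0 x s) \<in> borel_measurable \<sigma>'"
       unfolding f0_def by measurable
     qed
     finally show ?thesis .
    qed (simp add: b0_def f0_def)
   qed
   fix ph G and K :: "'a set" assume phi: "C1 ph G" "compact K" "K <= \<Omega>" "!!x. x \<notin> K ==> ph x = 0"
   show "(LI x. v x *\<^sub>R G x) = - (LINT x|DU.kappa. ph x *\<^sub>R gD x)"
   proof (rule euclidean_eqI)
    fix i :: 'a assume i: "i \<in> Basis"
    have G0: "!!x. x \<notin> K ==> G x = 0" using C1_zero_outside[OF phi(1) compact_imp_closed[OF phi(2)] phi(4)] by blast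
    have [measurable]: "G \<in> Borel" "ph \<in> Borel" using phi(1) by measurable
    obtain B where B: "!!x. norm (ph x) <= B" using bounded_compact_support[OF C1_continuous[OF phi(1)] phi(2,4)] by metis
    have i1: "integ (%x. v x *\<^sub>R G x)"
     by (rule B_integrable_bound[OF integrable_mult_right[OF integrable_norm[OF integrable_compact_support[OF C1_continuous_grad[OF phi(1)] phi(2) G0]], of C]])
       (use vb aC in "auto intro!: mult_right_mono")
    have i2: "integrable DU.kappa (%x. ph x *\<^sub>R gD x)"
    proof (rule B_integrable_bound[OF integrable_mult_right[OF integrable_norm[OF gD(1)], of B]])
     show "AE x in DU.kappa. norm (ph x *\<^sub>R gD x) <= norm (B*norm (gD x))"
      using order_trans[OF B abs_ge_self] by (intro AE_I2) (auto simp: abs_mult intro!: mult_right_mono)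
     show "(%x. ph x *\<^sub>R gD x) \<in> borel_measurable DU.kappa" using gD(1) by measurable
    qed
    have "(LI x. (v x *\<^sub>R i) \<bullet> G x) = - (LINT x|DU.kappa. ph x*(gD x \<bullet> i))"
    \<comment> \<open>The distributional gradient of u in direction i is the divergence of the field
      u i, so one passage lemma serves both hypotheses.\<close>
    proof (rule C1_test_identity[where A="%x. u x *\<^sub>R i" and \<mu>="%E. Du E \<bullet> i" and M=C and K=K])
     show "set_borel_measurable lebesgue \<Omega> (%x. u x *\<^sub>R i)"
      using borel_measurable_scaleR[OF um[unfolded set_borel_measurable_def] measurable_const[of i borel]] by (simp add: set_borel_measurable_def)
     show "norm (v x *\<^sub>R i) <= C" for x using vb i by simp
     show "(LINT x:\<Omega>|lebesgue. (u x *\<^sub>R i) \<bullet> grad ph x) = - sm_integral \<Omega> (%E. Du E \<bullet> i) ph" if t: "test_function \<Omega> ph" for ph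
     proof -
      have "i \<bullet> grad ph x = frechet_derivative ph (at x) i" for x
       using i by (simp add: grad_def inner_sum_right inner_Basis if_distrib cong: if_cong)
      thus ?thesis using u_BV t i by (simp add: is_BV_def)
     qed
     show "integrable DU.kappa (%x. gD x \<bullet> i)" using gD(1) by simp
     show "Du E \<bullet> i = (LINT x|DU.kappa. ind E x*(gD x \<bullet> i))" if "borel_sub \<Omega> E" for E
     proof -
      have E: "E \<in> sets borel" "E \<inter> \<Omega> = E" using that by (auto simp: borel_sub_def)
      have "integrable DU.kappa (%x. ind E x *\<^sub>R gD x)" using E(1) by (intro integrable_mult_indicator gD(1)) simp
      thus ?thesis using gD(2)[OF E(1)] E(2) by (simp flip: integral_inner_left)
     qed
    qed (use phi \<Omega> uv v0 DU.finite_kappa in auto)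
    thus "(LI x. v x *\<^sub>R G x) \<bullet> i = - (LINT x|DU.kappa. ph x *\<^sub>R gD x) \<bullet> i"
     using integral_inner_left[of i lborel "%x. v x *\<^sub>R G x"] integral_inner_left[of i DU.kappa "%x. ph x *\<^sub>R gD x"] i1 i2
     by (simp add: inner_commute del: integral_inner_left integral_inner_right)
   qed
  next
   show "(%p. f0 (fst p) (snd p)) \<in> Borel" unfolding f0_def by measurable
   show "\<bar>f0 x s\<bar> <= 1" "a <= \<bar>s\<bar> ==> b0 x s = 0" "a <= \<bar>s\<bar> ==> f0 x s = 0" for x s by (auto simp: b0_def f0_def)
  qed (fact \<Omega> v vb aC(1) b0m b0b bAE fin' sets' DU.finite_kappa DU.sets_kappa gD(1,3))+
  have Bu: "AE x in lborel. x \<in> \<Omega> --> B x (u x) = P.B x (v x)" using uv b2[unfolded AE_completion_iff]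
  proof (eventually_elim, intro impI)
   fix x assume x: "x \<in> \<Omega>" "x \<in> \<Omega> --> u x = v x" "x \<in> \<Omega> --> continuous_on UNIV (b x)"
   \<comment> \<open>Continuity in t makes the slice Borel, so the oriented integral can be
     rewritten as an integral over the line.\<close>
   have [measurable]: "b x \<in> Borel" using x by (auto intro: borel_measurable_continuous_onI)
   have eq: "(of_bool (s < v x) - of_bool (s < 0)) *\<^sub>R b x s = (of_bool (s < v x) - of_bool (s < 0)) *\<^sub>R b0 x s" for s
    using vb[of x] aC x(1) by (auto simp: b0_def split: split_of_bool)
   have "B x (v x) = (LI s. (of_bool (s < v x) - of_bool (s < 0)) *\<^sub>R b x s)"
    unfolding B_def by (rule interval_integral_of_bool) measurable
   thus "B x (u x) = P.B x (v x)" using x unfolding P.B_def eq by simp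
  qed
  have PBb: "norm (P.B x (v x)) <= Mb*(2*a)" for x
  proof -
   have "norm (P.B x (v x)) <= (LI s. Mb*ind {-a..a} s)" unfolding P.B_def
   proof (rule integral_norm_bound_AE)
    show "AE s in lborel. norm ((of_bool (s < v x) - of_bool (s < 0)) *\<^sub>R b0 x s) <= Mb*ind {-a..a} s"
    proof (rule AE_I2)
     fix s show "norm ((of_bool (s < v x) - of_bool (s < 0)) *\<^sub>R b0 x s) <= Mb*ind {-a..a} s"
      using b0b[of x s] P.b_zero[of s x] P.Mb_nonneg by (cases "\<bar>s\<bar> < a") (auto simp: indicator_def abs_less_iff split: split_of_bool)
    qed
   qed (simp add: integrable_indicator_iff emeasure_lborel_Icc_eq)
   thus ?thesis using aC by simp
  qed
  interpret Q: pairing_div \<Omega> v C b0 f0 \<sigma>' DU.kappa gD a Mb "max 0 M0" NU.kappa gn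
  proof (intro pairing_div.intro P.pairing_axioms pairing_div_axioms.intro)
   fix ph G and K :: "'a set" assume phi: "C1 ph G" "compact K" "K <= \<Omega>" "!!x. x \<notin> K ==> ph x = 0"
   show "(LI x. P.B x (v x) \<bullet> G x) = - (LINT x|NU.kappa. ph x*gn x)"
   proof (rule C1_test_identity[where A="%x. B x (u x)" and \<mu>=\<nu> and M="Mb*(2*a)" and K=K])
    show "(%x. P.B x (v x)) \<in> Borel" unfolding P.B_def by measurable
    show "P.B x (v x) = 0" if "x \<notin> \<Omega>" for x
    proof -
     have "b0 x s = 0" for s using that by (simp add: b0_def)
     thus ?thesis by (simp add: P.B_def)
    qed
    show "\<nu> E = (LINT x|NU.kappa. ind E x*gn x)" if "borel_sub \<Omega> E" for E
     using gn(2)[of E] that by (simp add: borel_sub_def Int_absorb2)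
   qed (use \<nu> phi \<Omega> Bu PBb gn NU.finite_kappa in "auto simp: is_div_def")
  qed (use gn NU.finite_kappa in auto)
  have lo: "um x = P.um x" "up x = P.up x" if "x \<in> \<Omega>" for x
  proof -
   show "um x = P.um x" using that ap_lower_cong[OF um uv v Ob] by (simp add: um_def P.um_def)
   have um': "set_borel_measurable lebesgue \<Omega> (%x. - u x)" using um by (simp add: set_borel_measurable_def)
   have "AE x in lborel. x \<in> \<Omega> --> - u x = - v x" using uv by eventually_elim simp
   from ap_lower_cong[OF um' this _ Ob] show "up x = P.up x"
    using that by (simp add: up_def P.up_def P.neg.um_def ap_upper_uminus)
  qed
  have f1x [measurable]: "f x \<in> Borel" if "x \<in> \<Omega>" for x
  proof -
   have "f x = f1 x" using that by (simp add: f1_def fun_eq_iff)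
   moreover have "f1 x \<in> Borel" by measurable
   ultimately show ?thesis by simp
  qed
  define \<Phi> where "\<Phi> h x = (LI s. (of_bool (s < h x) - of_bool (s < 0))*f1 x s)" for h :: "'a => real" and x
  have \<Phi>m [measurable]: "\<Phi> h \<in> Borel" if [measurable]: "h \<in> Borel" for h
   unfolding \<Phi>_def by measurable
  have F\<Phi>: "F x (h x) = \<Phi> h x" if "x \<in> \<Omega>" for h x
  proof -
   have "f1 x = f x" using that by (simp add: f1_def fun_eq_iff)
   thus ?thesis by (simp add: F_def \<Phi>_def interval_integral_of_bool[OF f1x[OF that]])
  qed
  \<comment> \<open>The two versions of f agree off null sets that depend on t. The quantifiers are
    exchanged so that integrals in t can be compared for fixed x.\<close>
  have "AE s in lborel. AE x in \<sigma>'. \<bar>s\<bar> < a --> f0 x s = f1 x s"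
   using f1_good by eventually_elim (auto elim!: eventually_mono simp: f0_def)
  moreover have "{p \<in> space (\<sigma>' \<Otimes>\<^sub>M lborel). \<bar>snd p\<bar> < a --> f0 (fst p) (snd p) = f1 (fst p) (snd p)} \<in> sets (\<sigma>' \<Otimes>\<^sub>M lborel)"
   by measurable
  ultimately have "AE x in \<sigma>'. AE s in lborel. \<bar>s\<bar> < a --> f0 x s = f1 x s"
   using pair_sigma_finite.AE_commute[OF P.pair_sf, of "%x s. \<bar>s\<bar> < a --> f0 x s = f1 x s"] by blast
  \<comment> \<open>The exceptional set does not depend on h, so one null set serves the lower
    limit, the upper limit and every function between them.\<close>
  hence \<Phi>F: "AE x in \<sigma>'. ALL h. (ALL x. \<bar>h x\<bar> <= C) --> \<Phi> h x = P.F x (h x)"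
  proof (eventually_elim, intro allI impI)
   fix x and h :: "'a => real" assume ae: "AE s in lborel. \<bar>s\<bar> < a --> f0 x s = f1 x s" and h: "ALL x. \<bar>h x\<bar> <= C"
   show "\<Phi> h x = P.F x (h x)" unfolding \<Phi>_def P.F_def
   proof (rule integral_cong_AE)
    show "AE s in lborel. (of_bool (s < h x) - of_bool (s < 0))*f1 x s = (of_bool (s < h x) - of_bool (s < 0))*f0 x s"
     using ae
    proof eventually_elim
     case (elim s)
     thus ?case using h[rule_format, of x] aC by (auto split: split_of_bool)
    qed
   qed measurable
  qed
  have main: "total_variation \<Omega> (%E. - (LINT x:E|\<sigma>. H x)+\<nu> E) E <= ennreal (linf_norm \<Omega> b)*total_variation \<Omega> Du E"
   if E: "borel_sub \<Omega> E" and H: "!!x. x \<in> \<Omega> ==> H x = H' x" and [measurable]: "H' \<in> Borel"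
    and ae: "AE x in \<sigma>'. H' x = HP x" and good: "Q.good HP" for H H' HP E
  proof -
   have [measurable]: "HP \<in> Borel" using good by (simp add: Q.good_def)
   have "total_variation \<Omega> (%E. - (LINT x:E|\<sigma>. H x)+\<nu> E) E <= ennreal (max 0 M0)*total_variation \<Omega> Du E"
   proof (rule DU.total_variation_le[OF _ _ E])
    fix A assume A: "borel_sub \<Omega> A"
    hence Ab [measurable]: "A \<in> sets borel" and AO: "A \<inter> \<Omega> = A" "A <= \<Omega>" by (auto simp: borel_sub_def)
    have "(LINT x:A|\<sigma>. H x) = (LINT x|\<sigma>. ind A x*H' x)"
     unfolding set_lebesgue_integral_def using H by (intro B_integral_cong) (auto simp: spS)
    also have "... = (LINT x|\<sigma>'. ind A x*H' x)" by (rule int'[symmetric]) measurable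
    also have "... = (LINT x|\<sigma>'. ind A x*HP x)"
     by (rule integral_cong_AE) (use ae in "auto elim!: eventually_mono")
    finally have "- (LINT x:A|\<sigma>. H x)+\<nu> A = Q.D HP A" using gn(2)[OF Ab] AO(1) by (simp add: Q.D_def)
    thus "norm (- (LINT x:A|\<sigma>. H x)+\<nu> A) <= max 0 M0*measure DU.kappa A" using good Ab AO(2) by (simp add: Q.good_def)
   qed simp
   \<comment> \<open>The truncated constant is replaced by \<open>linf_norm \<Omega> b\<close>; were
     the norm negative, both would be 0 as extended nonnegative numbers.\<close>
   thus ?thesis by (simp add: M0_def max_def ennreal_neg split: if_splits)
  qed
  define l0 where "l0 x = ind \<Omega> x*lam x" for x
  have [measurable]: "l0 \<in> Borel"
   using lam_meas Ob unfolding l0_def by (subst (asm) borel_measurable_restrict_space_iff) auto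
  have l0: "0 <= l0 x" "l0 x <= 1" for x using lam_range by (auto simp: l0_def indicator_def)
  define h where "h x = (1 - l0 x)*P.um x+l0 x*P.up x" for x
  have hm [measurable]: "h \<in> Borel" unfolding h_def by measurable
  have hu: "P.um x <= h x" "h x <= P.up x" for x
  proof -
   have "h x = P.um x+l0 x*(P.up x - P.um x)" "h x = P.up x - (1 - l0 x)*(P.up x - P.um x)" by (auto simp: h_def algebra_simps)
   moreover have "0 <= l0 x*(P.up x - P.um x)" "0 <= (1 - l0 x)*(P.up x - P.um x)" using l0[of x] P.um_le_up[of x] by simp_all
   ultimately show "P.um x <= h x" "h x <= P.up x" by linarith+
  qed
  have hC: "\<bar>h x\<bar> <= C" for x using hu[of x] P.um_bound[of x] by linarith
  show ?thesis
  proof (intro allI impI conjI)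
   fix E assume E: "borel_sub \<Omega> E"
   show "total_variation \<Omega> (%E. - (LINT x:E|\<sigma>. F x ((1 - lam x)*um x+lam x*up x))+\<nu> E) E <= ennreal (linf_norm \<Omega> b)*total_variation \<Omega> Du E"
   proof (rule main[OF E _ \<Phi>m[OF hm] _ Q.good_intermediate[OF hm hu]])
    show "F x ((1 - lam x)*um x+lam x*up x) = \<Phi> h x" if "x \<in> \<Omega>" for x
     using that lo F\<Phi>[OF that, of h] by (simp add: h_def l0_def)
    show "AE x in \<sigma>'. \<Phi> h x = P.F x (h x)" using \<Phi>F by eventually_elim (use hC in blast)
   qed
   show "total_variation \<Omega> (%E. - (LINT x:E|\<sigma>. (1 - lam x)*F x (um x)+lam x*F x (up x))+\<nu> E) E <= ennreal (linf_norm \<Omega> b)*total_variation \<Omega> Du E"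
   proof (rule main[OF E _ _ _ Q.good_mixture[of l0]])
    show "(1 - lam x)*F x (um x)+lam x*F x (up x) = (1 - l0 x)*\<Phi> P.um x+l0 x*\<Phi> P.up x" if "x \<in> \<Omega>" for x
     using that lo F\<Phi>[OF that, of P.um] F\<Phi>[OF that, of P.up] by (simp add: l0_def)
    show "AE x in \<sigma>'. (1 - l0 x)*\<Phi> P.um x+l0 x*\<Phi> P.up x = (1 - l0 x)*P.F x (P.um x)+l0 x*P.F x (P.up x)"
     using \<Phi>F by eventually_elim (use P.um_bound in auto)
   qed (use l0 in measurable)
  qed
 qed
qed

end
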